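(* Consider the two-class homoscedastic normal model in $\mathbb{R}^p$ with Mahalanobis distance $\Delta>0$ between the classes, and with class labels missing according to the logistic missing-label model $\mathrm{pr}\{M=1\mid Y=y,Z=z\}=\exp\{\xi_0+\xi_1 d(y;\beta)^2\}/[1+\exp\{\xi_0+\xi_1 d(y;\beta)^2\}]$, as described in the context. In the case $\pi_1=\pi_2$, the asymptotic relative efficiency of the estimated Bayes' rule $\hat R_{\rm PC}^{(\rm ig)}$ (from the likelihood ignoring the missingness mechanism) compared to the estimated Bayes' rule $\hat R_{\rm PC}^{(\rm full)}$ (from the full likelihood), both based on the partially classified sample, is $$\mathrm{ARE}(\hat R_{\rm PC}^{(\rm ig)}:\hat R_{\rm PC}^{(\rm full)})=\frac{\mathrm{ARE}(\hat R_{\rm PC}^{(\rm ig)})}{\mathrm{ARE}(\hat R_{\rm PC}^{(\rm full)})},$$ where the numerator and denominator (each an asymptotic relative efficiency compared to the rule $\hat R_{\rm CC}$ based on the completely classified sample) are given by $$\mathrm{ARE}(\hat R_{\rm PC}^{(\rm ig)})=1-(\Delta^2+4)\gamma d_0,\qquad \mathrm{ARE}(\hat R_{\rm PC}^{(\rm full)})=1-(\Delta^2+4)(\gamma d_0-b_0),$$ with $$b_0=\int_{-\infty}^{\infty}4\xi_1^2\Delta^2y_1^2\,q_1(y_1)\{1-q_1(y_1)\}f_{y_1}(y_1)\,dy_1,\qquad d_0=\int_{-\infty}^{\infty}\tau_1(y_1)\tau_2(y_1)q_1(y_1)\gamma^{-1}f_{y_1}(y_1)\,dy_1,$$ $\gamma=E\{q(Y;\Psi)\}$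 the expected proportion of missing labels, and $\tau_1,\tau_2,q_1,f_{y_1}$ the functions defined in the context.
   Context: Model. Let $p\ge 1$. The pair $(Y,Z)$ has $Z\in\{1,2\}$, $\mathrm{pr}(Z=i)=\pi_i$ with $\pi_1,\pi_2>0$, $\pi_1+\pi_2=1$, and $Y\mid Z=i\sim N(\mu_i,\Sigma)$ in $\mathbb{R}^p$, with $\Sigma$ positive definite and $\mu_1\ne\mu_2$; all of $\pi_1,\mu_1,\mu_2,\Sigma$ are unknown and are estimated (also when the true priors are equal). Collect them in $\theta$. Let $f_i$ denote the $N(\mu_i,\Sigma)$ density and $\Delta^2=(\mu_1-\mu_2)^T\Sigma^{-1}(\mu_1-\mu_2)$. Put $\beta=(\beta_0,\beta_1^T)^T$ with $\beta_1=\Sigma^{-1}(\mu_1-\mu_2)$ and $\beta_0=\log(\pi_1/\pi_2)-\tfrac12(\mu_1+\mu_2)^T\Sigma^{-1}(\mu_1-\mu_2)$, and $d(y;\beta)=\beta_0+\beta_1^Ty$. The Bayes' rule $R(y;\beta)$ assigns $y$ to Class 1 if $d(y;\beta)>0$ and to Class 2 if $d(y;\beta)<0$. Missing labels. $\xi=(\xi_0,\xi_1)^T\in\mathbb{R}^2$ is an unknown parameter distinct from $\theta$; $\Psi=(\theta^T,\xi^T)^T$. $(Y_j,Z_j,M_j)$, $j=1,\dots,n$, are i.i.d. copies of $(Y,Z,M)$, where $M\in\{0,1\}$ is the missing-label indicator ($M=1$ means missing) and $\mathrm{pr}\{M=1\mid Y=y,Z=z\}=q(y;\Psi)=\exp\{\xi_0+\xi_1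 d(y;\beta)^2\}/[1+\exp\{\xi_0+\xi_1 d(y;\beta)^2\}]$. The completely classified sample $x_{\rm CC}$ consists of all $(Y_j,Z_j)$; the partially classified sample $x_{\rm PC}$ consists of $(Y_j,Z_j)$ for $M_j=0$ and $Y_j$ only for $M_j=1$, together with the indicators $M_j$. Estimators. With $z_{ij}=1$ if $z_j=i$ and $0$ otherwise, $$\log L_{\rm PC}^{(\rm ig)}(\theta)=\sum_{j=1}^n(1-m_j)\sum_{i=1}^2 z_{ij}\log\{\pi_if_i(y_j)\}+\sum_{j=1}^n m_j\log\sum_{i=1}^2\pi_if_i(y_j),$$ $$\log L_{\rm PC}^{(\rm full)}(\Psi)=\log L_{\rm PC}^{(\rm ig)}(\theta)+\sum_{j=1}^n[(1-m_j)\log\{1-q(y_j;\Psi)\}+m_j\log q(y_j;\Psi)],$$ and $\log L_{\rm CC}(\theta)$ is $\log L_{\rm PC}^{(\rm ig)}(\theta)$ with all $m_j=0$. Let $\hat\beta_{\rm PC}^{(\rm ig)}$, $\hat\beta_{\rm PC}^{(\rm full)}$, $\hat\beta_{\rm CC}$ be the maximum likelihood estimators of $\beta$ from $L_{\rm PC}^{(\rm ig)}$, $L_{\rm PC}^{(\rm full)}$, $L_{\rm CC}$ respectively, and $\hat R_{\rm PC}^{(\rm ig)},\hat R_{\rm PC}^{(\rm full)},\hat R_{\rm CC}$ the rules $R(y;\cdot)$ with these estimates plugged in for $\beta$. Error rates and ARE. For an estimator $\hat\beta$, the conditional error rate on a new independent $(Y,Z)$ is $\mathrm{err}(\hat\beta;\beta)=1-\sum_{i=1}^2\pi_i\,\mathrm{pr}\{R(Y;\hat\beta)=i\mid\hat\beta,Z=i\}$;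 the optimal error rate $\mathrm{err}(\beta)$ is obtained by replacing $\hat\beta$ by $\beta$. $AE\{\mathrm{err}(\hat\beta;\beta)\}$ denotes the expansion of $E\{\mathrm{err}(\hat\beta;\beta)\}$ up to and including terms of first order in $1/n$. The asymptotic relative efficiency of a rule $R(y;\hat\beta_A)$ compared to a rule $R(y;\hat\beta_B)$ is $$\frac{AE\{\mathrm{err}(\hat\beta_B;\beta)\}-\mathrm{err}(\beta)}{AE\{\mathrm{err}(\hat\beta_A;\beta)\}-\mathrm{err}(\beta)}.$$ $\mathrm{ARE}(\hat R)$ with one argument means compared to $\hat R_{\rm CC}$; $\mathrm{ARE}(\hat R_{\rm PC}^{(\rm ig)}:\hat R_{\rm PC}^{(\rm full)})$ means $\hat R_{\rm PC}^{(\rm ig)}$ compared to $\hat R_{\rm PC}^{(\rm full)}$. Functions in the formulas (these refer to the canonical form $\Sigma=I_p$, $\mu_1=(\Delta/2,0,\dots,0)^T$, $\mu_2=-\mu_1$, $\pi_1=\pi_2=1/2$, in which $d(y;\beta)=\Delta y_1$ with $y_1$ the first coordinate of $y$): $\tau_i(y_1)=\mathrm{pr}\{Z=i\mid (Y)_1=y_1\}$ ($i=1,2$), i.e. $\tau_1(y_1)=e^{\Delta y_1}/(1+e^{\Delta y_1})$ and $\tau_2=1-\tau_1$; $q_1(y_1)=\mathrm{pr}\{M=1\mid (Y)_1=y_1\}=\exp(\xi_0+\xi_1\Delta^2y_1^2)/\{1+\exp(\xi_0+\xi_1\Delta^2y_1^2)\}$; $f_{y_1}(y_1)=\tfrac12\phi(y_1;\Delta/2,1)+\tfrac12\phi(y_1;-\Delta/2,1)$,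 where $\phi(\cdot;m,1)$ is the $N(m,1)$ density; $\gamma=\int q_1(y_1)f_{y_1}(y_1)\,dy_1$. *)

theory Defs
  imports "HOL-Probability.Probability" "HOL-Library.Landau_Symbols"
begin

text \<open>The components of a parameter vector are \<open>(\<pi>\<^sub>1, \<mu>\<^sub>1, \<mu>\<^sub>2, \<Sigma>)\<close>, with \<open>\<pi>\<^sub>2 = 1 - \<pi>\<^sub>1\<close>.\<close>

type_synonym 'p model = "real \<times> (real^'p) \<times> (real^'p) \<times> (real^'p^'p)"

fun prior :: "'p::finite model \<Rightarrow> nat \<Rightarrow> real" where
  "prior (p1, m1, m2, S) i = (if i = 1 then p1 else 1 - p1)"

fun mean :: "'p::finite model \<Rightarrow> nat \<Rightarrow> real^'p" where
  "mean (p1, m1, m2, S) i = (if i = 1 then m1 else m2)"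

fun cov :: "'p::finite model \<Rightarrow> real^'p^'p" where
  "cov (p1, m1, m2, S) = S"

definition pos_def :: "real^'p^'p \<Rightarrow> bool" where
  "pos_def S \<longleftrightarrow> transpose S = S \<and> (\<forall>x. x \<noteq> 0 \<longrightarrow> x \<bullet> (S *v x) > 0)"

definition model_space :: "'p::finite model set" where
  "model_space = {\<theta>. 0 < prior \<theta> 1 \<and> 0 < prior \<theta> 2 \<and> mean \<theta> 1 \<noteq> mean \<theta> 2 \<and> pos_def (cov \<theta>)}"

definition mvn_density :: "real^'p \<Rightarrow> real^'p^'p \<Rightarrow> real^'p \<Rightarrow> real" where
  "mvn_density \<mu> S y =
     exp (- ((y - \<mu>) \<bullet> (matrix_inv S *v (y - \<mu>))) / 2) / sqrt ((2 * pi) ^ CARD('p) * det S)"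

definition class_density :: "'p::finite model \<Rightarrow> nat \<Rightarrow> real^'p \<Rightarrow> real" where
  "class_density \<theta> i = mvn_density (mean \<theta> i) (cov \<theta>)"

definition class_distr :: "'p::finite model \<Rightarrow> nat \<Rightarrow> (real^'p) measure" where
  "class_distr \<theta> i = density lborel (\<lambda>y. ennreal (class_density \<theta> i y))"

definition mahalanobis :: "'p::finite model \<Rightarrow> real" where
  "mahalanobis \<theta> = sqrt ((mean \<theta> 1 - mean \<theta> 2) \<bullet> (matrix_inv (cov \<theta>) *v (mean \<theta> 1 - mean \<theta> 2)))"

definition coef :: "'p::finite model \<Rightarrow> real \<times> (real^'p)" where
  "coef \<theta> =
     (let v = matrix_inv (cov \<theta>) *v (mean \<theta> 1 - mean \<theta> 2)
      in (ln (prior \<theta> 1 / prior \<theta> 2) - ((mean \<theta> 1 + mean \<theta> 2) \<bullet> v) / 2, v))"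

definition discr :: "real \<times> (real^'p) \<Rightarrow> real^'p \<Rightarrow> real" where
  "discr \<beta> y = fst \<beta> + snd \<beta> \<bullet> y"

text \<open>The rule is left unspecified by the model on the hyperplane \<open>discr \<beta> y = 0\<close>; the value \<open>0\<close>
  means that such a \<open>y\<close> is assigned to neither class. This is a null event whenever
  \<open>snd \<beta> \<noteq> 0\<close>.\<close>

definition bayes_rule :: "real \<times> (real^'p) \<Rightarrow> real^'p \<Rightarrow> nat" where
  "bayes_rule \<beta> y = (if discr \<beta> y > 0 then 1 else if discr \<beta> y < 0 then 2 else 0)"

text \<open>Error rate, under the true model \<open>\<theta>\<close>, of the rule with coefficients \<open>b\<close>.\<close>

definition err :: "'p::finite model \<Rightarrow> real \<times> (real^'p) \<Rightarrow> real" where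
  "err \<theta> b = 1 - (\<Sum>i\<in>{1,2}. prior \<theta> i * measure (class_distr \<theta> i) {y. bayes_rule b y = i})"

definition missing_prob :: "'p::finite model \<Rightarrow> real \<times> real \<Rightarrow> real^'p \<Rightarrow> real" where
  "missing_prob \<theta> \<xi> y =
     exp (fst \<xi> + snd \<xi> * (discr (coef \<theta>) y)\<^sup>2) / (1 + exp (fst \<xi> + snd \<xi> * (discr (coef \<theta>) y)\<^sup>2))"

text \<open>The joint law of \<open>(Y, Z, M)\<close> is given by its density
  \<open>pr(Z = z) f\<^sub>z(y) pr(M = m | Y = y, Z = z)\<close> with respect to \<open>obs_base\<close>.\<close>

definition obs_base :: "((real^'p) \<times> nat \<times> nat) measure" where
  "obs_base = lborel \<Otimes>\<^sub>M count_space {1,2} \<Otimes>\<^sub>M count_space {0,1}"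

definition obs_density ::
    "'p::finite model \<Rightarrow> real \<times> real \<Rightarrow> (real^'p) \<times> nat \<times> nat \<Rightarrow> real" where
  "obs_density \<theta> \<xi> = (\<lambda>(y, z, m). prior \<theta> z * class_density \<theta> z y *
     (if m = 1 then missing_prob \<theta> \<xi> y else 1 - missing_prob \<theta> \<xi> y))"

text \<open>\<open>(Y j, Z j, M j)\<close>, \<open>j = 0, 1, 2, \<dots>\<close>, are i.i.d. on the probability space \<open>P\<close>; the sample of
  size \<open>n\<close> consists of the first \<open>n\<close> of them.\<close>

definition iid_sample ::
    "'w measure \<Rightarrow> 'p::finite model \<Rightarrow> real \<times> real \<Rightarrow>
     (nat \<Rightarrow> 'w \<Rightarrow> real^'p) \<Rightarrow> (nat \<Rightarrow> 'w \<Rightarrow> nat) \<Rightarrow> (nat \<Rightarrow> 'w \<Rightarrow> nat) \<Rightarrow> bool" where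
  "iid_sample P \<theta> \<xi> Y Z M \<longleftrightarrow>
     prob_space P \<and>
     prob_space.indep_vars P (\<lambda>_. obs_base) (\<lambda>j \<omega>. (Y j \<omega>, Z j \<omega>, M j \<omega>)) UNIV \<and>
     (\<forall>j. distributed P obs_base (\<lambda>\<omega>. (Y j \<omega>, Z j \<omega>, M j \<omega>)) (\<lambda>x. ennreal (obs_density \<theta> \<xi> x)))"

definition loglik_ig ::
    "nat \<Rightarrow> (nat \<Rightarrow> real^'p) \<Rightarrow> (nat \<Rightarrow> nat) \<Rightarrow> (nat \<Rightarrow> nat) \<Rightarrow> 'p::finite model \<Rightarrow> real" where
  "loglik_ig n y z m \<theta> =
     (\<Sum>j<n. (1 - real (m j)) *
        (\<Sum>i\<in>{1,2}. of_bool (z j = i) * ln (prior \<theta> i * class_density \<theta> i (y j)))) +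
     (\<Sum>j<n. real (m j) * ln (\<Sum>i\<in>{1,2}. prior \<theta> i * class_density \<theta> i (y j)))"

definition loglik_full ::
    "nat \<Rightarrow> (nat \<Rightarrow> real^'p) \<Rightarrow> (nat \<Rightarrow> nat) \<Rightarrow> (nat \<Rightarrow> nat) \<Rightarrow>
     'p::finite model \<times> (real \<times> real) \<Rightarrow> real" where
  "loglik_full n y z m = (\<lambda>(\<theta>, \<xi>). loglik_ig n y z m \<theta> +
     (\<Sum>j<n. (1 - real (m j)) * ln (1 - missing_prob \<theta> \<xi> (y j)) +
              real (m j) * ln (missing_prob \<theta> \<xi> (y j))))"

definition loglik_cc ::
    "nat \<Rightarrow> (nat \<Rightarrow> real^'p) \<Rightarrow> (nat \<Rightarrow> nat) \<Rightarrow> 'p::finite model \<Rightarrow> real" where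
  "loglik_cc n y z = loglik_ig n y z (\<lambda>_. 0)"

text \<open>\<open>b\<close> is the value of \<open>g\<close> at a maximiser of \<open>L\<close> over \<open>\<Theta>\<close>. For some (in particular small)
  samples the likelihood has no maximiser over the parameter space; then \<open>b\<close> is arbitrary.\<close>

definition ml_estimate :: "('t \<Rightarrow> real) \<Rightarrow> 't set \<Rightarrow> ('t \<Rightarrow> 'b) \<Rightarrow> 'b \<Rightarrow> bool" where
  "ml_estimate L \<Theta> g b \<longleftrightarrow>
     (\<exists>t. is_arg_max L (\<lambda>t. t \<in> \<Theta>) t) \<longrightarrow> (\<exists>t. is_arg_max L (\<lambda>t. t \<in> \<Theta>) t \<and> g t = b)"

definition mle_ig ::
    "'w measure \<Rightarrow> (nat \<Rightarrow> 'w \<Rightarrow> real^'p) \<Rightarrow> (nat \<Rightarrow> 'w \<Rightarrow> nat) \<Rightarrow> (nat \<Rightarrow> 'w \<Rightarrow> nat) \<Rightarrow>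
     (nat \<Rightarrow> 'w \<Rightarrow> real \<times> (real^'p::finite)) \<Rightarrow> bool" where
  "mle_ig P Y Z M b \<longleftrightarrow> (\<forall>n. b n \<in> borel_measurable P \<and>
     (AE \<omega> in P. ml_estimate (loglik_ig n (\<lambda>j. Y j \<omega>) (\<lambda>j. Z j \<omega>) (\<lambda>j. M j \<omega>))
        model_space coef (b n \<omega>)))"

definition mle_full ::
    "'w measure \<Rightarrow> (nat \<Rightarrow> 'w \<Rightarrow> real^'p) \<Rightarrow> (nat \<Rightarrow> 'w \<Rightarrow> nat) \<Rightarrow> (nat \<Rightarrow> 'w \<Rightarrow> nat) \<Rightarrow>
     (nat \<Rightarrow> 'w \<Rightarrow> real \<times> (real^'p::finite)) \<Rightarrow> bool" where
  "mle_full P Y Z M b \<longleftrightarrow> (\<forall>n. b n \<in> borel_measurable P \<and>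
     (AE \<omega> in P. ml_estimate (loglik_full n (\<lambda>j. Y j \<omega>) (\<lambda>j. Z j \<omega>) (\<lambda>j. M j \<omega>))
        (model_space \<times> UNIV) (\<lambda>(\<theta>, \<xi>). coef \<theta>) (b n \<omega>)))"

definition mle_cc ::
    "'w measure \<Rightarrow> (nat \<Rightarrow> 'w \<Rightarrow> real^'p) \<Rightarrow> (nat \<Rightarrow> 'w \<Rightarrow> nat) \<Rightarrow>
     (nat \<Rightarrow> 'w \<Rightarrow> real \<times> (real^'p::finite)) \<Rightarrow> bool" where
  "mle_cc P Y Z b \<longleftrightarrow> (\<forall>n. b n \<in> borel_measurable P \<and>
     (AE \<omega> in P. ml_estimate (loglik_cc n (\<lambda>j. Y j \<omega>) (\<lambda>j. Z j \<omega>)) model_space coef (b n \<omega>)))"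

definition expected_err ::
    "'w measure \<Rightarrow> 'p::finite model \<Rightarrow> (nat \<Rightarrow> 'w \<Rightarrow> real \<times> (real^'p)) \<Rightarrow> nat \<Rightarrow> real" where
  "expected_err P \<theta> b n = (\<integral>\<omega>. err \<theta> (b n \<omega>) \<partial>P)"

text \<open>\<open>A\<close> is the expansion of the sequence \<open>E\<close> up to and including the term of order \<open>1 / n\<close>. It is
  determined by \<open>E\<close>, if it exists.\<close>

definition has_AE :: "(nat \<Rightarrow> real) \<Rightarrow> (nat \<Rightarrow> real) \<Rightarrow> bool" where
  "has_AE E A \<longleftrightarrow>
     (\<exists>a0 a1. A = (\<lambda>n. a0 + a1 / real n)) \<and> (\<lambda>n. E n - A n) \<in> o(\<lambda>n. 1 / real n)"

text \<open>\<open>r\<close> is the asymptotic relative efficiency of the rule with coefficients \<open>bA\<close> compared to the rule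
  with coefficients \<open>bB\<close>. Both expansions are required to exist, and the denominator to be nonzero;
  the ratio must have the same value \<open>r\<close> for every sample size.\<close>

definition has_ARE ::
    "'w measure \<Rightarrow> 'p::finite model \<Rightarrow> (nat \<Rightarrow> 'w \<Rightarrow> real \<times> (real^'p)) \<Rightarrow>
     (nat \<Rightarrow> 'w \<Rightarrow> real \<times> (real^'p)) \<Rightarrow> real \<Rightarrow> bool" where
  "has_ARE P \<theta> bA bB r \<longleftrightarrow>
     (\<exists>A B. has_AE (expected_err P \<theta> bA) A \<and> has_AE (expected_err P \<theta> bB) B \<and>
        (\<forall>n\<ge>1. A n - err \<theta> (coef \<theta>) \<noteq> 0 \<and>
               (B n - err \<theta> (coef \<theta>)) / (A n - err \<theta> (coef \<theta>)) = r))"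

text \<open>\<open>D\<close> is the Mahalanobis distance. In the canonical form \<open>\<Sigma> = I\<close>, \<open>\<mu>\<^sub>1 = - \<mu>\<^sub>2 = (D/2, 0, \<dots>, 0)\<close> and
  \<open>\<pi>\<^sub>1 = \<pi>\<^sub>2 = 1/2\<close>, where the discriminant function is \<open>D\<close> times the first coordinate \<open>t\<close>.\<close>

definition tau1 :: "real \<Rightarrow> real \<Rightarrow> real" where
  "tau1 D t = exp (D * t) / (1 + exp (D * t))"

definition tau2 :: "real \<Rightarrow> real \<Rightarrow> real" where
  "tau2 D t = 1 - tau1 D t"

definition q1 :: "real \<Rightarrow> real \<times> real \<Rightarrow> real \<Rightarrow> real" where
  "q1 D \<xi> t = exp (fst \<xi> + snd \<xi> * D\<^sup>2 * t\<^sup>2) / (1 + exp (fst \<xi> + snd \<xi> * D\<^sup>2 * t\<^sup>2))"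

definition f_y1 :: "real \<Rightarrow> real \<Rightarrow> real" where
  "f_y1 D t = normal_density (D / 2) 1 t / 2 + normal_density (- D / 2) 1 t / 2"

definition gam :: "real \<Rightarrow> real \<times> real \<Rightarrow> real" where
  "gam D \<xi> = (\<integral>t. q1 D \<xi> t * f_y1 D t \<partial>lborel)"

definition b0 :: "real \<Rightarrow> real \<times> real \<Rightarrow> real" where
  "b0 D \<xi> = (\<integral>t. 4 * (snd \<xi>)\<^sup>2 * D\<^sup>2 * t\<^sup>2 * q1 D \<xi> t * (1 - q1 D \<xi> t) * f_y1 D t \<partial>lborel)"

definition d0 :: "real \<Rightarrow> real \<times> real \<Rightarrow> real" where
  "d0 D \<xi> = (\<integral>t. tau1 D t * tau2 D t * q1 D \<xi> t * inverse (gam D \<xi>) * f_y1 D t \<partial>lborel)"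

end

theory Submission
 imports Defs
begin

text \<open>An affine change of variables, under which samples, estimates and error rates are equivariant,
 brings the model to canonical form. Write \<open>q\<close> for the missingness probability. All three estimators
 then maximise one likelihood: ignoring the mechanism means restricting \<open>\<xi>\<close> to \<open>0\<close>, and a completely
 classified sample has \<open>q = 0\<close>.

 Consistency is Wald's argument. The pair of log-densities \<open>ln (\<pi>\<^sub>i f\<^sub>i)\<close> is a pair of quadratics whose
 exponentials have total integral at most \<open>1\<close>; such pairs form a closed set, on which Jensen's
 inequality identifies the true parameter.

 The score equations, one for every direction \<open>v\<close> in the parameter space, are linearised at the true
 parameter, outside an event of probability \<open>o(1/n)\<close>. There are \<open>p\<close> directions whose scores have
 variance \<open>\<lambda>\<close> and mean derivative \<open>- \<lambda> l\<^sub>i\<close>, where \<open>l\<^sub>1, ..., l\<^sub>p\<close> are the first-order deviations of the intercept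
 and of the components of \<open>\<beta>\<^sub>1\<close> orthogonal to the discriminant. To second order the error rate exceeds
 its optimum by \<open>c \<Sum>\<^sub>i l\<^sub>i\<^sup>2\<close> with \<open>c = \<phi>(\<Delta>/2) / (4\<Delta>)\<close>, so that its expectation has the \<open>1/n\<close> term
 \<open>c p / \<lambda>\<close>, and relative efficiencies are ratios of \<open>\<lambda>\<close>. Here \<open>\<lambda>\<close> is \<open>1 / (4 + \<Delta>^2)\<close> for complete
 classification, \<open>1 / (4 + \<Delta>^2) - \<gamma> d\<^sub>0\<close> if the mechanism is ignored, and
 \<open>1 / (4 + \<Delta>^2) - \<gamma> d\<^sub>0 + b\<^sub>0\<close> for the full likelihood.\<close>

definition softplus :: "real => real" where
 "softplus u = ln (1 + exp u)"

definition logistic :: "real => real" where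
 "logistic u = exp u / (1 + exp u)"

lemma one_plus_exp_pos [simp]: "0 < 1 + exp (u::real)" "1 + exp u \<noteq> 0"
 using exp_gt_zero [of u] by (linarith, metis add_pos_pos exp_gt_zero less_irrefl zero_less_one)

lemma logistic_pos [simp]: "0 < logistic u"
 by (simp add: logistic_def)

lemma logistic_less_1 [simp]: "logistic u < 1"
 by (simp add: logistic_def)

lemma logistic_le_1 [simp]: "logistic u \<le> 1" and logistic_nonneg [simp]: "0 \<le> logistic u"
 by (simp_all add: less_imp_le)

lemma logistic_minus: "logistic (- u) = 1 - logistic u"
 by (simp add: logistic_def exp_minus field_simps)

lemma logistic_0 [simp]: "logistic 0 = 1 / 2"
 by (simp add: logistic_def)

lemma softplus_pos: "0 < softplus u"
 by (simp add: softplus_def ln_gt_zero)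

lemma softplus_minus: "softplus u = u + softplus (- u)"
proof -
 have "1 + exp u = exp u * (1 + exp (- u))"
  by (simp add: exp_minus field_simps)
 thus ?thesis
  by (simp add: softplus_def ln_mult)
qed

lemma softplus_ge: "u \<le> softplus u"
 using softplus_minus [of u] softplus_pos [of "- u"] by linarith

lemma ln_logistic: "ln (logistic u) = u - softplus u"
 by (simp add: logistic_def softplus_def ln_div)

lemma ln_one_minus_logistic: "ln (1 - logistic u) = - softplus u"
 using ln_logistic [of "- u"] softplus_minus [of u] by (simp add: logistic_minus)

lemma ln_add_exp: "ln (exp a + exp b) = b + softplus (a - b)"
proof -
 have "exp a + exp b = exp b * (1 + exp (a - b))"
  by (simp add: exp_diff field_simps)
 thus ?thesis
  by (simp add: softplus_def ln_mult)
qed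

lemma DERIV_softplus [derivative_intros]:
 "(f has_real_derivative f') (at x within A) ==>
  ((\<lambda>x. softplus (f x)) has_real_derivative logistic (f x) * f') (at x within A)"
 unfolding softplus_def logistic_def by (auto intro!: derivative_eq_intros)

lemma DERIV_logistic [derivative_intros]:
 "(f has_real_derivative f') (at x within A) ==>
  ((\<lambda>x. logistic (f x)) has_real_derivative logistic (f x) * (1 - logistic (f x)) * f') (at x within A)"
 unfolding logistic_def by (auto intro!: derivative_eq_intros simp: field_simps power2_eq_square)

lemma continuous_on_softplus [continuous_intros]:
 "continuous_on A f ==> continuous_on A (\<lambda>x. softplus (f x))"
 unfolding softplus_def
 by (auto intro!: continuous_intros simp: add_pos_pos less_imp_neq[THEN not_sym])

lemma continuous_on_logistic [continuous_intros]:
 "continuous_on A f ==> continuous_on A (\<lambda>x. logistic (f x))"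
 unfolding logistic_def by (auto intro!: continuous_intros)

lemma measurable_softplus [measurable]: "softplus \<in> borel_measurable borel"
 unfolding softplus_def by measurable

lemma measurable_logistic [measurable]: "logistic \<in> borel_measurable borel"
 unfolding logistic_def by measurable

lemma mean_value_between:
 fixes f f' :: "real => real"
 assumes "\<And>x. (f has_real_derivative f' x) (at x)"
 obtains z where "f b - f a = (b - a) * f' z" "min a b \<le> z" "z \<le> max a b"
proof (cases a b rule: linorder_cases)
 case less
 thus ?thesis
  using MVT2 [of a b f f'] assms that by (metis less_eq_real_def max_def min_def)
next
 case equal
 thus ?thesis using that [of a] by auto
next
 case greater
 then obtain z where "b < z" "z < a" "f a - f b = (a - b) * f' z"
  using MVT2 [of b a f f'] assms by metis
 thus ?thesis
  using that [of z] by (simp add: algebra_simps)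
qed

lemma lipschitz_of_derivative_bound:
 fixes f f' :: "real => real"
 assumes "\<And>x. (f has_real_derivative f' x) (at x)" "\<And>x. \<bar>f' x\<bar> \<le> B"
 shows "\<bar>f b - f a\<bar> \<le> B * \<bar>b - a\<bar>"
proof -
 obtain z where "f b - f a = (b - a) * f' z"
  using mean_value_between [of f f' b a] assms(1) by metis
 thus ?thesis
  using mult_right_mono [OF assms(2) [of z] abs_ge_zero [of "b - a"]] by (simp add: abs_mult mult.commute)
qed

lemma taylor_remainder_of_lipschitz_derivative:
 fixes f f' :: "real => real"
 assumes "\<And>x. (f has_real_derivative f' x) (at x)" "\<And>x y. \<bar>f' y - f' x\<bar> \<le> B * \<bar>y - x\<bar>" "0 \<le> B"
 shows "\<bar>f b - f a - f' a * (b - a)\<bar> \<le> B * (b - a)^2"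
proof -
 obtain z where z: "f b - f a = (b - a) * f' z" "min a b \<le> z" "z \<le> max a b"
  using mean_value_between [of f f' b a] assms(1) by metis
 have "f b - f a - f' a * (b - a) = (f' z - f' a) * (b - a)"
  using z(1) by (simp add: algebra_simps)
 also have "\<bar>...\<bar> \<le> (B * \<bar>z - a\<bar>) * \<bar>b - a\<bar>"
  using assms(2) [of z a] by (simp add: abs_mult mult_right_mono)
 also have "... \<le> (B * \<bar>b - a\<bar>) * \<bar>b - a\<bar>"
  using z(2,3) assms(3) by (intro mult_right_mono mult_left_mono) auto
 finally show ?thesis
  by (simp add: power2_eq_square)
qed

lemma logistic_variance_le: "logistic u * (1 - logistic u) \<le> 1"
 by (rule mult_le_one) auto

lemma logistic_variance_pos: "0 < logistic u * (1 - logistic u)"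
 by simp

lemma softplus_lipschitz: "\<bar>softplus v - softplus u\<bar> \<le> \<bar>v - u\<bar>"
 using lipschitz_of_derivative_bound [of softplus logistic 1 v u]
  DERIV_softplus [OF DERIV_ident] by simp

lemma logistic_lipschitz: "\<bar>logistic v - logistic u\<bar> \<le> \<bar>v - u\<bar>"
 using lipschitz_of_derivative_bound [of logistic "\<lambda>u. logistic u * (1 - logistic u)" 1 v u]
  DERIV_logistic [OF DERIV_ident] logistic_variance_le by (simp add: abs_mult)

lemma logistic_variance_lipschitz:
 "\<bar>logistic v * (1 - logistic v) - logistic u * (1 - logistic u)\<bar> \<le> 1 * \<bar>v - u\<bar>"
proof -
 have "logistic v * (1 - logistic v) - logistic u * (1 - logistic u)
   = (logistic v - logistic u) * (1 - logistic v - logistic u)"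
  by (simp add: algebra_simps)
 also have "\<bar>1 - logistic v - logistic u\<bar> \<le> 1"
  using logistic_pos [of u] logistic_pos [of v] logistic_less_1 [of u] logistic_less_1 [of v]
  by linarith
 hence "\<bar>(logistic v - logistic u) * (1 - logistic v - logistic u)\<bar> \<le> \<bar>v - u\<bar> * 1"
  unfolding abs_mult using logistic_lipschitz [of v u] by (intro mult_mono) auto
 finally show ?thesis by simp
qed

lemma logistic_taylor: "\<bar>logistic v - logistic u - logistic u * (1 - logistic u) * (v - u)\<bar> \<le> (v - u)^2"
 using taylor_remainder_of_lipschitz_derivative [of logistic "\<lambda>u. logistic u * (1 - logistic u)" 1 v u]
  DERIV_logistic [OF DERIV_ident] logistic_variance_lipschitz by (simp add: mult.assoc)

lemma softplus_convex: "softplus v \<ge> softplus u + logistic u * (v - u)"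
proof -
 have "convex_on UNIV softplus"
 proof (rule f''_ge0_imp_convex)
  show "(softplus has_real_derivative logistic x) (at x)" for x
   using DERIV_softplus [OF DERIV_ident] by simp
  show "(logistic has_real_derivative logistic x * (1 - logistic x)) (at x)" for x
   using DERIV_logistic [OF DERIV_ident] by simp
 qed (simp_all add: less_imp_le)
 hence "softplus v - softplus u \<ge> logistic u * (v - u)"
  using convex_on_imp_above_tangent [of UNIV softplus u v "logistic u"]
   DERIV_softplus [OF DERIV_ident] by simp
 thus ?thesis by simp
qed

section \<open>Lebesgue integrals under linear maps\<close>

lemma nn_integral_lborel_of_image:
 fixes f h :: "'a::euclidean_space => 'a"
 assumes h[measurable]: "h \<in> borel_measurable borel" and hf: "\<And>x. h (f x) = x" "\<And>x. f (h x) = x"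
  and f: "linear f" and box: "\<And>a b. measure lebesgue (f ` cbox a b) = measure lebesgue (cbox a b)"
  and F[measurable]: "F \<in> borel_measurable borel"
 shows "(\<integral>\<^sup>+x. F (h x) \<partial>lborel) = (\<integral>\<^sup>+x. F x \<partial>lborel)"
proof -
 have "lborel = distr lborel borel h"
 proof (rule lborel_eqI)
  fix l u :: 'a assume le: "\<And>b. b \<in> Basis ==> l \<bullet> b \<le> u \<bullet> b"
  have vim: "h -` box l u = f ` box l u"
   using hf by (auto simp: image_iff) metis
  have S: "f ` box l u \<in> lmeasurable \<and> 1 * measure lebesgue (box l u) = measure lebesgue (f ` box l u)"
   by (rule measure_linear_sufficient [OF f]) (use box in auto)
  have b: "f ` box l u \<in> sets borel"
   using measurable_sets_borel [OF h, of "box l u"] vim by simp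
  have "emeasure (distr lborel borel h) (box l u) = emeasure lborel (f ` box l u)"
   using vim by (simp add: emeasure_distr)
  also have "... = emeasure lebesgue (f ` box l u)"
   using b by simp
  also have "... = measure lebesgue (f ` box l u)"
   using S by (simp add: emeasure_eq_measure2)
  also have "... = measure lebesgue (box l u)"
   using S by simp
  also have "... = (\<Prod>b\<in>Basis. (u - l) \<bullet> b)"
   using le by (simp add: measure_lborel_box_eq)
  finally show "emeasure (distr lborel borel h) (box l u) = (\<Prod>b\<in>Basis. (u - l) \<bullet> b)" .
 qed simp
 hence "(\<integral>\<^sup>+x. F x \<partial>lborel) = (\<integral>\<^sup>+x. F x \<partial>distr lborel borel h)"
  by (rule arg_cong)
 also have "... = (\<integral>\<^sup>+x. F (h x) \<partial>lborel)"
  by (rule nn_integral_distr) simp_all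
 finally show ?thesis ..
qed


lemma prod_Basis_vec: "(\<Prod>b\<in>(Basis :: (real^'n) set). g b) = (\<Prod>k\<in>UNIV. g (axis k 1))"
proof -
 have "(Basis :: (real^'n) set) = (\<lambda>k. axis k 1) ` UNIV"
  by (auto simp: Basis_vec_def)
 moreover have "inj (\<lambda>k. axis k 1 :: real^'n)"
  by (auto simp: inj_on_def axis_eq_axis)
 ultimately show ?thesis
  by (metis (no_types, lifting) prod.reindex_cong)
qed

lemma sum_Basis_vec: "(\<Sum>b\<in>(Basis :: (real^'n) set). g b) = (\<Sum>k\<in>UNIV. g (axis k 1))"
proof -
 have "(Basis :: (real^'n) set) = (\<lambda>k. axis k 1) ` UNIV"
  by (auto simp: Basis_vec_def)
 moreover have "inj (\<lambda>k. axis k 1 :: real^'n)"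
  by (auto simp: inj_on_def axis_eq_axis)
 ultimately show ?thesis
  by (metis (no_types, lifting) sum.reindex_cong)
qed

lemma nn_integral_lborel_stretch:
 fixes c :: "'n::finite => real" and F :: "real^'n => ennreal"
 defines "f \<equiv> \<lambda>x::real^'n. \<chi> i. c i * x $ i"
 assumes c: "\<And>i. c i \<noteq> 0" and F[measurable]: "F \<in> borel_measurable borel"
 shows "(\<integral>\<^sup>+x. F (f x) * ennreal \<bar>det (matrix f)\<bar> \<partial>lborel) = (\<integral>\<^sup>+x. F x \<partial>lborel)"
proof -
 define T where "T x = (\<Sum>b\<in>Basis. (c (axis_index b) * (x \<bullet> b)) *\<^sub>R b)" for x :: "real^'n"
 have T: "T = f"
 proof
  fix x :: "real^'n"
  have "T x = (\<Sum>k\<in>UNIV. (c k * x $ k) *\<^sub>R axis k 1)"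
   unfolding T_def sum_Basis_vec by (simp add: axis_index_axis inner_axis)
  also have "... = (\<Sum>k\<in>UNIV. (f x $ k) *s axis k 1)"
   by (simp add: f_def scalar_mult_eq_scaleR)
  also have "... = f x"
   by (rule basis_expansion)
  finally show "T x = f x" .
 qed
 have d: "\<bar>det (matrix f)\<bar> = (\<Prod>b\<in>(Basis :: (real^'n) set). \<bar>c (axis_index b)\<bar>)"
 proof -
  have "matrix f = (\<chi> i j. if i = j then c i else 0)"
   by (auto simp: matrix_def vec_eq_iff axis_def f_def)
  hence "det (matrix f) = (\<Prod>i\<in>UNIV. c i)"
   by (subst det_diagonal) auto
  thus ?thesis
   unfolding prod_Basis_vec by (simp add: axis_index_axis abs_prod)
 qed
 have Tm[measurable]: "T \<in> borel_measurable borel"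
  unfolding T_def by measurable
 have "(\<integral>\<^sup>+x. F x \<partial>lborel) = (\<integral>\<^sup>+x. F x \<partial>density (distr lborel borel T)
   (\<lambda>_. \<Prod>b\<in>(Basis :: (real^'n) set). \<bar>c (axis_index b)\<bar>))"
  using lborel_affine_euclidean [where t = "0::real^'n" and c = "\<lambda>b. c (axis_index b)"] c
  by (simp add: T_def [abs_def] prod_ennreal)
 also have "... = (\<integral>\<^sup>+x. F (T x) * ennreal \<bar>det (matrix f)\<bar> \<partial>lborel)"
  unfolding d by (subst nn_integral_density) (auto simp: nn_integral_distr mult.commute)
 finally show ?thesis
  by (simp add: T)
qed

lemma nn_integral_lborel_swap:
 fixes F :: "real^'n => ennreal" and m n :: 'n
 defines "h \<equiv> \<lambda>v::real^'n. \<chi> i. v $ Transposition.transpose m n i"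
 assumes mn: "m \<noteq> n" and F[measurable]: "F \<in> borel_measurable borel"
 shows "(\<integral>\<^sup>+x. F (h x) * ennreal \<bar>det (matrix h)\<bar> \<partial>lborel) = (\<integral>\<^sup>+x. F x \<partial>lborel)"
proof -
 have lin: "linear h"
  by (rule linearI) (simp_all add: vec_eq_iff h_def)
 have hh: "h (h x) = x" for x
  by (simp add: vec_eq_iff h_def)
 have "h ` cbox a b = cbox (h a) (h b)" for a b
 proof -
  have 1: "h x \<in> cbox (h a) (h b)" if "x \<in> cbox a b" for x a b
   using that by (simp add: mem_box_cart h_def)
  have "x \<in> h ` cbox a b" if "x \<in> cbox (h a) (h b)" for x
   using 1 [OF that] hh by (metis image_eqI)
  with 1 show ?thesis by blast
 qed
 moreover have "measure lebesgue (cbox (h a) (h b)) = measure lebesgue (cbox a b)" for a b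
 proof -
  have 1: "cbox (h a) (h b) = {}" if e: "cbox a b = {}" for a b
  proof -
   obtain i where "b $ i < a $ i" using e unfolding interval_eq_empty_cart by blast
   hence "h b $ Transposition.transpose m n i < h a $ Transposition.transpose m n i"
    by (simp add: h_def)
   thus ?thesis by (meson interval_eq_empty_cart)
  qed
  show ?thesis
  proof (cases "cbox a b = {}")
   case False
   hence "cbox (h a) (h b) \<noteq> {}" using 1 [of "h a" "h b"] hh by auto
   moreover have "(\<Prod>i\<in>UNIV. h b $ i - h a $ i) = (\<Prod>i\<in>UNIV. b $ i - a $ i)"
    using prod.permute [OF permutes_swap_id, where S=UNIV and g="\<lambda>i. b $ i - a $ i", of m n]
    by (simp add: o_def h_def)
   ultimately show ?thesis
    using False by (simp add: content_cbox_cart)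
  qed (use 1 in simp)
 qed
 ultimately have box: "measure lebesgue (h ` cbox a b) = measure lebesgue (cbox a b)" for a b
  by simp
 have "(\<integral>\<^sup>+x. F (h x) \<partial>lborel) = (\<integral>\<^sup>+x. F x \<partial>lborel)"
  by (rule nn_integral_lborel_of_image [where f = h])
   (use lin hh box F in \<open>auto simp: borel_measurable_continuous_onI linear_continuous_on linear_linear\<close>)
 moreover have "\<bar>det (matrix h)\<bar> = 1"
 proof -
  have "matrix h = (\<chi> i. (mat 1 :: real^'n^'n) $ Transposition.transpose m n i)"
   by (auto simp: matrix_def vec_eq_iff axis_def mat_def h_def)
  thus ?thesis
   using mn by (simp add: det_permute_rows permutes_swap_id sign_swap_id abs_mult)
 qed
 ultimately show ?thesis
  by simp
qed

lemma nn_integral_lborel_shear: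
 fixes F :: "real^'n => ennreal" and m n :: 'n
 defines "h \<equiv> \<lambda>v::real^'n. \<chi> i. if i = m then v $ m + v $ n else v $ i"
 assumes mn: "m \<noteq> n" and F[measurable]: "F \<in> borel_measurable borel"
 shows "(\<integral>\<^sup>+x. F (h x) * ennreal \<bar>det (matrix h)\<bar> \<partial>lborel) = (\<integral>\<^sup>+x. F x \<partial>lborel)"
proof -
 define g where "g v = (\<chi> i. if i = m then v $ m - v $ n else v $ i)" for v :: "real^'n"
 have lin: "linear h"
  by (rule linearI) (auto simp: vec_eq_iff algebra_simps h_def)
 have lg: "linear g"
  by (rule linearI) (auto simp: vec_eq_iff algebra_simps g_def)
 have hg: "h (g x) = x" "g (h x) = x" for x
  using mn by (auto simp: vec_eq_iff h_def g_def)
 have [measurable]: "h \<in> borel_measurable borel" "g \<in> borel_measurable borel"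
  using lin lg by (simp_all add: borel_measurable_continuous_onI linear_continuous_on linear_linear)
 have box: "measure lebesgue (h ` cbox a b) = measure lebesgue (cbox a b)" for a b
 proof (cases "cbox a b = {}")
  case False
  define v :: "real^'n" where "v = (\<chi> i. if i = n then - a $ n else 0)"
  have "h ` cbox a b = (+) (h (- v)) ` h ` (+) v ` cbox a b"
   unfolding image_comp o_def using linear_add [OF lin, symmetric] by simp
  hence "measure lebesgue (h ` cbox a b) = measure lebesgue (h ` (+) v ` cbox a b)"
   by (simp add: measure_translation)
  also have "... = measure lebesgue (h ` cbox (v + a) (v + b))"
   by (simp add: cbox_translation)
  also have "... = measure lebesgue (cbox (v + a) (v + b))"
   unfolding h_def using False mn by (intro measure_shear_interval)
    (auto simp: v_def cbox_translation)
  also have "... = measure lebesgue (cbox a b)"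
   by (metis cbox_translation measure_translation)
  finally show ?thesis .
 qed simp
 have "(\<integral>\<^sup>+x. F (h (g x)) \<partial>lborel) = (\<integral>\<^sup>+x. F (h x) \<partial>lborel)"
  by (rule nn_integral_lborel_of_image [where f = h and h = g and F = "\<lambda>x. F (h x)"])
   (use hg lin box in auto)
 hence "(\<integral>\<^sup>+x. F (h x) \<partial>lborel) = (\<integral>\<^sup>+x. F x \<partial>lborel)"
  by (simp add: hg)
 moreover have "det (matrix h) = 1"
 proof -
  have "matrix h = (\<chi> k. if k = m then row m (mat 1) + 1 *s row n (mat 1) else row k (mat 1))"
   by (auto simp: matrix_def vec_eq_iff axis_def mat_def row_def h_def)
  thus ?thesis
   by (simp only: det_row_operation [OF mn] det_I)
 qed
 ultimately show ?thesis
  by simp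
qed

lemma nn_integral_lborel_linear:
 fixes f :: "real^'n => real^'n"
 assumes f: "linear f" "inj f" and F: "F \<in> borel_measurable borel"
 shows "(\<integral>\<^sup>+x. F (f x) * ennreal \<bar>det (matrix f)\<bar> \<partial>lborel) = (\<integral>\<^sup>+x. F x \<partial>lborel)"
proof -
 define Q where "Q f \<longleftrightarrow> inj f \<longrightarrow> (\<forall>F\<in>borel_measurable borel.
   (\<integral>\<^sup>+x. F (f x) * ennreal \<bar>det (matrix f)\<bar> \<partial>lborel) = (\<integral>\<^sup>+x. F x \<partial>lborel))"
  for f :: "real^'n => real^'n"
 have "Q f"
 proof (rule induct_linear_elementary [OF f(1)])
  fix f g :: "real^'n => real^'n"
  assume lin: "linear f" "linear g" and f: "Q f" and g: "Q g"
  show "Q (f \<circ> g)"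
   unfolding Q_def
  proof (intro impI ballI)
   fix F :: "real^'n => ennreal"
   assume F[measurable]: "F \<in> borel_measurable borel" and inj: "inj (f \<circ> g)"
   have [measurable]: "f \<in> borel_measurable borel"
    using lin by (simp_all add: borel_measurable_continuous_onI linear_continuous_on linear_linear)
   have ig: "inj g"
    using inj by (rule inj_on_imageI2)
   hence "surj g"
    using lin(2) linear_injective_imp_surjective by blast
   have "inj f"
   proof (rule injI)
    fix x y assume "f x = f y"
    moreover obtain a b where ab: "x = g a" "y = g b"
     using \<open>surj g\<close> by (meson surjD)
    ultimately have "(f \<circ> g) a = (f \<circ> g) b"
     by simp
    with inj have "a = b"
     by (rule injD)
    with ab show "x = y"
     by simp
   qed
   hence "(\<integral>\<^sup>+x. F x \<partial>lborel) = (\<integral>\<^sup>+x. F (f x) * ennreal \<bar>det (matrix f)\<bar> \<partial>lborel)"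
    using f F by (simp add: Q_def)
   also have "... = (\<integral>\<^sup>+x. (F (f (g x)) * ennreal \<bar>det (matrix f)\<bar>) * ennreal \<bar>det (matrix g)\<bar> \<partial>lborel)"
    using g [unfolded Q_def, rule_format, OF ig, of "\<lambda>x. F (f x) * ennreal \<bar>det (matrix f)\<bar>"]
    by simp
   also have "... = (\<integral>\<^sup>+x. F ((f \<circ> g) x) * ennreal \<bar>det (matrix (f \<circ> g))\<bar> \<partial>lborel)"
    using lin by (simp add: matrix_compose det_mul abs_mult ennreal_mult mult.assoc)
   finally show "(\<integral>\<^sup>+x. F ((f \<circ> g) x) * ennreal \<bar>det (matrix (f \<circ> g))\<bar> \<partial>lborel)
     = (\<integral>\<^sup>+x. F x \<partial>lborel)" ..
  qed
 next
  fix f :: "real^'n => real^'n" and i :: 'n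
  assume "linear f" "\<And>x. f x $ i = 0"
  hence "\<not> inj f"
   by (metis (full_types) linear_injective_imp_surjective one_neq_zero surjE vec_component)
  thus "Q f" by (simp add: Q_def)
 next
  fix c :: "'n => real"
  show "Q (\<lambda>x. \<chi> i. c i * x $ i)"
   unfolding Q_def
  proof (intro impI ballI nn_integral_lborel_stretch)
   fix i
   assume inj: "inj (\<lambda>x::real^'n. \<chi> i. c i * x $ i)"
   show "c i \<noteq> 0"
   proof
    assume "c i = 0"
    hence "(\<chi> j. c j * axis i 1 $ j) = (\<chi> j. c j * (0::real^'n) $ j)"
     by (simp add: vec_eq_iff axis_def)
    with inj have "axis i (1::real) = 0" by (rule injD)
    thus False by (simp add: axis_eq_0_iff)
   qed
  qed
 next
  fix m n :: 'n
  assume "m \<noteq> n"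
  thus "Q (\<lambda>x. \<chi> i. x $ Transposition.transpose m n i)"
   unfolding Q_def by (intro impI ballI nn_integral_lborel_swap)
 next
  fix m n :: 'n
  assume "m \<noteq> n"
  thus "Q (\<lambda>x. \<chi> i. if i = m then x $ m + x $ n else x $ i)"
   unfolding Q_def by (intro impI ballI nn_integral_lborel_shear)
 qed
 with f F show ?thesis by (simp add: Q_def)
qed

lemma inner_matrix_vector: "((A::real^'n^'m) *v x) \<bullet> y = x \<bullet> (transpose A *v y)"
 by (metis dot_lmul_matrix inner_commute transpose_matrix_vector)

lemma matrix_inv_cancel:
 assumes "invertible (A::real^'n^'n)"
 shows "matrix_inv A ** A = mat 1" "A ** matrix_inv A = mat 1"
  "matrix_inv A *v (A *v x) = x" "A *v (matrix_inv A *v x) = x"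
proof -
 have "A ** matrix_inv A = mat 1 \<and> matrix_inv A ** A = mat 1"
  using assms unfolding matrix_inv_def invertible_def by (rule someI_ex)
 thus "matrix_inv A ** A = mat 1" "A ** matrix_inv A = mat 1"
  "matrix_inv A *v (A *v x) = x" "A *v (matrix_inv A *v x) = x"
  by (simp_all add: matrix_vector_mul_assoc)
qed

lemma matrix_inv_unique: "(A::real^'n^'n) ** B = mat 1 ==> matrix_inv A = B"
 by (metis invertible_right_inverse matrix_inv_cancel(1) matrix_mul_assoc matrix_mul_lid matrix_mul_rid)

lemma invertible_matrix_inv: "invertible (A::real^'n^'n) ==> invertible (matrix_inv A)"
 by (metis invertible_def matrix_inv_cancel(1,2))

lemma transpose_matrix_inv:
 "invertible (A::real^'n^'n) ==> matrix_inv (transpose A) = transpose (matrix_inv A)"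
 by (rule matrix_inv_unique) (metis matrix_inv_cancel(1) matrix_transpose_mul transpose_mat)

lemma pos_def_invertible:
 assumes "pos_def S"
 shows "invertible S"
proof -
 have "x = 0" if "S *v x = 0" for x
  using assms that unfolding pos_def_def by (metis inner_zero_right less_irrefl)
 thus ?thesis
  by (metis invertible_left_inverse matrix_left_invertible_ker)
qed

lemma pos_def_congruence:
 fixes S G :: "real^'n^'n"
 assumes "pos_def S" "invertible G"
 shows "pos_def (transpose G ** S ** G)"
 unfolding pos_def_def
proof (intro conjI allI impI)
 show "transpose (transpose G ** S ** G) = transpose G ** S ** G"
  using assms(1) by (simp add: pos_def_def matrix_transpose_mul matrix_mul_assoc)
 fix x :: "real^'n" assume "x \<noteq> 0"
 hence "G *v x \<noteq> 0"
  using assms(2) by (metis matrix_inv_cancel(3) matrix_vector_mult_0_right)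
 hence "(G *v x) \<bullet> (S *v (G *v x)) > 0"
  using assms(1) by (simp add: pos_def_def)
 thus "x \<bullet> ((transpose G ** S ** G) *v x) > 0"
  by (simp only: matrix_vector_mul_assoc [symmetric] inner_matrix_vector)
qed

lemma pos_def_mat_1: "pos_def (mat 1)"
 by (simp add: pos_def_def)

lemma pos_def_matrix_inv:
 assumes "pos_def S"
 shows "pos_def (matrix_inv S)"
proof -
 have inv: "invertible S"
  by (rule pos_def_invertible [OF assms])
 have "pos_def (transpose (matrix_inv S) ** S ** matrix_inv S)"
  by (rule pos_def_congruence [OF assms invertible_matrix_inv [OF inv]])
 moreover have "transpose (matrix_inv S) ** S ** matrix_inv S = matrix_inv S"
  using assms inv transpose_matrix_inv [OF inv]
  by (simp add: pos_def_def matrix_inv_cancel)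
 ultimately show ?thesis by simp
qed

lemma pos_def_orthonormal_set:
 fixes S :: "real^'n^'n" and u :: "real^'n"
 assumes S: "pos_def S" and u: "u \<bullet> (S *v u) = 1"
 shows "1 \<le> k ==> k \<le> CARD('n) ==> \<exists>F. finite F \<and> card F = k \<and> u \<in> F \<and>
   (\<forall>x\<in>F. \<forall>y\<in>F. x \<bullet> (S *v y) = (if x = y then 1 else 0))"
proof (induction k rule: dec_induct)
 case base
 show ?case using u by (intro exI [of _ "{u}"]) auto
next
 case (step k)
 then obtain F where F: "finite F" "card F = k" "u \<in> F"
  "\<And>x y. x \<in> F ==> y \<in> F ==> x \<bullet> (S *v y) = (if x = y then 1 else 0)"
  by (metis Suc_leD)
 have sym: "x \<bullet> (S *v y) = y \<bullet> (S *v x)" for x y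
  using S by (metis inner_commute inner_matrix_vector pos_def_def)
 have "dim ((*v) S ` F) \<le> card F"
  using F(1) by (meson card_image_le dim_le_card' finite_imageI le_trans)
 hence "dim ((*v) S ` F) < DIM(real^'n)"
  using F(2) step.prems by simp
 then obtain x where x: "x \<noteq> 0" "\<And>y. y \<in> span ((*v) S ` F) ==> orthogonal x y"
  using orthogonal_to_subspace_exists by metis
 have x0: "x \<bullet> (S *v y) = 0" if "y \<in> F" for y
  using x(2) [of "S *v y"] that by (simp add: orthogonal_def span_base)
 have pos: "0 < x \<bullet> (S *v x)"
  using S x(1) by (simp add: pos_def_def)
 define z where "z = (1 / sqrt (x \<bullet> (S *v x))) *\<^sub>R x"
 have z0: "z \<bullet> (S *v y) = 0" "y \<bullet> (S *v z) = 0" if "y \<in> F" for y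
  using x0 [OF that] sym [of z y] by (simp_all add: z_def)
 have z1: "z \<bullet> (S *v z) = 1"
  using pos by (simp add: z_def matrix_vector_mult_scaleR)
 have "z \<notin> F"
  using z0 z1 by force
 with F z0 z1 show ?case
  by (intro exI [of _ "insert z F"]) auto
qed

lemma pos_def_orthonormal_matrix:
 fixes S :: "real^'n^'n" and u :: "real^'n"
 assumes S: "pos_def S" and u: "u \<bullet> (S *v u) = 1"
 obtains A where "transpose A ** S ** A = mat 1" "A *v axis (k::'n) 1 = u" "invertible A"
proof -
 obtain F where F: "finite F" "card F = CARD('n)" "u \<in> F"
  "\<And>x y. x \<in> F ==> y \<in> F ==> x \<bullet> (S *v y) = (if x = y then 1 else 0)"
  using pos_def_orthonormal_set [OF assms, of "CARD('n)"] by auto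
 obtain h where h: "bij_betw h (UNIV :: 'n set) F"
  using F(1,2) by (metis bij_betw_iff_card finite_class.finite_UNIV)
 obtain j where j: "h j = u"
  using h F(3) by (metis bij_betw_iff_bijections)
 define g where "g = h \<circ> Transposition.transpose j k"
 have g: "bij_betw g UNIV F"
  unfolding g_def by (rule bij_betw_trans [OF _ h]) simp
 have gk: "g k = u"
  by (simp add: g_def j)
 define A :: "real^'n^'n" where "A = (\<chi> i j. g j $ i)"
 have Aax: "A *v axis i 1 = g i" for i
  by (simp add: A_def matrix_vector_mult_basis column_def vec_eq_iff)
 have "(transpose A ** S ** A) $ i $ j = (mat 1 :: real^'n^'n) $ i $ j" for i j
 proof -
  have "(transpose A ** S ** A) $ i $ j = axis i 1 \<bullet> ((transpose A ** S ** A) *v axis j 1)"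
   by (simp add: matrix_vector_mult_basis column_def inner_axis')
  also have "... = g i \<bullet> (S *v g j)"
   by (simp only: matrix_vector_mul_assoc [symmetric] inner_matrix_vector Aax transpose_transpose
     flip: inner_matrix_vector)
  also have "... = (mat 1 :: real^'n^'n) $ i $ j"
   using F(4) [of "g i" "g j"] g by (auto simp: mat_def bij_betw_def inj_on_def)
  finally show ?thesis .
 qed
 hence *: "transpose A ** S ** A = mat 1"
  by (simp add: vec_eq_iff)
 moreover have "invertible A"
  using * invertible_left_inverse by blast
 ultimately show ?thesis
  using that Aax gk by metis
qed

lemma pos_def_factor:
 fixes S :: "real^'n^'n"
 assumes S: "pos_def S"
 obtains L :: "real^'n^'n" where "invertible L" "S = transpose L ** L"
proof -
 define x :: "real^'n" where "x = axis undefined 1"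
 have "0 < x \<bullet> (S *v x)"
  using S by (simp add: pos_def_def x_def axis_eq_0_iff)
 hence "((1 / sqrt (x \<bullet> (S *v x))) *\<^sub>R x) \<bullet> (S *v ((1 / sqrt (x \<bullet> (S *v x))) *\<^sub>R x)) = 1"
  by (simp add: matrix_vector_mult_scaleR)
 from pos_def_orthonormal_matrix [OF S this, of undefined]
 obtain A :: "real^'n^'n" where A: "transpose A ** S ** A = mat 1" "invertible A" by blast
 let ?L = "matrix_inv A"
 have "S = transpose (A ** ?L) ** S ** (A ** ?L)"
  using A(2) by (simp add: matrix_inv_cancel)
 also have "... = transpose ?L ** (transpose A ** S ** A) ** ?L"
  by (simp only: matrix_transpose_mul matrix_mul_assoc)
 finally have "S = transpose ?L ** ?L"
  using A(1) by simp
 thus ?thesis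
  by (rule that [OF invertible_matrix_inv [OF A(2)]])
qed

lemma pos_def_det_pos:
 fixes S :: "real^'a^'a"
 assumes "pos_def S"
 shows "0 < det S"
proof -
 obtain L :: "real^'a^'a" where L: "invertible L" "S = transpose L ** L"
  using pos_def_factor [OF assms] by blast
 thus ?thesis
  by (metis det_mul det_transpose invertible_det_nz power2_eq_square zero_less_power2)
qed

section \<open>Polynomially bounded functions and normal laws\<close>

definition poly_bounded :: "('a::real_normed_vector => real) => bool" where
 "poly_bounded f \<longleftrightarrow> (\<exists>C N. \<forall>x. \<bar>f x\<bar> \<le> C * (1 + norm x) ^ N)"

named_theorems poly_bounded_intros

lemma poly_boundedI: "(\<And>x. \<bar>f x\<bar> \<le> C * (1 + norm x) ^ N) ==> poly_bounded f"
 by (auto simp: poly_bounded_def)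

lemma poly_boundedE:
 assumes "poly_bounded f"
 obtains C N where "C \<ge> 0" "\<And>x. \<bar>f x\<bar> \<le> C * (1 + norm x) ^ N"
proof -
 obtain C N where *: "\<And>x. \<bar>f x\<bar> \<le> C * (1 + norm x) ^ N"
  using assms by (auto simp: poly_bounded_def)
 from * [of 0] have "0 \<le> C" by (simp add: order_trans [OF abs_ge_zero])
 with * that show ?thesis by blast
qed

lemma weight_mono: "N \<le> N' ==> (1 + norm x) ^ N \<le> (1 + norm x) ^ N'"
 by (rule power_increasing) auto

lemma poly_bounded_bounded: "(\<And>x. \<bar>f x\<bar> \<le> C) ==> poly_bounded f"
 by (rule poly_boundedI [where C = C and N = 0]) simp

lemma poly_bounded_const [simp, poly_bounded_intros]: "poly_bounded (\<lambda>_. c)"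
 by (rule poly_bounded_bounded [where C = "\<bar>c\<bar>"]) simp

lemma poly_bounded_mono:
 fixes f g :: "'a::real_normed_vector => real"
 assumes "poly_bounded g" "\<And>x. \<bar>f x\<bar> \<le> \<bar>g x\<bar>"
 shows "poly_bounded f"
 using assms unfolding poly_bounded_def by (meson order_trans)

lemma poly_bounded_add [poly_bounded_intros]:
 fixes f g :: "'a::real_normed_vector => real"
 assumes "poly_bounded f" "poly_bounded g"
 shows "poly_bounded (\<lambda>x. f x + g x)"
proof -
 obtain C N where f: "C \<ge> 0" "\<And>x. \<bar>f x\<bar> \<le> C * (1 + norm x) ^ N"
  using poly_boundedE [OF assms(1)] by blast
 obtain C' N' where g: "C' \<ge> 0" "\<And>x. \<bar>g x\<bar> \<le> C' * (1 + norm x) ^ N'"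
  using poly_boundedE [OF assms(2)] by blast
 show ?thesis
 proof (rule poly_boundedI)
  fix x :: 'a
  have "C * (1 + norm x) ^ N \<le> C * (1 + norm x) ^ max N N'"
   "C' * (1 + norm x) ^ N' \<le> C' * (1 + norm x) ^ max N N'"
   using f(1) g(1) by (auto intro!: mult_left_mono weight_mono)
  thus "\<bar>f x + g x\<bar> \<le> (C + C') * (1 + norm x) ^ max N N'"
   using f(2) [of x] g(2) [of x] by (simp add: distrib_right)
 qed
qed

lemma poly_bounded_mult [poly_bounded_intros]:
 assumes "poly_bounded f" "poly_bounded g"
 shows "poly_bounded (\<lambda>x. f x * g x)"
proof -
 obtain C N where f: "C \<ge> 0" "\<And>x. \<bar>f x\<bar> \<le> C * (1 + norm x) ^ N"
  using poly_boundedE [OF assms(1)] by blast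
 obtain C' N' where g: "C' \<ge> 0" "\<And>x. \<bar>g x\<bar> \<le> C' * (1 + norm x) ^ N'"
  using poly_boundedE [OF assms(2)] by blast
 show ?thesis
 proof (rule poly_boundedI)
  fix x
  have "\<bar>f x * g x\<bar> \<le> (C * (1 + norm x) ^ N) * (C' * (1 + norm x) ^ N')"
   unfolding abs_mult using f g by (intro mult_mono) auto
  thus "\<bar>f x * g x\<bar> \<le> (C * C') * (1 + norm x) ^ (N + N')"
   by (simp add: power_add mult_ac)
 qed
qed

lemma poly_bounded_uminus [poly_bounded_intros]: "poly_bounded f ==> poly_bounded (\<lambda>x. - f x)"
 by (simp add: poly_bounded_def)

lemma poly_bounded_diff [poly_bounded_intros]:
 assumes "poly_bounded f" "poly_bounded g"
 shows "poly_bounded (\<lambda>x. f x - g x)"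
proof -
 have "poly_bounded (\<lambda>x. f x + - g x)"
  by (intro poly_bounded_add poly_bounded_uminus assms)
 thus ?thesis by simp
qed

lemma poly_bounded_divide [poly_bounded_intros]: "poly_bounded f ==> poly_bounded (\<lambda>x. f x / c)"
 using poly_bounded_mult [OF _ poly_bounded_const, of f "1 / c"] by simp

lemma poly_bounded_abs [poly_bounded_intros]: "poly_bounded f ==> poly_bounded (\<lambda>x. \<bar>f x\<bar>)"
 by (simp add: poly_bounded_def)

lemma poly_bounded_power [poly_bounded_intros]: "poly_bounded f ==> poly_bounded (\<lambda>x. f x ^ n)"
 by (induction n) (auto intro: poly_bounded_intros)

lemma poly_bounded_sum [poly_bounded_intros]: "(\<And>i. i \<in> I ==> poly_bounded (f i)) ==> poly_bounded (\<lambda>x. \<Sum>i\<in>I. f i x)"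
 by (induction I rule: infinite_finite_induct) (auto intro: poly_bounded_intros)

lemma poly_bounded_norm [simp, poly_bounded_intros]: "poly_bounded (\<lambda>x. norm x)"
 by (rule poly_boundedI [where C = 1 and N = 1]) simp

lemma poly_bounded_linear: "bounded_linear f ==> poly_bounded f"
proof -
 assume "bounded_linear f"
 then obtain K where K: "\<And>x. \<bar>f x\<bar> \<le> norm x * K"
  using bounded_linear.bounded by fastforce
 show ?thesis
 proof (rule poly_bounded_mono [of "\<lambda>x. norm x * \<bar>K\<bar>"])
  show "poly_bounded (\<lambda>x. norm x * \<bar>K\<bar>)"
   by (intro poly_bounded_intros)
  have "norm x * K \<le> norm x * \<bar>K\<bar>" for x
   by (simp add: mult_left_mono)
  thus "\<bar>f x\<bar> \<le> \<bar>norm x * \<bar>K\<bar>\<bar>" for x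
   unfolding abs_mult by (metis K abs_abs abs_norm_cancel order_trans)
 qed
qed

lemma poly_bounded_id [simp, poly_bounded_intros]: "poly_bounded (\<lambda>x::real. x)"
 by (rule poly_bounded_linear) (rule bounded_linear_ident)

lemma poly_bounded_inner [simp, poly_bounded_intros]: "poly_bounded (\<lambda>x. x \<bullet> a)" "poly_bounded (\<lambda>x. a \<bullet> x)"
 by (auto intro!: poly_bounded_linear bounded_linear_inner_left bounded_linear_inner_right)

lemma poly_bounded_nth [simp, poly_bounded_intros]: "poly_bounded (\<lambda>x::real^'n. x $ k)"
 by (rule poly_bounded_linear) (rule bounded_linear_vec_nth)

lemma poly_bounded_compose:
 assumes "poly_bounded f" "poly_bounded (\<lambda>x. norm (g x))"
 shows "poly_bounded (\<lambda>x. f (g x))"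
proof -
 obtain C N where f: "C \<ge> 0" "\<And>x. \<bar>f x\<bar> \<le> C * (1 + norm x) ^ N"
  using poly_boundedE [OF assms(1)] by blast
 have "poly_bounded (\<lambda>x. C * (1 + norm (g x)) ^ N)"
  by (intro poly_bounded_intros assms(2))
 thus ?thesis
  by (rule poly_bounded_mono) (meson abs_ge_self f(2) order_trans)
qed

lemma power_add_le: "0 \<le> a ==> 0 \<le> b ==> (a + b) ^ N \<le> 2 ^ N * (a ^ N + b ^ N :: real)"
proof -
 assume "0 \<le> a" "0 \<le> b"
 hence "(a + b) ^ N \<le> (2 * max a b) ^ N"
  by (intro power_mono) auto
 also have "... = 2 ^ N * max a b ^ N"
  by (simp add: power_mult_distrib)
 also have "... \<le> 2 ^ N * (a ^ N + b ^ N)"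
  using \<open>0 \<le> a\<close> \<open>0 \<le> b\<close> by (intro mult_left_mono) (auto simp: max_def)
 finally show ?thesis .
qed

lemma integrable_normal_density_poly_bounded:
 assumes [measurable]: "f \<in> borel_measurable borel" and f: "poly_bounded f"
 shows "integrable lborel (\<lambda>t. normal_density m 1 t * f t)"
proof -
 obtain C N where C: "C \<ge> 0" "\<And>x. \<bar>f x\<bar> \<le> C * (1 + norm x) ^ N"
  using poly_boundedE [OF f] by blast
 let ?b = "\<lambda>t. C * 2 ^ N * (1 + \<bar>m\<bar>) ^ N * normal_density m 1 t
   + C * 2 ^ N * (normal_density m 1 t * \<bar>t - m\<bar> ^ N)"
 have "\<bar>f t\<bar> \<le> C * 2 ^ N * ((1 + \<bar>m\<bar>) ^ N + \<bar>t - m\<bar> ^ N)" for t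
 proof -
  have "\<bar>f t\<bar> \<le> C * (1 + \<bar>t\<bar>) ^ N"
   using C(2) [of t] by simp
  also have "... \<le> C * ((1 + \<bar>m\<bar>) + \<bar>t - m\<bar>) ^ N"
   using C(1) by (intro mult_left_mono power_mono) auto
  also have "... \<le> C * (2 ^ N * ((1 + \<bar>m\<bar>) ^ N + \<bar>t - m\<bar> ^ N))"
   using C(1) by (intro mult_left_mono power_add_le) auto
  finally show ?thesis by simp
 qed
 hence "normal_density m 1 t * \<bar>f t\<bar> \<le> normal_density m 1 t * (C * 2 ^ N * ((1 + \<bar>m\<bar>) ^ N + \<bar>t - m\<bar> ^ N))" for t
  by (intro mult_left_mono) auto
 hence *: "norm (normal_density m 1 t * f t) \<le> ?b t" for t
  by (simp add: abs_mult algebra_simps)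
 show ?thesis
 proof (rule Bochner_Integration.integrable_bound)
  show "integrable lborel ?b"
   by (intro Bochner_Integration.integrable_add integrable_mult_right integrable_normal_density
     integrable_normal_moment_abs) auto
  show "AE t in lborel. norm (normal_density m 1 t * f t) \<le> norm (?b t)"
   using * by (intro always_eventually allI) (metis abs_ge_self order_trans real_norm_def)
 qed simp
qed

definition normal1 :: "real => real measure" where
 "normal1 m = density lborel (\<lambda>t. ennreal (normal_density m 1 t))"

definition iso_normal_density :: "real^'n => real^'n => real" where
 "iso_normal_density m y = (\<Prod>k\<in>UNIV. normal_density (m $ k) 1 (y $ k))"

definition iso_normal :: "real^'n => (real^'n) measure" where
 "iso_normal m = density lborel (\<lambda>y. ennreal (iso_normal_density m y))"

lemma sets_normal1 [simp, measurable_cong]: "sets (normal1 m) = sets borel"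
 and space_normal1 [simp]: "space (normal1 m) = UNIV"
 by (simp_all add: normal1_def)

lemma sets_iso_normal [simp, measurable_cong]: "sets (iso_normal m) = sets borel"
 and space_iso_normal [simp]: "space (iso_normal m) = UNIV"
 by (simp_all add: iso_normal_def)

lemma iso_normal_density_nonneg [simp]: "0 \<le> iso_normal_density m y"
 by (simp add: iso_normal_density_def prod_nonneg)

lemma iso_normal_density_pos: "0 < iso_normal_density m y"
 by (simp add: iso_normal_density_def prod_pos normal_density_pos)

lemma measurable_iso_normal_density [measurable]: "iso_normal_density m \<in> borel_measurable borel"
 unfolding iso_normal_density_def by measurable

lemma prob_space_normal1: "prob_space (normal1 m)"
 unfolding normal1_def by (rule prob_space_normal_density) simp

lemma integrable_normal1:
 "f \<in> borel_measurable borel ==> poly_bounded f ==> integrable (normal1 m) f"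
 unfolding normal1_def
 by (subst integrable_density) (auto simp: integrable_normal_density_poly_bounded)

lemma integral_normal1:
 "f \<in> borel_measurable borel ==> (LINT t|normal1 m. f t) = (LINT t|lborel. normal_density m 1 t * f t)"
 unfolding normal1_def by (subst integral_density) auto

lemma integral_iso_normal:
 "f \<in> borel_measurable borel ==> (LINT y|iso_normal m. f y) = (LINT y|lborel. iso_normal_density m y * f y)"
 for f :: "real^'n => real"
 unfolding iso_normal_def by (subst integral_density) auto

lemma lborel_vec_prod:
 fixes f :: "'n::finite => real => real"
 assumes f: "\<And>k. integrable lborel (f k)"
 shows "integrable lborel (\<lambda>y::real^'n. \<Prod>k\<in>UNIV. f k (y $ k))"
  and "(\<integral>y. (\<Prod>k\<in>UNIV. f k (y $ k)) \<partial>(lborel :: (real^'n) measure)) = (\<Prod>k\<in>UNIV. LINT t|lborel. f k t)"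
proof -
 let ?B = "Basis :: (real^'n) set"
 let ?g = "\<lambda>x. \<Sum>b\<in>?B. x b *\<^sub>R b"
 interpret product_sigma_finite "\<lambda>_::real^'n. lborel :: real measure" ..
 have m: "(\<lambda>y::real^'n. \<Prod>k\<in>UNIV. f k (y $ k)) \<in> borel_measurable borel"
  using borel_measurable_integrable [OF f] by measurable
 have g: "?g x $ k = x (axis k 1)" for x k
  by (simp add: sum_Basis_vec axis_def if_distrib cong: if_cong)
 have eq: "(\<Prod>k\<in>UNIV. f k (?g x $ k)) = (\<Prod>b\<in>?B. f (axis_index b) (x b))" for x
  by (simp only: g prod_Basis_vec axis_index_axis)
 have fb: "\<And>b. b \<in> ?B ==> integrable lborel (f (axis_index b))"
  using f by blast
 have gm: "?g \<in> (\<Pi>\<^sub>M b\<in>?B. lborel) \<rightarrow>\<^sub>M borel"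
  by measurable
 show "integrable lborel (\<lambda>y::real^'n. \<Prod>k\<in>UNIV. f k (y $ k))"
  unfolding lborel_eq [where 'a = "real^'n"]
  by (subst integrable_distr_eq [OF gm m]) (simp only: eq, rule product_integrable_prod [OF _ fb], auto)
 have "(\<integral>y. (\<Prod>k\<in>UNIV. f k (y $ k)) \<partial>(lborel :: (real^'n) measure))
   = (\<integral>x. (\<Prod>b\<in>?B. f (axis_index b) (x b)) \<partial>(\<Pi>\<^sub>M b\<in>?B. lborel))"
  unfolding lborel_eq [where 'a = "real^'n"] by (subst integral_distr [OF gm m]) (simp only: eq)
 also have "... = (\<Prod>b\<in>?B. LINT t|lborel. f (axis_index b) t)"
  by (rule product_integral_prod [OF _ fb]) auto
 finally show "(\<integral>y. (\<Prod>k\<in>UNIV. f k (y $ k)) \<partial>(lborel :: (real^'n) measure)) = (\<Prod>k\<in>UNIV. LINT t|lborel. f k t)"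
  by (simp add: prod_Basis_vec axis_index_axis)
qed

lemma integral_iso_normal_prod:
 fixes g :: "'n::finite => real => real" and m :: "real^'n"
 assumes g: "\<And>k. g k \<in> borel_measurable borel" "\<And>k. poly_bounded (g k)"
 shows "integrable (iso_normal m) (\<lambda>y. \<Prod>k\<in>UNIV. g k (y $ k))"
  and "(LINT y|iso_normal m. (\<Prod>k\<in>UNIV. g k (y $ k))) = (\<Prod>k\<in>UNIV. LINT t|normal1 (m $ k). g k t)"
proof -
 have [measurable]: "(\<lambda>y::real^'n. \<Prod>k\<in>UNIV. g k (y $ k)) \<in> borel_measurable borel"
  using g(1) by measurable
 have int: "\<And>k. integrable lborel (\<lambda>t. normal_density (m $ k) 1 t * g k t)"
  using integrable_normal_density_poly_bounded g by blast
 show "integrable (iso_normal m) (\<lambda>y. \<Prod>k\<in>UNIV. g k (y $ k))"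
  unfolding iso_normal_def
  using lborel_vec_prod(1) [OF int]
  by (subst integrable_density) (simp_all add: iso_normal_density_def [abs_def] prod.distrib prod_nonneg)
 show "(LINT y|iso_normal m. (\<Prod>k\<in>UNIV. g k (y $ k))) = (\<Prod>k\<in>UNIV. LINT t|normal1 (m $ k). g k t)"
  using lborel_vec_prod(2) [OF int] g(1)
  by (subst integral_iso_normal) (auto simp: iso_normal_density_def prod.distrib integral_normal1)
qed

lemma prob_space_iso_normal: "prob_space (iso_normal m)"
proof -
 have "integrable (iso_normal m) (\<lambda>y. 1::real)" "(LINT y|iso_normal m. (1::real)) = 1"
  using integral_iso_normal_prod [of "\<lambda>_ _. 1" m] prob_space.prob_space [OF prob_space_normal1, unfolded space_normal1]
  by (auto intro: poly_bounded_intros)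
 hence m: "measure (iso_normal m) (space (iso_normal m)) = 1"
  by simp
 hence "emeasure (iso_normal m) (space (iso_normal m)) \<noteq> \<top>"
  by (auto simp: measure_def)
 with m show ?thesis
  by (intro prob_spaceI) (metis emeasure_eq_ennreal_measure ennreal_1)
qed

lemma integrable_iso_normal:
 fixes f :: "real^'n => real"
 assumes [measurable]: "f \<in> borel_measurable borel" and f: "poly_bounded f"
 shows "integrable (iso_normal m) f"
proof -
 obtain C N where C: "C \<ge> 0" "\<And>x. \<bar>f x\<bar> \<le> C * (1 + norm x) ^ N"
  using poly_boundedE [OF f] by blast
 have sum_prod: "1 + (\<Sum>k\<in>I. a k) \<le> (\<Prod>k\<in>I. 1 + a k)"
  if "finite I" "\<And>k. 0 \<le> a k" for I and a :: "'n => real"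
  using that(1)
 proof induction
  case (insert i I)
  have "1 \<le> (\<Prod>k\<in>I. 1 + a k)"
   using that(2) by (intro prod_ge_1) auto
  hence "a i * 1 \<le> a i * (\<Prod>k\<in>I. 1 + a k)"
   using that(2) by (intro mult_left_mono) auto
  with insert show ?case by (simp add: distrib_right)
 qed simp
 have "\<bar>f y\<bar> \<le> C * (\<Prod>k\<in>UNIV. (1 + \<bar>y $ k\<bar>) ^ N)" for y
 proof -
  have "1 + norm y \<le> 1 + (\<Sum>k\<in>UNIV. \<bar>y $ k\<bar>)"
   using norm_le_l1_cart [of y] by simp
  also have "... \<le> (\<Prod>k\<in>UNIV. 1 + \<bar>y $ k\<bar>)"
   by (rule sum_prod) auto
  finally have "(1 + norm y) ^ N \<le> (\<Prod>k\<in>UNIV. 1 + \<bar>y $ k\<bar>) ^ N"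
   by (rule power_mono) auto
  hence "(1 + norm y) ^ N \<le> (\<Prod>k\<in>UNIV. (1 + \<bar>y $ k\<bar>) ^ N)"
   by (simp add: prod_power_distrib)
  thus ?thesis
   using C(2) [of y] mult_left_mono [OF _ C(1)] by fastforce
 qed
 moreover have "integrable (iso_normal m) (\<lambda>y. C * (\<Prod>k\<in>UNIV. (1 + \<bar>y $ k\<bar>) ^ N))"
  by (intro integrable_mult_right integral_iso_normal_prod(1)) (auto intro!: poly_bounded_intros simp flip: real_norm_def)
 ultimately show ?thesis
  by (elim Bochner_Integration.integrable_bound) (auto intro!: always_eventually intro: order_trans [OF _ abs_ge_self])
qed

lemma integral_iso_normal_coords:
 fixes \<phi> \<psi> \<eta> :: "real => real" and m :: "real^'n"
 assumes [measurable]: "\<phi> \<in> borel_measurable borel" "\<psi> \<in> borel_measurable borel" "\<eta> \<in> borel_measurable borel"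
  and pb: "poly_bounded \<phi>" "poly_bounded \<psi>" "poly_bounded \<eta>"
 shows "(LINT y|iso_normal m. \<phi> (y $ i)) = (LINT t|normal1 (m $ i). \<phi> t)"
  and "i \<noteq> j ==> (LINT y|iso_normal m. \<phi> (y $ i) * \<psi> (y $ j))
   = (LINT t|normal1 (m $ i). \<phi> t) * (LINT t|normal1 (m $ j). \<psi> t)"
  and "i \<noteq> j ==> i \<noteq> k ==> j \<noteq> k ==> (LINT y|iso_normal m. \<phi> (y $ i) * \<psi> (y $ j) * \<eta> (y $ k))
   = (LINT t|normal1 (m $ i). \<phi> t) * (LINT t|normal1 (m $ j). \<psi> t) * (LINT t|normal1 (m $ k). \<eta> t)"
proof -
 interpret N: prob_space "normal1 a" for a by (rule prob_space_normal1)
 have if1: "(\<Prod>k\<in>UNIV. if k = l then a else 1) = a" for l :: 'n and a :: real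
  by simp
 have if1': "(\<Prod>k\<in>UNIV. if k = l then h k else 1) = h l" for l :: 'n and h :: "'n => real"
  by simp
 show "(LINT y|iso_normal m. \<phi> (y $ i)) = (LINT t|normal1 (m $ i). \<phi> t)"
 proof -
  let ?g = "\<lambda>l t. if l = i then \<phi> t else 1"
  have "(\<Prod>k\<in>UNIV. ?g k (y $ k)) = \<phi> (y $ i)" for y
   by (rule if1')
  moreover have "(LINT t|normal1 (m $ l). ?g l t) = (if l = i then \<integral>t. \<phi> t \<partial>normal1 (m $ i) else 1)" for l
   by (auto simp: N.prob_space [unfolded space_normal1])
  moreover have "poly_bounded (?g l)" for l
   by (cases "l = i") (use pb in simp_all)
  ultimately show ?thesis
   using integral_iso_normal_prod(2) [of ?g m] by (simp add: if1)
 qed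
 show "(LINT y|iso_normal m. \<phi> (y $ i) * \<psi> (y $ j))
   = (LINT t|normal1 (m $ i). \<phi> t) * (LINT t|normal1 (m $ j). \<psi> t)" if "i \<noteq> j"
 proof -
  let ?g = "\<lambda>l t. (if l = i then \<phi> t else 1) * (if l = j then \<psi> t else 1)"
  have "(\<Prod>k\<in>UNIV. ?g k (y $ k)) = \<phi> (y $ i) * \<psi> (y $ j)" for y
   by (simp only: prod.distrib if1')
  moreover have "(LINT t|normal1 (m $ l). ?g l t) = (if l = i then \<integral>t. \<phi> t \<partial>normal1 (m $ i) else 1)
    * (if l = j then \<integral>t. \<psi> t \<partial>normal1 (m $ j) else 1)" for l
   using that by (auto simp: N.prob_space [unfolded space_normal1])
  moreover have "poly_bounded (?g l)" for l
   by (cases "l = i"; cases "l = j"; cases "l = k") (use pb that in \<open>simp_all add: poly_bounded_mult\<close>)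
  ultimately show ?thesis
   using integral_iso_normal_prod(2) [of ?g m] by (simp add: prod.distrib)
 qed
 show "(LINT y|iso_normal m. \<phi> (y $ i) * \<psi> (y $ j) * \<eta> (y $ k))
   = (LINT t|normal1 (m $ i). \<phi> t) * (LINT t|normal1 (m $ j). \<psi> t) * (LINT t|normal1 (m $ k). \<eta> t)"
  if "i \<noteq> j" "i \<noteq> k" "j \<noteq> k"
 proof -
  let ?g = "\<lambda>l t. (if l = i then \<phi> t else 1) * (if l = j then \<psi> t else 1) * (if l = k then \<eta> t else 1)"
  have "(\<Prod>k\<in>UNIV. ?g k (y $ k)) = \<phi> (y $ i) * \<psi> (y $ j) * \<eta> (y $ k)" for y
   by (simp only: prod.distrib if1')
  moreover have "(LINT t|normal1 (m $ l). ?g l t) = (if l = i then \<integral>t. \<phi> t \<partial>normal1 (m $ i) else 1)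
    * (if l = j then \<integral>t. \<psi> t \<partial>normal1 (m $ j) else 1) * (if l = k then \<integral>t. \<eta> t \<partial>normal1 (m $ k) else 1)" for l
   using that by (auto simp: N.prob_space [unfolded space_normal1])
  moreover have "poly_bounded (?g l)" for l
   by (cases "l = i"; cases "l = j"; cases "l = k") (use pb that in \<open>simp_all add: poly_bounded_mult\<close>)
  ultimately show ?thesis
   using integral_iso_normal_prod(2) [of ?g m] by (simp add: prod.distrib)
 qed
qed

section \<open>Affine equivariance\<close>

lemma measurable_matrix_vector [measurable]:
 "f \<in> borel_measurable M ==> (\<lambda>x. (A::real^'n^'m) *v f x) \<in> borel_measurable M"
 by (rule measurable_compose [of f M borel])
   (auto intro: borel_measurable_continuous_onI matrix_vector_mult_linear_continuous_on)

lemma nn_integral_lborel_affine: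
 fixes G :: "real^'n^'n"
 assumes G: "invertible G" and F[measurable]: "F \<in> borel_measurable borel"
 shows "(\<integral>\<^sup>+y. F (G *v (y - c)) * ennreal \<bar>det G\<bar> \<partial>lborel) = (\<integral>\<^sup>+y. F y \<partial>lborel)"
proof -
 have "(\<integral>\<^sup>+y. F (G *v (y - c)) * ennreal \<bar>det G\<bar> \<partial>lborel)
   = (\<integral>\<^sup>+y. F (G *v (y - c)) * ennreal \<bar>det G\<bar> \<partial>distr lborel borel ((+) c))"
  by (simp add: lborel_distr_plus)
 also have "... = (\<integral>\<^sup>+y. F (G *v y) * ennreal \<bar>det G\<bar> \<partial>lborel)"
  by (subst nn_integral_distr) auto
 also have "... = (\<integral>\<^sup>+y. F y \<partial>lborel)"
 proof -
  have "inj ((*v) G)"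
   by (metis G injI matrix_inv_cancel(3))
  thus ?thesis
   using nn_integral_lborel_linear [of "(*v) G" F] by simp
 qed
 finally show ?thesis .
qed

lemma measurable_mvn_density [measurable]: "mvn_density \<mu> S \<in> borel_measurable borel"
 unfolding mvn_density_def by measurable

lemma mvn_density_pos: "pos_def S ==> 0 < mvn_density \<mu> S y"
 unfolding mvn_density_def using pos_def_det_pos [of S] by (auto intro!: divide_pos_pos)

lemma pos_def_congruence':
 "pos_def S ==> invertible G ==> pos_def (G ** S ** transpose (G :: real^'n^'n))"
 using pos_def_congruence [of S "transpose G"] by (simp add: transpose_invertible)

lemma matrix_inv_congruence:
 fixes G S :: "real^'n^'n"
 assumes "invertible G" "invertible S"
 shows "matrix_inv (G ** S ** transpose G) = transpose (matrix_inv G) ** matrix_inv S ** matrix_inv G"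
proof (rule matrix_inv_unique)
 have 1: "transpose G ** transpose (matrix_inv G) = mat 1"
  using assms(1) by (metis matrix_inv_cancel(1) matrix_transpose_mul transpose_mat)
 have "G ** S ** transpose G ** (transpose (matrix_inv G) ** matrix_inv S ** matrix_inv G)
   = G ** S ** (transpose G ** transpose (matrix_inv G)) ** matrix_inv S ** matrix_inv G"
  by (simp only: matrix_mul_assoc)
 also have "... = G ** (S ** matrix_inv S) ** matrix_inv G"
  by (simp only: 1 matrix_mul_rid matrix_mul_assoc)
 also have "... = mat 1"
  using assms by (simp add: matrix_inv_cancel)
 finally show "G ** S ** transpose G ** (transpose (matrix_inv G) ** matrix_inv S ** matrix_inv G) = mat 1" .
qed

lemma mvn_density_affine:
 fixes G :: "real^'n^'n"
 assumes G: "invertible G" and S: "pos_def S"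
 shows "mvn_density \<mu> S y = \<bar>det G\<bar> * mvn_density (G *v (\<mu> - c)) (G ** S ** transpose G) (G *v (y - c))"
proof -
 have d: "det G \<noteq> 0"
  using G by (simp add: invertible_det_nz)
 have e: "G *v (y - c) - G *v (\<mu> - c) = G *v (y - \<mu>)"
  by (simp add: matrix_vector_mult_diff_distrib [symmetric])
 have q: "(G *v (y - \<mu>)) \<bullet> (matrix_inv (G ** S ** transpose G) *v (G *v (y - \<mu>)))
   = (y - \<mu>) \<bullet> (matrix_inv S *v (y - \<mu>))"
 proof -
  have "matrix_inv (G ** S ** transpose G) *v (G *v (y - \<mu>))
    = transpose (matrix_inv G) *v (matrix_inv S *v (y - \<mu>))"
   using G by (simp only: matrix_inv_congruence [OF G pos_def_invertible [OF S]]
     matrix_vector_mul_assoc [symmetric] matrix_inv_cancel)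
  thus ?thesis
   using G by (simp only: inner_matrix_vector [symmetric] matrix_inv_cancel)
 qed
 have "sqrt ((2 * pi) ^ CARD('n) * det (G ** S ** transpose G))
   = \<bar>det G\<bar> * sqrt ((2 * pi) ^ CARD('n) * det S)"
 proof -
  have "(2 * pi) ^ CARD('n) * det (G ** S ** transpose G) = (det G)^2 * ((2 * pi) ^ CARD('n) * det S)"
   by (simp add: det_mul power2_eq_square del: transpose_matrix_vector)
  thus ?thesis by (simp add: real_sqrt_mult)
 qed
 with d show ?thesis
  unfolding mvn_density_def e q by simp
qed

lemma mvn_density_iso: "mvn_density (m :: real^'n) (mat 1) = iso_normal_density m"
proof
 fix y :: "real^'n"
 have inv: "matrix_inv (mat 1 :: real^'n^'n) = mat 1"
  by (rule matrix_inv_unique) simp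
 have "mvn_density m (mat 1) y = exp (- ((y - m) \<bullet> (y - m)) / 2) / sqrt (2 * pi) ^ CARD('n)"
  by (simp only: mvn_density_def inv matrix_vector_mul_lid det_I mult_1_right real_sqrt_power)
 also have "... = (\<Prod>k\<in>UNIV. exp (- ((y $ k - m $ k)^2) / 2) / sqrt (2 * pi))"
  by (simp add: inner_vec_def prod_dividef exp_sum [symmetric] sum_negf power2_eq_square
    sum_divide_distrib [symmetric])
 also have "... = iso_normal_density m y"
  by (simp add: iso_normal_density_def normal_density_def)
 finally show "mvn_density m (mat 1) y = iso_normal_density m y" .
qed

lemma nn_integral_mvn_density:
 fixes S :: "real^'n^'n"
 assumes S: "pos_def S"
 shows "(\<integral>\<^sup>+y. ennreal (mvn_density \<mu> S y) \<partial>lborel) = 1"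
proof -
 obtain L :: "real^'n^'n" where L: "invertible L" "matrix_inv S = transpose L ** L"
  using pos_def_factor [OF pos_def_matrix_inv [OF S]] by blast
 have "L ** S ** transpose L = mat 1"
 proof -
  have "L ** S ** transpose L = L ** (S ** (transpose L ** L)) ** matrix_inv L"
   using L(1) by (metis matrix_inv_cancel(2) matrix_mul_assoc matrix_mul_rid)
  also have "... = mat 1"
   using L pos_def_invertible [OF S] by (metis matrix_inv_cancel(2) matrix_mul_rid)
  finally show ?thesis .
 qed
 hence eq: "mvn_density \<mu> S y = iso_normal_density 0 (L *v (y - \<mu>)) * \<bar>det L\<bar>" for y
  using mvn_density_affine [OF L(1) S, of \<mu> y \<mu>] by (simp add: mvn_density_iso)
 have "(\<integral>\<^sup>+y. ennreal (mvn_density \<mu> S y) \<partial>lborel) = (\<integral>\<^sup>+y. ennreal (iso_normal_density 0 (y::real^'n)) \<partial>lborel)"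
  unfolding eq using nn_integral_lborel_affine [OF L(1), of "\<lambda>y. ennreal (iso_normal_density 0 y)" \<mu>]
  by (simp add: ennreal_mult)
 also have "... = emeasure (iso_normal (0::real^'n)) UNIV"
  unfolding iso_normal_def by (subst emeasure_density) auto
 also have "... = 1"
  using prob_space.emeasure_space_1 [OF prob_space_iso_normal] by simp
 finally show ?thesis .
qed

fun affine_model :: "real^'n^'n => real^'n => 'n::finite model => 'n model" where
 "affine_model G c (p1, m1, m2, S) = (p1, G *v (m1 - c), G *v (m2 - c), G ** S ** transpose G)"

definition affine_coef :: "real^'n^'n => real^'n => real \<times> (real^'n) => real \<times> (real^'n)" where
 "affine_coef G c b = (fst b - (transpose G *v snd b) \<bullet> c, transpose G *v snd b)"

definition affine_coef_inv :: "real^'n^'n => real^'n => real \<times> (real^'n) => real \<times> (real^'n)" where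
 "affine_coef_inv G c b = (fst b + snd b \<bullet> c, matrix_inv (transpose G) *v snd b)"

locale affine_transformation =
 fixes G :: "real^'n::finite^'n" and c :: "real^'n"
 assumes G: "invertible G"
begin

lemma affine_coef_inv: "affine_coef G c (affine_coef_inv G c b) = b"
 "affine_coef_inv G c (affine_coef G c b) = b"
 using matrix_inv_cancel(3,4) [OF transpose_invertible [OF G]]
 by (simp_all add: affine_coef_def affine_coef_inv_def del: transpose_matrix_vector)

lemma discr_affine_coef: "discr (affine_coef G c b) y = discr b (G *v (y - c))"
proof -
 have "(transpose G *v snd b) \<bullet> z = snd b \<bullet> (G *v z)" for z
  by (simp add: dot_lmul_matrix)
 thus ?thesis
  by (simp add: discr_def affine_coef_def matrix_vector_mult_diff_distrib inner_diff_right
    del: transpose_matrix_vector)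
qed

lemma bayes_rule_affine_coef: "bayes_rule (affine_coef G c b) y = bayes_rule b (G *v (y - c))"
 by (simp add: bayes_rule_def discr_affine_coef)

lemma prior_affine [simp]: "prior (affine_model G c \<theta>) i = prior \<theta> i"
 and mean_affine: "mean (affine_model G c \<theta>) i = G *v (mean \<theta> i - c)"
 and cov_affine: "cov (affine_model G c \<theta>) = G ** cov \<theta> ** transpose G"
 by (cases \<theta>; simp)+

lemma affine_model_space: "affine_model G c \<theta> \<in> model_space \<longleftrightarrow> \<theta> \<in> model_space"
proof -
 have "pos_def (G ** S ** transpose G) \<longleftrightarrow> pos_def S" for S
 proof
  assume "pos_def (G ** S ** transpose G)"
  hence "pos_def (matrix_inv G ** (G ** S ** transpose G) ** transpose (matrix_inv G))"
   by (rule pos_def_congruence' [OF _ invertible_matrix_inv [OF G]])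
  moreover have "matrix_inv G ** (G ** S ** transpose G) ** transpose (matrix_inv G) = S"
  proof -
   have "matrix_inv G ** (G ** S ** transpose G) ** transpose (matrix_inv G)
     = (matrix_inv G ** G) ** S ** transpose (matrix_inv G ** G)"
    by (simp only: matrix_transpose_mul matrix_mul_assoc)
   thus ?thesis by (simp add: matrix_inv_cancel [OF G])
  qed
  ultimately show "pos_def S" by simp
 qed (rule pos_def_congruence' [OF _ G])
 moreover have "G *v (a - c) = G *v (b - c) \<longleftrightarrow> a = b" for a b
  by (metis G matrix_inv_cancel(3) diff_add_cancel)
 ultimately show ?thesis
  by (simp add: model_space_def mean_affine cov_affine)
qed

lemma affine_model_surj:
 obtains \<theta>' where "affine_model G c \<theta>' = \<theta>"
proof -
 obtain p1 m1 m2 S where t: "\<theta> = (p1, m1, m2, S)" by (cases \<theta>)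
 have "G ** (matrix_inv G ** S ** transpose (matrix_inv G)) ** transpose G
   = (G ** matrix_inv G) ** S ** transpose (G ** matrix_inv G)"
  by (simp only: matrix_transpose_mul matrix_mul_assoc)
 hence "affine_model G c (p1, matrix_inv G *v m1 + c, matrix_inv G *v m2 + c,
   matrix_inv G ** S ** transpose (matrix_inv G)) = \<theta>"
  by (simp add: t matrix_inv_cancel [OF G])
 thus thesis by (rule that)
qed

lemma class_density_affine:
 "pos_def (cov \<theta>) ==> class_density \<theta> i y = \<bar>det G\<bar> * class_density (affine_model G c \<theta>) i (G *v (y - c))"
 unfolding class_density_def mean_affine cov_affine by (rule mvn_density_affine [OF G])

lemma coef_affine:
 assumes "pos_def (cov \<theta>)"
 shows "affine_coef G c (coef (affine_model G c \<theta>)) = coef \<theta>"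
proof -
 obtain p1 m1 m2 S where t: "\<theta> = (p1, m1, m2, S)" by (cases \<theta>)
 hence S: "pos_def S" using assms by simp
 define v where "v = matrix_inv S *v (m1 - m2)"
 have d: "G *v (m1 - c) - G *v (m2 - c) = G *v (m1 - m2)"
  by (simp add: matrix_vector_mult_diff_distrib [symmetric])
 have w: "matrix_inv (G ** S ** transpose G) *v (G *v (m1 - m2)) = transpose (matrix_inv G) *v v"
  unfolding v_def using G by (simp only: matrix_inv_congruence [OF G pos_def_invertible [OF S]]
     matrix_vector_mul_assoc [symmetric] matrix_inv_cancel)
 have tv: "transpose G *v (transpose (matrix_inv G) *v v) = v"
  using matrix_inv_cancel(4) [OF transpose_invertible [OF G], of v] transpose_matrix_inv [OF G] by simp
 have s: "(G *v (m1 - c) + G *v (m2 - c)) \<bullet> (transpose (matrix_inv G) *v v) = (m1 + m2) \<bullet> v - 2 * (v \<bullet> c)"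
 proof -
  have "G *v (m1 - c) + G *v (m2 - c) = G *v (m1 + m2 - 2 *\<^sub>R c)"
   by (simp add: matrix_vector_right_distrib [symmetric] scaleR_2)
  hence "(G *v (m1 - c) + G *v (m2 - c)) \<bullet> (transpose (matrix_inv G) *v v) = (m1 + m2 - 2 *\<^sub>R c) \<bullet> v"
   by (simp only: inner_matrix_vector tv)
  also have "... = (m1 + m2) \<bullet> v - 2 * (v \<bullet> c)"
   by (simp add: inner_diff_left inner_commute [of c v])
  finally show ?thesis .
 qed
 show ?thesis
  unfolding t coef_def affine_coef_def Let_def affine_model.simps prior.simps mean.simps cov.simps
  by (simp del: transpose_matrix_vector add: d w tv s diff_divide_distrib flip: v_def)
qed

lemma discr_coef_affine:
 "pos_def (cov \<theta>) ==> discr (coef (affine_model G c \<theta>)) (G *v (y - c)) = discr (coef \<theta>) y"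
 by (metis coef_affine discr_affine_coef)

lemma missing_prob_affine:
 "pos_def (cov \<theta>) ==> missing_prob (affine_model G c \<theta>) \<xi> (G *v (y - c)) = missing_prob \<theta> \<xi> y"
 by (simp add: missing_prob_def discr_coef_affine)

lemma measurable_class_density [measurable]: "class_density \<theta> i \<in> borel_measurable borel"
 unfolding class_density_def by measurable

lemma measurable_discr [measurable]: "discr b \<in> borel_measurable borel"
 unfolding discr_def [abs_def] by measurable

lemma sets_bayes_rule: "{y. bayes_rule b y = i} \<in> sets borel"
 unfolding bayes_rule_def by measurable

lemma err_affine:
 assumes S: "pos_def (cov \<theta>)"
 shows "err \<theta> (affine_coef G c b) = err (affine_model G c \<theta>) b"
proof -
 have "measure (class_distr \<theta> i) {y. bayes_rule (affine_coef G c b) y = j}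
   = measure (class_distr (affine_model G c \<theta>) i) {y. bayes_rule b y = j}" for i j
 proof -
  let ?A = "{y. bayes_rule b y = j}"
  have [measurable]: "?A \<in> sets borel" by (rule sets_bayes_rule)
  have "emeasure (class_distr \<theta> i) {y. bayes_rule (affine_coef G c b) y = j}
    = (\<integral>\<^sup>+y. ennreal (class_density \<theta> i y) * indicator ?A (G *v (y - c)) \<partial>lborel)"
   unfolding class_distr_def using sets_bayes_rule [of "affine_coef G c b" j]
   by (subst emeasure_density) (auto simp: bayes_rule_affine_coef indicator_def intro!: nn_integral_cong)
  also have "... = (\<integral>\<^sup>+y. (ennreal (class_density (affine_model G c \<theta>) i (G *v (y - c)))
    * indicator ?A (G *v (y - c))) * ennreal \<bar>det G\<bar> \<partial>lborel)"
   using mvn_density_pos [OF pos_def_congruence' [OF S G]]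
   by (subst class_density_affine [OF S]) (simp add: ennreal_mult' mult_ac)
  also have "... = emeasure (class_distr (affine_model G c \<theta>) i) ?A"
   unfolding class_distr_def
   by (subst nn_integral_lborel_affine [OF G]) (auto simp: emeasure_density)
  finally show ?thesis by (simp add: measure_def)
 qed
 thus ?thesis by (simp add: err_def)
qed

end

lemma measurable_obs_base:
 fixes F :: "(real^'p) \<times> nat \<times> nat => 'b"
 assumes "\<And>z m. (\<lambda>y. F (y, z, m)) \<in> borel \<rightarrow>\<^sub>M N"
 shows "F \<in> obs_base \<rightarrow>\<^sub>M N"
proof -
 have 1: "(\<lambda>x. F (fst x, fst (snd x), m)) \<in> obs_base \<rightarrow>\<^sub>M N" for m
 proof (rule measurable_compose_countable' [where f = "\<lambda>z x. F (fst x, z, m)" and g = "\<lambda>x. fst (snd x)" and I = "{1,2}"])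
  show "(\<lambda>x. F (fst x, i, m)) \<in> obs_base \<rightarrow>\<^sub>M N" for i
   by (rule measurable_compose [OF _ assms]) (simp add: obs_base_def)
  show "(\<lambda>x. fst (snd x)) \<in> obs_base \<rightarrow>\<^sub>M count_space {1, 2}"
   unfolding obs_base_def by measurable
 qed simp
 have "(\<lambda>x. F (fst x, fst (snd x), snd (snd x))) \<in> obs_base \<rightarrow>\<^sub>M N"
 proof (rule measurable_compose_countable' [where f = "\<lambda>m x. F (fst x, fst (snd x), m)" and g = "\<lambda>x. snd (snd x)" and I = "{0,1}"])
  show "(\<lambda>x. snd (snd x)) \<in> obs_base \<rightarrow>\<^sub>M count_space {0, 1}"
   unfolding obs_base_def by measurable
 qed (use 1 in simp_all)
 thus ?thesis by simp
qed

lemma nn_integral_obs_base: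
 fixes F :: "(real^'p) \<times> nat \<times> nat => ennreal"
 assumes F: "F \<in> borel_measurable obs_base"
 shows "(\<integral>\<^sup>+x. F x \<partial>obs_base) = (\<Sum>z\<in>{1,2}. \<Sum>m\<in>{0,1}. \<integral>\<^sup>+y. F (y, z, m) \<partial>lborel)"
proof -
 let ?N = "count_space {1, 2} \<Otimes>\<^sub>M count_space {0, 1} :: (nat \<times> nat) measure"
 interpret c1: sigma_finite_measure "count_space {1, 2} :: nat measure"
  by (rule sigma_finite_measure_count_space_finite) simp
 interpret c2: sigma_finite_measure "count_space {0, 1} :: nat measure"
  by (rule sigma_finite_measure_count_space_finite) simp
 interpret c: pair_sigma_finite "count_space {1, 2} :: nat measure" "count_space {0, 1} :: nat measure" ..
 interpret pair_sigma_finite "lborel :: (real^'p) measure" ?N ..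
 have F': "F \<in> borel_measurable (lborel \<Otimes>\<^sub>M ?N)"
  using F by (simp add: obs_base_def)
 have G: "(\<lambda>zm. \<integral>\<^sup>+y. F (y, zm) \<partial>lborel) \<in> borel_measurable ?N"
  using F' by measurable
 have "(\<integral>\<^sup>+x. F x \<partial>obs_base) = (\<integral>\<^sup>+zm. (\<integral>\<^sup>+y. F (y, zm) \<partial>lborel) \<partial>?N)"
  unfolding obs_base_def by (rule nn_integral_snd [OF F', symmetric])
 also have "... = (\<integral>\<^sup>+z. \<integral>\<^sup>+m. (\<integral>\<^sup>+y. F (y, z, m) \<partial>lborel) \<partial>count_space {0, 1} \<partial>count_space {1, 2})"
  by (rule c2.nn_integral_fst [OF G, symmetric])
 finally show ?thesis
  by (simp add: nn_integral_count_space_finite)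
qed

lemma measurable_missing_prob [measurable]: "missing_prob \<theta> \<xi> \<in> borel_measurable borel"
proof -
 have [measurable]: "discr b \<in> borel_measurable borel" for b :: "real \<times> (real^'a)"
  unfolding discr_def [abs_def] by measurable
 show ?thesis unfolding missing_prob_def [abs_def] by measurable
qed

lemma measurable_obs_density: "obs_density \<theta> \<xi> \<in> borel_measurable obs_base"
proof (rule measurable_obs_base)
 fix z m
 have [measurable]: "class_density \<theta> z \<in> borel_measurable borel"
  unfolding class_density_def by measurable
 show "(\<lambda>y. obs_density \<theta> \<xi> (y, z, m)) \<in> borel_measurable borel"
  unfolding obs_density_def by simp measurable
qed

lemma missing_prob_logistic: "missing_prob \<theta> \<xi> y = logistic (fst \<xi> + snd \<xi> * (discr (coef \<theta>) y)^2)"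
 by (simp add: missing_prob_def logistic_def)

lemma obs_density_nonneg:
 "\<theta> \<in> model_space ==> z \<in> {1, 2} ==> 0 \<le> obs_density \<theta> \<xi> (y, z, m)"
 by (auto simp: obs_density_def model_space_def class_density_def missing_prob_logistic
   intro!: mult_nonneg_nonneg less_imp_le [OF mvn_density_pos])

lemma ml_estimate_image:
 assumes ml: "ml_estimate L \<Theta> g b"
  and h: "h ` \<Theta> = \<Theta>'" and a: "0 < a"
  and L: "\<And>t. t \<in> \<Theta> ==> L' (h t) = a * L t + (C :: real)"
  and g: "\<And>t. t \<in> \<Theta> ==> g' (h t) = T (g t)"
 shows "ml_estimate L' \<Theta>' g' (T b)"
proof -
 have max: "is_arg_max L' (\<lambda>t. t \<in> \<Theta>') (h t) \<longleftrightarrow> is_arg_max L (\<lambda>t. t \<in> \<Theta>) t" if "t \<in> \<Theta>" for t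
  using that L a h by (auto simp: is_arg_max_def)
 show ?thesis
  unfolding ml_estimate_def
 proof
  assume "\<exists>t. is_arg_max L' (\<lambda>t. t \<in> \<Theta>') t"
  then obtain s where s: "s \<in> \<Theta>" "is_arg_max L' (\<lambda>t. t \<in> \<Theta>') (h s)"
   using h by (auto simp: is_arg_max_def)
  hence "is_arg_max L (\<lambda>t. t \<in> \<Theta>) s" by (simp only: max)
  then obtain t where t: "is_arg_max L (\<lambda>t. t \<in> \<Theta>) t" "g t = b"
   using ml unfolding ml_estimate_def by blast
  hence "t \<in> \<Theta>" by (simp add: is_arg_max_def)
  thus "\<exists>t. is_arg_max L' (\<lambda>t. t \<in> \<Theta>') t \<and> g' t = T b"
   using t max g by metis
 qed
qed

lemma ml_estimate_transfer:
 assumes ml: "ml_estimate L \<Theta> g b"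
  and h: "\<And>t. h t \<in> \<Theta>' \<longleftrightarrow> t \<in> \<Theta>" "surj h"
  and L: "\<And>t. t \<in> \<Theta> ==> L' (h t) = L t + (C :: real)"
  and g: "\<And>t. t \<in> \<Theta> ==> g' (h t) = T (g t)"
 shows "ml_estimate L' \<Theta>' g' (T b)"
proof -
 have "h ` \<Theta> = \<Theta>'"
  using h by (auto simp: image_iff) (metis surjD)
 thus ?thesis
  by (rule ml_estimate_image [OF ml, where a = 1 and C = C]) (use L g in auto)
qed

context affine_transformation
begin

lemma iid_sample_affine:
 assumes \<theta>: "\<theta> \<in> model_space" and iid: "iid_sample P \<theta> \<xi> Y Z M"
 shows "iid_sample P (affine_model G c \<theta>) \<xi> (\<lambda>j w. G *v (Y j w - c)) Z M"
proof -
 interpret prob_space P using iid by (simp add: iid_sample_def)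
 have S: "pos_def (cov \<theta>)" using \<theta> by (simp add: model_space_def)
 define g :: "(real^'n) \<times> nat \<times> nat => (real^'n) \<times> nat \<times> nat"
  where "g = (\<lambda>(y, z, m). (G *v (y - c), z, m))"
 have g: "g \<in> obs_base \<rightarrow>\<^sub>M obs_base"
  unfolding obs_base_def g_def by measurable
 have ind: "indep_vars (\<lambda>_. obs_base) (\<lambda>j w. g (Y j w, Z j w, M j w)) UNIV"
 proof (rule indep_vars_compose2 [where Y = "\<lambda>_. g"])
  show "indep_vars (\<lambda>_. obs_base) (\<lambda>j w. (Y j w, Z j w, M j w)) UNIV"
   using iid unfolding iid_sample_def by blast
 qed (rule g)
 have dens: "density obs_base (\<lambda>x. ennreal (obs_density (affine_model G c \<theta>) \<xi> x))
   = distr (density obs_base (\<lambda>x. ennreal (obs_density \<theta> \<xi> x))) obs_base g" (is "?A = ?B")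
 proof (rule measure_eqI)
  fix A assume "A \<in> sets ?A"
  hence A[measurable]: "A \<in> sets obs_base" by simp
  note [measurable] = measurable_obs_density g
  have mP: "(\<lambda>y. (y, z, m)) \<in> borel \<rightarrow>\<^sub>M obs_base" if "z \<in> {1,2}" "m \<in> {0,1}" for z m
   unfolding obs_base_def using that by (intro measurable_Pair) auto
  have ind[measurable]: "(\<lambda>y. indicator A (y, z, m) :: ennreal) \<in> borel_measurable borel"
   if "z \<in> {1,2}" "m \<in> {0,1}" for z m
   by (rule measurable_compose [OF mP [OF that]]) measurable
  have "emeasure ?B A = (\<integral>\<^sup>+x. ennreal (obs_density \<theta> \<xi> x) * indicator A (g x) \<partial>obs_base)"
   by (subst emeasure_distr [OF _ A], simp, subst emeasure_density)
    (auto intro!: nn_integral_cong measurable_sets [OF g A] simp: indicator_def)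
  also have "... = (\<Sum>z\<in>{1,2}. \<Sum>m\<in>{0,1}. \<integral>\<^sup>+y. ennreal (obs_density \<theta> \<xi> (y, z, m)) * indicator A (G *v (y - c), z, m) \<partial>lborel)"
  proof -
   have "(\<lambda>x. ennreal (obs_density \<theta> \<xi> x) * indicator A (g x)) \<in> borel_measurable obs_base"
    by measurable
   from nn_integral_obs_base [OF this] show ?thesis by (simp add: g_def)
  qed
  also have "... = (\<Sum>z\<in>{1,2}. \<Sum>m\<in>{0,1}. \<integral>\<^sup>+y. ennreal (obs_density (affine_model G c \<theta>) \<xi> (y, z, m)) * indicator A (y, z, m) \<partial>lborel)"
  proof (intro sum.cong refl)
   fix z m :: nat assume zm: "z \<in> {1,2}" "m \<in> {0,1}"
   let ?o = "\<lambda>y. obs_density (affine_model G c \<theta>) \<xi> (y, z, m)"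
   have m1: "(\<lambda>y. ennreal (?o y)) \<in> borel_measurable borel"
    by (rule measurable_compose [OF mP [OF zm]]) measurable
   have "obs_density \<theta> \<xi> (y, z, m) = ?o (G *v (y - c)) * \<bar>det G\<bar>" for y
    by (simp add: obs_density_def class_density_affine [OF S] missing_prob_affine [OF S])
   moreover have "0 \<le> ?o y" for y
    using \<theta> zm by (intro obs_density_nonneg) (simp_all add: affine_model_space)
   ultimately have "(\<integral>\<^sup>+y. ennreal (obs_density \<theta> \<xi> (y, z, m)) * indicator A (G *v (y - c), z, m) \<partial>lborel)
     = (\<integral>\<^sup>+y. (ennreal (?o (G *v (y - c))) * indicator A (G *v (y - c), z, m)) * ennreal \<bar>det G\<bar> \<partial>lborel)"
    by (simp add: ennreal_mult mult_ac)
   also have "... = (\<integral>\<^sup>+y. ennreal (?o y) * indicator A (y, z, m) \<partial>lborel)"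
    using ind [OF zm] m1 by (subst nn_integral_lborel_affine [OF G]) auto
   finally show "(\<integral>\<^sup>+y. ennreal (obs_density \<theta> \<xi> (y, z, m)) * indicator A (G *v (y - c), z, m) \<partial>lborel)
     = (\<integral>\<^sup>+y. ennreal (?o y) * indicator A (y, z, m) \<partial>lborel)" .
  qed
  also have "... = emeasure ?A A"
   by (subst emeasure_density) (auto simp: nn_integral_obs_base)
  finally show "emeasure ?A A = emeasure ?B A" ..
 qed simp
 have "distributed P obs_base (\<lambda>w. g (Y j w, Z j w, M j w))
   (\<lambda>x. ennreal (obs_density (affine_model G c \<theta>) \<xi> x))" for j
 proof -
  have d: "distributed P obs_base (\<lambda>w. (Y j w, Z j w, M j w)) (\<lambda>x. ennreal (obs_density \<theta> \<xi> x))"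
   using iid by (simp add: iid_sample_def)
  hence m: "(\<lambda>w. (Y j w, Z j w, M j w)) \<in> P \<rightarrow>\<^sub>M obs_base"
   by (rule distributed_measurable)
  have "distr P obs_base (\<lambda>w. g (Y j w, Z j w, M j w))
    = distr (distr P obs_base (\<lambda>w. (Y j w, Z j w, M j w))) obs_base g"
   by (subst distr_distr [OF g m]) (simp add: o_def)
  also have "... = density obs_base (\<lambda>x. ennreal (obs_density (affine_model G c \<theta>) \<xi> x))"
   unfolding distributed_distr_eq_density [OF d] dens ..
  finally show ?thesis
   using measurable_compose [OF m g] measurable_compose [OF measurable_obs_density measurable_ennreal]
   by (simp add: distributed_def)
 qed
 with ind show ?thesis
  unfolding iid_sample_def g_def by (simp add: prob_space_axioms)
qed

lemma loglik_ig_affine: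
 assumes "\<theta> \<in> model_space"
 shows "loglik_ig n (\<lambda>j. G *v (y j - c)) z m (affine_model G c \<theta>) = loglik_ig n y z m \<theta>
  + - ln \<bar>det G\<bar> * (\<Sum>j<n. (1 - real (m j)) * of_bool (z j \<in> {1, 2}) + real (m j))"
proof -
 have S: "pos_def (cov \<theta>)" and p: "0 < prior \<theta> i" for i
  using assms by (cases \<theta>; auto simp: model_space_def)+
 have d: "0 < \<bar>det G\<bar>" using G by (simp add: invertible_det_nz)
 let ?f = "\<lambda>i y. prior \<theta> i * class_density (affine_model G c \<theta>) i (G *v (y - c))"
 have f: "0 < ?f i y" for i y
  using p mvn_density_pos [OF pos_def_congruence' [OF S G]]
  by (simp add: class_density_def cov_affine)
 have e: "prior \<theta> i * class_density \<theta> i y = \<bar>det G\<bar> * ?f i y" for i y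
  by (simp add: class_density_affine [OF S])
 have l: "ln (prior \<theta> i * class_density \<theta> i y) = ln \<bar>det G\<bar> + ln (?f i y)" for i y
  unfolding e using d f [of i y] by (simp only: ln_mult_pos)
 have ls: "ln (\<Sum>i\<in>{1,2}. prior \<theta> i * class_density \<theta> i y) = ln \<bar>det G\<bar> + ln (\<Sum>i\<in>{1,2}. ?f i y)" for y
  unfolding e sum_distrib_left [symmetric]
  using d f by (intro ln_mult_pos) (auto intro!: sum_pos simp del: sum.insert)
 have 1: "(\<Sum>i\<in>{1,2}. of_bool (k = i) * ln (prior \<theta> i * class_density \<theta> i y))
   = ln \<bar>det G\<bar> * of_bool (k \<in> {1, 2}) + (\<Sum>i\<in>{1,2}. of_bool (k = i) * ln (?f i y))" for k :: nat and y
  unfolding l by auto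
 have aux: "(\<Sum>j<n. (1 - k j) * a j) + (\<Sum>j<n. k j * b j)
   = (\<Sum>j<n. (1 - k j) * (L * w j + a j)) + (\<Sum>j<n. k j * (L + b j))
    + - L * (\<Sum>j<n. (1 - k j) * w j + k j)" for k a b w :: "nat => real" and L
  by (simp add: sum.distrib sum_distrib_left sum_subtractf sum_negf algebra_simps)
 show ?thesis
  unfolding loglik_ig_def 1 ls prior_affine by (rule aux)
qed

lemma loglik_full_affine:
 assumes "\<theta> \<in> model_space"
 shows "loglik_full n (\<lambda>j. G *v (y j - c)) z m (affine_model G c \<theta>, \<xi>) = loglik_full n y z m (\<theta>, \<xi>)
  + - ln \<bar>det G\<bar> * (\<Sum>j<n. (1 - real (m j)) * of_bool (z j \<in> {1, 2}) + real (m j))"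
 using assms by (simp add: loglik_full_def loglik_ig_affine missing_prob_affine model_space_def)

lemma coef_affine_inv:
 "\<theta> \<in> model_space ==> coef (affine_model G c \<theta>) = affine_coef_inv G c (coef \<theta>)"
 by (metis (no_types, lifting) affine_coef_inv(2) coef_affine mem_Collect_eq model_space_def)

lemma surj_affine_model: "surj (affine_model G c)"
 unfolding surj_def by (metis affine_model_surj)

lemma measurable_affine_coef_inv:
 "b \<in> borel_measurable P ==> (\<lambda>w. affine_coef_inv G c (b w)) \<in> borel_measurable P"
 unfolding affine_coef_inv_def
 by (erule measurable_compose, rule borel_measurable_continuous_onI)
  (auto intro!: continuous_intros continuous_on_compose2 [OF matrix_vector_mult_linear_continuous_on])

lemma mle_ig_affine:
 assumes "mle_ig P Y Z M b"
 shows "mle_ig P (\<lambda>j w. G *v (Y j w - c)) Z M (\<lambda>n w. affine_coef_inv G c (b n w))"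
 unfolding mle_ig_def
proof (intro allI conjI)
 fix n
 show "(\<lambda>w. affine_coef_inv G c (b n w)) \<in> borel_measurable P"
  using assms by (intro measurable_affine_coef_inv) (simp add: mle_ig_def)
 have "AE w in P. ml_estimate (loglik_ig n (\<lambda>j. Y j w) (\<lambda>j. Z j w) (\<lambda>j. M j w)) model_space coef (b n w)"
  using assms by (simp add: mle_ig_def)
 thus "AE w in P. ml_estimate (loglik_ig n (\<lambda>j. G *v (Y j w - c)) (\<lambda>j. Z j w) (\<lambda>j. M j w)) model_space coef
   (affine_coef_inv G c (b n w))"
 proof eventually_elim
  case (elim w)
  show ?case
   by (rule ml_estimate_transfer [OF elim, where h = "affine_model G c"])
    (simp add: affine_model_space, rule surj_affine_model, erule loglik_ig_affine, erule coef_affine_inv)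
 qed
qed

lemma mle_cc_affine:
 assumes "mle_cc P Y Z b"
 shows "mle_cc P (\<lambda>j w. G *v (Y j w - c)) Z (\<lambda>n w. affine_coef_inv G c (b n w))"
 using mle_ig_affine [of P Y Z "\<lambda>_ _. 0" b] assms by (simp add: mle_cc_def mle_ig_def loglik_cc_def)

lemma mle_full_affine:
 assumes "mle_full P Y Z M b"
 shows "mle_full P (\<lambda>j w. G *v (Y j w - c)) Z M (\<lambda>n w. affine_coef_inv G c (b n w))"
 unfolding mle_full_def
proof (intro allI conjI)
 fix n
 show "(\<lambda>w. affine_coef_inv G c (b n w)) \<in> borel_measurable P"
  using assms by (intro measurable_affine_coef_inv) (simp add: mle_full_def)
 have "AE w in P. ml_estimate (loglik_full n (\<lambda>j. Y j w) (\<lambda>j. Z j w) (\<lambda>j. M j w)) (model_space \<times> UNIV)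
   (\<lambda>(\<theta>, \<xi>). coef \<theta>) (b n w)"
  using assms by (simp add: mle_full_def)
 thus "AE w in P. ml_estimate (loglik_full n (\<lambda>j. G *v (Y j w - c)) (\<lambda>j. Z j w) (\<lambda>j. M j w))
   (model_space \<times> UNIV) (\<lambda>(\<theta>, \<xi>). coef \<theta>) (affine_coef_inv G c (b n w))"
 proof eventually_elim
  case (elim w)
  show ?case
  proof (rule ml_estimate_transfer [OF elim, where h = "map_prod (affine_model G c) id"])
   show "surj (map_prod (affine_model G c) (id :: real \<times> real => _))"
    by (rule map_prod_surj) (simp_all add: surj_affine_model)
  qed (auto simp: affine_model_space loglik_full_affine coef_affine_inv map_prod_def
    simp del: affine_model.simps)
 qed
qed

lemma expected_err_affine:
 assumes "\<theta> \<in> model_space"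
 shows "expected_err P \<theta> b = expected_err P (affine_model G c \<theta>) (\<lambda>n w. affine_coef_inv G c (b n w))"
proof -
 have "err \<theta> x = err (affine_model G c \<theta>) (affine_coef_inv G c x)" for x
  using err_affine [of \<theta> "affine_coef_inv G c x"] assms by (simp add: affine_coef_inv model_space_def)
 thus ?thesis
  by (simp add: expected_err_def [abs_def])
qed

lemma has_ARE_affine:
 assumes "\<theta> \<in> model_space"
 shows "has_ARE P \<theta> bA bB r \<longleftrightarrow> has_ARE P (affine_model G c \<theta>)
  (\<lambda>n w. affine_coef_inv G c (bA n w)) (\<lambda>n w. affine_coef_inv G c (bB n w)) r"
proof -
 have "err \<theta> (coef \<theta>) = err (affine_model G c \<theta>) (coef (affine_model G c \<theta>))"
  using err_affine [of \<theta> "coef (affine_model G c \<theta>)"] coef_affine [of \<theta>] assms by (simp add: model_space_def)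
 thus ?thesis
  by (simp only: has_ARE_def expected_err_affine [OF assms])
qed

end

definition canonical_model :: "real => 'p => 'p::finite model" where
 "canonical_model D k = (1 / 2, axis k (D / 2), axis k (- D / 2), mat 1)"

lemma exists_canonical_model:
 assumes \<theta>: "\<theta> \<in> model_space" and prior: "prior \<theta> 1 = prior \<theta> 2"
 obtains G c where "affine_transformation G" "affine_model G c \<theta> = canonical_model (mahalanobis \<theta>) k"
  "0 < mahalanobis \<theta>"
proof -
 obtain p1 m1 m2 S where t: "\<theta> = (p1, m1, m2, S)" by (cases \<theta>)
 have S: "pos_def S" and ne: "m1 \<noteq> m2" and p1: "p1 = 1 / 2"
  using \<theta> prior by (auto simp: t model_space_def)
 define v where "v = matrix_inv S *v (m1 - m2)"
 define D where "D = mahalanobis \<theta>"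
 have Sv: "S *v v = m1 - m2"
  using matrix_inv_cancel(4) [OF pos_def_invertible [OF S]] by (simp add: v_def)
 have pos: "0 < (m1 - m2) \<bullet> v"
  using pos_def_matrix_inv [OF S] ne by (simp add: v_def pos_def_def)
 have D: "D = sqrt ((m1 - m2) \<bullet> v)" "0 < D"
  using pos by (simp_all add: D_def mahalanobis_def t v_def)
 have D2: "(m1 - m2) \<bullet> v = D^2"
  using pos D by simp
 have "((1 / D) *\<^sub>R v) \<bullet> (S *v ((1 / D) *\<^sub>R v)) = 1"
  using D(2) D2 by (simp add: matrix_vector_mult_scaleR Sv inner_commute power2_eq_square)
 from pos_def_orthonormal_matrix [OF S this, of k]
 obtain A :: "real^'a^'a" where A: "transpose A ** S ** A = mat 1" "A *v axis k 1 = (1 / D) *\<^sub>R v" "invertible A"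
  by blast
 define c where "c = (1 / 2) *\<^sub>R (m1 + m2)"
 have "transpose A *v (m1 - m2) = transpose A *v (S *v (D *\<^sub>R (A *v axis k 1)))"
  using D(2) A(2) by (simp add: Sv del: transpose_matrix_vector)
 also have "... = D *\<^sub>R ((transpose A ** S ** A) *v axis k 1)"
  by (simp only: matrix_vector_mult_scaleR matrix_vector_mul_assoc matrix_mul_assoc)
 finally have m12: "transpose A *v (m1 - m2) = D *\<^sub>R axis k 1"
  by (simp add: A(1))
 have "m1 - c = (1 / 2) *\<^sub>R (m1 - m2)"
  by (simp add: c_def vec_eq_iff field_simps)
 moreover have "m2 - c = (- 1 / 2) *\<^sub>R (m1 - m2)"
  by (simp add: c_def vec_eq_iff field_simps)
 moreover have "D *\<^sub>R axis k 1 = (axis k D :: real^'a)"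
  by (simp add: vec_eq_iff axis_def)
 ultimately have "transpose A *v (m1 - c) = axis k (D / 2)" "transpose A *v (m2 - c) = axis k (- D / 2)"
  using m12 by (simp_all only: matrix_vector_mult_scaleR) (simp_all add: vec_eq_iff axis_def)
 hence "affine_model (transpose A) c \<theta> = canonical_model D k"
  using A(1) by (simp add: canonical_model_def t p1 del: transpose_matrix_vector)
 moreover have "affine_transformation (transpose A)"
  by unfold_locales (rule transpose_invertible [OF A(3)])
 ultimately show ?thesis
  using that D by (simp add: D_def)
qed

section \<open>Averages of independent observations\<close>

locale iid_moments = prob_space P for P :: "'w measure" +
 fixes X :: "nat => 'w => 'x::euclidean_space" and Q :: "'x measure"
 assumes indep: "indep_vars (\<lambda>_. borel) X UNIV"
  and distr_X: "\<And>j. distr P borel (X j) = Q"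
  and moments: "\<And>k. integrable Q (\<lambda>x. norm x ^ k)"
begin

lemma X_measurable [measurable]: "X j \<in> borel_measurable P"
 using indep by (simp add: indep_vars_def)

lemma sets_Q [simp, measurable_cong]: "sets Q = sets borel" and space_Q [simp]: "space Q = UNIV"
 using distr_X [of 0] by (metis sets_distr, metis space_distr space_borel)

lemma prob_space_Q: "prob_space Q"
 using distr_X [of 0] prob_space_distr [of "X 0" borel] by simp

sublocale Q: prob_space Q by (rule prob_space_Q)

definition nice :: "('x => real) => bool" where
 "nice F \<longleftrightarrow> F \<in> borel_measurable borel \<and> poly_bounded F"

lemma nice_integrable:
 assumes "nice F"
 shows "integrable Q F"
proof -
 have [measurable]: "F \<in> borel_measurable borel" using assms by (simp add: nice_def)
 obtain C N where C: "C \<ge> 0" "\<And>x. \<bar>F x\<bar> \<le> C * (1 + norm x) ^ N"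
  using assms poly_boundedE unfolding nice_def by blast
 have int: "integrable Q (\<lambda>x. C * (2 ^ N * (1 ^ N + norm x ^ N)))"
  using moments by auto
 have bound: "norm (F x) \<le> norm (C * (2 ^ N * (1 ^ N + norm x ^ N)))" for x
 proof -
  have "(1 + norm x) ^ N \<le> 2 ^ N * (1 ^ N + norm x ^ N)"
   by (rule power_add_le) auto
  hence "C * (1 + norm x) ^ N \<le> C * (2 ^ N * (1 ^ N + norm x ^ N))"
   using C(1) by (rule mult_left_mono)
  thus ?thesis using C(2) [of x] by simp
 qed
 show ?thesis
  by (rule Bochner_Integration.integrable_bound [OF int]) (use bound in \<open>auto intro!: always_eventually\<close>)
qed

lemma integrable_X: "nice F ==> integrable P (\<lambda>w. F (X j w))"
 using nice_integrable [of F] integrable_distr [of "X j" P borel F] by (simp add: distr_X)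

lemma expectation_X: "nice F ==> expectation (\<lambda>w. F (X j w)) = (LINT x|Q. F x)"
 using integral_distr [of "X j" P borel F] by (simp add: distr_X nice_def)

lemma nice_add: "nice F ==> nice G ==> nice (\<lambda>x. F x + G x)"
 and nice_diff: "nice F ==> nice G ==> nice (\<lambda>x. F x - G x)"
 and nice_mult: "nice F ==> nice G ==> nice (\<lambda>x. F x * G x)"
 and nice_power: "nice F ==> nice (\<lambda>x. F x ^ k)"
 and nice_const: "nice (\<lambda>x. c)"
 by (auto simp: nice_def intro!: poly_bounded_intros)

definition avg :: "('x => real) => nat => 'w => real" where
 "avg F n v = (\<Sum>j<n. F (X j v)) / real n"

lemma measurable_avg: "nice F ==> avg F n \<in> borel_measurable P"
proof -
 assume "nice F"
 hence [measurable]: "F \<in> borel_measurable borel" by (simp add: nice_def)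
 show ?thesis unfolding avg_def by measurable
qed

lemma avg_add: "avg (\<lambda>x. F x + G x) n w = avg F n w + avg G n w"
 and avg_diff: "avg (\<lambda>x. F x - G x) n w = avg F n w - avg G n w"
 and avg_cmult: "avg (\<lambda>x. c * F x) n w = c * avg F n w"
 by (simp_all add: avg_def sum.distrib add_divide_distrib sum_subtractf diff_divide_distrib sum_distrib_left)

lemma avg_const: "n > 0 ==> avg (\<lambda>x. c) n w = c"
 by (simp add: avg_def)

lemma avg_mono: "(\<And>j. j < n ==> F (X j w) \<le> G (X j w)) ==> avg F n w \<le> avg G n w"
 unfolding avg_def by (intro divide_right_mono sum_mono) auto

lemma avg_abs: "\<bar>avg F n w\<bar> \<le> avg (\<lambda>x. \<bar>F x\<bar>) n w"
 unfolding avg_def by (auto intro!: divide_right_mono sum_abs)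

lemma sum_moments:
 assumes F: "nice F" and z: "(LINT x|Q. F x) = 0"
 defines "S \<equiv> \<lambda>n w. \<Sum>j<n. F (X j w)"
  and "s2 \<equiv> \<integral>x. (F x)^2 \<partial>Q" and "s4 \<equiv> \<integral>x. (F x) ^ 4 \<partial>Q"
 shows "(\<forall>k\<le>4. integrable P (\<lambda>w. S n w ^ k)) \<and> expectation (S n) = 0 \<and>
  expectation (\<lambda>w. (S n w)^2) = n * s2 \<and>
  expectation (\<lambda>w. (S n w) ^ 4) = n * s4 + 3 * n * (real n - 1) * s2^2"
proof (induction n)
 case 0
 show ?case
  by (auto simp: S_def power_0_left)
next
 case (Suc n)
 have Fm[measurable]: "F \<in> borel_measurable borel" using F by (simp add: nice_def)
 define Y where "Y w = F (X n w)" for w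
 have SY: "S (Suc n) w = S n w + Y w" for w
  by (simp add: S_def Y_def)
 have "indep_vars (\<lambda>_. borel) (\<lambda>j w. F (X j w)) UNIV"
  by (rule indep_vars_compose2 [OF indep]) simp
 hence "indep_vars (\<lambda>_. borel) (\<lambda>j w. F (X j w)) (insert n {..<n})"
  by (rule indep_vars_subset) simp
 hence ind: "indep_var borel Y borel (S n)"
  unfolding Y_def S_def by (intro indep_vars_sum) auto
 have ind': "indep_var borel (\<lambda>w. Y w ^ b) borel (\<lambda>w. S n w ^ a)" for a b
  using indep_var_compose [OF ind, of "\<lambda>y. y ^ b" borel "\<lambda>y. y ^ a" borel]
  by (simp add: o_def)
 have intY: "integrable P (\<lambda>w. Y w ^ b)" for b
  unfolding Y_def by (rule integrable_X) (rule nice_power [OF F])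
 have EY: "expectation (\<lambda>w. Y w ^ b) = (LINT x|Q. F x ^ b)" for b
  unfolding Y_def by (rule expectation_X) (rule nice_power [OF F])
 have intS: "integrable P (\<lambda>w. S n w ^ a)" if "a \<le> 4" for a
  using Suc that by blast
 have int[simp]: "integrable P (\<lambda>w. Y w ^ b * S n w ^ a)" if "a \<le> 4" for a b
  by (rule indep_var_integrable [OF ind' intY intS [OF that]])
 have E: "expectation (\<lambda>w. Y w ^ b * S n w ^ a) = (LINT x|Q. F x ^ b) * expectation (\<lambda>w. S n w ^ a)"
  if "a \<le> 4" for a b
  using indep_var_lebesgue_integral [OF ind' intY intS [OF that]] EY by simp
 have e1: "S n w + Y w = Y w ^ 0 * S n w ^ 1 + Y w ^ 1 * S n w ^ 0" for w by simp
 have e2: "(S n w + Y w) ^ 2 = Y w ^ 0 * S n w ^ 2 + 2 * (Y w ^ 1 * S n w ^ 1) + Y w ^ 2 * S n w ^ 0" for w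
  by (simp add: power2_eq_square algebra_simps)
 have e3: "(S n w + Y w) ^ 3 = Y w ^ 0 * S n w ^ 3 + 3 * (Y w ^ 1 * S n w ^ 2)
   + 3 * (Y w ^ 2 * S n w ^ 1) + Y w ^ 3 * S n w ^ 0" for w
  by (simp add: power2_eq_square power3_eq_cube algebra_simps)
 have e4: "(S n w + Y w) ^ 4 = Y w ^ 0 * S n w ^ 4 + 4 * (Y w ^ 1 * S n w ^ 3)
   + 6 * (Y w ^ 2 * S n w ^ 2) + 4 * (Y w ^ 3 * S n w ^ 1) + Y w ^ 4 * S n w ^ 0" for w
  by (simp add: power2_eq_square power3_eq_cube power4_eq_xxxx algebra_simps)
 have "integrable P (\<lambda>w. S (Suc n) w ^ k)" if k4: "k \<le> 4" for k
 proof -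
  consider "k = 0" | "k = 1" | "k = 2" | "k = 3" | "k = 4" using k4 by linarith
  thus ?thesis
  proof cases
   case 1 thus ?thesis by simp
  next
   case 2
   have "integrable P (\<lambda>w. S n w + Y w)"
    unfolding e1 by (intro Bochner_Integration.integrable_add int) auto
   with 2 show ?thesis by (simp add: SY)
  next
   case 3 show ?thesis unfolding 3 SY e2
    by (intro Bochner_Integration.integrable_add integrable_mult_right int) auto
  next
   case 4 show ?thesis unfolding 4 SY e3
    by (intro Bochner_Integration.integrable_add integrable_mult_right int) auto
  next
   case 5 show ?thesis unfolding 5 SY e4
    by (intro Bochner_Integration.integrable_add integrable_mult_right int) auto
  qed
 qed
 moreover
 have le: "(0::nat) \<le> 4" "1 \<le> (4::nat)" "2 \<le> (4::nat)" "3 \<le> (4::nat)" "4 \<le> (4::nat)"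
  by simp_all
 note expand = Bochner_Integration.integral_add Bochner_Integration.integrable_add integrable_mult_right
  integral_mult_right_zero int E le
 have IH: "expectation (\<lambda>w. S n w ^ 0) = 1" "expectation (\<lambda>w. S n w ^ 1) = 0"
  "expectation (\<lambda>w. S n w ^ 2) = n * s2"
  "expectation (\<lambda>w. S n w ^ 4) = n * s4 + 3 * n * (real n - 1) * s2^2"
  using Suc prob_space by simp_all
 have QF: "(LINT x|Q. F x ^ 0) = 1" "(LINT x|Q. F x ^ 1) = 0"
  "(LINT x|Q. F x ^ 2) = s2" "(LINT x|Q. F x ^ 4) = s4"
  using z Q.prob_space by (simp_all add: s2_def s4_def)
 have "expectation (\<lambda>w. S n w + Y w) = 0"
  unfolding e1 by (simp only: expand IH QF)
 moreover have "expectation (\<lambda>w. (S n w + Y w) ^ 2) = real (Suc n) * s2"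
  unfolding e2 by (simp only: expand IH QF) (simp add: algebra_simps)
 moreover have "expectation (\<lambda>w. (S n w + Y w) ^ 4)
   = real (Suc n) * s4 + 3 * real (Suc n) * (real (Suc n) - 1) * s2^2"
  unfolding e4 by (simp only: expand IH QF) (simp add: algebra_simps power2_eq_square)
 ultimately show ?case
  by (simp add: SY [abs_def])
qed

lemma avg_second_moment:
 assumes F: "nice F" and z: "(LINT x|Q. F x) = 0" and n: "n > 0"
 shows "integrable P (\<lambda>w. (avg F n w)^2)" "expectation (\<lambda>w. (avg F n w)^2) = (LINT x|Q. (F x)^2) / n"
proof -
 have "integrable P (\<lambda>w. (\<Sum>j<n. F (X j w))^2)"
  "expectation (\<lambda>w. (\<Sum>j<n. F (X j w))^2) = n * (LINT x|Q. (F x)^2)"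
  using sum_moments [OF F z, of n] by auto
 thus "integrable P (\<lambda>w. (avg F n w)^2)" "expectation (\<lambda>w. (avg F n w)^2) = (LINT x|Q. (F x)^2) / n"
  using n by (simp_all add: avg_def power_divide power2_eq_square)
qed

lemma avg_fourth_moment:
 assumes F: "nice F" and z: "(LINT x|Q. F x) = 0"
 shows "\<exists>C\<ge>0. \<forall>n>0. integrable P (\<lambda>w. avg F n w ^ 4) \<and> expectation (\<lambda>w. avg F n w ^ 4) \<le> C / (real n)^2"
proof (intro exI conjI allI impI)
 let ?s2 = "LINT x|Q. (F x)^2" and ?s4 = "LINT x|Q. (F x) ^ 4"
 have s4: "0 \<le> ?s4" by simp
 thus "0 \<le> ?s4 + 3 * ?s2\<^sup>2" by simp
 fix n :: nat assume n: "n > 0"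
 note sm = sum_moments [OF F z, of n]
 show "integrable P (\<lambda>w. avg F n w ^ 4)"
  using sm by (simp add: avg_def power_divide)
 have "real n * ?s4 + 3 * n * (real n - 1) * ?s2\<^sup>2 \<le> (real n)^2 * (?s4 + 3 * ?s2\<^sup>2)"
 proof -
  have "real n * ?s4 \<le> (real n)^2 * ?s4"
   using s4 n by (intro mult_right_mono) (auto simp: power2_eq_square)
  moreover have "3 * n * (real n - 1) * ?s2\<^sup>2 \<le> (real n)^2 * (3 * ?s2\<^sup>2)"
   using n by (simp add: power2_eq_square algebra_simps)
  ultimately show ?thesis by (simp add: distrib_left)
 qed
 hence "expectation (\<lambda>w. (\<Sum>j<n. F (X j w)) ^ 4) / real n ^ 4 \<le> (real n)^2 * (?s4 + 3 * ?s2\<^sup>2) / real n ^ 4"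
  using sm by (intro divide_right_mono) auto
 thus "expectation (\<lambda>w. avg F n w ^ 4) \<le> (?s4 + 3 * ?s2\<^sup>2) / (real n)^2"
  using n by (simp add: avg_def power_divide power2_eq_square power4_eq_xxxx)
qed

definition whp :: "(nat => 'w => bool) => bool" where
 "whp R \<longleftrightarrow> (\<exists>B. (\<forall>n. B n \<in> events) \<and> (\<lambda>n. real n * prob (B n)) \<longlonglongrightarrow> 0 \<and>
   (\<forall>n. \<forall>v\<in>space P. v \<notin> B n \<longrightarrow> R n v))"

lemma whp_mono: "whp R ==> (\<And>n w. w \<in> space P ==> R n w ==> R' n w) ==> whp R'"
 unfolding whp_def by meson

lemma whp_conj:
 assumes "whp R" "whp R'"
 shows "whp (\<lambda>n w. R n w \<and> R' n w)"
proof -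
 obtain B where B: "\<And>n. B n \<in> events" "(\<lambda>n. real n * prob (B n)) \<longlonglongrightarrow> 0"
  "\<And>n w. w \<in> space P ==> w \<notin> B n ==> R n w"
  using assms(1) unfolding whp_def by metis
 obtain B' where B': "\<And>n. B' n \<in> events" "(\<lambda>n. real n * prob (B' n)) \<longlonglongrightarrow> 0"
  "\<And>n w. w \<in> space P ==> w \<notin> B' n ==> R' n w"
  using assms(2) unfolding whp_def by metis
 have "(\<lambda>n. real n * prob (B n \<union> B' n)) \<longlonglongrightarrow> 0"
 proof (rule tendsto_sandwich [OF _ _ tendsto_const])
  show "(\<lambda>n. real n * prob (B n) + real n * prob (B' n)) \<longlonglongrightarrow> 0"
   using tendsto_add [OF B(2) B'(2)] by simp
  have "real n * prob (B n \<union> B' n) \<le> real n * prob (B n) + real n * prob (B' n)" for n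
   using measure_Un_le [OF B(1) B'(1), of n n]
   by (simp add: distrib_left [symmetric] mult_left_mono)
  thus "\<forall>\<^sub>F n in sequentially. real n * prob (B n \<union> B' n) \<le> real n * prob (B n) + real n * prob (B' n)"
   by simp
 qed simp
 with B B' show ?thesis
  unfolding whp_def by (intro exI [of _ "\<lambda>n. B n \<union> B' n"] conjI) (simp_all add: sets.Un)
qed

lemma whp_True: "whp (\<lambda>_ _. True)"
 unfolding whp_def by (intro exI [of _ "\<lambda>_. {}"]) auto

lemma whp_ball_finite: "finite I ==> (\<And>i. i \<in> I ==> whp (R i)) ==> whp (\<lambda>n w. \<forall>i\<in>I. R i n w)"
proof (induction I rule: finite_induct)
 case empty
 show ?case by (simp add: whp_True)
next
 case (insert i I)
 hence "whp (\<lambda>n w. R i n w \<and> (\<forall>i\<in>I. R i n w))"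
  by (intro whp_conj) auto
 thus ?case by simp
qed

lemma whp_AE: "(\<And>n. AE w in P. R n w) ==> whp R"
proof -
 assume "\<And>n. AE w in P. R n w"
 hence "\<exists>N. \<forall>n. N n \<in> null_sets P \<and> {w \<in> space P. \<not> R n w} \<subseteq> N n"
  by (intro choice allI) (auto simp: eventually_ae_filter)
 then obtain N where "\<And>n. N n \<in> null_sets P" "\<And>n. {w \<in> space P. \<not> R n w} \<subseteq> N n"
  by blast
 thus ?thesis
  unfolding whp_def by (intro exI [of _ N]) (auto simp: null_sets_def measure_def)
qed

lemma whp_large: "whp (\<lambda>n _. n \<ge> N)"
proof -
 have "\<forall>\<^sub>F n in sequentially. real n * prob (if n \<ge> N then {} else space P) = 0"
  using eventually_ge_at_top [of N] by eventually_elim simp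
 hence "(\<lambda>n. real n * prob (if n \<ge> N then {} else space P)) \<longlonglongrightarrow> 0"
  by (rule tendsto_eventually)
 thus ?thesis
  unfolding whp_def by (intro exI [of _ "\<lambda>n. if n \<ge> N then {} else space P"]) auto
qed

lemma whp_avg:
 assumes F: "nice F" and e: "e > 0"
 shows "whp (\<lambda>n w. \<bar>avg F n w - (LINT x|Q. F x)\<bar> < e)"
proof -
 define G where "G x = F x - (LINT x|Q. F x)" for x
 have G: "nice G" "(LINT x|Q. G x) = 0"
  unfolding G_def using F nice_integrable [OF F]
  by (auto intro: nice_diff nice_const simp: Q.prob_space [unfolded space_Q])
 obtain C where C: "C \<ge> 0" "\<And>n. n > 0 ==> integrable P (\<lambda>w. avg G n w ^ 4)"
  "\<And>n. n > 0 ==> expectation (\<lambda>w. avg G n w ^ 4) \<le> C / (real n)^2"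
  using avg_fourth_moment [OF G] by blast
 define B where "B n = (if n = 0 then space P else {w \<in> space P. e ^ 4 \<le> avg G n w ^ 4})" for n
 have [measurable]: "avg G n \<in> borel_measurable P" for n
  by (rule measurable_avg [OF G(1)])
 have B: "B n \<in> events" for n
  unfolding B_def by (auto intro!: borel_measurable_le)
 have "prob (B n) \<le> C / (real n)^2 / e ^ 4" if "n > 0" for n
 proof -
  have "prob (B n) \<le> expectation (\<lambda>w. avg G n w ^ 4) / e ^ 4"
   using that e integral_Markov_inequality_measure [where A = "{}", OF C(2) [OF that], of "e ^ 4"]
   by (simp add: B_def)
  also have "... \<le> C / (real n)^2 / e ^ 4"
   using C(3) [OF that] by (intro divide_right_mono) auto
  finally show ?thesis .
 qed
 hence bd: "real n * prob (B n) \<le> C / e ^ 4 * (1 / real n)" if "n > 0" for n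
  using mult_left_mono [of "prob (B n)" "C / (real n)^2 / e ^ 4" "real n"] that
  by (simp add: power2_eq_square mult.commute)
 have "(\<lambda>n. real n * prob (B n)) \<longlonglongrightarrow> 0"
 proof (rule tendsto_sandwich [OF _ _ tendsto_const])
  show "(\<lambda>n. C / e ^ 4 * (1 / real n)) \<longlonglongrightarrow> 0"
   by (intro tendsto_mult_right_zero lim_1_over_n)
  show "\<forall>\<^sub>F n in sequentially. real n * prob (B n) \<le> C / e ^ 4 * (1 / real n)"
   using eventually_gt_at_top [of 0] by eventually_elim (rule bd)
 qed simp
 moreover have "\<bar>avg F n w - (LINT x|Q. F x)\<bar> < e" if "w \<in> space P" "w \<notin> B n" for n w
 proof -
  from that have n: "n > 0" and "\<not> e ^ 4 \<le> avg G n w ^ 4" by (auto simp: B_def split: if_splits)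
  hence "\<bar>avg G n w\<bar> ^ 4 < e ^ 4" by (simp add: power_even_abs)
  hence "\<bar>avg G n w\<bar> < e"
   by (rule power_less_imp_less_base) (use e in simp)
  thus ?thesis
   using n unfolding G_def by (simp add: avg_diff avg_const)
 qed
 ultimately show ?thesis
  unfolding whp_def using B by blast
qed

end

lemma normal1_moments:
 "(LINT t|normal1 m. t) = m" "(LINT t|normal1 m. (t - m)) = 0" "(LINT t|normal1 m. (t - m)^2) = 1"
 "(LINT t|normal1 m. (t - m) ^ 3) = 0" "(LINT t|normal1 m. (t - m) ^ 4) = 3"
 using integral_normal_moment_nz_1 [of 1 m] integral_normal_moment_odd [of 1 m 0]
  integral_normal_moment_odd [of 1 m 1] integral_normal_moment_even [of 1 m 1]
  integral_normal_moment_even [of 1 m 2]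
 by (simp_all add: integral_normal1 fact_numeral)

lemma iso_normal_moments:
 fixes m :: "real^'n"
 shows "(LINT y|iso_normal m. (y - m) \<bullet> a) = 0"
  and "(LINT y|iso_normal m. (y - m) \<bullet> (C *v (y - m))) = (\<Sum>i\<in>UNIV. C $ i $ i)"
proof -
 have 1: "(LINT y|iso_normal m. y $ i - m $ i) = 0" for i
  using integral_iso_normal_coords(1) [of "\<lambda>t. t - m $ i" "\<lambda>_. 0" "\<lambda>_. 0" m i] normal1_moments(2)
  by (simp add: poly_bounded_intros)
 have 2: "(LINT y|iso_normal m. (y $ i - m $ i) * (y $ j - m $ j)) = (if i = j then 1 else 0)" for i j
 proof (cases "i = j")
  case True
  thus ?thesis
   using integral_iso_normal_coords(1) [of "\<lambda>t. (t - m $ i)^2" "\<lambda>_. 0" "\<lambda>_. 0" m i] normal1_moments(3)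
   by (simp add: poly_bounded_intros power2_eq_square)
 next
  case False
  thus ?thesis
   using integral_iso_normal_coords(2) [of "\<lambda>t. t - m $ i" "\<lambda>t. t - m $ j" "\<lambda>_. 0" i j m] normal1_moments(2)
   by (simp add: poly_bounded_intros)
 qed
 have i1: "integrable (iso_normal m) (\<lambda>y. (y $ i - m $ i) * c)" for i c
  by (rule integrable_iso_normal) (auto intro!: poly_bounded_intros)
 have i2: "integrable (iso_normal m) (\<lambda>y. (y $ i - m $ i) * (c * (y $ j - m $ j)))" for i j c
  by (rule integrable_iso_normal) (auto intro!: poly_bounded_intros)
 show "(LINT y|iso_normal m. (y - m) \<bullet> a) = 0"
  using i1 by (simp add: inner_vec_def 1)
 have "(LINT y|iso_normal m. (y - m) \<bullet> (C *v (y - m)))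
   = (\<Sum>i\<in>UNIV. \<Sum>j\<in>UNIV. LINT y|iso_normal m. (y $ i - m $ i) * (C $ i $ j * (y $ j - m $ j)))"
  using i2 by (simp add: inner_vec_def matrix_vector_mult_def sum_distrib_left)
 also have "... = (\<Sum>i\<in>UNIV. \<Sum>j\<in>UNIV. C $ i $ j * (if i = j then 1 else 0))"
  unfolding 2 [symmetric] by (simp add: mult.left_commute)
 finally show "(LINT y|iso_normal m. (y - m) \<bullet> (C *v (y - m))) = (\<Sum>i\<in>UNIV. C $ i $ i)"
  by (simp add: if_distrib cong: if_cong)
qed

lemma integral_iso_normal_orthogonal:
 fixes m x w :: "real^'n" and \<phi> :: "real => real"
 assumes [measurable]: "\<phi> \<in> borel_measurable borel" and pb: "poly_bounded \<phi>"
  and m: "\<And>i. i \<noteq> k ==> m $ i = 0" and x: "x $ k = 0"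
 shows "(LINT y|iso_normal m. \<phi> (y $ k) * (x \<bullet> y)) = 0"
  and "(LINT y|iso_normal m. \<phi> (y $ k) * ((x \<bullet> y) * (w \<bullet> y))) = (x \<bullet> w) * (LINT t|normal1 (m $ k). \<phi> t)"
proof -
 have idm: "(\<lambda>t::real. t) \<in> borel_measurable borel" by simp
 have n1: "(LINT t|normal1 0. t) = 0" "(LINT t|normal1 0. t * t) = 1"
  using normal1_moments(1,3) [of 0] by (simp_all add: power2_eq_square)
 have 1: "(LINT y|iso_normal m. \<phi> (y $ k) * y $ i) = 0" if "i \<noteq> k" for i
 proof -
  have "(LINT y|iso_normal m. \<phi> (y $ k) * y $ i) = (LINT t|normal1 (m $ k). \<phi> t) * (LINT t|normal1 (m $ i). t)"
   by (rule integral_iso_normal_coords(2) [OF assms(1) idm idm pb poly_bounded_id poly_bounded_id])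
    (use that in simp)
  thus ?thesis by (simp only: m [OF that] n1 mult_zero_right)
 qed
 have 2: "(LINT y|iso_normal m. \<phi> (y $ k) * (y $ i * y $ j))
   = (if i = j then \<integral>t. \<phi> t \<partial>normal1 (m $ k) else 0)" if "i \<noteq> k" for i j
 proof -
  consider "i = j" | "j = k" | "i \<noteq> j" "j \<noteq> k" by blast
  thus ?thesis
  proof cases
   case 1
   have "(LINT y|iso_normal m. \<phi> (y $ k) * (y $ i * y $ i))
     = (LINT t|normal1 (m $ k). \<phi> t) * (LINT t|normal1 (m $ i). t * t)"
    using that by (intro integral_iso_normal_coords(2) [where \<psi> = "\<lambda>t. t * t" and \<eta> = "\<lambda>_. 0"])
     (auto intro: pb poly_bounded_intros)
   hence "(LINT y|iso_normal m. \<phi> (y $ k) * (y $ i * y $ i)) = (LINT t|normal1 (m $ k). \<phi> t)"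
    by (simp only: m [OF that] n1 mult_1_right)
   with 1 show ?thesis by simp
  next
   case 2
   have "(LINT y|iso_normal m. (\<phi> (y $ k) * y $ k) * y $ i)
     = (LINT t|normal1 (m $ k). \<phi> t * t) * (LINT t|normal1 (m $ i). t)"
    using that by (intro integral_iso_normal_coords(2) [where \<phi> = "\<lambda>t. \<phi> t * t" and \<psi> = "\<lambda>t. t" and \<eta> = "\<lambda>_. 0"])
     (auto intro: pb poly_bounded_intros)
   hence "(LINT y|iso_normal m. (\<phi> (y $ k) * y $ k) * y $ i) = 0"
    by (simp only: m [OF that] n1 mult_zero_right)
   with 2 that show ?thesis by (simp add: mult_ac)
  next
   case 3
   have "(LINT y|iso_normal m. \<phi> (y $ k) * y $ i * y $ j)
     = (LINT t|normal1 (m $ k). \<phi> t) * (LINT t|normal1 (m $ i). t) * (LINT t|normal1 (m $ j). t)"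
    by (rule integral_iso_normal_coords(3) [OF assms(1) idm idm pb poly_bounded_id poly_bounded_id])
     (use that 3 in auto)
   hence "(LINT y|iso_normal m. \<phi> (y $ k) * y $ i * y $ j) = 0"
    by (simp only: m [OF that] n1 mult_zero_right mult_zero_left)
   with 3 show ?thesis by (simp add: mult_ac)
  qed
 qed
 have pbk: "poly_bounded (\<lambda>y::real^'n. \<phi> (y $ k))"
  by (rule poly_bounded_compose [OF pb]) (auto intro!: poly_bounded_intros)
 have i1: "integrable (iso_normal m) (\<lambda>y. \<phi> (y $ k) * (c * y $ i))" for i c
  by (rule integrable_iso_normal)
   (auto intro!: poly_bounded_intros pbk)
 have i2: "integrable (iso_normal m) (\<lambda>y. \<phi> (y $ k) * (c * y $ i * (d * y $ j)))" for i j c d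
  by (rule integrable_iso_normal)
   (auto intro!: poly_bounded_intros pbk)
 have "(LINT y|iso_normal m. \<phi> (y $ k) * (x \<bullet> y)) = (\<Sum>i\<in>UNIV. LINT y|iso_normal m. \<phi> (y $ k) * (x $ i * y $ i))"
  using i1 by (simp add: inner_vec_def sum_distrib_left)
 also have "... = (\<Sum>i\<in>UNIV. x $ i * (LINT y|iso_normal m. \<phi> (y $ k) * y $ i))"
  by (simp add: mult.left_commute)
 also have "... = 0"
  by (rule sum.neutral) (metis 1 mult_zero_left mult_zero_right x)
 finally show "(LINT y|iso_normal m. \<phi> (y $ k) * (x \<bullet> y)) = 0" .
 have "(LINT y|iso_normal m. \<phi> (y $ k) * ((x \<bullet> y) * (w \<bullet> y)))
   = (\<Sum>i\<in>UNIV. \<Sum>j\<in>UNIV. LINT y|iso_normal m. \<phi> (y $ k) * (x $ i * y $ i * (w $ j * y $ j)))"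
 proof -
  have "\<phi> (y $ k) * ((x \<bullet> y) * (w \<bullet> y))
    = (\<Sum>i\<in>UNIV. \<Sum>j\<in>UNIV. \<phi> (y $ k) * (x $ i * y $ i * (w $ j * y $ j)))" for y
   by (simp only: inner_vec_def inner_real_def sum_product) (simp only: sum_distrib_left)
  thus ?thesis
   by (simp only: Bochner_Integration.integral_sum Bochner_Integration.integrable_sum i2)
 qed
 also have "... = (\<Sum>i\<in>UNIV. \<Sum>j\<in>UNIV. x $ i * w $ j * (LINT y|iso_normal m. \<phi> (y $ k) * (y $ i * y $ j)))"
 proof -
  have "\<phi> (y $ k) * (x $ i * y $ i * (w $ j * y $ j)) = (x $ i * w $ j) * (\<phi> (y $ k) * (y $ i * y $ j))" for y i j
   by (simp add: mult_ac)
  thus ?thesis by (simp only: integral_mult_right_zero)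
 qed
 also have "... = (\<Sum>i\<in>UNIV. \<Sum>j\<in>UNIV. x $ i * w $ j * (if i = j then \<integral>t. \<phi> t \<partial>normal1 (m $ k) else 0))"
 proof (intro sum.cong refl)
  fix i j
  show "x $ i * w $ j * (LINT y|iso_normal m. \<phi> (y $ k) * (y $ i * y $ j))
    = x $ i * w $ j * (if i = j then \<integral>t. \<phi> t \<partial>normal1 (m $ k) else 0)"
   by (cases "i = k") (simp_all only: 2 x mult_zero_left not_False_eq_True simp_thms)
 qed
 also have "... = (x \<bullet> w) * (LINT t|normal1 (m $ k). \<phi> t)"
  by (simp add: if_distrib inner_vec_def sum_distrib_right cong: if_cong)
 finally show "(LINT y|iso_normal m. \<phi> (y $ k) * ((x \<bullet> y) * (w \<bullet> y))) = (x \<bullet> w) * (LINT t|normal1 (m $ k). \<phi> t)" .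
qed

lemma normal1_reflect:
 fixes \<phi> :: "real => real"
 assumes [measurable]: "\<phi> \<in> borel_measurable borel"
 shows "(LINT t|normal1 (- m). \<phi> (- t)) = (LINT t|normal1 m. \<phi> t)"
proof -
 have "(LINT t|normal1 (- m). \<phi> (- t)) = (LINT t|lborel. normal_density (- m) 1 t * \<phi> (- t))"
  by (subst integral_normal1) auto
 also have "... = (LINT t|lborel. normal_density (- m) 1 (- t) * \<phi> t)"
  by (subst lborel_integral_real_affine [where c = "-1" and t = 0]) auto
 also have "... = (LINT t|lborel. normal_density m 1 t * \<phi> t)"
  by (simp add: normal_density_def power2_commute [of m])
 finally show ?thesis by (subst (asm) integral_normal1) (auto simp: integral_normal1)
qed

type_synonym 'p obs = "(real^'p) \<times> real \<times> real"

definition class_mean :: "real => 'p => real => real^'p" where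
 "class_mean D k s = axis k (if s = 1 then D / 2 else - D / 2)"

locale canonical_law = iid_moments P X Q
 for P :: "'w measure" and X :: "nat => 'w => 'p::finite obs" and Q +
 fixes D :: real and k :: 'p and q :: "real => real"
 assumes D: "0 < D" and q_measurable [measurable]: "q \<in> borel_measurable borel"
  and q: "\<And>t. 0 \<le> q t" "\<And>t. q t < 1" and q_even: "\<And>t. q (- t) = q t"
  and law: "\<And>F. F \<in> borel_measurable borel ==> (\<integral>\<^sup>+x. F x \<partial>Q) =
   (\<Sum>s\<in>{0,1}. \<integral>\<^sup>+y. ennreal (1 / 2) * (ennreal (q (y $ k)) * F (y, s, 1) + ennreal (1 - q (y $ k)) * F (y, s, 0))
    \<partial>iso_normal (class_mean D k s))"
begin

lemma poly_bounded_obs: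
 assumes "poly_bounded (F :: 'p obs => real)"
 shows "poly_bounded (\<lambda>y. F (y, s, m))"
proof (rule poly_bounded_compose [OF assms])
 show "poly_bounded (\<lambda>y::real^'p. norm (y, s, m))"
 proof (rule poly_boundedI [where N = 1])
  fix y :: "real^'p"
  have "norm (y, s, m) \<le> norm y + norm (s, m)"
   by (simp add: norm_Pair_le)
  also have "... \<le> (1 + norm (s, m)) * (1 + norm y) ^ 1"
   by (simp add: algebra_simps)
  finally show "\<bar>norm (y, s, m)\<bar> \<le> (1 + norm (s, m)) * (1 + norm y) ^ 1" by simp
 qed
qed

lemma measurable_obs:
 assumes [measurable]: "F \<in> borel_measurable borel"
 shows "(\<lambda>y. F (y, s, m)) \<in> borel_measurable borel"
 by (rule measurable_compose [OF _ assms]) (auto intro!: borel_measurable_continuous_onI continuous_intros)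

lemma q_le_1: "q t \<le> 1"
 using q(2) [of t] by simp

definition obs_given_y :: "('p obs => real) => real => real^'p => real" where
 "obs_given_y F s y = q (y $ k) * F (y, s, 1) + (1 - q (y $ k)) * F (y, s, 0)"

lemma obs_given_y_nice:
 assumes "nice F"
 shows "obs_given_y F s \<in> borel_measurable borel" "poly_bounded (obs_given_y F s)"
  "integrable (iso_normal m) (obs_given_y F s)"
proof -
 have [measurable]: "(\<lambda>y. F (y, s, m)) \<in> borel_measurable borel" and pb: "poly_bounded (\<lambda>y. F (y, s, m))" for m
  using assms measurable_obs poly_bounded_obs by (auto simp: nice_def)
 show 1: "obs_given_y F s \<in> borel_measurable borel"
  unfolding obs_given_y_def by measurable
 have "poly_bounded (\<lambda>y. q (y $ k))" "poly_bounded (\<lambda>y. 1 - q (y $ k))"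
  using q q_le_1 by (auto intro!: poly_bounded_bounded [where C = 1])
 thus 2: "poly_bounded (obs_given_y F s)"
  unfolding obs_given_y_def [abs_def] by (intro poly_bounded_add poly_bounded_mult pb)
 show "integrable (iso_normal m) (obs_given_y F s)"
  by (rule integrable_iso_normal [OF 1 2])
qed

lemma integral_Q_nonneg:
 assumes F: "nice F" and nn: "\<And>x. 0 \<le> F x"
 shows "(LINT x|Q. F x) = (LINT y|iso_normal (class_mean D k 1). obs_given_y F 1 y) / 2
  + (LINT y|iso_normal (class_mean D k 0). obs_given_y F 0 y) / 2"
proof -
 have Fm: "F \<in> borel_measurable borel" using F by (simp add: nice_def)
 note og = obs_given_y_nice [OF F]
 have ognn: "0 \<le> obs_given_y F s y" for s y
  unfolding obs_given_y_def using q q_le_1 nn by (intro add_nonneg_nonneg mult_nonneg_nonneg) auto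
 have "ennreal (LINT x|Q. F x) = (\<integral>\<^sup>+x. ennreal (F x) \<partial>Q)"
  using nice_integrable [OF F] nn by (simp add: nn_integral_eq_integral)
 also have "... = (\<Sum>s\<in>{0,1}. \<integral>\<^sup>+y. ennreal (obs_given_y F s y / 2) \<partial>iso_normal (class_mean D k s))"
 proof -
  have *: "ennreal h * (ennreal a * ennreal u + ennreal b * ennreal v) = ennreal ((a * u + b * v) * h)"
   if "0 \<le> h" "0 \<le> a" "0 \<le> b" "0 \<le> u" "0 \<le> v" for h a b u v
   using that by (simp add: ennreal_mult [symmetric] ennreal_plus [symmetric] mult.commute del: ennreal_plus)
  have "ennreal (1 / 2) * (ennreal (q (y $ k)) * ennreal (F (y, s, 1)) + ennreal (1 - q (y $ k)) * ennreal (F (y, s, 0)))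
    = ennreal (obs_given_y F s y / 2)" for y s
   using * [of "1 / 2" "q (y $ k)" "1 - q (y $ k)"] nn q q_le_1 by (simp add: obs_given_y_def)
  thus ?thesis
   using Fm by (subst law) auto
 qed
 also have "... = (\<Sum>s\<in>{0,1}. ennreal ((LINT y|iso_normal (class_mean D k s). obs_given_y F s y) / 2))"
  using og(3) ognn by (intro sum.cong refl) (subst nn_integral_eq_integral, auto)
 also have "... = ennreal ((LINT y|iso_normal (class_mean D k 1). obs_given_y F 1 y) / 2
  + (LINT y|iso_normal (class_mean D k 0). obs_given_y F 0 y) / 2)"
  using ognn by (simp add: ennreal_plus [symmetric] del: ennreal_plus)
 finally show ?thesis
  using nn ognn by (subst (asm) ennreal_inj) auto
qed

lemma integral_Q:
 assumes F: "nice F"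
 shows "(LINT x|Q. F x) = (LINT y|iso_normal (class_mean D k 1). obs_given_y F 1 y) / 2
  + (LINT y|iso_normal (class_mean D k 0). obs_given_y F 0 y) / 2"
proof -
 let ?p = "\<lambda>x. max (F x) 0" and ?n = "\<lambda>x. max (- F x) 0"
 have p: "nice ?p" and n: "nice ?n"
  using F poly_bounded_mono [of F ?p] poly_bounded_mono [of F ?n] by (auto simp: nice_def)
 have "(LINT x|Q. F x) = (LINT x|Q. ?p x - ?n x)"
  by (rule Bochner_Integration.integral_cong) auto
 also have "... = (LINT x|Q. ?p x) - (LINT x|Q. ?n x)"
  using nice_integrable [OF p] nice_integrable [OF n] by (rule Bochner_Integration.integral_diff)
 also have "... = ((LINT y|iso_normal (class_mean D k 1). obs_given_y ?p 1 y) - (LINT y|iso_normal (class_mean D k 1). obs_given_y ?n 1 y)) / 2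
  + ((LINT y|iso_normal (class_mean D k 0). obs_given_y ?p 0 y) - (LINT y|iso_normal (class_mean D k 0). obs_given_y ?n 0 y)) / 2"
  by (subst integral_Q_nonneg [OF p], simp, subst integral_Q_nonneg [OF n], simp) (simp add: field_simps)
 also have "... = (LINT y|iso_normal (class_mean D k 1). obs_given_y ?p 1 y - obs_given_y ?n 1 y) / 2
  + (LINT y|iso_normal (class_mean D k 0). obs_given_y ?p 0 y - obs_given_y ?n 0 y) / 2"
  using obs_given_y_nice(3) [OF p] obs_given_y_nice(3) [OF n] by (subst (1 2) Bochner_Integration.integral_diff) auto
 also have "... = (LINT y|iso_normal (class_mean D k 1). obs_given_y F 1 y) / 2
  + (LINT y|iso_normal (class_mean D k 0). obs_given_y F 0 y) / 2"
 proof -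
  have "a * max u 0 + b * max v 0 - (a * max (- u) 0 + b * max (- v) 0) = a * u + b * v" for a b u v :: real
   by (simp add: max_def)
  hence "obs_given_y ?p s y - obs_given_y ?n s y = obs_given_y F s y" for s y
   unfolding obs_given_y_def .
  thus ?thesis by (simp only:)
 qed
 finally show ?thesis .
qed

definition EY :: "(real^'p => real) => real" where
 "EY g = (LINT y|iso_normal (class_mean D k 1). g y) / 2 + (LINT y|iso_normal (class_mean D k 0). g y) / 2"

definition ey :: "(real => real) => real" where
 "ey \<phi> = (LINT t|normal1 (D / 2). \<phi> t) / 2 + (LINT t|normal1 (- D / 2). \<phi> t) / 2"

definition niceY :: "(real^'p => real) => bool" where
 "niceY g \<longleftrightarrow> g \<in> borel_measurable borel \<and> poly_bounded g"

definition nice1 :: "(real => real) => bool" where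
 "nice1 \<phi> \<longleftrightarrow> \<phi> \<in> borel_measurable borel \<and> poly_bounded \<phi>"

lemma class_mean_k [simp]: "class_mean D k 1 $ k = D / 2" "class_mean D k 0 $ k = - D / 2"
 and class_mean_other: "i \<noteq> k ==> class_mean D k s $ i = 0"
 by (simp_all add: class_mean_def axis_def)

lemma density_ratio:
 "(1 - logistic (D * y $ k)) * iso_normal_density (class_mean D k 1) y
  = logistic (D * y $ k) * iso_normal_density (class_mean D k 0) y"
proof -
 have *: "iso_normal_density (class_mean D k s) y = normal_density (class_mean D k s $ k) 1 (y $ k)
   * (\<Prod>i\<in>UNIV - {k}. normal_density 0 1 (y $ i))" for s
  unfolding iso_normal_density_def
  by (subst prod.remove [of UNIV k]) (auto intro!: prod.cong simp: class_mean_other)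
 have e: "exp (D * t) * exp (- ((t + D / 2)^2 / 2)) = exp (- ((t - D / 2)^2 / 2))" for t
  unfolding exp_add [symmetric] by (simp add: power2_eq_square field_simps)
 have "(1 - logistic (D * t)) * normal_density (D / 2) 1 t = logistic (D * t) * normal_density (- D / 2) 1 t" for t
 proof -
  have "1 - logistic (D * t) = 1 / (1 + exp (D * t))"
   by (simp add: logistic_def field_simps)
  thus ?thesis
   by (simp add: normal_density_def logistic_def e [symmetric])
 qed
 thus ?thesis
  unfolding * class_mean_k by (metis (no_types, lifting) mult.assoc)
qed

lemma tower:
 assumes "niceY g"
 shows "(LINT y|iso_normal (class_mean D k 1). g y) / 2 = EY (\<lambda>y. logistic (D * y $ k) * g y)"
  and "(LINT y|iso_normal (class_mean D k 0). g y) / 2 = EY (\<lambda>y. (1 - logistic (D * y $ k)) * g y)"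
proof -
 have [measurable]: "g \<in> borel_measurable borel" and pb: "poly_bounded g"
  using assms by (auto simp: niceY_def)
 let ?t = "\<lambda>y::real^'p. logistic (D * y $ k)"
 have tb: "poly_bounded ?t" "poly_bounded (\<lambda>y::real^'p. 1 - ?t y)"
  by (auto intro!: poly_bounded_bounded [where C = 1])
 have int: "integrable (iso_normal m) (\<lambda>y. ?t y * g y)" "integrable (iso_normal m) (\<lambda>y. (1 - ?t y) * g y)" for m
  using pb tb by (auto intro!: integrable_iso_normal poly_bounded_mult)
 have swap: "(LINT y|iso_normal (class_mean D k 0). ?t y * g y) = (LINT y|iso_normal (class_mean D k 1). (1 - ?t y) * g y)"
  using density_ratio by (subst (1 2) integral_iso_normal) (auto intro!: Bochner_Integration.integral_cong simp: mult_ac)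
 have s1: "(LINT y|iso_normal m. g y) = (LINT y|iso_normal m. ?t y * g y) + (LINT y|iso_normal m. (1 - ?t y) * g y)" for m
  using int by (subst Bochner_Integration.integral_add [symmetric]) (auto simp: algebra_simps)
 show "(LINT y|iso_normal (class_mean D k 1). g y) / 2 = EY (\<lambda>y. ?t y * g y)"
  unfolding EY_def swap s1 [of "class_mean D k 1"] by simp
 show "(LINT y|iso_normal (class_mean D k 0). g y) / 2 = EY (\<lambda>y. (1 - ?t y) * g y)"
  unfolding EY_def swap [symmetric] s1 [of "class_mean D k 0"] by simp
qed

lemma EY_add: "niceY f ==> niceY g ==> EY (\<lambda>y. f y + g y) = EY f + EY g"
 unfolding EY_def niceY_def by (simp add: integrable_iso_normal add_divide_distrib)

lemma EY_cmult: "EY (\<lambda>y. c * g y) = c * EY g"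
 by (simp add: EY_def distrib_left)

lemma EY_nonneg: "(\<And>y. 0 \<le> g y) ==> 0 \<le> EY g"
 by (auto simp: EY_def intro!: add_nonneg_nonneg)

lemma integral_Q_EY:
 assumes F: "nice F"
 shows "(LINT x|Q. F x) = EY (\<lambda>y. logistic (D * y $ k) * obs_given_y F 1 y + (1 - logistic (D * y $ k)) * obs_given_y F 0 y)"
proof -
 have n: "niceY (obs_given_y F s)" for s
  using obs_given_y_nice [OF F] by (simp add: niceY_def)
 have [measurable]: "obs_given_y F s \<in> borel_measurable borel" for s
  by (rule obs_given_y_nice [OF F])
 have pb: "poly_bounded (\<lambda>y::real^'p. logistic (D * y $ k))" "poly_bounded (\<lambda>y::real^'p. 1 - logistic (D * y $ k))"
  by (auto intro!: poly_bounded_bounded [where C = 1])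
 have t: "niceY (\<lambda>y. logistic (D * y $ k) * obs_given_y F 1 y)" "niceY (\<lambda>y. (1 - logistic (D * y $ k)) * obs_given_y F 0 y)"
  unfolding niceY_def using n pb by (auto simp: niceY_def intro!: poly_bounded_mult)
 show ?thesis
  unfolding integral_Q [OF F] tower [OF n] EY_add [OF t] ..
qed

lemma EY_coord: "nice1 \<phi> ==> EY (\<lambda>y. \<phi> (y $ k)) = ey \<phi>"
 unfolding EY_def ey_def nice1_def
 using integral_iso_normal_coords(1) [of \<phi> "\<lambda>_. 0" "\<lambda>_. 0" "class_mean D k _" k] by simp

lemma EY_orthogonal:
 assumes "nice1 \<phi>" "x $ k = 0"
 shows "EY (\<lambda>y. \<phi> (y $ k) * (x \<bullet> y)) = 0"
  and "EY (\<lambda>y. \<phi> (y $ k) * ((x \<bullet> y) * (w \<bullet> y))) = (x \<bullet> w) * ey \<phi>"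
proof -
 have \<phi>: "\<phi> \<in> borel_measurable borel" "poly_bounded \<phi>"
  using assms(1) by (auto simp: nice1_def)
 note * = integral_iso_normal_orthogonal [OF \<phi> class_mean_other assms(2)]
 show "EY (\<lambda>y. \<phi> (y $ k) * (x \<bullet> y)) = 0"
  by (simp add: EY_def *(1))
 show "EY (\<lambda>y. \<phi> (y $ k) * ((x \<bullet> y) * (w \<bullet> y))) = (x \<bullet> w) * ey \<phi>"
  by (simp add: EY_def ey_def *(2) distrib_left)
qed

lemma ey_odd:
 assumes "nice1 \<phi>" "\<And>t. \<phi> (- t) = - \<phi> t"
 shows "ey \<phi> = 0"
 using normal1_reflect [of \<phi> "D / 2"] assms by (simp add: ey_def nice1_def)

lemma ey_add: "nice1 f ==> nice1 g ==> ey (\<lambda>y. f y + g y) = ey f + ey g"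
 and ey_diff: "nice1 f ==> nice1 g ==> ey (\<lambda>y. f y - g y) = ey f - ey g"
 unfolding ey_def nice1_def by (simp_all add: integrable_normal1 add_divide_distrib diff_divide_distrib)

lemma ey_nonneg: "(\<And>y. 0 \<le> g y) ==> 0 \<le> ey g"
 by (auto simp: ey_def intro!: add_nonneg_nonneg)

lemma ey_pos:
 assumes g: "nice1 g" "\<And>t. 0 \<le> g t" and pos: "AE t in lborel. 0 < g t"
 shows "0 < ey g"
proof -
 have gm: "g \<in> borel_measurable borel" using g by (simp add: nice1_def)
 have "0 < (LINT t|normal1 (D / 2). g t)"
 proof (rule ccontr)
  assume "\<not> ?thesis"
  hence "(LINT t|normal1 (D / 2). g t) = 0"
   using g(2) by (metis integral_nonneg_AE not_less_iff_gr_or_eq AE_I2 not_le)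
  hence "AE t in normal1 (D / 2). g t = 0"
   using g by (subst (asm) integral_nonneg_eq_0_iff_AE) (auto simp: nice1_def intro!: integrable_normal1)
  hence "AE t in lborel. g t = 0"
   unfolding normal1_def using gm by (subst (asm) AE_density) (auto simp: normal_density_pos)
  with pos have "AE t::real in lborel. False"
   by eventually_elim simp
  hence "emeasure lborel (space (lborel :: real measure)) = 0"
   unfolding trivial_limit_def [symmetric] ae_filter_eq_bot_iff .
  thus False by simp
 qed
 moreover have "0 \<le> (LINT t|normal1 (- D / 2). g t)"
  using g by simp
 ultimately show ?thesis by (simp add: ey_def)
qed

end

section \<open>First-order expansions in the parameter\<close>

definition jet_bound where
 "jet_bound (t::'e::euclidean_space) F F' (G :: 'x::euclidean_space => real) \<longleftrightarrow> poly_bounded G \<and>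
   (\<forall>x. \<bar>F t x\<bar> \<le> G x) \<and> (\<forall>x h. \<bar>F' x h\<bar> \<le> G x * norm h) \<and>
   (\<forall>x h. norm h \<le> 1 \<longrightarrow> \<bar>F (t + h) x - F t x - F' x h\<bar> \<le> G x * (norm h)^2) \<and>
   (\<forall>x. linear (F' x)) \<and> (\<forall>h. (\<lambda>x. F' x h) \<in> borel_measurable borel) \<and> F t \<in> borel_measurable borel"

definition jet where
 "jet t F F' \<longleftrightarrow> Ex (jet_bound t F F')"

lemma jetI:
 assumes "\<And>x. linear (F' x)" "\<And>h. (\<lambda>x. F' x h) \<in> borel_measurable borel" "F t \<in> borel_measurable borel"
  "poly_bounded G" "\<And>x. \<bar>F t x\<bar> \<le> G x" "\<And>x h. \<bar>F' x h\<bar> \<le> G x * norm h"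
  "\<And>x h. norm h \<le> 1 ==> \<bar>F (t + h) x - F t x - F' x h\<bar> \<le> G x * (norm h)^2"
 shows "jet t F F'"
 using assms unfolding jet_def jet_bound_def by blast

lemma jetD:
 assumes "jet t F F'"
 shows "linear (F' x)" "(\<lambda>x. F' x h) \<in> borel_measurable borel" "F t \<in> borel_measurable borel"
 using assms by (auto simp: jet_def jet_bound_def)

lemma jet_boundD:
 assumes "jet_bound t F F' G"
 shows "poly_bounded G" "\<bar>F t x\<bar> \<le> G x" "\<bar>F' x h\<bar> \<le> G x * norm h"
  "norm h \<le> 1 ==> \<bar>F (t + h) x - F t x - F' x h\<bar> \<le> G x * (norm h)^2" "0 \<le> G x"
proof -
 show 1: "\<bar>F t x\<bar> \<le> G x"
  using assms by (simp add: jet_bound_def)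
 show "0 \<le> G x" using 1 by linarith
qed (use assms in \<open>simp_all add: jet_bound_def\<close>)

lemma jet_fixed:
 assumes "g \<in> borel_measurable borel" "poly_bounded g"
 shows "jet t (\<lambda>_. g) (\<lambda>_ _. 0)"
 by (rule jetI [where G = "\<lambda>x. \<bar>g x\<bar>"]) (use assms in \<open>auto intro: poly_bounded_abs linear_zero\<close>)

lemma jet_const: "jet t (\<lambda>_ _. c) (\<lambda>_ _. 0)"
 by (rule jet_fixed) simp_all

lemma jet_param:
 assumes "linear L"
 shows "jet t (\<lambda>s _. L s) (\<lambda>_. L)"
proof -
 obtain K where K: "\<And>h. \<bar>L h\<bar> \<le> norm h * K"
  using linear_bounded [OF assms] by (metis mult.commute real_norm_def)
 show ?thesis
 proof (rule jetI [where G = "\<lambda>_. \<bar>L t\<bar> + \<bar>K\<bar>"])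
  show "\<bar>L h\<bar> \<le> (\<bar>L t\<bar> + \<bar>K\<bar>) * norm h" for h
  proof -
   have "norm h * K \<le> norm h * (\<bar>L t\<bar> + \<bar>K\<bar>)"
    by (rule mult_left_mono) auto
   thus ?thesis using K [of h] by (simp add: mult.commute)
  qed
 qed (use assms in \<open>simp_all add: linear_add\<close>)
qed

lemma jet_add:
 assumes J: "jet t F F'" "jet t H H'"
 shows "jet t (\<lambda>s x. F s x + H s x) (\<lambda>x h. F' x h + H' x h)"
proof -
 obtain G G2 where "jet_bound t F F' G" "jet_bound t H H' G2"
  using J by (auto simp: jet_def)
 note F = jet_boundD [OF this(1)] and H = jet_boundD [OF this(2)]
 note [measurable] = J [THEN jetD(2)] J [THEN jetD(3)]
 show ?thesis
 proof (rule jetI [where G = "\<lambda>x. G x + G2 x"])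
  show "linear (\<lambda>h. F' x h + H' x h)" for x
   using J [THEN jetD(1)] by (rule linear_compose_add)
  show "poly_bounded (\<lambda>x. G x + G2 x)"
   using F(1) H(1) by (rule poly_bounded_add)
  show "\<bar>F t x + H t x\<bar> \<le> G x + G2 x" for x
   using F(2) [of x] H(2) [of x] by linarith
  show "\<bar>F' x h + H' x h\<bar> \<le> (G x + G2 x) * norm h" for x h
   using F(3) [of x h] H(3) [of x h] by (simp add: distrib_right)
  show "\<bar>F (t + h) x + H (t + h) x - (F t x + H t x) - (F' x h + H' x h)\<bar> \<le> (G x + G2 x) * (norm h)^2"
   if "norm h \<le> 1" for x h
   using F(4) [OF that, of x] H(4) [OF that, of x] by (simp add: distrib_right)
 qed measurable
qed

lemma jet_compose:
 assumes J: "jet t F F'"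
  and \<phi>: "\<And>u. \<bar>\<phi>' u\<bar> \<le> B * (1 + \<bar>u\<bar>)" "\<And>u v. \<bar>\<phi> v - \<phi> u - \<phi>' u * (v - u)\<bar> \<le> B * (v - u)^2"
  and [measurable]: "\<phi> \<in> borel_measurable borel" "\<phi>' \<in> borel_measurable borel"
 shows "jet t (\<lambda>s x. \<phi> (F s x)) (\<lambda>x h. \<phi>' (F t x) * F' x h)"
proof -
 obtain G where "jet_bound t F F' G"
  using J by (auto simp: jet_def)
 note F = jet_boundD [OF this]
 note [measurable] = jetD(2,3) [OF J]
 have B: "0 \<le> B" using \<phi>(1) [of 0] by simp
 define E where "E x = B * (1 + G x)" for x
 have E: "0 \<le> E x" "B \<le> E x" "\<bar>\<phi>' (F t x)\<bar> \<le> E x" for x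
  using \<phi>(1) [of "F t x"] mult_left_mono [OF F(2) B, of x] mult_nonneg_nonneg [OF B F(5)] B
  by (auto simp: E_def distrib_left)
 define G' where "G' x = \<bar>\<phi> 0\<bar> + E x * G x + B * (G x)^2 + B * (2 * G x)^2" for x
 have G': "\<bar>\<phi> 0\<bar> + E x * G x + B * (G x)^2 \<le> G' x" "E x * G x \<le> G' x" "B * (2 * G x)^2 + E x * G x \<le> G' x" for x
  using B F(5) E(1) by (auto simp: G'_def)
 show ?thesis
 proof (rule jetI [where G = G'])
  show "linear (\<lambda>h. \<phi>' (F t x) * F' x h)" for x
   using linear_compose_scale_right [OF jetD(1) [OF J], of "\<phi>' (F t x)" x] by simp
  show "poly_bounded G'"
   unfolding G'_def E_def using F(1) by (intro poly_bounded_intros)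
  show "\<bar>\<phi> (F t x)\<bar> \<le> G' x" for x
  proof -
   have "\<bar>\<phi>' 0 * F t x\<bar> \<le> E x * G x"
    unfolding abs_mult using \<phi>(1) [of 0] E [of x] F(2,5) by (intro mult_mono) auto
   moreover have "B * (F t x)^2 \<le> B * (G x)^2"
    using F(2,5) B by (intro mult_left_mono) (auto simp: abs_le_square_iff [symmetric])
   ultimately show ?thesis
    using \<phi>(2) [of "F t x" 0] G'(1) [of x] by simp
  qed
  show "\<bar>\<phi>' (F t x) * F' x h\<bar> \<le> G' x * norm h" for x h
  proof -
   have "\<bar>\<phi>' (F t x) * F' x h\<bar> \<le> E x * (G x * norm h)"
    unfolding abs_mult using E F(3) by (intro mult_mono) auto
   also have "... \<le> G' x * norm h"
    using mult_right_mono [OF G'(2) norm_ge_zero] by (simp add: mult.assoc)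
   finally show ?thesis .
  qed
  show "\<bar>\<phi> (F (t + h) x) - \<phi> (F t x) - \<phi>' (F t x) * F' x h\<bar> \<le> G' x * (norm h)^2" if h: "norm h \<le> 1" for x h
  proof -
   define d where "d = F (t + h) x - F t x"
   have N: "(norm h)^2 \<le> norm h"
    using h by (simp add: power2_eq_square mult_left_le)
   have "\<bar>d\<bar> \<le> G x * norm h + G x * (norm h)^2"
    using F(3) [of x h] F(4) [OF h, of x] by (simp add: d_def)
   also have "... \<le> G x * norm h + G x * norm h"
    using N F(5) by (intro add_mono mult_left_mono) auto
   finally have "\<bar>d\<bar> \<le> \<bar>2 * G x * norm h\<bar>"
    using F(5) by simp
   hence "d^2 \<le> (2 * G x * norm h)^2"
    by (simp add: abs_le_square_iff)
   hence d2: "B * d^2 \<le> B * (2 * G x)^2 * (norm h)^2"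
    using B mult_left_mono [of "d^2" "(2 * G x * norm h)^2" B] by (simp add: power_mult_distrib)
   have "\<bar>\<phi>' (F t x) * (d - F' x h)\<bar> \<le> E x * (G x * (norm h)^2)"
    unfolding abs_mult using E F(4) [OF h, of x] by (intro mult_mono) (auto simp: d_def)
   moreover have "\<bar>\<phi> (F (t + h) x) - \<phi> (F t x) - \<phi>' (F t x) * d\<bar> \<le> B * d^2"
    using \<phi>(2) [of "F (t + h) x" "F t x"] by (simp add: d_def)
   moreover have "\<phi> (F (t + h) x) - \<phi> (F t x) - \<phi>' (F t x) * F' x h
     = (\<phi> (F (t + h) x) - \<phi> (F t x) - \<phi>' (F t x) * d) + \<phi>' (F t x) * (d - F' x h)"
    by (simp add: algebra_simps)
   ultimately have "\<bar>\<phi> (F (t + h) x) - \<phi> (F t x) - \<phi>' (F t x) * F' x h\<bar> \<le> B * d^2 + E x * (G x * (norm h)^2)"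
    by linarith
   also have "... \<le> (B * (2 * G x)^2 + E x * G x) * (norm h)^2"
    using d2 by (simp add: distrib_right mult.assoc)
   also have "... \<le> G' x * (norm h)^2"
    by (intro mult_right_mono G') simp
   finally show ?thesis .
  qed
 qed measurable
qed

lemma jet_cong:
 assumes "jet t F F'" "\<And>s x. F s x = H s x" "\<And>x h. F' x h = H' x h"
 shows "jet t H H'"
proof -
 have "F = H" "F' = H'"
  using assms(2,3) by (intro ext, simp)+
 with assms(1) show ?thesis by simp
qed

lemma jet_cmult: "jet t F F' ==> jet t (\<lambda>s x. c * F s x) (\<lambda>x h. c * F' x h)"
 by (rule jet_compose [where B = "\<bar>c\<bar>" and \<phi> = "\<lambda>u. c * u" and \<phi>' = "\<lambda>_. c"]) (simp_all add: algebra_simps)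

lemma jet_diff: "jet t F F' ==> jet t H H' ==> jet t (\<lambda>s x. F s x - H s x) (\<lambda>x h. F' x h - H' x h)"
 using jet_add [OF _ jet_cmult [of t H H' "-1"]] by (rule jet_cong) auto

text \<open>Polarisation: $4ab = (a + b)^2 - (a - b)^2$.\<close>

lemma jet_mult:
 assumes "jet t F F'" "jet t H H'"
 shows "jet t (\<lambda>s x. F s x * H s x) (\<lambda>x h. F' x h * H t x + F t x * H' x h)"
proof -
 have 1: "v^2 - u^2 - 2 * u * (v - u) = (v - u)^2" for u v :: real
  by (simp add: power2_eq_square algebra_simps)
 have sq: "jet t A A' ==> jet t (\<lambda>s x. (A s x)^2) (\<lambda>x h. 2 * A t x * A' x h)" for A A'
  by (rule jet_compose [where B = 2 and \<phi> = power2 and \<phi>' = "\<lambda>u. 2 * u"]) (simp_all add: 1 abs_mult)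
 show ?thesis
  by (rule jet_cong [OF jet_cmult [where c = "1/4", OF jet_diff [OF sq [OF jet_add [OF assms]] sq [OF jet_diff [OF assms]]]]])
   (simp_all add: power2_eq_square field_simps)
qed

lemma jet_sum:
 assumes "\<And>i. i \<in> I ==> jet t (F i) (F' i)"
 shows "jet t (\<lambda>s x. \<Sum>i\<in>I. F i s x) (\<lambda>x h. \<Sum>i\<in>I. F' i x h)"
 using assms
 by (induction I rule: infinite_finite_induct) (simp_all add: jet_const jet_add)

lemma jet_logistic:
 "jet t F F' ==> jet t (\<lambda>s x. logistic (F s x)) (\<lambda>x h. logistic (F t x) * (1 - logistic (F t x)) * F' x h)"
 using logistic_taylor
 by (intro jet_compose [where B = 1 and \<phi>' = "\<lambda>u. logistic u * (1 - logistic u)"])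
  (auto simp: abs_mult intro!: order_trans [OF logistic_variance_le])

context iid_moments
begin

lemma jet_nice:
 assumes "jet t F F'"
 shows "nice (F t)" "nice (\<lambda>x. F' x h)"
proof -
 obtain G where "jet_bound t F F' G"
  using assms by (auto simp: jet_def)
 note F = jet_boundD [OF this] and m = jetD(2,3) [OF assms]
 show "nice (F t)"
  unfolding nice_def using m(2) poly_bounded_mono [OF F(1), of "F t"] F(2) by (meson abs_ge_self order_trans)
 have "poly_bounded (\<lambda>x. G x * norm h)"
  using F(1) by (intro poly_bounded_intros)
 thus "nice (\<lambda>x. F' x h)"
  unfolding nice_def using m(1) [of h] poly_bounded_mono [of "\<lambda>x. G x * norm h" "\<lambda>x. F' x h"] F(3) by (meson abs_ge_self order_trans)
qed

lemma jet_integral_linear: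
 assumes "jet t F F'"
 shows "linear (\<lambda>h. LINT x|Q. F' x h)"
proof -
 note lin = jetD(1) [OF assms]
 show ?thesis
  using nice_integrable [OF jet_nice(2) [OF assms]]
  by (intro linearI) (simp_all add: linear_add [OF lin] linear_cmul [OF lin])
qed

lemma linear_avg: "(\<And>x. linear (F' x)) ==> linear (\<lambda>h. avg (\<lambda>x. F' x h) n w)"
 by (intro linearI) (simp_all add: linear_add linear_cmul avg_add avg_cmult [of _ "\<lambda>x. F' x _"])

lemma jet_whp:
 fixes t :: "'e::euclidean_space"
 assumes J: "jet t F F'" and \<delta>: "0 < \<delta>"
 obtains r where "0 < r" "r \<le> 1" "whp (\<lambda>n w. \<forall>h. norm h \<le> r \<longrightarrow>
  \<bar>avg (F (t + h)) n w - avg (F t) n w - (LINT x|Q. F' x h)\<bar> \<le> \<delta> * norm h)"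
proof -
 obtain G where "jet_bound t F F' G"
  using J by (auto simp: jet_def)
 note G = jet_boundD [OF this] and lin = jetD(1) [OF J]
 obtain C N where CN: "C \<ge> 0" "\<And>x. \<bar>G x\<bar> \<le> C * (1 + norm x) ^ N"
  using poly_boundedE [OF G(1)] by blast
 define W where "W x = C * (1 + norm x) ^ N" for x :: 'x
 have W: "nice W"
  unfolding nice_def W_def by (auto intro!: poly_bounded_intros)
 define K where "K = (LINT x|Q. W x) + 1"
 have W0: "0 \<le> W x" for x using CN(1) by (simp add: W_def)
 have K: "0 < K"
  unfolding K_def using W0 by (intro add_nonneg_pos) auto
 define r where "r = min 1 (\<delta> / (2 * K))"
 define \<eta> where "\<eta> = \<delta> / (2 * real DIM('e))"
 have \<eta>: "0 < \<eta>" using \<delta> by (simp add: \<eta>_def)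
 have "whp (\<lambda>n w. (\<forall>b\<in>Basis. \<bar>avg (\<lambda>x. F' x b) n w - (LINT x|Q. F' x b)\<bar> < \<eta>)
   \<and> \<bar>avg W n w - (LINT x|Q. W x)\<bar> < 1)"
  using \<eta> by (intro whp_conj whp_ball_finite whp_avg jet_nice(2) [OF J] W) auto
 hence "whp (\<lambda>n w. \<forall>h. norm h \<le> r \<longrightarrow>
  \<bar>avg (F (t + h)) n w - avg (F t) n w - (LINT x|Q. F' x h)\<bar> \<le> \<delta> * norm h)"
 proof (rule whp_mono, intro allI impI)
  fix n w and h :: 'e
  assume *: "(\<forall>b\<in>Basis. \<bar>avg (\<lambda>x. F' x b) n w - (LINT x|Q. F' x b)\<bar> < \<eta>)
   \<and> \<bar>avg W n w - (LINT x|Q. W x)\<bar> < 1" and h: "norm h \<le> r"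
  define L where "L h = avg (\<lambda>x. F' x h) n w - (LINT x|Q. F' x h)" for h
  have L: "linear L"
   unfolding L_def by (intro linear_compose_sub linear_avg [OF lin] jet_integral_linear [OF J])
  have Lh: "L h = (\<Sum>b\<in>Basis. (h \<bullet> b) * L b)"
   using linear_sum [OF L, of "\<lambda>b. (h \<bullet> b) *\<^sub>R b" Basis] linear_cmul [OF L]
   by (simp add: euclidean_representation)
  have "\<bar>L h\<bar> \<le> (\<Sum>b\<in>(Basis :: 'e set). norm h * \<eta>)"
  proof -
   have "\<bar>\<Sum>b\<in>Basis. (h \<bullet> b) * L b\<bar> \<le> (\<Sum>b\<in>Basis. \<bar>(h \<bullet> b) * L b\<bar>)"
    by (rule sum_abs)
   also have "... \<le> (\<Sum>b\<in>(Basis :: 'e set). norm h * \<eta>)"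
    unfolding abs_mult using * by (intro sum_mono mult_mono) (auto simp: L_def Basis_le_norm less_imp_le)
   finally show ?thesis using Lh by simp
  qed
  also have "... = \<delta> / 2 * norm h"
   by (simp add: \<eta>_def)
  finally have 1: "\<bar>L h\<bar> \<le> \<delta> / 2 * norm h" .
  have h1: "norm h \<le> 1" using h by (simp add: r_def)
  have "\<bar>avg (\<lambda>x. F (t + h) x - F t x - F' x h) n w\<bar> \<le> avg (\<lambda>x. \<bar>F (t + h) x - F t x - F' x h\<bar>) n w"
   by (rule avg_abs)
  also have "... \<le> avg (\<lambda>x. (norm h)^2 * W x) n w"
  proof (rule avg_mono)
   fix j
   have "G (X j w) * (norm h)^2 \<le> W (X j w) * (norm h)^2"
    using CN(2) [of "X j w"] by (intro mult_right_mono) (auto simp: W_def)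
   thus "\<bar>F (t + h) (X j w) - F t (X j w) - F' (X j w) h\<bar> \<le> (norm h)^2 * W (X j w)"
    using G(4) [OF h1, of "X j w"] by (simp add: mult.commute)
  qed
  also have "... \<le> (norm h)^2 * K"
   unfolding avg_cmult using * by (intro mult_left_mono) (auto simp: K_def)
  also have "... \<le> \<delta> / 2 * norm h"
  proof -
   have "norm h * K \<le> \<delta> / 2"
    using h K by (simp add: r_def field_simps)
   thus ?thesis
    using mult_left_mono [of "norm h * K" "\<delta> / 2" "norm h"] by (simp add: power2_eq_square mult_ac)
  qed
  finally have 2: "\<bar>avg (F (t + h)) n w - avg (F t) n w - avg (\<lambda>x. F' x h) n w\<bar> \<le> \<delta> / 2 * norm h"
   by (simp add: avg_diff)
  show "\<bar>avg (F (t + h)) n w - avg (F t) n w - (LINT x|Q. F' x h)\<bar> \<le> \<delta> * norm h"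
  proof -
   have "\<delta> / 2 * norm h + \<delta> / 2 * norm h = \<delta> * norm h" by simp
   thus ?thesis using 1 2 unfolding L_def by linarith
  qed
 qed
 moreover have "0 < r" "r \<le> 1"
  using K \<delta> by (auto simp: r_def)
 ultimately show ?thesis using that by blast
qed

lemma has_AE_of_quadratic_expansion:
 fixes I :: "'i set" and B :: "'b set"
 assumes I: "finite I" and \<phi>: "\<And>i. i \<in> I ==> nice (\<phi> i)" "\<And>i. i \<in> I ==> (LINT x|Q. \<phi> i x) = 0"
  "\<And>i. i \<in> I ==> (LINT x|Q. (\<phi> i x)^2) = lam" and lam: "0 < lam"
  and B: "finite B" and \<psi>: "\<And>b. b \<in> B ==> nice (\<psi> b)" "\<And>b. b \<in> B ==> (LINT x|Q. \<psi> b x) = 0"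
  and R [measurable]: "\<And>n. R n \<in> borel_measurable P" and R01: "\<And>n w. \<bar>R n w\<bar> \<le> 1"
  and ex: "\<And>\<delta>. 0 < \<delta> ==> whp (\<lambda>n w. \<bar>R n w - r0 - c * (\<Sum>i\<in>I. (avg (\<phi> i) n w / lam)^2)\<bar>
    \<le> \<delta> * (\<Sum>b\<in>B. (avg (\<psi> b) n w)^2))"
 shows "has_AE (\<lambda>n. expectation (R n)) (\<lambda>n. r0 + (c * card I / lam) / real n)"
proof -
 define T where "T n w = c * (\<Sum>i\<in>I. (avg (\<phi> i) n w / lam)^2)" for n w
 define U where "U n w = (\<Sum>b\<in>B. (avg (\<psi> b) n w)^2)" for n w
 define V where "V = (\<Sum>b\<in>B. LINT x|Q. (\<psi> b x)^2)"
 have ET: "integrable P (T n)" "expectation (T n) = (c * card I / lam) / real n" if n: "n > 0" for n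
 proof -
  have i: "integrable P (\<lambda>w. (avg (\<phi> i) n w / lam)^2)"
   "expectation (\<lambda>w. (avg (\<phi> i) n w / lam)^2) = 1 / (lam * real n)" if "i \<in> I" for i
   using avg_second_moment [OF \<phi>(1) [OF that] \<phi>(2) [OF that] n] \<phi>(3) [OF that] lam
   by (simp_all add: power_divide power2_eq_square)
  show "integrable P (T n)"
   unfolding T_def [abs_def] using i by (intro integrable_mult_right Bochner_Integration.integrable_sum) auto
  have "expectation (T n) = c * (\<Sum>i\<in>I. 1 / (lam * real n))"
   unfolding T_def [abs_def] using i by (simp add: Bochner_Integration.integral_sum)
  thus "expectation (T n) = (c * card I / lam) / real n" by simp
 qed
 have EU: "integrable P (U n)" "expectation (U n) = V / real n" if n: "n > 0" for n
 proof -
  have i: "integrable P (\<lambda>w. (avg (\<psi> b) n w)^2)"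
   "expectation (\<lambda>w. (avg (\<psi> b) n w)^2) = (LINT x|Q. (\<psi> b x)^2) / real n" if "b \<in> B" for b
   using avg_second_moment [OF \<psi>(1) [OF that] \<psi>(2) [OF that] n] by simp_all
  show "integrable P (U n)"
   unfolding U_def [abs_def] using i by (intro Bochner_Integration.integrable_sum) auto
  show "expectation (U n) = V / real n"
   unfolding U_def [abs_def] V_def using i by (simp add: Bochner_Integration.integral_sum sum_divide_distrib)
 qed
 have "\<exists>C. \<forall>i\<in>I. 0 \<le> C i \<and> (\<forall>n>0. integrable P (\<lambda>w. avg (\<phi> i) n w ^ 4) \<and> expectation (\<lambda>w. avg (\<phi> i) n w ^ 4) \<le> C i / (real n)^2)"
  using avg_fourth_moment \<phi> by (intro bchoice ballI) blast
 then obtain Ci where Ci: "\<And>i. i \<in> I ==> 0 \<le> Ci i"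
  "\<And>i n. i \<in> I ==> 0 < n ==> integrable P (\<lambda>w. avg (\<phi> i) n w ^ 4)"
  "\<And>i n. i \<in> I ==> 0 < n ==> expectation (\<lambda>w. avg (\<phi> i) n w ^ 4) \<le> Ci i / (real n)^2"
  by blast
 define K where "K = c^2 * card I / lam ^ 4"
 define C where "C = K * (\<Sum>i\<in>I. Ci i)"
 define W where "W n w = K * (\<Sum>i\<in>I. avg (\<phi> i) n w ^ 4)" for n w
 have K0: "0 \<le> K" using lam by (simp add: K_def)
 have TW: "(T n w)^2 \<le> W n w" for n w
 proof -
  have "(\<Sum>i\<in>I. (avg (\<phi> i) n w / lam)^2 * 1)^2 \<le> (\<Sum>i\<in>I. ((avg (\<phi> i) n w / lam)^2)^2) * (\<Sum>i\<in>I. 1^2)"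
   by (rule Cauchy_Schwarz_ineq_sum)
  hence "c^2 * (\<Sum>i\<in>I. (avg (\<phi> i) n w / lam)^2)^2 \<le> c^2 * ((\<Sum>i\<in>I. ((avg (\<phi> i) n w / lam)^2)^2) * card I)"
   by (intro mult_left_mono) auto
  also have "... = W n w"
   by (simp add: W_def K_def power_divide sum_divide_distrib [symmetric] power_mult [symmetric])
  finally show ?thesis by (simp add: T_def power_mult_distrib)
 qed
 have EW: "integrable P (W n)" "expectation (W n) \<le> C / (real n)^2" if n: "n > 0" for n
 proof -
  show "integrable P (W n)"
   unfolding W_def [abs_def] using Ci(2) n by (intro integrable_mult_right Bochner_Integration.integrable_sum) auto
  have "expectation (W n) = K * (\<Sum>i\<in>I. expectation (\<lambda>w. avg (\<phi> i) n w ^ 4))"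
   unfolding W_def [abs_def] using Ci(2) n by (simp add: Bochner_Integration.integral_sum)
  also have "... \<le> K * (\<Sum>i\<in>I. Ci i / (real n)^2)"
   using Ci(3) n K0 by (intro mult_left_mono sum_mono) auto
  finally show "expectation (W n) \<le> C / (real n)^2"
   by (simp add: C_def sum_divide_distrib [symmetric])
 qed
 have R_int: "integrable P (R n)" for n
  by (rule integrable_const_bound [where B = 1]) (use R01 in auto)
 have C0: "0 \<le> C" unfolding C_def using K0 Ci(1) by (intro mult_nonneg_nonneg sum_nonneg) auto
 have V0: "0 \<le> V" unfolding V_def by (intro sum_nonneg) auto
 have U0: "0 \<le> U n w" for n w unfolding U_def by (intro sum_nonneg) auto
 have main: "\<forall>\<^sub>F n in sequentially. \<bar>expectation (R n) - (r0 + (c * card I / lam) / real n)\<bar> \<le> e * \<bar>1 / real n\<bar>"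
  if e: "0 < e" for e
 proof -
  define \<delta> where "\<delta> = e / (3 * (V + C + 1))"
  have \<delta>: "0 < \<delta>" using e V0 C0 by (simp add: \<delta>_def)
  have \<delta>V: "\<delta> * V + \<delta> * C \<le> e / 3"
  proof -
   have "V + C + 1 \<noteq> 0" using V0 C0 by linarith
   hence "\<delta> * (V + C + 1) = e / 3"
    unfolding \<delta>_def by (metis nonzero_mult_div_cancel_right times_divide_eq_left mult_divide_mult_cancel_right)
   moreover have "\<delta> * (V + C) \<le> \<delta> * (V + C + 1)"
    using \<delta> by (intro mult_left_mono) auto
   ultimately show ?thesis by (simp add: distrib_left)
  qed
  obtain A where A: "\<And>n. A n \<in> events" "(\<lambda>n. real n * prob (A n)) \<longlonglongrightarrow> 0"
   "\<And>n w. w \<in> space P ==> w \<notin> A n ==> \<bar>R n w - r0 - T n w\<bar> \<le> \<delta> * U n w"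
   using ex [OF \<delta>] unfolding whp_def T_def U_def by blast
  note [measurable] = A(1)
  define L where "L = 1 + \<bar>r0\<bar>"
  have bound: "\<bar>R n w - r0 - T n w\<bar> \<le> \<delta> * U n w + L * indicator (A n) w
    + (\<delta> * real n * W n w + 1 / (\<delta> * real n) * indicator (A n) w)"
   if n: "n > 0" and w: "w \<in> space P" for n w
  proof -
   have W0: "0 \<le> W n w" using TW [of n w] by (meson order_trans zero_le_power2)
   show ?thesis
   proof (cases "w \<in> A n")
    case False
    thus ?thesis
     using A(3) [OF w False] W0 \<delta> by (simp add: add_increasing2)
   next
    case True
    define a where "a = \<delta> * real n"
    have a: "0 < a" using \<delta> n by (simp add: a_def)
    have "\<bar>T n w\<bar> \<le> a * (T n w)^2 + 1 / a"
    proof (cases "\<bar>T n w\<bar> \<le> 1 / a")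
     case True thus ?thesis using a by (simp add: add_increasing)
    next
     case False
     hence "1 \<le> a * \<bar>T n w\<bar>" using a by (simp add: field_simps)
     hence "\<bar>T n w\<bar> * 1 \<le> \<bar>T n w\<bar> * (a * \<bar>T n w\<bar>)"
      by (intro mult_left_mono) auto
     hence "\<bar>T n w\<bar> \<le> a * (T n w)^2"
      by (simp add: power2_eq_square mult.left_commute)
     thus ?thesis using a by (simp add: add_increasing2)
    qed
    also have "... \<le> a * W n w + 1 / a"
     using TW [of n w] a by simp
    finally have "\<bar>T n w\<bar> \<le> a * W n w + 1 / a" .
    moreover have "\<bar>R n w - r0\<bar> \<le> L"
     using R01 [of n w] by (simp add: L_def)
    moreover have "0 \<le> \<delta> * U n w" using \<delta> U0 by simp
    ultimately show ?thesis
     using True by (simp add: a_def)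
   qed
  qed
  have fin: "\<bar>expectation (R n) - (r0 + (c * card I / lam) / real n)\<bar>
    \<le> ((\<delta> * V + \<delta> * C) + L * (real n * prob (A n)) + prob (A n) / \<delta>) * (1 / real n)" if n: "n > 0" for n
  proof -
   have iA: "integrable P (\<lambda>w. indicat_real (A n) w)"
    using A(1) by (simp add: integrable_real_indicator less_top [symmetric])
   have i0: "integrable P (\<lambda>w. R n w - r0 - T n w)"
    using R_int ET(1) [OF n] by auto
   have i1: "integrable P (\<lambda>w. \<delta> * U n w + L * indicator (A n) w)"
    using EU(1) [OF n] iA by (intro Bochner_Integration.integrable_add integrable_mult_right)
   have i2: "integrable P (\<lambda>w. \<delta> * real n * W n w + 1 / (\<delta> * real n) * indicator (A n) w)"
    using EW(1) [OF n] iA by (intro Bochner_Integration.integrable_add integrable_mult_right)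
   have "expectation (R n) - (r0 + (c * card I / lam) / real n) = expectation (\<lambda>w. R n w - r0 - T n w)"
    using R_int ET [OF n] prob_space by simp
   also have "\<bar>...\<bar> \<le> expectation (\<lambda>w. \<bar>R n w - r0 - T n w\<bar>)"
    by (rule integral_abs_bound)
   also have "... \<le> expectation (\<lambda>w. (\<delta> * U n w + L * indicator (A n) w)
    + (\<delta> * real n * W n w + 1 / (\<delta> * real n) * indicator (A n) w))"
    by (intro integral_mono integrable_abs Bochner_Integration.integrable_add [OF i1 i2] i0 bound [OF n])
   also have "... = (\<delta> * (V / real n) + L * prob (A n)) + (\<delta> * real n * expectation (W n) + 1 / (\<delta> * real n) * prob (A n))"
    unfolding Bochner_Integration.integral_add [OF i1 i2] using EU [OF n] EW(1) [OF n] iA A(1)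
    by (simp add: Int_absorb2 sets.sets_into_space)
   also have "... \<le> (\<delta> * (V / real n) + L * prob (A n)) + (\<delta> * real n * (C / (real n)^2) + 1 / (\<delta> * real n) * prob (A n))"
    using EW(2) [OF n] \<delta> by (intro add_mono mult_left_mono order_refl) auto
   also have "... = ((\<delta> * V + \<delta> * C) + L * (real n * prob (A n)) + prob (A n) / \<delta>) * (1 / real n)"
    using n \<delta> by (simp add: field_simps power2_eq_square)
   finally show ?thesis .
  qed
  have pA: "(\<lambda>n. prob (A n)) \<longlonglongrightarrow> 0"
  proof (rule tendsto_sandwich [OF _ _ tendsto_const A(2)])
   show "\<forall>\<^sub>F n in sequentially. prob (A n) \<le> real n * prob (A n)"
    using eventually_ge_at_top [of 1]
    by eventually_elim (simp add: mult_right_mono [of 1 _ "prob _", simplified])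
  qed simp
  have "(\<lambda>n. L * (real n * prob (A n)) + prob (A n) / \<delta>) \<longlonglongrightarrow> L * 0 + 0 / \<delta>"
   using \<delta> by (intro tendsto_intros A(2) pA) auto
  hence "\<forall>\<^sub>F n in sequentially. L * (real n * prob (A n)) + prob (A n) / \<delta> < e / 3"
   using e by (intro order_tendstoD(2)) auto
  thus ?thesis
   using eventually_gt_at_top [of 0]
  proof eventually_elim
   case (elim n)
   have "(\<delta> * V + \<delta> * C) + L * (real n * prob (A n)) + prob (A n) / \<delta> \<le> e"
    using elim(1) \<delta>V e by linarith
   hence "((\<delta> * V + \<delta> * C) + L * (real n * prob (A n)) + prob (A n) / \<delta>) * (1 / real n) \<le> e * (1 / real n)"
    by (rule mult_right_mono) simp
   thus ?case using fin [OF elim(2)] by simp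
  qed
 qed
 have "(\<lambda>n. expectation (R n) - (r0 + (c * card I / lam) / real n)) \<in> o(\<lambda>n. 1 / real n)"
  by (rule landau_o.smallI) (use main in \<open>simp\<close>)
 thus ?thesis
  unfolding has_AE_def by blast
qed

end

type_synonym 'p par = "real \<times> (real^'p) \<times> (real^'p) \<times> (real^'p^'p)"

abbreviation par_rho :: "'p::finite par => real" where "par_rho t \<equiv> fst t"
abbreviation par_mu1 :: "'p::finite par => real^'p" where "par_mu1 t \<equiv> fst (snd t)"
abbreviation par_mu2 :: "'p::finite par => real^'p" where "par_mu2 t \<equiv> fst (snd (snd t))"
abbreviation par_K :: "'p::finite par => real^'p^'p" where "par_K t \<equiv> snd (snd (snd t))"

definition vjet :: "'e::euclidean_space => ('e => 'x::euclidean_space => real^'n) => ('x => 'e => real^'n) => bool" where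
 "vjet t F F' \<longleftrightarrow> (\<forall>i. jet t (\<lambda>s x. F s x $ i) (\<lambda>x h. F' x h $ i))"

lemma vjet_fixed:
 assumes "linear L"
 shows "vjet t (\<lambda>_ x. L x + c) (\<lambda>_ _. 0)"
 unfolding vjet_def
proof
 fix i
 have "linear (\<lambda>x. L x $ i)"
  using assms by (simp add: linear_iff)
 hence *: "bounded_linear (\<lambda>x. L x $ i)"
  by (rule linear_conv_bounded_linear [THEN iffD1])
 have "jet t (\<lambda>_ x. L x $ i + c $ i) (\<lambda>_ _. 0)"
  using borel_measurable_continuous_onI [OF linear_continuous_on [OF *]] poly_bounded_linear [OF *]
  by (intro jet_fixed poly_bounded_add borel_measurable_add) simp_all
 thus "jet t (\<lambda>_ x. (L x + c) $ i) (\<lambda>_ _. 0 $ i)"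
  by simp
qed

lemma vjet_param:
 assumes "linear L"
 shows "vjet t (\<lambda>s _. L s) (\<lambda>_ h. L h)"
 unfolding vjet_def
proof
 fix i
 have "linear (\<lambda>s. L s $ i)"
  using assms by (simp add: linear_iff)
 thus "jet t (\<lambda>s _. L s $ i) (\<lambda>_ h. L h $ i)"
  by (rule jet_param)
qed

lemma vjet_diff: "vjet t F F' ==> vjet t H H' ==> vjet t (\<lambda>s x. F s x - H s x) (\<lambda>x h. F' x h - H' x h)"
 by (simp add: vjet_def jet_diff)

lemma jet_bilinear:
 fixes K :: "'e::euclidean_space => real^'n^'n"
 assumes a: "vjet t a a'" and b: "vjet t b b'" and K: "linear K"
 shows "jet t (\<lambda>s x. a s x \<bullet> (K s *v b s x))
  (\<lambda>x h. a' x h \<bullet> (K t *v b t x) + a t x \<bullet> (K h *v b t x) + a t x \<bullet> (K t *v b' x h))"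
proof -
 have Kij: "jet t (\<lambda>s _. K s $ i $ j) (\<lambda>_ h. K h $ i $ j)" for i j
  by (rule jet_param) (use K in \<open>simp add: linear_iff\<close>)
 have "jet t (\<lambda>s x. \<Sum>i\<in>UNIV. \<Sum>j\<in>UNIV. a s x $ i * (K s $ i $ j * b s x $ j))
  (\<lambda>x h. \<Sum>i\<in>UNIV. \<Sum>j\<in>UNIV. a' x h $ i * (K t $ i $ j * b t x $ j)
   + a t x $ i * (K h $ i $ j * b t x $ j + K t $ i $ j * b' x h $ j))"
  using a b by (intro jet_sum jet_mult Kij) (auto simp: vjet_def)
 thus ?thesis
  by (rule jet_cong)
   (simp_all add: inner_vec_def matrix_vector_mult_def sum_distrib_left sum.distrib distrib_left add.assoc)
qed

definition score2 :: "'p::finite par => 'p par => real^'p => real" where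
 "score2 v t y = - (par_rho v * logistic (par_rho t)) + trace (par_K v)
   - (y - par_mu2 t) \<bullet> (par_K t *v (par_K v *v y - par_mu2 v))"

definition score_diff :: "'p::finite par => 'p par => real^'p => real" where
 "score_diff v t y = par_rho v - (y - par_mu1 t) \<bullet> (par_K t *v (par_K v *v y - par_mu1 v))
   + (y - par_mu2 t) \<bullet> (par_K t *v (par_K v *v y - par_mu2 v))"

definition log_odds :: "'p::finite par => real^'p => real" where
 "log_odds t y = par_rho t - ((y - par_mu1 t) \<bullet> (par_K t *v (y - par_mu1 t))) / 2
   + ((y - par_mu2 t) \<bullet> (par_K t *v (y - par_mu2 t))) / 2"

definition score_ig :: "'p::finite par => 'p par => 'p obs => real" where
 "score_ig v t x = score2 v t (fst x) + ((1 - snd (snd x)) * fst (snd x)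
   + snd (snd x) * logistic (log_odds t (fst x))) * score_diff v t (fst x)"

definition par0 :: "real => 'p => 'p::finite par" where
 "par0 D k = (0, class_mean D k 1, class_mean D k 0, mat 1)"

definition dlog_odds :: "real => 'p => real^'p => 'p::finite par => real" where
 "dlog_odds D k y h = par_rho h
   + par_mu1 h \<bullet> (y - class_mean D k 1) - ((y - class_mean D k 1) \<bullet> (par_K h *v (y - class_mean D k 1))) / 2
   - par_mu2 h \<bullet> (y - class_mean D k 0) + ((y - class_mean D k 0) \<bullet> (par_K h *v (y - class_mean D k 0))) / 2"

definition dscore2 :: "real => 'p => 'p::finite par => real^'p => 'p par => real" where
 "dscore2 D k v y h = - (par_rho v * par_rho h / 4) + par_mu2 h \<bullet> (par_K v *v y - par_mu2 v)
   - (y - class_mean D k 0) \<bullet> (par_K h *v (par_K v *v y - par_mu2 v))"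

definition dscore1 :: "real => 'p => 'p::finite par => real^'p => 'p par => real" where
 "dscore1 D k v y h = - (par_rho v * par_rho h / 4) + par_mu1 h \<bullet> (par_K v *v y - par_mu1 v)
   - (y - class_mean D k 1) \<bullet> (par_K h *v (par_K v *v y - par_mu1 v))"

definition dscore_ig :: "real => 'p => 'p::finite par => 'p obs => 'p par => real" where
 "dscore_ig D k v x h = dscore2 D k v (fst x) h
   + (snd (snd x) * (logistic (D * fst x $ k) * (1 - logistic (D * fst x $ k)) * dlog_odds D k (fst x) h)
     * score_diff v (par0 D k) (fst x)
    + ((1 - snd (snd x)) * fst (snd x) + snd (snd x) * logistic (D * fst x $ k))
     * (dscore1 D k v (fst x) h - dscore2 D k v (fst x) h))"

lemma par_linear [simp]: "linear (\<lambda>t::'p::finite par. par_rho t)" "linear (\<lambda>t::'p par. par_mu1 t)"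
 "linear (\<lambda>t::'p par. par_mu2 t)" "linear (\<lambda>t::'p par. par_K t)"
 by (simp_all add: linear_iff)

lemma log_odds_par0: "log_odds (par0 D k) y = D * y $ k"
proof -
 have "class_mean D k 0 = - class_mean D k 1" "class_mean D k 1 = axis k (D / 2)"
  by (auto simp: class_mean_def vec_eq_iff axis_def)
 thus ?thesis
  by (simp add: log_odds_def par0_def inner_diff_left inner_diff_right inner_axis inner_axis' inner_add_left
    inner_add_right field_simps inner_commute)
qed

lemma vjet_y: "vjet t (\<lambda>_ (x::'p::finite obs). fst x) (\<lambda>_ _. 0)"
 using vjet_fixed [of "\<lambda>x::'p obs. fst x" t 0] by (simp add: linear_fst)

lemma vjet_By: "vjet t (\<lambda>_ (x::'p::finite obs). B *v fst x - c) (\<lambda>_ _. 0)"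
proof -
 have "linear (\<lambda>x::'p obs. B *v fst x)"
  by (simp add: linear_iff matrix_vector_right_distrib matrix_vector_mult_scaleR)
 from vjet_fixed [OF this, of t "- c"] show ?thesis by simp
qed

lemma jet_log_odds:
 "jet (par0 D k) (\<lambda>t (x::'p::finite obs). log_odds t (fst x)) (\<lambda>x h. dlog_odds D k (fst x) h)"
proof -
 have q: "jet (par0 D k) (\<lambda>t (x::'p obs). ((fst x - \<mu> t) \<bullet> (par_K t *v (fst x - \<mu> t))))
   (\<lambda>x h. (0 - \<mu> h) \<bullet> (par_K (par0 D k) *v (fst x - \<mu> (par0 D k))) + (fst x - \<mu> (par0 D k)) \<bullet> (par_K h *v (fst x - \<mu> (par0 D k)))
    + (fst x - \<mu> (par0 D k)) \<bullet> (par_K (par0 D k) *v (0 - \<mu> h)))" if "linear \<mu>" for \<mu> :: "'p par => real^'p"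
  by (rule jet_bilinear [OF vjet_diff [OF vjet_y vjet_param [OF that]] vjet_diff [OF vjet_y vjet_param [OF that]] par_linear(4)])
 have "jet (par0 D k) (\<lambda>t (x::'p obs). par_rho t - (1/2) * ((fst x - par_mu1 t) \<bullet> (par_K t *v (fst x - par_mu1 t)))
   + (1/2) * ((fst x - par_mu2 t) \<bullet> (par_K t *v (fst x - par_mu2 t))))
  (\<lambda>x h. par_rho h - (1/2) * ((0 - par_mu1 h) \<bullet> (par_K (par0 D k) *v (fst x - par_mu1 (par0 D k)))
   + (fst x - par_mu1 (par0 D k)) \<bullet> (par_K h *v (fst x - par_mu1 (par0 D k)))
    + (fst x - par_mu1 (par0 D k)) \<bullet> (par_K (par0 D k) *v (0 - par_mu1 h)))
   + (1/2) * ((0 - par_mu2 h) \<bullet> (par_K (par0 D k) *v (fst x - par_mu2 (par0 D k)))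
   + (fst x - par_mu2 (par0 D k)) \<bullet> (par_K h *v (fst x - par_mu2 (par0 D k)))
    + (fst x - par_mu2 (par0 D k)) \<bullet> (par_K (par0 D k) *v (0 - par_mu2 h))))"
  by (intro jet_add jet_diff jet_cmult q jet_param par_linear)
 thus ?thesis
  by (rule jet_cong)
   (simp_all add: log_odds_def dlog_odds_def par0_def inner_commute field_simps)
qed

lemma jet_quad_score:
 fixes \<mu> :: "'p::finite par => real^'p"
 assumes "linear \<mu>"
 shows "jet (par0 D k) (\<lambda>t (x::'p obs). (fst x - \<mu> t) \<bullet> (par_K t *v (B *v fst x - c)))
  (\<lambda>x h. - (\<mu> h \<bullet> (B *v fst x - c)) + (fst x - \<mu> (par0 D k)) \<bullet> (par_K h *v (B *v fst x - c)))"
 by (rule jet_cong [OF jet_bilinear [OF vjet_diff [OF vjet_y vjet_param [OF assms]] vjet_By par_linear(4)]])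
  (simp_all add: par0_def)

lemma jet_score2:
 "jet (par0 D k) (\<lambda>t (x::'p::finite obs). score2 v t (fst x)) (\<lambda>x h. dscore2 D k v (fst x) h)"
proof -
 have "jet (par0 D k) (\<lambda>t (x::'p obs). - par_rho v * logistic (par_rho t) + trace (par_K v)
   - (fst x - par_mu2 t) \<bullet> (par_K t *v (par_K v *v fst x - par_mu2 v)))
  (\<lambda>x h. - par_rho v * (logistic (par_rho (par0 D k)) * (1 - logistic (par_rho (par0 D k))) * par_rho h) + 0
   - (- (par_mu2 h \<bullet> (par_K v *v fst x - par_mu2 v)) + (fst x - par_mu2 (par0 D k)) \<bullet> (par_K h *v (par_K v *v fst x - par_mu2 v))))"
  by (intro jet_add jet_diff jet_cmult jet_const jet_logistic jet_param jet_quad_score par_linear)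
 thus ?thesis
  by (rule jet_cong) (simp_all add: score2_def dscore2_def par0_def)
qed

lemma jet_score_diff:
 "jet (par0 D k) (\<lambda>t (x::'p::finite obs). score_diff v t (fst x))
   (\<lambda>x h. dscore1 D k v (fst x) h - dscore2 D k v (fst x) h)"
proof -
 have "jet (par0 D k) (\<lambda>t (x::'p obs). par_rho v - (fst x - par_mu1 t) \<bullet> (par_K t *v (par_K v *v fst x - par_mu1 v))
   + (fst x - par_mu2 t) \<bullet> (par_K t *v (par_K v *v fst x - par_mu2 v)))
  (\<lambda>x h. 0 - (- (par_mu1 h \<bullet> (par_K v *v fst x - par_mu1 v)) + (fst x - par_mu1 (par0 D k)) \<bullet> (par_K h *v (par_K v *v fst x - par_mu1 v)))
   + (- (par_mu2 h \<bullet> (par_K v *v fst x - par_mu2 v)) + (fst x - par_mu2 (par0 D k)) \<bullet> (par_K h *v (par_K v *v fst x - par_mu2 v))))"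
  by (intro jet_add jet_diff jet_const jet_quad_score par_linear)
 thus ?thesis
  by (rule jet_cong) (simp_all add: score_diff_def dscore1_def dscore2_def par0_def)
qed

lemma jet_obs_coord: "jet t (\<lambda>_ (x::'p::finite obs). fst (snd x)) (\<lambda>_ _. 0)"
 "jet t (\<lambda>_ (x::'p obs). snd (snd x)) (\<lambda>_ _. 0)"
proof -
 have "linear (\<lambda>x::'p obs. fst (snd x))" "linear (\<lambda>x::'p obs. snd (snd x))"
  by (simp_all add: linear_iff)
 hence "bounded_linear (\<lambda>x::'p obs. fst (snd x))" "bounded_linear (\<lambda>x::'p obs. snd (snd x))"
  by (blast intro: linear_conv_bounded_linear [THEN iffD1])+
 thus "jet t (\<lambda>_ (x::'p obs). fst (snd x)) (\<lambda>_ _. 0)" "jet t (\<lambda>_ (x::'p obs). snd (snd x)) (\<lambda>_ _. 0)"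
  by (auto intro!: jet_fixed poly_bounded_linear borel_measurable_continuous_onI linear_continuous_on)
qed

lemma jet_score_ig: "jet (par0 D k) (score_ig v) (dscore_ig D k v)"
proof -
 have "jet (par0 D k) (\<lambda>t x. score2 v t (fst x) + ((1 - snd (snd x)) * fst (snd x)
   + snd (snd x) * logistic (log_odds t (fst x))) * score_diff v t (fst x))
  (\<lambda>x h. dscore2 D k v (fst x) h + ((((0 - 0) * fst (snd x) + (1 - snd (snd x)) * 0)
   + (0 * logistic (log_odds (par0 D k) (fst x)) + snd (snd x) * (logistic (log_odds (par0 D k) (fst x)) * (1 - logistic (log_odds (par0 D k) (fst x))) * dlog_odds D k (fst x) h)))
     * score_diff v (par0 D k) (fst x)
    + ((1 - snd (snd x)) * fst (snd x) + snd (snd x) * logistic (log_odds (par0 D k) (fst x)))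
     * (dscore1 D k v (fst x) h - dscore2 D k v (fst x) h)))"
  by (intro jet_add jet_mult jet_diff jet_logistic jet_const jet_obs_coord jet_score2 jet_score_diff jet_log_odds)
 thus ?thesis
  by (rule jet_cong) (simp_all add: score_ig_def dscore_ig_def log_odds_par0)
qed

context canonical_law
begin

abbreviation "t0 \<equiv> par0 D k"
abbreviation "\<tau> y \<equiv> logistic (D * y $ k)"

lemma niceY_of_jet:
 fixes F :: "'e::euclidean_space => 'p obs => real"
 assumes "jet t F F'"
 shows "niceY (\<lambda>y. F t (y, s, m))" "niceY (\<lambda>y. F' (y, s, m) h)"
 using jet_nice [OF assms] poly_bounded_obs [of "F t"] measurable_obs [of "F t"]
  poly_bounded_obs [of "\<lambda>x. F' x h"] measurable_obs [of "\<lambda>x. F' x h"] by (auto simp: niceY_def nice_def)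

lemma niceY_intros:
 "niceY f ==> niceY g ==> niceY (\<lambda>y. f y + g y)"
 "niceY f ==> niceY g ==> niceY (\<lambda>y. f y - g y)"
 "niceY f ==> niceY g ==> niceY (\<lambda>y. f y * g y)"
 "niceY (\<lambda>y. c)" "niceY (\<lambda>y. y $ i)" "niceY (\<lambda>y. a \<bullet> y)"
 "niceY (\<lambda>y. q (y $ k))" "niceY (\<lambda>y. logistic (c * y $ k))"
proof -
 show "niceY (\<lambda>y. q (y $ k))" "niceY (\<lambda>y. logistic (c * y $ k))"
  using q q_le_1 by (auto simp: niceY_def intro!: poly_bounded_bounded [where C = 1])
qed (auto simp: niceY_def intro!: poly_bounded_add poly_bounded_diff poly_bounded_mult)

lemma integral_dscore_ig:
 "(LINT x|Q. dscore_ig D k v x h) =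
   - (par_rho v * par_rho h / 4 + trace (par_K h ** par_K v)
    + par_mu1 h \<bullet> (par_mu1 v - par_K v *v class_mean D k 1) / 2
    + par_mu2 h \<bullet> (par_mu2 v - par_K v *v class_mean D k 0) / 2)
   + EY (\<lambda>y. q (y $ k) * (\<tau> y * (1 - \<tau> y)) * (dlog_odds D k y h * score_diff v t0 y))"
proof -
 have n1: "niceY (\<lambda>y. dscore1 D k v y h)" and n2: "niceY (\<lambda>y. dscore2 D k v y h)"
 proof -
  have 1: "niceY (\<lambda>y. dscore1 D k v y h - dscore2 D k v y h)" "niceY (\<lambda>y. dscore2 D k v y h)"
   using niceY_of_jet(2) [OF jet_score_diff [of D k v], where h = h] niceY_of_jet(2) [OF jet_score2 [of D k v], where h = h]
   by simp_all
  note 2 = niceY_intros(1) [OF 1] 1(2)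
  thus "niceY (\<lambda>y. dscore1 D k v y h)" "niceY (\<lambda>y. dscore2 D k v y h)" using 2 by simp_all
 qed
 have nd: "niceY (\<lambda>y. dlog_odds D k y h)" and ns: "niceY (\<lambda>y. score_diff v t0 y)"
  using niceY_of_jet(2) [OF jet_log_odds [of D k], where h = h] niceY_of_jet(1) [OF jet_score_diff [of D k v]] by simp_all
 have cls: "(LINT y|iso_normal m. - (a / 4) + u \<bullet> (B *v y - c) - (y - m) \<bullet> (A *v (B *v y - c)))
   = - (a / 4) + u \<bullet> (B *v m - c) - trace (A ** B)" for a u B A c and m :: "real^'p"
 proof -
  have e: "- (a / 4) + u \<bullet> (B *v y - c) - (y - m) \<bullet> (A *v (B *v y - c))
   = (- (a / 4) + u \<bullet> (B *v m - c)) + (y - m) \<bullet> (transpose B *v u - A *v (B *v m - c)) - (y - m) \<bullet> ((A ** B) *v (y - m))" for y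
  proof -
   have "B *v y - c = B *v (y - m) + (B *v m - c)"
    by (simp add: matrix_vector_mult_diff_distrib)
   thus ?thesis
    by (simp add: inner_add_right inner_diff_right matrix_vector_right_distrib matrix_vector_mul_assoc [symmetric]
      matrix_vector_mult_diff_distrib inner_matrix_vector [of B] inner_commute [of u] algebra_simps
      del: transpose_matrix_vector)
  qed
  have i1: "integrable (iso_normal m) (\<lambda>y. (y - m) \<bullet> z)" for z
   by (rule integrable_iso_normal) (auto simp: inner_diff_left intro!: poly_bounded_intros)
  have i2: "integrable (iso_normal m) (\<lambda>y. (y - m) \<bullet> ((A ** B) *v (y - m)))"
   by (rule integrable_iso_normal)
    (auto simp: inner_vec_def matrix_vector_mult_def intro!: poly_bounded_intros)
  interpret N: prob_space "iso_normal m" by (rule prob_space_iso_normal)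
  have gen: "(LINT y|iso_normal m. w + f y - g y) = w + (LINT y|iso_normal m. f y) - (LINT y|iso_normal m. g y)"
   if "integrable (iso_normal m) f" "integrable (iso_normal m) g" for f g :: "real^'p => real" and w
   using that N.prob_space by simp
  show ?thesis
   unfolding e gen [OF i1 i2] iso_normal_moments by (simp add: trace_def)
 qed
 have nice: "nice (\<lambda>x. dscore_ig D k v x h)"
  by (rule jet_nice(2) [OF jet_score_ig])
 have "(LINT x|Q. dscore_ig D k v x h) = EY (\<lambda>y. (\<tau> y * dscore1 D k v y h + (1 - \<tau> y) * dscore2 D k v y h)
   + q (y $ k) * (\<tau> y * (1 - \<tau> y)) * (dlog_odds D k y h * score_diff v t0 y))"
  unfolding integral_Q_EY [OF nice] unfolding obs_given_y_def dscore_ig_def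
  by (rule arg_cong [of _ _ EY]) (simp add: fun_eq_iff algebra_simps)
 also have "... = EY (\<lambda>y. \<tau> y * dscore1 D k v y h) + EY (\<lambda>y. (1 - \<tau> y) * dscore2 D k v y h)
   + EY (\<lambda>y. q (y $ k) * (\<tau> y * (1 - \<tau> y)) * (dlog_odds D k y h * score_diff v t0 y))"
  using n1 n2 nd ns by (subst EY_add EY_add, auto intro!: niceY_intros)+
 also have "EY (\<lambda>y. \<tau> y * dscore1 D k v y h) = (- (par_rho v * par_rho h / 4) + par_mu1 h \<bullet> (par_K v *v class_mean D k 1 - par_mu1 v)
   - trace (par_K h ** par_K v)) / 2"
  unfolding tower(1) [OF n1, symmetric] unfolding dscore1_def cls ..
 also have "EY (\<lambda>y. (1 - \<tau> y) * dscore2 D k v y h) = (- (par_rho v * par_rho h / 4) + par_mu2 h \<bullet> (par_K v *v class_mean D k 0 - par_mu2 v)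
   - trace (par_K h ** par_K v)) / 2"
  unfolding tower(2) [OF n2, symmetric] unfolding dscore2_def cls ..
 finally show ?thesis
  by (simp add: inner_diff_right field_simps)
qed

end

lemma normal1_poly2:
 "(LINT t|normal1 m. (a + b * (t - m) + c * ((t - m)^2 - 1))^2) = a^2 + b^2 + 2 * c^2"
proof -
 interpret N: prob_space "normal1 m" by (rule prob_space_normal1)
 have i: "integrable (normal1 m) (\<lambda>t. (t - m) ^ j)" for j
  by (rule integrable_normal1) (auto intro!: poly_bounded_intros)
 have e: "(a + b * (t - m) + c * ((t - m)^2 - 1))^2
   = (a - c)^2 + 2 * (a - c) * b * (t - m) ^ 1 + (b^2 + 2 * (a - c) * c) * (t - m) ^ 2
    + 2 * b * c * (t - m) ^ 3 + c^2 * (t - m) ^ 4" for t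
  by (simp add: power2_eq_square power3_eq_cube power4_eq_xxxx algebra_simps)
 have gen: "(LINT t|normal1 m. w + b1 * f1 t + b2 * f2 t + b3 * f3 t + b4 * f4 t)
   = w + b1 * (LINT t|normal1 m. f1 t) + b2 * (LINT t|normal1 m. f2 t)
    + b3 * (LINT t|normal1 m. f3 t) + b4 * (LINT t|normal1 m. f4 t)"
  if "integrable (normal1 m) f1" "integrable (normal1 m) f2" "integrable (normal1 m) f3" "integrable (normal1 m) f4"
  for w b1 b2 b3 b4 :: real and f1 f2 f3 f4 :: "real => real"
  using that N.prob_space by simp
 have "(LINT t|normal1 m. (a + b * (t - m) + c * ((t - m)^2 - 1))^2)
   = (a - c)^2 + 2 * (a - c) * b * (LINT t|normal1 m. (t - m) ^ 1) + (b^2 + 2 * (a - c) * c) * (LINT t|normal1 m. (t - m) ^ 2)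
    + 2 * b * c * (LINT t|normal1 m. (t - m) ^ 3) + c^2 * (LINT t|normal1 m. (t - m) ^ 4)"
  unfolding e by (rule gen) (rule i)+
 thus ?thesis
  using normal1_moments [of m] by (simp add: power2_eq_square algebra_simps)
qed

definition dcoef0 :: "real => 'p => 'p::finite par => real" where
 "dcoef0 D k h = par_rho h - D / 2 * (par_mu1 h $ k + par_mu2 h $ k)"

definition dcoef1 :: "real => 'p => 'p::finite par => real^'p" where
 "dcoef1 D k h = par_mu1 h - par_mu2 h + D *\<^sub>R (par_K h *v axis k 1)"

definition eff_dir :: "real => 'p => real => real^'p => 'p::finite par" where
 "eff_dir D k x0 x = (let \<kappa> = D / (4 + D^2) in
   (4 * x0 / (4 + D^2), (2 / (4 + D^2)) *\<^sub>R x - axis k (\<kappa> * x0), - ((2 / (4 + D^2)) *\<^sub>R x) - axis k (\<kappa> * x0),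
   (\<chi> i j. if i = k then \<kappa> * x $ j else 0)))"

definition tilt_dir :: "real => 'p => 'p::finite par => 'p par" where
 "tilt_dir D k h = (par_rho h, par_mu1 h + (1 / 2) *\<^sub>R (par_K h *v class_mean D k 1),
   par_mu2 h + (1 / 2) *\<^sub>R (par_K h *v class_mean D k 0), (1 / 2) *\<^sub>R par_K h)"

lemma class_mean_axis: "class_mean D k 1 = (D / 2) *\<^sub>R axis k 1" "class_mean D k 0 = - ((D / 2) *\<^sub>R axis k 1)"
 by (auto simp: class_mean_def vec_eq_iff axis_def)

lemma matrix_vector_mult_uminus: "A *v (- x) = - ((A :: real^'n^'m) *v x)"
 by (simp add: vec_eq_iff matrix_vector_mult_def sum_negf)

lemma scaleR_matrix_vector: "(c *\<^sub>R (A :: real^'n^'m)) *v x = c *\<^sub>R (A *v x)"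
 by (simp add: vec_eq_iff matrix_vector_mult_def sum_distrib_left mult.assoc)

lemma inner_symmetric_matrix: "transpose A = A ==> x \<bullet> ((A :: real^'n^'n) *v y) = y \<bullet> (A *v x)"
 by (metis inner_commute inner_matrix_vector)

lemma dlog_odds_symmetric:
 assumes "transpose (par_K h) = par_K h"
 shows "dlog_odds D k y h = dcoef0 D k h + dcoef1 D k h \<bullet> y"
 using inner_symmetric_matrix [OF assms, of y "axis k 1"]
 unfolding dlog_odds_def dcoef0_def dcoef1_def class_mean_axis
 by (simp add: inner_diff_left inner_diff_right inner_add_left inner_add_right inner_axis
   matrix_vector_mult_diff_distrib matrix_vector_right_distrib matrix_vector_mult_scaleR field_simps
   inner_commute [of _ y])

lemma score_diff_tilt_dir:
 assumes h: "transpose (par_K h) = par_K h"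
 shows "score_diff (tilt_dir D k h) (par0 D k) y = dcoef0 D k h + dcoef1 D k h \<bullet> y"
 using inner_symmetric_matrix [OF h, of y "axis k 1"]
 unfolding score_diff_def par0_def tilt_dir_def dcoef0_def dcoef1_def class_mean_axis
 by (simp add: inner_diff_left inner_diff_right inner_add_left inner_add_right inner_axis inner_axis' scaleR_matrix_vector
  matrix_vector_mult_diff_distrib matrix_vector_right_distrib matrix_vector_mult_scaleR matrix_vector_mult_uminus
  inner_commute [of _ y], simp add: field_simps)

lemma score_diff_eff_dir:
 assumes "x $ k = 0" and D: "0 < D"
 shows "score_diff (eff_dir D k x0 x) (par0 D k) y = x0 + x \<bullet> y"
  and "score2 (eff_dir D k x0 x) (par0 D k) y = - (x0 + x \<bullet> y) * (1 / 2 + D / (4 + D^2) * y $ k)"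
proof -
 define \<kappa> where "\<kappa> = D / (4 + D^2)"
 have D4: "4 + D^2 > 0" by (simp add: add_pos_nonneg)
 have B: "(\<chi> i j. if i = k then \<kappa> * x $ j else 0) *v y = (\<kappa> * (x \<bullet> y)) *\<^sub>R axis k 1"
  by (simp add: vec_eq_iff matrix_vector_mult_def axis_def inner_vec_def sum_distrib_left mult.assoc)
 have ax: "axis k (\<kappa> * x0) = (\<kappa> * x0) *\<^sub>R (axis k 1 :: real^'a)"
  by (simp add: vec_eq_iff axis_def)
 have xk: "x \<bullet> axis k 1 = 0" "axis k 1 \<bullet> x = 0"
  using assms(1) by (simp_all add: inner_axis inner_axis')
 have kk: "axis k 1 \<bullet> (axis k 1 :: real^'a) = 1"
  by (simp add: inner_axis_axis)
 have yk: "y \<bullet> axis k 1 = y $ k"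
  by (simp add: inner_axis)
 have tr: "trace (\<chi> i j. if i = k then \<kappa> * x $ j else 0) = 0"
  using assms(1) by (simp add: trace_def if_distrib cong: if_cong)
 define l where "l = 1 / (4 + D^2)"
 have l: "l * (4 + D^2) = 1" "\<kappa> = D * l" using D4 by (simp_all add: l_def \<kappa>_def)
 have l4: "4 * l = 1 - D * \<kappa>" using l(1) by (simp add: l(2) power2_eq_square algebra_simps)
 have fold: "4 * x0 / (4 + D^2) = 4 * l * x0" "2 / (4 + D^2) = 2 * l"
  by (simp_all add: l_def)
 show "score_diff (eff_dir D k x0 x) (par0 D k) y = x0 + x \<bullet> y"
 proof -
  have "score_diff (eff_dir D k x0 x) (par0 D k) y = 4 * l * x0 + D * \<kappa> * x0 + (4 * l + D * \<kappa>) * (x \<bullet> y)"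
   unfolding score_diff_def par0_def eff_dir_def Let_def class_mean_axis \<kappa>_def [symmetric] fold
   by (simp add: B ax inner_diff_left inner_diff_right inner_add_left inner_add_right xk kk yk
     algebra_simps inner_commute [of y x])
  also have "... = x0 + x \<bullet> y"
   unfolding l4 by (simp add: algebra_simps)
  finally show ?thesis .
 qed
 show "score2 (eff_dir D k x0 x) (par0 D k) y = - (x0 + x \<bullet> y) * (1 / 2 + D / (4 + D^2) * y $ k)"
 proof -
  have "score2 (eff_dir D k x0 x) (par0 D k) y = - (x0 + x \<bullet> y) * ((4 * l + D * \<kappa>) / 2 + \<kappa> * y $ k)"
   unfolding score2_def par0_def eff_dir_def Let_def class_mean_axis \<kappa>_def [symmetric] fold
   by (simp add: B ax tr inner_diff_left inner_diff_right inner_add_left inner_add_right xk kk yk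
     algebra_simps inner_commute [of y x])
  also have "... = - (x0 + x \<bullet> y) * (1 / 2 + \<kappa> * y $ k)"
   unfolding l4 by simp
  finally show ?thesis by (simp add: \<kappa>_def)
 qed
qed

lemma quadratic_par_lower_bound:
 fixes h :: "'p::finite par"
 assumes sym: "transpose (par_K h) = par_K h" and D: "0 < D"
 shows "((dcoef0 D k h)^2 + (norm (dcoef1 D k h - axis k (dcoef1 D k h $ k)))^2) / (4 + D^2) + (dcoef1 D k h $ k)^2 / (4 + 2 * D^2)
  \<le> (par_rho h)^2 / 4 + (norm (par_K h))^2 / 2 + (norm (par_mu1 h))^2 / 2 + (norm (par_mu2 h))^2 / 2"
proof -
 define K where "K = par_K h"
 define a where "a i = (par_mu1 h $ i + par_mu2 h $ i) / 2" for i
 define b where "b i = (par_mu1 h $ i - par_mu2 h $ i) / 2" for i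
 have D4: "4 + D^2 > 0" "4 + 2 * D^2 > 0" by (simp_all add: add_pos_nonneg)
 have Ks: "K $ i $ j = K $ j $ i" for i j
  using arg_cong [OF sym, of "\<lambda>A. A $ j $ i"] by (simp add: transpose_def K_def)
 have c1: "dcoef1 D k h $ i = 2 * b i + D * K $ i $ k" for i
  by (simp add: dcoef1_def b_def K_def matrix_vector_mult_basis column_def)
 have c0: "dcoef0 D k h = par_rho h - D * a k"
  by (simp add: dcoef0_def a_def)
 have "(dcoef0 D k h)^2 \<le> (4 + D^2) * ((par_rho h)^2 / 4 + (a k)^2)"
 proof -
  have "(4 + D^2) * ((par_rho h)^2 / 4 + (a k)^2) - (dcoef0 D k h)^2 = (D * par_rho h / 2 + 2 * a k)^2"
   by (simp add: c0 power2_eq_square field_simps)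
  thus ?thesis using zero_le_power2 [of "D * par_rho h / 2 + 2 * a k"] by linarith
 qed
 hence 0: "(dcoef0 D k h)^2 / (4 + D^2) \<le> (par_rho h)^2 / 4 + (a k)^2"
  using D4(1) by (simp add: pos_divide_le_eq mult.commute)
 have "(dcoef1 D k h $ k)^2 \<le> (4 + 2 * D^2) * ((b k)^2 + (K $ k $ k)^2 / 2)"
 proof -
  have "(4 + 2 * D^2) * ((b k)^2 + (K $ k $ k)^2 / 2) - (dcoef1 D k h $ k)^2 = 2 * (D * b k - K $ k $ k)^2"
   by (simp add: c1 power2_eq_square field_simps)
  thus ?thesis using zero_le_power2 [of "D * b k - K $ k $ k"] by linarith
 qed
 hence 1: "(dcoef1 D k h $ k)^2 / (4 + 2 * D^2) \<le> (b k)^2 + (K $ k $ k)^2 / 2"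
  using D4(2) by (simp add: pos_divide_le_eq mult.commute)
 have "(dcoef1 D k h $ i)^2 \<le> (4 + D^2) * ((b i)^2 + (K $ i $ k)^2)" for i
 proof -
  have "(4 + D^2) * ((b i)^2 + (K $ i $ k)^2) - (dcoef1 D k h $ i)^2 = (D * b i - 2 * K $ i $ k)^2"
   by (simp add: c1 power2_eq_square field_simps)
  thus ?thesis using zero_le_power2 [of "D * b i - 2 * K $ i $ k"] by linarith
 qed
 hence "(dcoef1 D k h $ i)^2 / (4 + D^2) \<le> (b i)^2 + (K $ i $ k)^2" for i
  using D4(1) by (simp add: pos_divide_le_eq mult.commute)
 hence "(\<Sum>i\<in>UNIV - {k}. (dcoef1 D k h $ i)^2 / (4 + D^2)) \<le> (\<Sum>i\<in>UNIV - {k}. (b i)^2 + (K $ i $ k)^2)"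
  by (rule sum_mono)
 moreover have "(norm (dcoef1 D k h - axis k (dcoef1 D k h $ k)))^2 = (\<Sum>i\<in>UNIV - {k}. (dcoef1 D k h $ i)^2)"
  unfolding power2_norm_eq_inner inner_vec_def
  by (subst sum.remove [of UNIV k]) (auto intro!: sum.cong simp: axis_def power2_eq_square)
 ultimately have 2: "(norm (dcoef1 D k h - axis k (dcoef1 D k h $ k)))^2 / (4 + D^2)
   \<le> (\<Sum>i\<in>UNIV - {k}. (b i)^2) + (\<Sum>i\<in>UNIV - {k}. (K $ i $ k)^2)"
  by (simp add: sum_divide_distrib sum.distrib)
 have "(norm (par_mu1 h))^2 / 2 + (norm (par_mu2 h))^2 / 2 = (\<Sum>i\<in>UNIV. (a i)^2 + (b i)^2)"
  unfolding power2_norm_eq_inner inner_vec_def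
 proof -
  have "(a i)^2 + (b i)^2 = par_mu1 h $ i * par_mu1 h $ i / 2 + par_mu2 h $ i * par_mu2 h $ i / 2" for i
   by (simp add: a_def b_def power2_eq_square field_simps)
  thus "(\<Sum>i\<in>UNIV. par_mu1 h $ i \<bullet> par_mu1 h $ i) / 2 + (\<Sum>i\<in>UNIV. par_mu2 h $ i \<bullet> par_mu2 h $ i) / 2
    = (\<Sum>i\<in>UNIV. (a i)^2 + (b i)^2)"
   by (simp add: sum_divide_distrib sum.distrib)
 qed
 also have "... \<ge> (a k)\<^sup>2 + ((b k)^2 + (\<Sum>i\<in>UNIV - {k}. (b i)^2))"
  by (simp add: sum.distrib sum.remove [of UNIV k] sum_nonneg)
 finally have 3: "(a k)^2 + ((b k)^2 + (\<Sum>i\<in>UNIV - {k}. (b i)^2)) \<le> (norm (par_mu1 h))^2 / 2 + (norm (par_mu2 h))^2 / 2" .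
 have "(norm K)^2 = (\<Sum>i\<in>UNIV. \<Sum>j\<in>UNIV. (K $ i $ j)^2)"
  unfolding power2_norm_eq_inner inner_vec_def by (simp add: power2_eq_square)
 also have "... = (\<Sum>j\<in>UNIV. (K $ k $ j)^2) + (\<Sum>i\<in>UNIV - {k}. \<Sum>j\<in>UNIV. (K $ i $ j)^2)"
  by (simp add: sum.remove [of UNIV k])
 also have "... \<ge> ((K $ k $ k)^2 + (\<Sum>j\<in>UNIV - {k}. (K $ j $ k)^2)) + (\<Sum>i\<in>UNIV - {k}. (K $ i $ k)^2)"
 proof (rule add_mono)
  show "(K $ k $ k)^2 + (\<Sum>j\<in>UNIV - {k}. (K $ j $ k)^2) \<le> (\<Sum>j\<in>UNIV. (K $ k $ j)^2)"
  proof -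
   have "(\<Sum>j\<in>UNIV. (K $ k $ j)^2) = (K $ k $ k)^2 + (\<Sum>j\<in>UNIV - {k}. (K $ k $ j)^2)"
    by (simp add: sum.remove [of UNIV k])
   also have "(\<Sum>j\<in>UNIV - {k}. (K $ k $ j)^2) = (\<Sum>j\<in>UNIV - {k}. (K $ j $ k)^2)"
    by (intro sum.cong refl) (metis Ks)
   finally show ?thesis by simp
  qed
  show "(\<Sum>i\<in>UNIV - {k}. (K $ i $ k)^2) \<le> (\<Sum>i\<in>UNIV - {k}. \<Sum>j\<in>UNIV. (K $ i $ j)^2)"
  proof (rule sum_mono)
   fix i show "(K $ i $ k)^2 \<le> (\<Sum>j\<in>UNIV. (K $ i $ j)^2)"
    using member_le_sum [of k UNIV "\<lambda>j. (K $ i $ j)^2"] by simp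
  qed
 qed
 finally have 4: "(K $ k $ k)^2 / 2 + (\<Sum>i\<in>UNIV - {k}. (K $ i $ k)^2) \<le> (norm (par_K h))^2 / 2"
  by (simp add: K_def)
 show ?thesis
  using 0 1 2 3 4 by (simp add: add_divide_distrib)
qed

context canonical_law
begin

lemma D4: "4 + D^2 > 0" "4 + 2 * D^2 > 0"
 by (simp_all add: add_pos_nonneg)

lemma nice1_intros:
 "nice1 f ==> nice1 g ==> nice1 (\<lambda>y. f y + g y)"
 "nice1 f ==> nice1 g ==> nice1 (\<lambda>y. f y - g y)"
 "nice1 f ==> nice1 g ==> nice1 (\<lambda>y. f y * g y)"
 "nice1 f ==> nice1 (\<lambda>y. f y ^ j)"
 "nice1 (\<lambda>y. c)" "nice1 (\<lambda>y. y)" "nice1 q" "nice1 (\<lambda>y. logistic (c * y))"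
proof -
 show "nice1 q" "nice1 (\<lambda>y. logistic (c * y))"
  using q q_le_1 by (auto simp: nice1_def intro!: poly_bounded_bounded [where C = 1])
qed (auto simp: nice1_def intro!: poly_bounded_add poly_bounded_diff poly_bounded_mult poly_bounded_power)

lemma niceY_coord: "nice1 \<phi> ==> niceY (\<lambda>y. \<phi> (y $ k))"
 by (auto simp: nice1_def niceY_def intro!: poly_bounded_compose [of \<phi>] poly_bounded_abs)

lemma EY_affine_product:
 assumes \<phi>: "nice1 \<phi>" and even: "\<And>t. \<phi> (- t) = \<phi> t" and x: "x $ k = 0"
 shows "EY (\<lambda>y. \<phi> (y $ k) * ((x0 + x \<bullet> y) * (w0 + w \<bullet> y))) = (x0 * w0 + x \<bullet> w) * ey \<phi>"
proof -
 define z where "z = w - axis k (w $ k)"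
 have z: "z $ k = 0" by (simp add: z_def)
 have w: "w \<bullet> y = w $ k * y $ k + z \<bullet> y" for y
  by (simp add: z_def inner_diff_left inner_axis')
 have xw: "x \<bullet> w = x \<bullet> z"
  using x by (simp add: z_def inner_diff_right inner_axis)
 have n: "niceY (\<lambda>y. \<phi> (y $ k))" by (rule niceY_coord [OF \<phi>])
 have e: "\<phi> (y $ k) * ((x0 + x \<bullet> y) * (w0 + w \<bullet> y))
   = (x0 * w0 * \<phi> (y $ k) + x0 * w $ k * (\<phi> (y $ k) * y $ k)) + (x0 * (\<phi> (y $ k) * (z \<bullet> y)) + w0 * (\<phi> (y $ k) * (x \<bullet> y)))
   + (\<phi> (y $ k) * ((x \<bullet> y) * (w \<bullet> y)))" for y
  by (simp add: w algebra_simps)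
 have odd: "EY (\<lambda>y. \<phi> (y $ k) * y $ k) = 0"
  using EY_coord [of "\<lambda>t. \<phi> t * t"] ey_odd [of "\<lambda>t. \<phi> t * t"] even \<phi> by (simp add: nice1_intros)
 have nn: "niceY (\<lambda>y. x0 * w0 * \<phi> (y $ k))" "niceY (\<lambda>y. x0 * w $ k * (\<phi> (y $ k) * y $ k))"
  "niceY (\<lambda>y. x0 * (\<phi> (y $ k) * (z \<bullet> y)))" "niceY (\<lambda>y. w0 * (\<phi> (y $ k) * (x \<bullet> y)))"
  "niceY (\<lambda>y. \<phi> (y $ k) * ((x \<bullet> y) * (w \<bullet> y)))"
  by (intro niceY_intros n)+
 have "EY (\<lambda>y. \<phi> (y $ k) * ((x0 + x \<bullet> y) * (w0 + w \<bullet> y)))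
   = (x0 * w0 * ey \<phi> + x0 * w $ k * 0) + (x0 * 0 + w0 * 0) + (x \<bullet> w) * ey \<phi>"
  unfolding e
  by (simp only: EY_add nn niceY_intros(1))
   (simp only: EY_cmult EY_orthogonal(1) [OF \<phi> x] EY_orthogonal(1) [OF \<phi> z] EY_orthogonal(2) [OF \<phi> x] odd EY_coord [OF \<phi>])
 thus ?thesis by (simp add: algebra_simps)
qed

lemma EY_affine_square:
 assumes \<phi>: "nice1 \<phi>" and even: "\<And>t. \<phi> (- t) = \<phi> t"
 shows "EY (\<lambda>y. \<phi> (y $ k) * (w0 + w \<bullet> y)^2)
  = (w0^2 + (norm (w - axis k (w $ k)))^2) * ey \<phi> + (w $ k)^2 * ey (\<lambda>t. \<phi> t * t^2)"
proof -
 define z where "z = w - axis k (w $ k)"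
 have z: "z $ k = 0" by (simp add: z_def)
 have w: "w \<bullet> y = w $ k * y $ k + z \<bullet> y" for y
  by (simp add: z_def inner_diff_left inner_axis')
 have \<phi>2: "nice1 (\<lambda>t. \<phi> t * t^2)" "nice1 (\<lambda>t. \<phi> t * t)"
  by (intro nice1_intros \<phi>)+
 have n: "niceY (\<lambda>y. \<phi> (y $ k))" by (rule niceY_coord [OF \<phi>])
 have e: "\<phi> (y $ k) * (w0 + w \<bullet> y)^2 = \<phi> (y $ k) * ((w0 + z \<bullet> y) * (w0 + z \<bullet> y))
   + ((2 * w $ k) * ((\<phi> (y $ k) * y $ k) * (z \<bullet> y)) + ((2 * w0 * w $ k) * (\<phi> (y $ k) * y $ k)
    + (w $ k)^2 * (\<phi> (y $ k) * (y $ k)^2)))" for y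
  by (simp add: w power2_eq_square algebra_simps)
 have sq: "EY (\<lambda>y. \<phi> (y $ k) * ((w0 + z \<bullet> y) * (w0 + z \<bullet> y))) = (w0 * w0 + z \<bullet> z) * ey \<phi>"
  by (rule EY_affine_product [OF \<phi> even z])
 have odd: "EY (\<lambda>y. \<phi> (y $ k) * y $ k) = 0"
  using EY_coord [of "\<lambda>t. \<phi> t * t"] ey_odd [of "\<lambda>t. \<phi> t * t"] even \<phi> by (simp add: nice1_intros)
 have nn: "niceY (\<lambda>y. \<phi> (y $ k) * ((w0 + z \<bullet> y) * (w0 + z \<bullet> y)))" "niceY (\<lambda>y. (\<phi> (y $ k) * y $ k) * (z \<bullet> y))"
  "niceY (\<lambda>y. \<phi> (y $ k) * y $ k)" "niceY (\<lambda>y. \<phi> (y $ k) * (y $ k)^2)"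
  "niceY (\<lambda>y. (2 * w $ k) * ((\<phi> (y $ k) * y $ k) * (z \<bullet> y)))" "niceY (\<lambda>y. (2 * w0 * w $ k) * (\<phi> (y $ k) * y $ k))"
  "niceY (\<lambda>y. (w $ k)^2 * (\<phi> (y $ k) * (y $ k)^2))"
  unfolding power2_eq_square by (intro niceY_intros n)+
 have "EY (\<lambda>y. \<phi> (y $ k) * (w0 + w \<bullet> y)^2) = (w0 * w0 + z \<bullet> z) * ey \<phi> + (2 * w $ k * 0 + (2 * w0 * w $ k * 0
   + (w $ k)^2 * ey (\<lambda>t. \<phi> t * t^2)))"
  unfolding e
  by (subst EY_add [OF nn(1) niceY_intros(1) [OF nn(5) niceY_intros(1) [OF nn(6,7)]]],
    subst EY_add [OF nn(5) niceY_intros(1) [OF nn(6,7)]], subst EY_add [OF nn(6,7)])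
   (simp only: EY_cmult sq odd EY_orthogonal(1) [OF \<phi>2(2) z] EY_coord [OF \<phi>2(1)])
 thus ?thesis
  unfolding z_def [symmetric] power2_norm_eq_inner by (simp add: power2_eq_square)
qed

definition var1 :: "real => real" where
 "var1 t = logistic (D * t) * (1 - logistic (D * t))"

lemma var1: "nice1 var1" "var1 (- t) = var1 t" "0 < var1 t"
proof -
 show "nice1 var1" unfolding var1_def [abs_def] by (intro nice1_intros)
 show "var1 (- t) = var1 t"
  using logistic_minus [of "D * t"] by (simp add: var1_def)
qed (simp add: var1_def)

lemma tower1:
 assumes "nice1 \<phi>"
 shows "(LINT t|normal1 (D / 2). \<phi> t) / 2 = ey (\<lambda>t. logistic (D * t) * \<phi> t)"
  and "(LINT t|normal1 (- D / 2). \<phi> t) / 2 = ey (\<lambda>t. (1 - logistic (D * t)) * \<phi> t)"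
proof -
 have c: "(LINT y|iso_normal (class_mean D k s). \<phi> (y $ k)) = (LINT t|normal1 (class_mean D k s $ k). \<phi> t)" for s
  using integral_iso_normal_coords(1) [of \<phi> "\<lambda>_. 0" "\<lambda>_. 0"] assms by (simp add: nice1_def)
 have n: "nice1 (\<lambda>t. logistic (D * t) * \<phi> t)" "nice1 (\<lambda>t. (1 - logistic (D * t)) * \<phi> t)"
  by (intro nice1_intros assms)+
 show "(LINT t|normal1 (D / 2). \<phi> t) / 2 = ey (\<lambda>t. logistic (D * t) * \<phi> t)"
  using tower(1) [OF niceY_coord [OF assms]] EY_coord [OF n(1)] by (simp add: c)
 show "(LINT t|normal1 (- D / 2). \<phi> t) / 2 = ey (\<lambda>t. (1 - logistic (D * t)) * \<phi> t)"
  using tower(2) [OF niceY_coord [OF assms]] EY_coord [OF n(2)] by (simp add: c)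
qed

lemma ey_variance_split:
 assumes A: "nice1 A" and w: "nice1 w"
 shows "(LINT t|normal1 (D / 2). (A t + w t)^2) / 2 + (LINT t|normal1 (- D / 2). (A t)^2) / 2
  = ey (\<lambda>t. var1 t * (w t)^2) + ey (\<lambda>t. (A t + logistic (D * t) * w t)^2)"
proof -
 have n: "nice1 (\<lambda>t. (A t + w t)^2)" "nice1 (\<lambda>t. (A t)^2)"
  "nice1 (\<lambda>t. logistic (D * t) * (A t + w t)^2)" "nice1 (\<lambda>t. (1 - logistic (D * t)) * (A t)^2)"
  "nice1 (\<lambda>t. var1 t * (w t)^2)" "nice1 (\<lambda>t. (A t + logistic (D * t) * w t)^2)"
  by (intro nice1_intros A w var1(1))+
 show ?thesis
  unfolding tower1(1) [OF n(1)] tower1(2) [OF n(2)] ey_add [OF n(3,4), symmetric] ey_add [OF n(5,6), symmetric]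
  by (rule arg_cong [of _ _ ey]) (simp add: fun_eq_iff var1_def power2_eq_square algebra_simps)
qed

lemma ey_var1_le: "ey var1 \<le> 1 / (4 + D^2)" "ey (\<lambda>t. var1 t * t^2) \<le> 1 / (4 + 2 * D^2)"
proof -
 define l where "l = 1 / (4 + D^2)"
 have l: "l * (4 + D^2) = 1" using D4 by (simp add: l_def)
 have l4: "4 * l = 1 - D * D * l" using l by (simp add: power2_eq_square algebra_simps)
 have nA: "nice1 (\<lambda>t. - 1 / 2 - D * l * t)" by (intro nice1_intros)
 have I1: "(LINT t|normal1 (D / 2). (- 1 / 2 - D * l * t + 1)^2) = (2 * l)^2 + (D * l)^2"
 proof -
  have "- 1 / 2 - D * l * t + 1 = 2 * l + (- D * l) * (t - D / 2) + 0 * ((t - D / 2)^2 - 1)" for t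
   using l4 by (simp add: algebra_simps)
  thus ?thesis by (simp only: normal1_poly2) simp
 qed
 have I2: "(LINT t|normal1 (- D / 2). (- 1 / 2 - D * l * t)^2) = (2 * l)^2 + (D * l)^2"
 proof -
  have "- 1 / 2 - D * l * t = - 2 * l + (- D * l) * (t - - D / 2) + 0 * ((t - - D / 2)^2 - 1)" for t
   using l4 by (simp add: algebra_simps)
  thus ?thesis by (simp only: normal1_poly2) simp
 qed
 have I3: "(2 * l)^2 + (D * l)^2 = l"
 proof -
  have "(2 * l)^2 + (D * l)^2 = l * (l * (4 + D^2))" by (simp add: power2_eq_square algebra_simps)
  thus ?thesis using l by simp
 qed
 have I4: "0 \<le> ey (\<lambda>t. (- 1 / 2 - D * l * t + logistic (D * t) * 1)^2)"
  by (rule ey_nonneg) simp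
 have "l / 2 + l / 2 = ey (\<lambda>t. var1 t * 1^2) + ey (\<lambda>t. (- 1 / 2 - D * l * t + logistic (D * t) * 1)^2)"
  using ey_variance_split [OF nA nice1_intros(5) [of 1]] unfolding I1 I2 I3 .
 hence "ey (\<lambda>t. var1 t * 1^2) \<le> l"
  using I4 by linarith
 thus "ey var1 \<le> 1 / (4 + D^2)"
  by (simp add: l_def)
 define \<kappa> where "\<kappa> = D / (4 + 2 * D^2)"
 define c where "c = 2 / (4 + 2 * D^2)"
 have k: "\<kappa> * (4 + 2 * D^2) = D" "c * (4 + 2 * D^2) = 2"
  using D4(2) unfolding \<kappa>_def c_def by (metis less_irrefl nonzero_eq_divide_eq)+
 have k': "1 / 2 - \<kappa> * D = c" "\<kappa> = D * c / 2"
 proof -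
  have "D / X = D * (2 / X) / 2" for X :: real by simp
  thus "\<kappa> = D * c / 2" unfolding \<kappa>_def c_def .
  thus "1 / 2 - \<kappa> * D = c" using k(2) by (simp add: power2_eq_square algebra_simps)
 qed
 define A where "A t = - t / 2 - \<kappa> * (t^2 - 1 - D^2 / 4) - D / 4" for t
 have nA: "nice1 A" unfolding A_def [abs_def] by (intro nice1_intros) (auto simp: nice1_def intro!: poly_bounded_intros)
 have J1: "(LINT t|normal1 (D / 2). (A t + t)^2) = c^2 + 2 * \<kappa>^2"
 proof -
  have "A t + t = 0 + (1 / 2 - \<kappa> * D) * (t - D / 2) + (- \<kappa>) * ((t - D / 2)^2 - 1)" for t
   by (simp add: A_def power2_eq_square algebra_simps)
  thus ?thesis by (simp only: normal1_poly2 k'(1)) simp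
 qed
 have J2: "(LINT t|normal1 (- D / 2). (A t)^2) = c^2 + 2 * \<kappa>^2"
 proof -
  have "A t = 0 + (- (1 / 2 - \<kappa> * D)) * (t - - D / 2) + (- \<kappa>) * ((t - - D / 2)^2 - 1)" for t
   by (simp add: A_def power2_eq_square algebra_simps)
  thus ?thesis by (simp only: normal1_poly2 k'(1)) simp
 qed
 have J3: "c^2 + 2 * \<kappa>^2 = 1 / (4 + 2 * D^2)"
 proof -
  have "c^2 + 2 * \<kappa>^2 = c * (c * (4 + 2 * D^2)) / 4"
   by (simp add: k'(2) power2_eq_square field_simps)
  hence "c^2 + 2 * \<kappa>^2 = c * 2 / 4"
   by (simp only: k(2))
  also have "(2 / X) * 2 / 4 = 1 / X" for X :: real by simp
  hence "c * 2 / 4 = 1 / (4 + 2 * D^2)" unfolding c_def .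
  finally show ?thesis .
 qed
 have J4: "0 \<le> ey (\<lambda>t. (A t + logistic (D * t) * t)^2)"
  by (rule ey_nonneg) simp
 show "ey (\<lambda>t. var1 t * t^2) \<le> 1 / (4 + 2 * D^2)"
  using ey_variance_split [OF nA nice1_intros(6)] J4 unfolding J1 J2 J3 by linarith
qed

definition info_loss :: real where
 "info_loss = ey (\<lambda>t. q t * var1 t)"

lemma q_var1: "nice1 (\<lambda>t. q t * var1 t)" "nice1 (\<lambda>t. q t * var1 t * t^2)"
 "\<And>t. q (- t) * var1 (- t) = q t * var1 t"
proof -
 show "nice1 (\<lambda>t. q t * var1 t)" "nice1 (\<lambda>t. q t * var1 t * t^2)"
  by (intro nice1_intros var1(1))+
qed (simp add: var1(2) q_even)

lemma info_loss_less: "info_loss < 1 / (4 + D^2)" "ey (\<lambda>t. q t * var1 t * t^2) < 1 / (4 + 2 * D^2)"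
proof -
 have "0 < ey (\<lambda>t. (1 - q t) * var1 t)"
 proof (intro ey_pos always_eventually allI)
  show "nice1 (\<lambda>t. (1 - q t) * var1 t)" by (intro nice1_intros var1(1))
  show "0 < (1 - q t) * var1 t" for t using q(2) var1(3) by simp
  thus "0 \<le> (1 - q t) * var1 t" for t by (simp add: less_imp_le)
 qed
 moreover have "ey (\<lambda>t. var1 t - q t * var1 t) = ey var1 - info_loss"
  unfolding info_loss_def by (rule ey_diff [OF var1(1) q_var1(1)])
 ultimately show "info_loss < 1 / (4 + D^2)"
  using ey_var1_le(1) by (simp add: left_diff_distrib)
 have n: "nice1 (\<lambda>t. var1 t * t^2)" using var1 by (intro nice1_intros)
 have "0 < ey (\<lambda>t. (1 - q t) * var1 t * t^2)"
 proof (rule ey_pos)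
  show "AE t in lborel. 0 < (1 - q t) * var1 t * t^2"
   using AE_lborel_singleton [of "0::real"] by eventually_elim (use q(2) var1(3) in simp)
  show "nice1 (\<lambda>t. (1 - q t) * var1 t * t^2)" by (intro nice1_intros var1(1))
  show "0 \<le> (1 - q t) * var1 t * t^2" for t using q_le_1 [of t] var1(3) [of t] by simp
 qed
 moreover have "ey (\<lambda>t. var1 t * t^2 - q t * var1 t * t^2) = ey (\<lambda>t. var1 t * t^2) - ey (\<lambda>t. q t * var1 t * t^2)"
  by (rule ey_diff [OF n q_var1(2)])
 ultimately show "ey (\<lambda>t. q t * var1 t * t^2) < 1 / (4 + 2 * D^2)"
  using ey_var1_le(2) by (simp add: left_diff_distrib)
qed

lemma integral_score_ig_zero: "(LINT x|Q. score_ig v t0 x) = 0"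
proof -
 let ?S1 = "\<lambda>y. score2 v t0 y + score_diff v t0 y"
 have n2: "niceY (\<lambda>y. score2 v t0 y)" and nd: "niceY (\<lambda>y. score_diff v t0 y)"
  using niceY_of_jet(1) [OF jet_score_diff [of D k v]] niceY_of_jet(1) [OF jet_score2 [of D k v]] by simp_all
 have n1: "niceY ?S1" by (rule niceY_intros(1) [OF n2 nd])
 have cls: "(LINT y|iso_normal m. a + trace B - (y - m) \<bullet> (B *v y - c)) = a" for a B c and m :: "real^'p"
 proof -
  have e: "a + trace B - (y - m) \<bullet> (B *v y - c)
   = (a + trace B) + (y - m) \<bullet> (c - B *v m) - (y - m) \<bullet> (B *v (y - m))" for y
   by (simp add: inner_diff_right matrix_vector_mult_diff_distrib algebra_simps)
  have i1: "integrable (iso_normal m) (\<lambda>y. (y - m) \<bullet> z)" for z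
   by (rule integrable_iso_normal) (auto simp: inner_diff_left intro!: poly_bounded_intros)
  have i2: "integrable (iso_normal m) (\<lambda>y. (y - m) \<bullet> (B *v (y - m)))"
   by (rule integrable_iso_normal)
    (auto simp: inner_vec_def matrix_vector_mult_def intro!: poly_bounded_intros)
  interpret N: prob_space "iso_normal m" by (rule prob_space_iso_normal)
  have gen: "(LINT y|iso_normal m. w + f y - g y) = w + (LINT y|iso_normal m. f y) - (LINT y|iso_normal m. g y)"
   if "integrable (iso_normal m) f" "integrable (iso_normal m) g" for f g :: "real^'p => real" and w
   using that N.prob_space by simp
  show ?thesis
   unfolding e gen [OF i1 i2] iso_normal_moments by (simp add: trace_def)
 qed
 have s1: "?S1 y = par_rho v / 2 + trace (par_K v) - (y - class_mean D k 1) \<bullet> (par_K v *v y - par_mu1 v)" for y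
  by (simp add: score2_def score_diff_def par0_def)
 have s2: "score2 v t0 y = - par_rho v / 2 + trace (par_K v) - (y - class_mean D k 0) \<bullet> (par_K v *v y - par_mu2 v)" for y
  by (simp add: score2_def par0_def)
 have nice: "nice (score_ig v t0)"
  by (rule jet_nice(1) [OF jet_score_ig])
 have "(LINT x|Q. score_ig v t0 x) = EY (\<lambda>y. \<tau> y * ?S1 y + (1 - \<tau> y) * score2 v t0 y)"
  unfolding integral_Q_EY [OF nice] unfolding obs_given_y_def score_ig_def log_odds_par0
  by (rule arg_cong [of _ _ EY]) (simp add: fun_eq_iff log_odds_par0 algebra_simps)
 also have "... = EY (\<lambda>y. \<tau> y * ?S1 y) + EY (\<lambda>y. (1 - \<tau> y) * score2 v t0 y)"
  by (intro EY_add niceY_intros n2 nd)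
 also have "... = 0"
  unfolding tower(1) [OF n1, symmetric] tower(2) [OF n2, symmetric] unfolding s1 unfolding s2 cls by simp
 finally show ?thesis .
qed

lemma score_ig_eff_dir:
 assumes "x $ k = 0"
 shows "score_ig (eff_dir D k x0 x) t0 z = (x0 + x \<bullet> fst z) *
  ((1 - snd (snd z)) * fst (snd z) + snd (snd z) * \<tau> (fst z) - (1 / 2 + D / (4 + D^2) * fst z $ k))"
proof -
 have "- a * (1 / 2 + c * t) + u * a = a * (u - (1 / 2 + c * t))" for a c t u :: real
  by (simp add: algebra_simps)
 thus ?thesis
  unfolding score_ig_def score_diff_eff_dir [OF assms D] log_odds_par0 .
qed

lemma integral_dscore_eff_dir:
 assumes x: "x $ k = 0" and h: "transpose (par_K h) = par_K h"
 shows "(LINT z|Q. dscore_ig D k (eff_dir D k x0 x) z h)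
  = - (1 / (4 + D^2) - info_loss) * (x0 * dcoef0 D k h + x \<bullet> dcoef1 D k h)"
proof -
 define l where "l = 1 / (4 + D^2)"
 define \<kappa> where "\<kappa> = D / (4 + D^2)"
 have \<kappa>: "\<kappa> = D * l" by (simp add: \<kappa>_def l_def)
 have fold: "4 * x0 / (4 + D^2) = 4 * l * x0" "2 / (4 + D^2) = 2 * l"
  by (simp_all add: l_def)
 have ax: "axis k (\<kappa> * x0) = (\<kappa> * x0) *\<^sub>R (axis k 1 :: real^'p)"
  by (simp add: vec_eq_iff axis_def)
 have B0: "(\<chi> i j. if i = k then \<kappa> * x $ j else 0) *v axis k a = 0" for a
  using x by (auto simp: vec_eq_iff matrix_vector_mult_def axis_def intro!: sum.neutral)
 have Bm: "(\<chi> i j. if i = k then \<kappa> * x $ j else 0) *v class_mean D k s = 0" for s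
  by (simp add: class_mean_def B0)
 have tr: "trace (par_K h ** (\<chi> i j. if i = k then \<kappa> * x $ j else 0)) = \<kappa> * (x \<bullet> (par_K h *v axis k 1))"
 proof -
  have "trace (par_K h ** (\<chi> i j. if i = k then \<kappa> * x $ j else 0)) = (\<Sum>i\<in>UNIV. \<Sum>j\<in>UNIV. par_K h $ i $ j * (if j = k then \<kappa> * x $ i else 0))"
   by (simp add: trace_def matrix_matrix_mult_def)
  also have "... = (\<Sum>i\<in>UNIV. par_K h $ i $ k * (\<kappa> * x $ i))"
   by (simp add: if_distrib cong: if_cong)
  also have "... = \<kappa> * (x \<bullet> (par_K h *v axis k 1))"
   by (simp add: inner_vec_def matrix_vector_mult_basis column_def sum_distrib_left mult_ac)
  finally show ?thesis .
 qed
 have ey: "EY (\<lambda>y. q (y $ k) * (\<tau> y * (1 - \<tau> y)) * (dlog_odds D k y h * score_diff (eff_dir D k x0 x) t0 y))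
   = (x0 * dcoef0 D k h + x \<bullet> dcoef1 D k h) * info_loss"
  unfolding info_loss_def EY_affine_product [OF q_var1(1,3) x, symmetric]
   dlog_odds_symmetric [OF h] score_diff_eff_dir(1) [OF x D]
  by (simp add: var1_def mult_ac)
 have mu: "par_mu1 h \<bullet> x = x \<bullet> par_mu1 h" "par_mu2 h \<bullet> x = x \<bullet> par_mu2 h"
  by (simp_all add: inner_commute)
 have "- (par_rho (eff_dir D k x0 x) * par_rho h / 4 + trace (par_K h ** par_K (eff_dir D k x0 x))
    + par_mu1 h \<bullet> (par_mu1 (eff_dir D k x0 x) - par_K (eff_dir D k x0 x) *v class_mean D k 1) / 2
    + par_mu2 h \<bullet> (par_mu2 (eff_dir D k x0 x) - par_K (eff_dir D k x0 x) *v class_mean D k 0) / 2)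
   = - l * (x0 * dcoef0 D k h + x \<bullet> dcoef1 D k h)"
  unfolding eff_dir_def Let_def \<kappa>_def [symmetric] fold
  by (simp add: Bm tr ax dcoef0_def dcoef1_def inner_diff_right inner_add_right mu inner_axis, simp add: \<kappa> field_simps)
 thus ?thesis
  unfolding integral_dscore_ig ey l_def by (simp add: algebra_simps)
qed

lemma integral_score_eff_dir_square:
 assumes x: "x $ k = 0"
 shows "(LINT z|Q. (score_ig (eff_dir D k x0 x) t0 z)^2) = (1 / (4 + D^2) - info_loss) * (x0^2 + x \<bullet> x)"
proof -
 define \<kappa> where "\<kappa> = D / (4 + D^2)"
 let ?l = "\<lambda>t. logistic (D * t)"
 define g where "g t = ?l t * (1 / 2 - \<kappa> * t)^2 + (1 - ?l t) * (1 / 2 + \<kappa> * t)^2 - q t * var1 t" for t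
 have ng: "nice1 g"
  unfolding g_def [abs_def] by (intro nice1_intros var1(1))
 have even: "g (- t) = g t" for t
 proof -
  have "a * (1 / 2 + \<kappa> * t)^2 + (1 - a) * (1 / 2 - \<kappa> * t)^2 = (1 - (1 - a)) * (1 / 2 + \<kappa> * t)^2 + (1 - a) * (1 / 2 - \<kappa> * t)^2" for a
   by simp
  thus ?thesis
   unfolding g_def q_var1(3) mult_minus_right logistic_minus by (simp add: algebra_simps)
 qed
 have nice: "nice (\<lambda>z. (score_ig (eff_dir D k x0 x) t0 z)^2)"
  by (intro nice_power jet_nice(1) [OF jet_score_ig])
 have alg: "T * (p * (a * ((1 - 1) * 1 + 1 * T - (1 / 2 + u)))^2 + (1 - p) * (a * ((1 - 0) * 1 + 0 * T - (1 / 2 + u)))^2)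
   + (1 - T) * (p * (a * ((1 - 1) * 0 + 1 * T - (1 / 2 + u)))^2 + (1 - p) * (a * ((1 - 0) * 0 + 0 * T - (1 / 2 + u)))^2)
   = (T * (1 / 2 - u)^2 + (1 - T) * (1 / 2 + u)^2 - p * (T * (1 - T))) * (a * a)" for T p a u :: real
  by (simp add: power2_eq_square field_simps)
 have "(LINT z|Q. (score_ig (eff_dir D k x0 x) t0 z)^2) = EY (\<lambda>y. g (y $ k) * ((x0 + x \<bullet> y) * (x0 + x \<bullet> y)))"
  unfolding integral_Q_EY [OF nice] unfolding obs_given_y_def score_ig_eff_dir [OF x] g_def var1_def \<kappa>_def [symmetric]
  by (rule arg_cong [of _ _ EY]) (simp only: fst_conv snd_conv alg)
 also have "... = (x0 * x0 + x \<bullet> x) * ey g"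
  by (rule EY_affine_product [OF ng even x])
 also have "ey g = 1 / (4 + D^2) - info_loss"
 proof -
  define l where "l = 1 / (4 + D^2)"
  have l: "l * (4 + D^2) = 1" using D4(1) unfolding l_def by (metis less_irrefl nonzero_eq_divide_eq)
  have kl: "\<kappa> = D * l" by (simp add: \<kappa>_def l_def)
  have l4: "4 * l = 1 - D * D * l" using l by (simp add: power2_eq_square algebra_simps)
  have n: "nice1 (\<lambda>t. ?l t * (1 / 2 - \<kappa> * t)^2)" "nice1 (\<lambda>t. (1 - ?l t) * (1 / 2 + \<kappa> * t)^2)"
   "nice1 (\<lambda>t. (1 / 2 - \<kappa> * t)^2)" "nice1 (\<lambda>t. (1 / 2 + \<kappa> * t)^2)"
   by (intro nice1_intros)+
  have 1: "(LINT t|normal1 (D / 2). (1 / 2 - \<kappa> * t)^2) = (2 * l)^2 + (D * l)^2"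
  proof -
   have "1 / 2 - \<kappa> * t = 2 * l + (- D * l) * (t - D / 2) + 0 * ((t - D / 2)^2 - 1)" for t
    using l4 by (simp add: kl algebra_simps)
   thus ?thesis by (simp only: normal1_poly2) simp
  qed
  have 2: "(LINT t|normal1 (- D / 2). (1 / 2 + \<kappa> * t)^2) = (2 * l)^2 + (D * l)^2"
  proof -
   have "1 / 2 + \<kappa> * t = 2 * l + (D * l) * (t - - D / 2) + 0 * ((t - - D / 2)^2 - 1)" for t
    using l4 by (simp add: kl algebra_simps)
   thus ?thesis by (simp only: normal1_poly2) simp
  qed
  have 3: "(2 * l)^2 + (D * l)^2 = l"
  proof -
   have "(2 * l)^2 + (D * l)^2 = l * (l * (4 + D^2))" by (simp add: power2_eq_square algebra_simps)
   thus ?thesis using l by simp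
  qed
  have "ey g = l / 2 + l / 2 - info_loss"
   unfolding g_def [abs_def] info_loss_def ey_diff [OF nice1_intros(1) [OF n(1,2)] q_var1(1)] ey_add [OF n(1,2)]
    tower1(1) [OF n(3), symmetric] tower1(2) [OF n(4), symmetric] 1 2 3 ..
  thus ?thesis unfolding l_def [symmetric] by simp
 qed
 finally show ?thesis by (simp add: power2_eq_square mult.commute)
qed

lemma integral_dscore_tilt_dir:
 obtains c where "0 < c" "\<And>h. transpose (par_K h) = par_K h ==>
  (LINT z|Q. dscore_ig D k (tilt_dir D k h) z h) \<le> - c * (norm h)^2"
proof -
 define \<theta> where "\<theta> = max (info_loss * (4 + D^2)) (ey (\<lambda>t. q t * var1 t * t^2) * (4 + 2 * D^2))"
 have \<theta>1: "\<theta> < 1"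
  using info_loss_less D4 by (simp add: \<theta>_def pos_less_divide_eq)
 have \<theta>0: "0 \<le> \<theta>"
 proof -
  have "0 \<le> info_loss" unfolding info_loss_def
   using q var1(3) by (intro ey_nonneg mult_nonneg_nonneg) (auto intro: less_imp_le)
  thus ?thesis using D4 by (simp add: \<theta>_def le_max_iff_disj)
 qed
 have gb: "info_loss \<le> \<theta> / (4 + D^2)" "ey (\<lambda>t. q t * var1 t * t^2) \<le> \<theta> / (4 + 2 * D^2)"
  using D4 by (simp_all add: \<theta>_def pos_le_divide_eq)
 show thesis
 proof (rule that [of "(1 - \<theta>) / 4"])
  show "0 < (1 - \<theta>) / 4" using \<theta>1 by simp
  fix h :: "'p par" assume h: "transpose (par_K h) = par_K h"
  define Qf where "Qf = (par_rho h)^2 / 4 + (norm (par_K h))^2 / 2 + (norm (par_mu1 h))^2 / 2 + (norm (par_mu2 h))^2 / 2"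
  define w0 where "w0 = dcoef0 D k h"
  define w where "w = dcoef1 D k h"
  define R where "R = (w0^2 + (norm (w - axis k (w $ k)))^2) / (4 + D^2) + (w $ k)^2 / (4 + 2 * D^2)"
  have RQ: "R \<le> Qf"
   unfolding R_def Qf_def w0_def w_def by (rule quadratic_par_lower_bound [OF h D])
  have sd: "score_diff (tilt_dir D k h) t0 y = w0 + w \<bullet> y" for y
   unfolding w0_def w_def by (rule score_diff_tilt_dir [OF h])
  have tr: "trace (par_K h ** ((1 / 2) *\<^sub>R par_K h)) = (norm (par_K h))^2 / 2"
  proof -
   have s: "par_K h $ j $ i = par_K h $ i $ j" for i j
    using arg_cong [OF h, of "\<lambda>A. A $ i $ j"] by (simp add: transpose_def)
   have "trace (par_K h ** ((1 / 2) *\<^sub>R par_K h)) = (\<Sum>i\<in>UNIV. \<Sum>j\<in>UNIV. par_K h $ i $ j * (1 / 2 * par_K h $ j $ i))"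
    by (simp add: trace_def matrix_matrix_mult_def)
   also have "... = (\<Sum>i\<in>UNIV. \<Sum>j\<in>UNIV. par_K h $ i $ j * par_K h $ i $ j) / 2"
   proof -
    have "par_K h $ i $ j * (1 / 2 * par_K h $ j $ i) = par_K h $ i $ j * par_K h $ i $ j / 2" for i j
     using s [of j i] by simp
    thus ?thesis by (simp only: sum_divide_distrib)
   qed
   also have "... = (norm (par_K h))^2 / 2"
    unfolding power2_norm_eq_inner inner_vec_def inner_real_def ..
   finally show ?thesis .
  qed
  have "(LINT z|Q. dscore_ig D k (tilt_dir D k h) z h) = - Qf + EY (\<lambda>y. (q (y $ k) * var1 (y $ k)) * (w0 + w \<bullet> y)^2)"
  proof -
   have "- (par_rho (tilt_dir D k h) * par_rho h / 4 + trace (par_K h ** par_K (tilt_dir D k h))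
    + par_mu1 h \<bullet> (par_mu1 (tilt_dir D k h) - par_K (tilt_dir D k h) *v class_mean D k 1) / 2
    + par_mu2 h \<bullet> (par_mu2 (tilt_dir D k h) - par_K (tilt_dir D k h) *v class_mean D k 0) / 2) = - Qf"
    unfolding Qf_def power2_norm_eq_inner [of "par_mu1 h"] power2_norm_eq_inner [of "par_mu2 h"]
    by (simp add: tilt_dir_def tr scaleR_matrix_vector power2_eq_square)
   moreover have "EY (\<lambda>y. q (y $ k) * (\<tau> y * (1 - \<tau> y)) * (dlog_odds D k y h * score_diff (tilt_dir D k h) t0 y))
    = EY (\<lambda>y. (q (y $ k) * var1 (y $ k)) * (w0 + w \<bullet> y)^2)"
    unfolding sd dlog_odds_symmetric [OF h] w0_def [symmetric] w_def [symmetric] var1_def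
    by (simp add: power2_eq_square)
   ultimately show ?thesis
    unfolding integral_dscore_ig by simp
  qed
  also have "EY (\<lambda>y. (q (y $ k) * var1 (y $ k)) * (w0 + w \<bullet> y)^2)
    = (w0^2 + (norm (w - axis k (w $ k)))^2) * info_loss + (w $ k)^2 * ey (\<lambda>t. q t * var1 t * t^2)"
   unfolding info_loss_def by (rule EY_affine_square [OF q_var1(1,3)])
  also have "... \<le> (w0^2 + (norm (w - axis k (w $ k)))^2) * (\<theta> / (4 + D^2)) + (w $ k)^2 * (\<theta> / (4 + 2 * D^2))"
   by (intro add_mono mult_left_mono gb) auto
  also have "... = \<theta> * R"
   by (simp add: R_def distrib_left mult_ac add_divide_distrib)
  also have "\<theta> * R \<le> \<theta> * Qf"
   by (rule mult_left_mono [OF RQ \<theta>0])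
  finally have 1: "(LINT z|Q. dscore_ig D k (tilt_dir D k h) z h) \<le> - (1 - \<theta>) * Qf"
   by (simp add: algebra_simps)
  have nh: "(norm h)^2 = (par_rho h)^2 + ((norm (par_mu1 h))^2 + ((norm (par_mu2 h))^2 + (norm (par_K h))^2))"
   by (cases h) (simp add: norm_Pair)
  have "(norm h)^2 / 4 \<le> Qf"
   unfolding nh Qf_def by simp
  hence "(1 - \<theta>) * ((norm h)^2 / 4) \<le> (1 - \<theta>) * Qf"
   using \<theta>1 by (intro mult_left_mono) auto
  with 1 show "(LINT z|Q. dscore_ig D k (tilt_dir D k h) z h) \<le> - ((1 - \<theta>) / 4) * (norm h)^2"
   by (simp add: algebra_simps)
 qed
qed

end

section \<open>Estimating equations and consistency\<close>

lemma linear_sum_Basis: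
 "linear f ==> f v = (\<Sum>b\<in>Basis. (v \<bullet> b) * (f b :: real))"
 using linear_sum [of f "\<lambda>b. (v \<bullet> b) *\<^sub>R b" Basis] linear_cmul [of f]
 by (simp add: euclidean_representation)

lemma sq_diff_le:
 fixes a b u M N :: real
 assumes "\<bar>a\<bar> \<le> M * N" "\<bar>b - a\<bar> \<le> u * N" "0 \<le> u" "u \<le> 1" "0 \<le> N" "0 \<le> M"
 shows "\<bar>a\<^sup>2 - b^2\<bar> \<le> u * (2 * M + 1) * N^2"
proof -
 have "\<bar>a\<^sup>2 - b^2\<bar> = \<bar>b - a\<bar> * \<bar>b + a\<bar>"
  by (simp add: power2_eq_square abs_mult [symmetric] algebra_simps abs_minus_commute)
 moreover have "\<bar>b + a\<bar> \<le> (2 * M + 1) * N"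
  using assms mult_right_mono [of u 1 N] by (simp add: algebra_simps)
 ultimately have "\<bar>a\<^sup>2 - b^2\<bar> \<le> (u * N) * ((2 * M + 1) * N)"
  using assms by (auto intro!: mult_mono)
 thus ?thesis by (simp add: power2_eq_square mult_ac)
qed

context iid_moments
begin

lemma has_AE_of_Z_estimator:
 fixes F :: "'v::euclidean_space => 'e::euclidean_space => 'x => real" and I :: "'i set"
 assumes J: "\<And>v. jet t (F v) (F' v)"
  and lin: "\<And>s x. linear (\<lambda>v. F v s x)" "\<And>x h. linear (\<lambda>v. F' v x h)"
  and zero: "\<And>v. (LINT x|Q. F v t x) = 0"
  and T: "linear T" "0 < \<kappa>" "\<And>h. h \<in> W ==> (LINT x|Q. F' (T h) x h) \<le> - \<kappa> * (norm h)^2"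
  and I: "finite I" and lam: "0 < lam" and v: "\<And>i. i \<in> I ==> (LINT x|Q. (F (v i) t x)^2) = lam"
  and l: "\<And>i h. i \<in> I ==> h \<in> W ==> (LINT x|Q. F' (v i) x h) = - lam * l i h"
  and e: "\<And>\<delta>. 0 < \<delta> ==> \<exists>r>0. \<forall>h\<in>W. norm h \<le> r \<longrightarrow>
    \<bar>e (t + h) - r0 - c * (\<Sum>i\<in>I. (l i h)^2)\<bar> \<le> \<delta> * (norm h)^2"
  and R: "\<And>n. R n \<in> borel_measurable P" "\<And>n z. \<bar>R n z\<bar> \<le> 1"
  and est: "\<And>r. 0 < r ==> whp (\<lambda>n z. \<exists>h\<in>W. norm h \<le> r \<and>
    (\<forall>v. avg (F v (t + h)) n z = 0) \<and> R n z = e (t + h))"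
 shows "has_AE (\<lambda>n. expectation (R n)) (\<lambda>n. r0 + (c * card I / lam) / real n)"
proof (rule has_AE_of_quadratic_expansion
  [where \<phi> = "\<lambda>i. F (v i) t" and \<psi> = "\<lambda>b. F b t" and B = Basis])
 show "finite I" "0 < lam" "finite (Basis :: 'v set)" by (fact I lam finite_Basis)+
 show "nice (F w t)" "(LINT x|Q. F w t x) = 0" for w
  by (rule jet_nice [OF J], rule zero)
 show "nice (F w t)" "(LINT x|Q. F w t x) = 0" for w
  by (rule jet_nice [OF J], rule zero)
 show "(LINT x|Q. (F (v i) t x)^2) = lam" if "i \<in> I" for i using v that .
 show "R n \<in> borel_measurable P" "\<bar>R n z\<bar> \<le> 1" for n z by (fact R)+
 fix \<delta> :: real assume \<delta>: "0 < \<delta>"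
 obtain M where M: "0 < M" "\<And>h. norm (T h) \<le> M * norm h"
  using linear_bounded_pos [OF T(1)] by blast
 have "\<exists>B>0. \<forall>h\<in>W. \<bar>l i h\<bar> \<le> B * norm h" if i: "i \<in> I" for i
 proof -
  obtain B where B: "0 < B" "\<And>h. norm (LINT x|Q. F' (v i) x h) \<le> B * norm h"
   using linear_bounded_pos [OF jet_integral_linear [OF J]] by blast
  have "\<bar>l i h\<bar> \<le> B / lam * norm h" if "h \<in> W" for h
   using B(2) [of h] l [OF i that] lam by (simp add: abs_mult field_simps)
  thus ?thesis using B lam by (intro exI [of _ "B / lam"]) auto
 qed
 then obtain Bl where Bl: "\<And>i. i \<in> I ==> 0 < Bl i"
  "\<And>i h. i \<in> I ==> h \<in> W ==> \<bar>l i h\<bar> \<le> Bl i * norm h"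
  by metis
 define BL where "BL = (\<Sum>i\<in>I. Bl i)"
 have BL: "\<bar>l i h\<bar> \<le> BL * norm h" if "i \<in> I" "h \<in> W" for i h
 proof -
  have "Bl i \<le> BL" unfolding BL_def using that I Bl(1) by (intro member_le_sum) (auto intro: less_imp_le)
  thus ?thesis using Bl(2) [OF that] mult_right_mono [of "Bl i" BL "norm h"] by simp
 qed
 have BL0: "0 \<le> BL" unfolding BL_def using Bl(1) by (intro sum_nonneg) (auto intro: less_imp_le)
 define d where "d = real DIM('v)"
 have d: "0 < d" by (simp add: d_def)
 define C where "C = (2 * M / \<kappa>)^2 * d"
 have C: "0 < C" using M T d by (simp add: C_def)
 define N where "N = 1 + \<bar>c\<bar> * card I * (2 * BL + 1)"
 have N: "0 < N" using BL0 by (auto simp: N_def intro!: add_pos_nonneg mult_nonneg_nonneg)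
 define u where "u = min 1 (\<delta> / (C * N))"
 have u: "0 < u" "u \<le> 1" "C * N * u \<le> \<delta>"
  using \<delta> C N by (auto simp: u_def min_def field_simps)
 define vm where "vm = 1 + (\<Sum>i\<in>I. norm (v i))"
 have vm: "0 < vm" "i \<in> I ==> norm (v i) \<le> vm" for i
  using member_le_sum [of i I "\<lambda>i. norm (v i)"] I
  by (auto simp: vm_def intro!: add_pos_nonneg sum_nonneg)
 define \<epsilon> where "\<epsilon> = min (\<kappa> / (2 * M * d)) (lam * u / (vm * d))"
 have \<epsilon>: "0 < \<epsilon>" using T M d lam u vm by (simp add: \<epsilon>_def)
 have "\<forall>b. \<exists>r. 0 < r \<and> whp (\<lambda>n z. \<forall>h. norm h \<le> r \<longrightarrow>
  \<bar>avg (F b (t + h)) n z - avg (F b t) n z - (LINT x|Q. F' b x h)\<bar> \<le> \<epsilon> * norm h)"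
  (is "\<forall>b. \<exists>r. 0 < r \<and> ?whp b r")
  by (rule allI, rule jet_whp [OF J \<epsilon>], rule exI, rule conjI)
 from choice [OF this] obtain rb where "\<forall>b. 0 < rb b \<and> ?whp b (rb b)" ..
 from this [rule_format, THEN conjunct1] this [rule_format, THEN conjunct2]
 have rb: "0 < rb b" "?whp b (rb b)" for b .
 obtain re where re: "0 < re" "\<And>h. h \<in> W ==> norm h \<le> re ==>
    \<bar>e (t + h) - r0 - c * (\<Sum>i\<in>I. (l i h)^2)\<bar> \<le> u * (norm h)^2"
  using e [OF u(1)] by blast
 define r where "r = Min (insert re (rb ` Basis))"
 have r: "0 < r" "r \<le> re" "\<And>b. b \<in> Basis ==> r \<le> rb b"
  unfolding r_def using re(1) rb(1) by (subst Min_gr_iff, auto simp del: Min_insert intro!: Min_le)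
 have "whp (\<lambda>n z. (\<forall>b\<in>Basis. \<forall>h. norm h \<le> rb b \<longrightarrow>
  \<bar>avg (F b (t + h)) n z - avg (F b t) n z - (LINT x|Q. F' b x h)\<bar> \<le> \<epsilon> * norm h) \<and>
  (\<exists>h\<in>W. norm h \<le> r \<and> (\<forall>v. avg (F v (t + h)) n z = 0) \<and> R n z = e (t + h)))"
  by (intro whp_conj whp_ball_finite rb est r) auto
 thus "whp (\<lambda>n z. \<bar>R n z - r0 - c * (\<Sum>i\<in>I. (avg (F (v i) t) n z / lam)^2)\<bar>
    \<le> \<delta> * (\<Sum>b\<in>Basis. (avg (F b t) n z)^2))"
 proof (rule whp_mono)
  fix n z
  let ?S = "\<lambda>v. avg (F v t) n z"
  assume *: "(\<forall>b\<in>Basis. \<forall>h. norm h \<le> rb b \<longrightarrow>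
   \<bar>avg (F b (t + h)) n z - avg (F b t) n z - (LINT x|Q. F' b x h)\<bar> \<le> \<epsilon> * norm h) \<and>
   (\<exists>h\<in>W. norm h \<le> r \<and> (\<forall>v. avg (F v (t + h)) n z = 0) \<and> R n z = e (t + h))"
  then obtain h where h: "h \<in> W" "norm h \<le> r" "\<And>v. avg (F v (t + h)) n z = 0" "R n z = e (t + h)"
   by blast
  have b: "\<bar>?S b + (LINT x|Q. F' b x h)\<bar> \<le> \<epsilon> * norm h" if "b \<in> Basis" for b
  proof -
   have "norm h \<le> rb b" using h(2) r(3) [OF that] by simp
   hence "\<bar>avg (F b (t + h)) n z - ?S b - (LINT x|Q. F' b x h)\<bar> \<le> \<epsilon> * norm h"
    using * that by blast
   thus ?thesis using h(3) [of b] by linarith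
  qed
  have "linear ?S"
   using linear_avg [of "\<lambda>x v. F v t x", OF lin(1)] by simp
  moreover have "linear (\<lambda>v. LINT x|Q. F' v x h)"
   using nice_integrable [OF jet_nice(2) [OF J]]
   by (intro linearI) (simp_all add: linear_add [OF lin(2)] linear_cmul [OF lin(2)])
  ultimately have lin2: "linear (\<lambda>v. ?S v + (LINT x|Q. F' v x h))"
   by (rule linear_compose_add)
  have lin1: "linear ?S" by fact
  have sv: "\<bar>?S v + (LINT x|Q. F' v x h)\<bar> \<le> norm v * (d * \<epsilon> * norm h)" for v
  proof -
   have "\<bar>?S v + (LINT x|Q. F' v x h)\<bar> \<le> (\<Sum>b\<in>(Basis :: 'v set). norm v * (\<epsilon> * norm h))"
    unfolding linear_sum_Basis [OF lin2, of v]
    by (rule order_trans [OF sum_abs], rule sum_mono, unfold abs_mult, rule mult_mono)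
     (auto simp: Basis_le_norm intro: b)
   thus ?thesis by (simp add: d_def mult_ac)
  qed
  define A where "A = (\<Sum>b\<in>Basis. \<bar>?S b\<bar>)"
  have SA: "\<bar>?S v\<bar> \<le> norm v * A" for v
   unfolding linear_sum_Basis [OF lin1, of v] A_def sum_distrib_left
   by (rule order_trans [OF sum_abs], rule sum_mono, unfold abs_mult, rule mult_mono)
    (auto simp: Basis_le_norm)
  have A0: "0 \<le> A" by (simp add: A_def sum_nonneg)
  have "\<kappa> * norm h \<le> M * A + M * (d * \<epsilon> * norm h)"
  proof (cases "norm h = 0")
   case True thus ?thesis using M A0 by (simp add: mult_nonneg_nonneg less_imp_le)
  next
   case False
   have "\<kappa> * (norm h)^2 \<le> \<bar>?S (T h)\<bar> + \<bar>?S (T h) + (LINT x|Q. F' (T h) x h)\<bar>"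
    using T(3) [OF h(1)] by linarith
   also have "... \<le> norm (T h) * A + norm (T h) * (d * \<epsilon> * norm h)"
    by (intro add_mono SA sv)
   also have "... \<le> (M * norm h) * A + (M * norm h) * (d * \<epsilon> * norm h)"
    using M(2) A0 d \<epsilon> by (intro add_mono mult_right_mono) (auto intro!: mult_nonneg_nonneg)
   finally have "norm h * (\<kappa> * norm h) \<le> norm h * (M * A + M * (d * \<epsilon> * norm h))"
    by (simp add: power2_eq_square algebra_simps)
   thus ?thesis using False by simp
  qed
  moreover have "M * (d * \<epsilon> * norm h) \<le> \<kappa> / 2 * norm h"
  proof -
   have "\<epsilon> \<le> \<kappa> / (2 * M * d)" by (simp add: \<epsilon>_def)
   hence "M * d * \<epsilon> \<le> \<kappa> / 2" using M d by (simp add: field_simps)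
   thus ?thesis using mult_right_mono [of "M * d * \<epsilon>" "\<kappa> / 2" "norm h"] by (simp add: mult_ac)
  qed
  ultimately have "\<kappa> * norm h \<le> 2 * M * A" by (simp add: algebra_simps)
  hence hA: "norm h \<le> 2 * M / \<kappa> * A" using T(2) by (simp add: field_simps)
  have hC: "(norm h)^2 \<le> C * (\<Sum>b\<in>Basis. (?S b)^2)"
  proof -
   have "(norm h)^2 \<le> (2 * M / \<kappa>)^2 * A^2"
    using power_mono [OF hA, of 2] by (simp only: power_mult_distrib [symmetric] norm_ge_zero simp_thms)
   also have "... \<le> (2 * M / \<kappa>)^2 * (d * (\<Sum>b\<in>Basis. (?S b)^2))"
    unfolding A_def d_def using sum_squared_le_sum_of_squares [of "\<lambda>b. \<bar>?S b\<bar>" "Basis :: 'v set"]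
    by (intro mult_left_mono) (auto simp: mult_ac)
   finally show ?thesis by (simp add: C_def mult_ac)
  qed
  have tm: "\<bar>(l i h)^2 - (?S (v i) / lam)^2\<bar> \<le> u * (2 * BL + 1) * (norm h)^2" if i: "i \<in> I" for i
  proof (rule sq_diff_le)
   show "\<bar>l i h\<bar> \<le> BL * norm h" using BL i h by blast
   have "\<bar>?S (v i) - lam * l i h\<bar> \<le> norm (v i) * (d * \<epsilon> * norm h)"
    using sv [of "v i"] l [OF i h(1)] by simp
   also have "... \<le> vm * (d * \<epsilon> * norm h)"
    using vm(2) [OF i] d \<epsilon> by (intro mult_right_mono) auto
   also have "... \<le> lam * u * norm h"
   proof -
    have "\<epsilon> \<le> lam * u / (vm * d)" by (simp add: \<epsilon>_def)
    hence "vm * d * \<epsilon> \<le> lam * u" using vm d by (simp add: field_simps)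
    thus ?thesis using mult_right_mono [of "vm * d * \<epsilon>" "lam * u" "norm h"] by (simp add: mult_ac)
   qed
   finally have "\<bar>?S (v i) - lam * l i h\<bar> / lam \<le> u * norm h" using lam by (simp add: field_simps)
   moreover have "?S (v i) / lam - l i h = (?S (v i) - lam * l i h) / lam"
    using lam by (simp add: field_simps)
   ultimately show "\<bar>?S (v i) / lam - l i h\<bar> \<le> u * norm h" using lam by simp
  qed (use u BL0 in auto)
  have "\<bar>c * (\<Sum>i\<in>I. (l i h)^2) - c * (\<Sum>i\<in>I. (?S (v i) / lam)^2)\<bar>
    \<le> \<bar>c\<bar> * (\<Sum>i\<in>I. u * (2 * BL + 1) * (norm h)^2)"
   unfolding right_diff_distrib [symmetric] sum_subtractf [symmetric] abs_mult
   by (intro mult_left_mono order_trans [OF sum_abs] sum_mono tm) auto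
  also have "... = u * (N - 1) * (norm h)^2"
   by (simp add: N_def mult_ac)
  finally have "\<bar>R n z - r0 - c * (\<Sum>i\<in>I. (?S (v i) / lam)^2)\<bar>
    \<le> u * (N - 1) * (norm h)^2 + u * (norm h)^2"
   using re(2) [OF h(1)] h(2,4) r(2) by simp
  also have "... = u * N * (norm h)^2" by (simp add: algebra_simps)
  also have "... \<le> u * N * (C * (\<Sum>b\<in>Basis. (?S b)^2))"
   using u N by (intro mult_left_mono hC) auto
  also have "... = (C * N * u) * (\<Sum>b\<in>Basis. (?S b)^2)" by simp
  also have "... \<le> \<delta> * (\<Sum>b\<in>Basis. (?S b)^2)"
   using u by (intro mult_right_mono sum_nonneg) auto
  finally show "\<bar>R n z - r0 - c * (\<Sum>i\<in>I. (?S (v i) / lam)^2)\<bar> \<le> \<delta> * (\<Sum>b\<in>Basis. (?S b)^2)" .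
 qed
qed

lemma whp_uniform_avg:
 fixes F :: "'e::euclidean_space => 'x => real"
 assumes C: "compact C" and F: "\<And>w. nice (F w)" and G: "nice G"
  and lip: "\<And>w w' x. \<bar>F w x - F w' x\<bar> \<le> norm (w - w') * G x" and e: "0 < e"
 shows "whp (\<lambda>n v. \<forall>w\<in>C. \<bar>avg (F w) n v - (LINT x|Q. F w x)\<bar> < e)"
proof -
 define K where "K = \<bar>LINT x|Q. G x\<bar> + 1"
 define r where "r = e / (4 * K)"
 have K: "0 < K" by (simp add: K_def)
 have r: "0 < r" using e K by (simp add: r_def)
 obtain N where N: "finite N" "N \<subseteq> C" "C \<subseteq> (\<Union>x\<in>N. ball x r)"
  using compactE_image [OF C, of C "\<lambda>x. ball x r"] r by (metis UN_I centre_in_ball open_ball subsetI)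
 have "whp (\<lambda>n v. (\<forall>w\<in>N. \<bar>avg (F w) n v - (LINT x|Q. F w x)\<bar> < e / 2) \<and> \<bar>avg G n v - (LINT x|Q. G x)\<bar> < 1)"
  using e N by (intro whp_conj whp_ball_finite whp_avg F G) auto
 thus ?thesis
 proof (rule whp_mono, intro ballI)
  fix n v w
  assume *: "(\<forall>w\<in>N. \<bar>avg (F w) n v - (LINT x|Q. F w x)\<bar> < e / 2) \<and> \<bar>avg G n v - (LINT x|Q. G x)\<bar> < 1"
   and w: "w \<in> C"
  obtain a where a: "a \<in> N" "norm (w - a) < r"
   using N(3) w by (auto simp: dist_norm norm_minus_commute)
  have small: "norm (w - a) * x \<le> e / 4" if "x \<le> K" for x
  proof -
   have "norm (w - a) * x \<le> norm (w - a) * K" using that by (intro mult_left_mono) auto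
   also have "... \<le> r * K" using a K by (intro mult_right_mono) auto
   also have "... = e / 4" using K by (simp add: r_def)
   finally show ?thesis .
  qed
  have "\<bar>avg (F w) n v - avg (F a) n v\<bar> \<le> avg (\<lambda>x. norm (w - a) * G x) n v"
   unfolding avg_diff [symmetric] by (intro order_trans [OF avg_abs] avg_mono lip)
  also have "... \<le> e / 4"
   unfolding avg_cmult using * by (intro small) (auto simp: K_def)
  finally have 1: "\<bar>avg (F w) n v - avg (F a) n v\<bar> \<le> e / 4" .
  have "\<bar>LINT x|Q. F w x - F a x\<bar> \<le> (LINT x|Q. \<bar>F w x - F a x\<bar>)"
   by (rule integral_abs_bound)
  also have "... \<le> (LINT x|Q. norm (w - a) * G x)"
   using lip F G by (intro integral_mono integrable_abs integrable_mult_right nice_integrable nice_diff) auto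
  also have "... \<le> e / 4"
   using small [of "LINT x|Q. G x"] by (auto simp: K_def)
  finally have 2: "\<bar>(LINT x|Q. F w x) - (LINT x|Q. F a x)\<bar> \<le> e / 4"
   using F nice_integrable by simp
  show "\<bar>avg (F w) n v - (LINT x|Q. F w x)\<bar> < e"
  proof -
   have "\<bar>avg (F a) n v - (LINT x|Q. F a x)\<bar> < e / 2" using * a by blast
   thus ?thesis using 1 2 by linarith
  qed
 qed
qed

lemma integral_continuous_of_lipschitz:
 assumes F: "\<And>w. nice (F w)" and G: "nice G"
  and lip: "\<And>w w' x. \<bar>F w x - F w' x\<bar> \<le> norm (w - w' :: 'e::real_normed_vector) * G x"
 shows "continuous_on A (\<lambda>w. LINT x|Q. F w x)"
proof (rule continuous_on_subset [OF _ subset_UNIV], rule lipschitz_on_continuous_on, rule lipschitz_onI)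
 fix w w' :: 'e
 have "\<bar>LINT x|Q. F w x - F w' x\<bar> \<le> (LINT x|Q. \<bar>F w x - F w' x\<bar>)"
  by (rule integral_abs_bound)
 also have "... \<le> (LINT x|Q. norm (w - w') * G x)"
  using lip F G by (intro integral_mono integrable_abs integrable_mult_right nice_integrable nice_diff) auto
 also have "... = norm (w - w') * (LINT x|Q. G x)" by simp
 also have "... \<le> norm (w - w') * \<bar>LINT x|Q. G x\<bar>" by (intro mult_left_mono) auto
 finally show "dist (LINT x|Q. F w x) (LINT x|Q. F w' x) \<le> \<bar>LINT x|Q. G x\<bar> * dist w w'"
  using F nice_integrable by (simp add: dist_norm mult.commute)
qed simp

text \<open>Wald's argument, with the behaviour of the likelihood at infinity controlled by its horizon
 function \<open>\<Phi>\<close> on the directions in which \<open>S\<close> recedes.\<close>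

lemma whp_maximiser_close:
 fixes F :: "'e::euclidean_space => 'x => real"
 assumes F: "\<And>w. nice (F w)" and \<Phi>: "\<And>w. nice (\<Phi> w)" and G: "nice G"
  and lip: "\<And>w w' x. \<bar>F w x - F w' x\<bar> \<le> norm (w - w') * G x"
   "\<And>w w' x. \<bar>\<Phi> w x - \<Phi> w' x\<bar> \<le> norm (w - w') * G x"
  and hom: "\<And>a w x. 0 < a ==> \<Phi> (a *\<^sub>R w) x = a * \<Phi> w x"
  and le: "\<And>w x. F w x \<le> \<Phi> w x + c"
  and S: "closed S"
  and rec: "\<And>f a u. (\<And>n. f n \<in> S) ==> filterlim a at_top sequentially ==> (\<And>n. 0 < a n) ==>
    (\<lambda>n::nat. f n /\<^sub>R a n) \<longlonglongrightarrow> u ==> u \<noteq> 0 ==> (LINT x|Q. \<Phi> u x) < 0"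
  and less: "\<And>w. w \<in> S ==> w \<noteq> w0 ==> (LINT x|Q. F w x) < (LINT x|Q. F w0 x)"
  and r: "0 < r"
 shows "whp (\<lambda>n v. \<forall>w\<in>S. avg (F w0) n v \<le> avg (F w) n v \<longrightarrow> norm (w - w0) < r)"
proof -
 let ?E = "\<lambda>w. LINT x|Q. F w x" and ?H = "\<lambda>w. LINT x|Q. \<Phi> w x"
 have contE: "continuous_on A ?E" and contH: "continuous_on A ?H" for A
  by (rule integral_continuous_of_lipschitz [OF F G lip(1)], rule integral_continuous_of_lipschitz [OF \<Phi> G lip(2)])
 have "\<exists>k::nat. \<forall>w\<in>S. real (Suc k) \<le> norm w \<longrightarrow> ?H (w /\<^sub>R norm w) \<le> - (1 / real (Suc k))"
 proof (rule ccontr)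
  assume "\<not> ?thesis"
  then obtain f where f: "\<And>k. f k \<in> S" "\<And>k. real (Suc k) \<le> norm (f k)"
   "\<And>k. - (1 / real (Suc k)) < ?H (f k /\<^sub>R norm (f k))"
   by (metis linorder_not_less)
  have pos: "0 < norm (f k)" for k by (rule less_le_trans [OF _ f(2)]) simp
  have "f k /\<^sub>R norm (f k) \<in> sphere 0 1" for k
   using pos [of k] by simp
  then obtain u s where u: "u \<in> sphere 0 1" "strict_mono s" "(\<lambda>k. f (s k) /\<^sub>R norm (f (s k))) \<longlonglongrightarrow> u"
   using seq_compactE [OF compact_imp_seq_compact [OF compact_sphere [of 0 1]], of "\<lambda>k. f k /\<^sub>R norm (f k)"]
   unfolding comp_def by blast
  have "?H u < 0"
  proof (rule rec [of "\<lambda>k. f (s k)" "\<lambda>k. norm (f (s k))"])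
   show "filterlim (\<lambda>k. norm (f (s k))) at_top sequentially"
   proof (rule filterlim_at_top_mono [OF filterlim_real_sequentially], rule always_eventually, rule allI)
    fix k show "real k \<le> norm (f (s k))"
     using f(2) [of "s k"] seq_suble [OF u(2), of k] by linarith
   qed
  qed (use f u pos in auto)
  have lH: "(\<lambda>k. ?H (f (s k) /\<^sub>R norm (f (s k)))) \<longlonglongrightarrow> ?H u"
   using continuous_on_tendsto_compose [OF contH [of UNIV] u(3)] by simp
  have l0: "(\<lambda>k. - (1 / real (Suc (s k)))) \<longlonglongrightarrow> - 0"
   by (intro tendsto_minus LIMSEQ_subseq_LIMSEQ [OF LIMSEQ_inverse_real_of_nat u(2), unfolded comp_def inverse_eq_divide])
  have "- 0 \<le> ?H u"
   by (rule LIMSEQ_le [OF l0 lH]) (use f(3) in \<open>auto intro: less_imp_le\<close>)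
  thus False using \<open>?H u < 0\<close> by simp
 qed
 then obtain k :: nat where k: "\<And>w. w \<in> S ==> real (Suc k) \<le> norm w ==> ?H (w /\<^sub>R norm w) \<le> - (1 / real (Suc k))"
  by blast
 define \<epsilon> where "\<epsilon> = 1 / real (Suc k)"
 have \<epsilon>: "0 < \<epsilon>" by (simp add: \<epsilon>_def)
 define R where "R = max (real (Suc k)) (2 * (\<bar>c\<bar> + \<bar>?E w0\<bar> + 2) / \<epsilon>)"
 define K where "K = S \<inter> cball 0 R \<inter> {w. r \<le> norm (w - w0)}"
 have K: "compact K"
  unfolding K_def
  by (intro compact_Int_closed closed_Int_compact S compact_cball closed_Collect_le continuous_intros)
 have "\<exists>\<eta>>0. \<forall>w\<in>K. ?E w + \<eta> \<le> ?E w0"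
 proof (cases "K = {}")
  case False
  obtain wm where wm: "wm \<in> K" "\<And>w. w \<in> K ==> ?E w \<le> ?E wm"
   using continuous_attains_sup [OF K False contE] by blast
  have "?E wm < ?E w0"
   using wm(1) r by (intro less) (auto simp: K_def)
  thus ?thesis using wm(2) by (intro exI [of _ "?E w0 - ?E wm"]) auto
 qed (auto intro: exI [of _ 1])
 then obtain \<eta> where \<eta>: "0 < \<eta>" "\<And>w. w \<in> K ==> ?E w + \<eta> \<le> ?E w0" by blast
 define \<zeta> where "\<zeta> = min 1 (\<eta> / 2)"
 have \<zeta>: "0 < \<zeta>" "\<zeta> \<le> 1" "2 * \<zeta> \<le> \<eta>" using \<eta> by (auto simp: \<zeta>_def)
 have "whp (\<lambda>n v. (\<forall>w\<in>sphere 0 1. \<bar>avg (\<Phi> w) n v - ?H w\<bar> < \<epsilon> / 2) \<and>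
   (\<forall>w\<in>insert w0 K. \<bar>avg (F w) n v - ?E w\<bar> < \<zeta>) \<and> 1 \<le> n)"
  using \<epsilon> \<zeta> K by (intro whp_conj whp_large whp_uniform_avg [OF _ _ G] F \<Phi> lip) auto
 thus ?thesis
 proof (rule whp_mono, intro ballI impI)
  fix n v w
  assume *: "(\<forall>w\<in>sphere 0 1. \<bar>avg (\<Phi> w) n v - ?H w\<bar> < \<epsilon> / 2) \<and>
   (\<forall>w\<in>insert w0 K. \<bar>avg (F w) n v - ?E w\<bar> < \<zeta>) \<and> 1 \<le> n"
   and w: "w \<in> S" "avg (F w0) n v \<le> avg (F w) n v"
  have E0: "\<bar>avg (F w0) n v - ?E w0\<bar> < \<zeta>" using * by blast
  have "norm w \<le> R"
  proof (rule ccontr)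
   assume "\<not> norm w \<le> R"
   hence R: "real (Suc k) \<le> norm w" "2 * (\<bar>c\<bar> + \<bar>?E w0\<bar> + 2) / \<epsilon> < norm w"
    by (auto simp: R_def)
   have n0: "0 < norm w" by (rule less_le_trans [OF _ R(1)]) simp
   define u where "u = w /\<^sub>R norm w"
   have u: "u \<in> sphere 0 1" "w = norm w *\<^sub>R u" using n0 by (auto simp: u_def)
   have "\<bar>avg (\<Phi> u) n v - ?H u\<bar> < \<epsilon> / 2" using * u(1) by blast
   hence "avg (\<Phi> u) n v \<le> - \<epsilon> / 2"
    using k [OF w(1) R(1), folded u_def \<epsilon>_def] by linarith
   hence "avg (\<Phi> w) n v \<le> norm w * (- \<epsilon> / 2)"
    unfolding hom [OF n0, of u, folded u(2), THEN ext] avg_cmult by (intro mult_left_mono) auto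
   moreover have "avg (F w) n v \<le> avg (\<Phi> w) n v + avg (\<lambda>_. c) n v"
    unfolding avg_add [symmetric] by (intro avg_mono le)
   moreover have "2 * (\<bar>c\<bar> + \<bar>?E w0\<bar> + 2) < norm w * \<epsilon>"
    using R(2) \<epsilon> by (simp add: field_simps)
   ultimately show False
    using avg_const [of n c v] * w(2) E0 \<zeta> by (simp add: abs_if split: if_splits)
  qed
  show "norm (w - w0) < r"
  proof (rule ccontr)
   assume "\<not> norm (w - w0) < r"
   hence "w \<in> K" using \<open>norm w \<le> R\<close> w(1) by (simp add: K_def)
   hence "\<bar>avg (F w) n v - ?E w\<bar> < \<zeta>" "?E w + \<eta> \<le> ?E w0" using * \<eta> by auto
   thus False using E0 w(2) \<zeta> by linarith
  qed
 qed
qed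

end

section \<open>Log-densities as exponents of quadratics\<close>

type_synonym 'p quad = "real \<times> (real^'p) \<times> (real^'p^'p)"

definition qvec :: "real^'p => 'p::finite quad" where
 "qvec y = (1, y, \<chi> i. (y $ i) *\<^sub>R y)"

definition quad :: "'p::finite quad => real^'p => real" where
 "quad w y = w \<bullet> qvec y"

definition sym_quad :: "'p::finite quad => bool" where
 "sym_quad w \<longleftrightarrow> transpose (snd (snd w)) = snd (snd w)"

lemma quad_eq: "quad (a, b, A) y = a + b \<bullet> y + y \<bullet> (A *v y)"
 unfolding quad_def qvec_def
 by (simp add: inner_vec_def [of A] inner_vec_def [of y "A *v y"] matrix_vector_mul_component add.assoc)

lemma quad_scaleR: "quad (c *\<^sub>R w) y = c * quad w y"
 by (simp add: quad_def)

lemma quad_0 [simp]: "quad 0 y = 0"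
 by (simp add: quad_def)

lemma quad_lipschitz: "\<bar>quad w y - quad w' y\<bar> \<le> norm (w - w') * norm (qvec y)"
 unfolding quad_def inner_diff_left [symmetric] by (rule Cauchy_Schwarz_ineq2)

lemma norm_qvec_le: "norm (qvec y) \<le> 1 + norm y + (norm y)^2"
proof -
 have "norm (\<chi> i. (y $ i) *\<^sub>R y) = norm y * norm y"
  using L2_set_left_distrib [of "norm y" "\<lambda>i. norm (y $ i)" UNIV, folded norm_vec_def]
  by (simp add: norm_vec_def [of "\<chi> i. (y $ i) *\<^sub>R y"])
 thus ?thesis
  unfolding qvec_def
  by (intro order_trans [OF norm_Pair_le] order_trans [OF add_left_mono [OF norm_Pair_le]])
   (simp add: power2_eq_square)
qed

lemma poly_bounded_qvec: "poly_bounded (\<lambda>y. norm (qvec y))"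
 by (rule poly_bounded_mono [of "\<lambda>y. 1 + norm y + (norm y)^2"])
  (auto intro!: poly_bounded_intros order_trans [OF norm_qvec_le])

lemma continuous_on_qvec [continuous_intros]: "continuous_on A qvec"
 unfolding qvec_def by (intro continuous_intros)

lemma continuous_on_quad [continuous_intros]:
 "continuous_on A f ==> continuous_on A g ==> continuous_on A (\<lambda>x. quad (f x) (g x))"
 unfolding quad_def qvec_def by (intro continuous_intros)

lemma measurable_qvec [measurable]: "qvec \<in> borel_measurable borel"
 by (intro borel_measurable_continuous_onI continuous_intros)

lemma measurable_quad [measurable]: "f \<in> borel_measurable M ==> (\<lambda>x. quad w (f x)) \<in> borel_measurable M"
 unfolding quad_def by measurable

lemma quad_eq_0_imp:
 assumes "sym_quad w" "\<And>y. quad w y = 0"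
 shows "w = 0"
proof -
 obtain a b A where w: "w = (a, b, A)" by (cases w)
 have *: "a + b \<bullet> y + y \<bullet> (A *v y) = 0" for y
  using assms(2) [of y] by (simp add: w quad_eq)
 have a: "a = 0" using * [of 0] by simp
 have "b \<bullet> y = 0 \<and> y \<bullet> (A *v y) = 0" for y
  using * [of y] * [of "- y"] a by (simp add: matrix_vector_mult_uminus)
 hence b: "b = 0" and A: "\<And>y. y \<bullet> (A *v y) = 0"
  using inner_eq_zero_iff by blast+
 have "x \<bullet> (A *v y) = 0" for x y
 proof -
  have "(x + y) \<bullet> (A *v (x + y)) = x \<bullet> (A *v x) + y \<bullet> (A *v y) + 2 * (x \<bullet> (A *v y))"
   using inner_symmetric_matrix [of A y x] assms(1)
   by (simp add: w sym_quad_def matrix_vector_right_distrib inner_simps)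
  thus ?thesis using A [of "x + y"] A [of x] A [of y] by linarith
 qed
 hence "A *v y = 0" for y
  using inner_eq_zero_iff by blast
 hence "A = 0"
  by (metis matrix_eq matrix_vector_mult_0)
 thus ?thesis using a b w by (simp add: zero_prod_def)
qed

lemma transpose_eq_iff: "transpose A = (A :: real^'n^'n) \<longleftrightarrow> (\<forall>i j. A $ i $ j = A $ j $ i)"
 by (auto simp: transpose_def vec_eq_iff)

lemma closed_sym_quad: "closed {w::'p::finite quad. sym_quad w}"
 unfolding sym_quad_def transpose_eq_iff
 by (intro closed_Collect_all closed_Collect_eq continuous_intros)

lemma sym_quad_diff: "sym_quad w ==> sym_quad w' ==> sym_quad (w - w')"
 and sym_quad_scaleR: "sym_quad w ==> sym_quad (c *\<^sub>R w)"
 and sym_quad_0: "sym_quad 0"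
 by (simp_all add: sym_quad_def transpose_eq_iff)

text \<open>The logarithms of pairs of subdensities, as exponents of two quadratics.\<close>

definition sub_quads :: "('p::finite quad \<times> 'p quad) set" where
 "sub_quads = {w. sym_quad (fst w) \<and> sym_quad (snd w) \<and>
   (\<integral>\<^sup>+y. ennreal (exp (quad (fst w) y) + exp (quad (snd w) y)) \<partial>lborel) \<le> 1}"

lemma closed_sub_quads: "closed (sub_quads :: ('p::finite quad \<times> 'p quad) set)"
 unfolding closed_sequential_limits
proof (intro allI impI, elim conjE)
 fix f and l :: "'p quad \<times> 'p quad"
 let ?F = "\<lambda>w y. ennreal (exp (quad (fst w) y) + exp (quad (snd w) y))"
 assume f: "\<forall>n. f n \<in> sub_quads" "f \<longlonglongrightarrow> l"
 have "liminf (\<lambda>n. ?F (f n) y) = ?F l y" for y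
  by (intro lim_imp_Liminf tendsto_ennrealI tendsto_intros f(2) continuous_on_tendsto_compose
   [where f = "\<lambda>w. quad (fst w) y" and s = UNIV] continuous_on_tendsto_compose
   [where f = "\<lambda>w. quad (snd w) y" and s = UNIV] continuous_intros) auto
 hence "(\<integral>\<^sup>+y. ?F l y \<partial>lborel) \<le> liminf (\<lambda>n. \<integral>\<^sup>+y. ?F (f n) y \<partial>lborel)"
  using nn_integral_liminf [of "\<lambda>n. ?F (f n)" lborel] by simp
 also have "... \<le> 1"
  using f(1) by (intro Liminf_le) (auto simp: sub_quads_def)
 finally have "(\<integral>\<^sup>+y. ?F l y \<partial>lborel) \<le> 1" .
 moreover have "fst l \<in> {w. sym_quad w}" "snd l \<in> {w. sym_quad w}"
  by (rule closed_sequentially [OF closed_sym_quad _ tendsto_fst [OF f(2)]],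
    use f(1) in \<open>simp add: sub_quads_def\<close>)
   (rule closed_sequentially [OF closed_sym_quad _ tendsto_snd [OF f(2)]],
    use f(1) in \<open>simp add: sub_quads_def\<close>)
 ultimately show "l \<in> sub_quads" by (simp only: sub_quads_def mem_Collect_eq)
qed

lemma AE_lborel_closed:
 "closed {y. P y} ==> AE y in lborel. P (y::'a::euclidean_space) ==> P y"
 using mem_closed_if_AE_lebesgue [of "{y. P y}" y] AE_completion [of P lborel] by simp

lemma sub_quads_recession:
 assumes f: "\<And>n. f n \<in> sub_quads" and a: "filterlim a at_top sequentially" "\<And>n. 0 < a n"
  and lim: "(\<lambda>n. f n /\<^sub>R a n) \<longlonglongrightarrow> u"
 shows "quad (fst u) y \<le> 0" "quad (snd u) y \<le> 0"
proof -
 have main: "quad (g u) y \<le> 0"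
  if g: "linear g" and le: "\<And>w y. exp (quad (g w) y) \<le> exp (quad (fst w) y) + exp (quad (snd w) y)" for g
 proof (rule AE_lborel_closed [where P = "\<lambda>y. quad (g u) y \<le> 0"])
  show "closed {y. quad (g u) y \<le> 0}"
   by (intro closed_Collect_le continuous_intros)
  let ?F = "\<lambda>n y. ennreal (exp (quad (g (f n)) y))"
  have "(\<integral>\<^sup>+y. liminf (\<lambda>n. ?F n y) \<partial>lborel) \<le> liminf (\<lambda>n. \<integral>\<^sup>+y. ?F n y \<partial>lborel)"
   by (intro nn_integral_liminf) auto
  also have "... \<le> 1"
  proof (intro Liminf_le always_eventually allI)
   fix n
   have "(\<integral>\<^sup>+y. ?F n y \<partial>lborel) \<le> (\<integral>\<^sup>+y. ennreal (exp (quad (fst (f n)) y) + exp (quad (snd (f n)) y)) \<partial>lborel)"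
    using le by (intro nn_integral_mono ennreal_leI)
   also have "... \<le> 1" using f [of n] by (simp add: sub_quads_def)
   finally show "(\<integral>\<^sup>+y. ?F n y \<partial>lborel) \<le> 1" .
  qed simp
  finally have "(\<integral>\<^sup>+y. liminf (\<lambda>n. ?F n y) \<partial>lborel) \<noteq> \<infinity>"
   by (auto simp: top_unique)
  hence "AE y in lborel. liminf (\<lambda>n. ?F n y) \<noteq> \<infinity>"
   by (intro nn_integral_PInf_AE) auto
  thus "AE y in lborel. quad (g u) y \<le> 0"
  proof eventually_elim
   case (elim y)
   show ?case
   proof (rule ccontr)
    assume pos: "\<not> ?case"
    have "(\<lambda>n. quad (g (f n /\<^sub>R a n)) y) \<longlonglongrightarrow> quad (g u) y"
     by (intro continuous_on_tendsto_compose [where f = "\<lambda>w. quad (g w) y" and s = UNIV, OF _ lim]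
      continuous_intros linear_continuous_on linear_conv_bounded_linear [THEN iffD1] g) auto
    hence "filterlim (\<lambda>n. quad (g (f n /\<^sub>R a n)) y * a n) at_top sequentially"
     by (rule filterlim_tendsto_pos_mult_at_top) (use pos a in auto)
    moreover have "quad (g (f n /\<^sub>R a n)) y * a n = quad (g (f n)) y" for n
     using a(2) [of n] by (simp add: linear_cmul [OF g] quad_scaleR)
    ultimately have "(\<lambda>n. ?F n y) \<longlonglongrightarrow> top"
     by (simp add: ennreal_tendsto_top_eq_at_top filterlim_compose [OF exp_at_top])
    thus False
     using elim lim_imp_Liminf [of sequentially "\<lambda>n. ?F n y" top] by simp
   qed
  qed
 qed
 show "quad (fst u) y \<le> 0" "quad (snd u) y \<le> 0"
  by (intro main linear_fst linear_snd; simp)+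
qed

lemma exp_eq_one_plus_imp:
 assumes "exp u = 1 + (u::real)"
 shows "u = 0"
proof -
 have "0 \<le> 1 + u / 2" using assms exp_gt_zero [of u] by linarith
 hence "(1 + u / 2)^2 \<le> exp (u / 2) ^ 2"
  using exp_ge_add_one_self [of "u / 2"] by (intro power_mono)
 also have "... = exp u" by (simp add: exp_double [symmetric])
 finally have "u^2 \<le> 0" using assms by (simp add: power2_eq_square algebra_simps)
 thus ?thesis by simp
qed

lemma (in prob_space) expectation_le_0_if_exp_le_1:
 assumes U: "integrable M U" and e: "(\<integral>\<^sup>+x. ennreal (exp (U x)) \<partial>M) \<le> 1"
 shows "expectation U \<le> 0" "expectation U = 0 ==> AE x in M. U x = 0"
proof -
 have [measurable]: "U \<in> borel_measurable M" using U by auto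
 have I: "integrable M (\<lambda>x. exp (U x))"
  using e by (intro integrableI_nonneg) (auto simp: top_unique less_top [symmetric])
 have "ennreal (expectation (\<lambda>x. exp (U x))) \<le> ennreal 1"
  using e by (subst nn_integral_eq_integral [symmetric, OF I]) auto
 hence e1: "expectation (\<lambda>x. exp (U x)) \<le> 1"
  by (subst (asm) ennreal_le_iff) auto
 have J: "integrable M (\<lambda>x. exp (U x) - 1 - U x)" using I U by auto
 have nn: "0 \<le> exp (U x) - 1 - U x" for x using exp_ge_add_one_self [of "U x"] by linarith
 have "0 \<le> expectation (\<lambda>x. exp (U x) - 1 - U x)" using nn by (rule Bochner_Integration.integral_nonneg)
 also have "... = expectation (\<lambda>x. exp (U x)) - 1 - expectation U"
  using I U by (simp add: prob_space)
 finally show "expectation U \<le> 0" using e1 by simp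
 assume "expectation U = 0"
 hence "expectation (\<lambda>x. exp (U x) - 1 - U x) \<le> 0"
  using I U e1 by (simp add: prob_space)
 hence "expectation (\<lambda>x. exp (U x) - 1 - U x) = 0"
  using Bochner_Integration.integral_nonneg [of M "\<lambda>x. exp (U x) - 1 - U x", OF nn] by linarith
 hence "AE x in M. exp (U x) - 1 - U x = 0"
  using nn by (subst (asm) integral_nonneg_eq_0_iff_AE [OF J]) auto
 thus "AE x in M. U x = 0"
 proof eventually_elim
  case (elim x)
  show ?case by (rule exp_eq_one_plus_imp) (use elim in linarith)
 qed
qed

definition class_quad :: "'p::finite model => nat => 'p quad" where
 "class_quad \<theta> i = (let K = matrix_inv (cov \<theta>) in
   (ln (prior \<theta> i / sqrt ((2 * pi) ^ CARD('p) * det (cov \<theta>))) - (mean \<theta> i \<bullet> (K *v mean \<theta> i)) / 2,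
   K *v mean \<theta> i, - ((1 / 2) *\<^sub>R K)))"

lemma model_spaceD:
 assumes "\<theta> \<in> model_space"
 shows "pos_def (cov \<theta>)" "0 < prior \<theta> 1" "0 < prior \<theta> 2" "mean \<theta> 1 \<noteq> mean \<theta> 2"
  "transpose (matrix_inv (cov \<theta>)) = matrix_inv (cov \<theta>)" "0 < det (cov \<theta>)"
 using assms pos_def_matrix_inv [of "cov \<theta>"] pos_def_det_pos [of "cov \<theta>"]
 by (auto simp: model_space_def pos_def_def)

lemma sym_class_quad: "\<theta> \<in> model_space ==> sym_quad (class_quad \<theta> i)"
 using model_spaceD(5) [of \<theta>] by (simp add: sym_quad_def class_quad_def Let_def transpose_eq_iff)

lemma quad_completed_square:
 assumes "transpose K = K"
 shows "quad (c - (m \<bullet> (K *v m)) / 2, K *v m, - ((1 / 2) *\<^sub>R K)) y = c - ((y - m) \<bullet> (K *v (y - m))) / 2"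
proof -
 have "(- ((1 / 2) *\<^sub>R K)) *v y = - ((1 / 2) *\<^sub>R (K *v y))"
  using scaleR_matrix_vector [of "- 1 / 2" K y] by simp
 thus ?thesis
  using inner_symmetric_matrix [OF assms, of y m]
  by (simp add: quad_eq inner_simps matrix_vector_mult_diff_distrib inner_commute field_simps)
qed

lemma exp_class_quad:
 assumes \<theta>: "\<theta> \<in> model_space" and i: "i \<in> {1, 2}"
 shows "exp (quad (class_quad \<theta> i) y) = prior \<theta> i * class_density \<theta> i y"
proof -
 note \<theta> = model_spaceD [OF \<theta>]
 have "0 < prior \<theta> i / sqrt ((2 * pi) ^ CARD('a) * det (cov \<theta>))"
  using \<theta> i by auto
 thus ?thesis
  unfolding class_quad_def Let_def quad_completed_square [OF \<theta>(5)] exp_diff class_density_def mvn_density_def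
  by (simp add: exp_minus field_simps)
qed

lemma class_quads_sub_quads:
 assumes \<theta>: "\<theta> \<in> model_space"
 shows "(class_quad \<theta> 1, class_quad \<theta> 2) \<in> sub_quads"
proof -
 note \<theta>' = model_spaceD [OF \<theta>]
 have dens: "(\<integral>\<^sup>+y. ennreal (exp (quad (class_quad \<theta> i) y)) \<partial>lborel) = ennreal (prior \<theta> i)"
  if "i \<in> {1, 2}" for i
 proof -
  have "(\<integral>\<^sup>+y. ennreal (exp (quad (class_quad \<theta> i) y)) \<partial>lborel)
    = (\<integral>\<^sup>+y. ennreal (prior \<theta> i) * ennreal (class_density \<theta> i y) \<partial>lborel)"
   unfolding exp_class_quad [OF \<theta> that]
   using \<theta>' that by (intro nn_integral_cong) (auto simp: ennreal_mult' class_density_def)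
  also have "... = ennreal (prior \<theta> i) * 1"
   unfolding class_density_def by (subst nn_integral_cmult) (auto simp: nn_integral_mvn_density [OF \<theta>'(1)])
  finally show ?thesis by simp
 qed
 have "(\<integral>\<^sup>+y. ennreal (exp (quad (class_quad \<theta> 1) y) + exp (quad (class_quad \<theta> 2) y)) \<partial>lborel)
   = (\<integral>\<^sup>+y. ennreal (exp (quad (class_quad \<theta> 1) y)) \<partial>lborel)
    + (\<integral>\<^sup>+y. ennreal (exp (quad (class_quad \<theta> 2) y)) \<partial>lborel)"
  by (subst nn_integral_add [symmetric]) (auto intro!: nn_integral_cong)
 also have "... = ennreal (prior \<theta> 1 + prior \<theta> 2)"
  using \<theta>' by (simp add: dens)
 also have "prior \<theta> 1 + prior \<theta> 2 = 1" by (cases \<theta>) simp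
 finally show ?thesis
  using sym_class_quad [OF \<theta>] by (simp add: sub_quads_def)
qed

definition mech_quad :: "real \<times> real => real \<times> (real^'p) => 'p::finite quad" where
 "mech_quad \<xi> b = (fst \<xi> + snd \<xi> * (fst b)^2, (2 * snd \<xi> * fst b) *\<^sub>R snd b, \<chi> i. (snd \<xi> * snd b $ i) *\<^sub>R snd b)"

lemma quad_mech_quad: "quad (mech_quad \<xi> b) y = fst \<xi> + snd \<xi> * (discr b y)^2"
proof -
 have "(\<chi> i. (snd \<xi> * snd b $ i) *\<^sub>R snd b) *v y = (snd \<xi> * (snd b \<bullet> y)) *\<^sub>R snd b"
  by (simp add: vec_eq_iff matrix_vector_mul_component)
 thus ?thesis
  by (simp add: mech_quad_def quad_eq discr_def power2_eq_square algebra_simps inner_commute)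
qed

lemma sym_mech_quad: "sym_quad (mech_quad \<xi> b)"
 by (simp add: sym_quad_def transpose_eq_iff mech_quad_def)

text \<open>Log-likelihood of one observation and its horizon function, in terms of the two log-densities
 \<open>a\<close>, \<open>b\<close> and the logit \<open>g\<close> of the missingness probability.\<close>

definition ell_obs :: "real => real => real => real \<times> real => real" where
 "ell_obs a b g sm = (if snd sm = 1 then b + softplus (a - b) + (g - softplus g)
   else (if fst sm = 1 then a else b) - softplus g)"

definition horizon_obs :: "real => real => real => real \<times> real => real" where
 "horizon_obs a b g sm = (if snd sm = 1 then max a b + min 0 g
   else (if fst sm = 1 then a else b) - max 0 g)"

lemma ell_obs_lipschitz:
 "\<bar>ell_obs a b g sm - ell_obs a' b' g' sm\<bar> \<le> \<bar>a - a'\<bar> + 2 * \<bar>b - b'\<bar> + 2 * \<bar>g - g'\<bar>"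
 "\<bar>horizon_obs a b g sm - horizon_obs a' b' g' sm\<bar> \<le> \<bar>a - a'\<bar> + 2 * \<bar>b - b'\<bar> + 2 * \<bar>g - g'\<bar>"
 using softplus_lipschitz [of "a - b" "a' - b'"] softplus_lipschitz [of g g']
 unfolding ell_obs_def horizon_obs_def by (smt (verit))+

lemma ell_obs_le_horizon: "ell_obs a b g sm \<le> horizon_obs a b g sm + softplus 0"
proof -
 have "softplus (a - b) \<le> max 0 (a - b) + softplus 0"
 proof (cases "a \<le> b")
  case True
  hence "logistic (a - b) * (0 - (a - b)) \<ge> 0" by (intro mult_nonneg_nonneg) auto
  moreover have "max 0 (a - b) = 0" using True by simp
  ultimately show ?thesis using softplus_convex [of "a - b" 0] by linarith
 qed (use softplus_lipschitz [of "a - b" 0] in auto)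
 thus ?thesis
  using softplus_pos [of g] softplus_ge [of g] softplus_pos [of 0]
  by (auto simp: ell_obs_def horizon_obs_def)
qed

definition ell :: "'p::finite quad \<times> 'p quad \<times> 'p quad => 'p obs => real" where
 "ell w x = ell_obs (quad (fst w) (fst x)) (quad (fst (snd w)) (fst x)) (quad (snd (snd w)) (fst x)) (snd x)"

definition horizon :: "'p::finite quad \<times> 'p quad \<times> 'p quad => 'p obs => real" where
 "horizon w x = horizon_obs (quad (fst w) (fst x)) (quad (fst (snd w)) (fst x)) (quad (snd (snd w)) (fst x)) (snd x)"

lemma measurable_obs_components [measurable]:
 "(fst :: 'p::finite obs => _) \<in> borel_measurable borel"
 "(\<lambda>x::'p obs. fst (snd x)) \<in> borel_measurable borel" "(\<lambda>x::'p obs. snd (snd x)) \<in> borel_measurable borel"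
 by (intro borel_measurable_continuous_onI continuous_intros)+

lemma measurable_ell [measurable]: "ell w \<in> borel_measurable borel" "horizon w \<in> borel_measurable borel"
 unfolding ell_def horizon_def ell_obs_def horizon_obs_def by measurable

lemma norm_components_le: "norm (fst z) \<le> norm z" "norm (snd z) \<le> norm z"
 by (cases z, simp add: norm_fst_le norm_snd_le)+

lemma ell_lipschitz:
 "\<bar>ell w x - ell w' x\<bar> \<le> norm (w - w') * (5 * norm (qvec (fst x)))"
 "\<bar>horizon w x - horizon w' x\<bar> \<le> norm (w - w') * (5 * norm (qvec (fst x)))"
proof -
 let ?q = "norm (qvec (fst x))"
 have n: "norm (fst w - fst w') \<le> norm (w - w')" "norm (fst (snd w) - fst (snd w')) \<le> norm (w - w')"
  "norm (snd (snd w) - snd (snd w')) \<le> norm (w - w')"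
  using norm_components_le [of "w - w'"] norm_components_le [of "snd (w - w')"] by auto
 have "\<bar>quad u (fst x) - quad v (fst x)\<bar> \<le> norm (w - w') * ?q" if "norm (u - v) \<le> norm (w - w')" for u v
  by (rule order_trans [OF quad_lipschitz]) (intro mult_right_mono that norm_ge_zero)
 note this [OF n(1)] this [OF n(2)] this [OF n(3)]
 thus "\<bar>ell w x - ell w' x\<bar> \<le> norm (w - w') * (5 * ?q)"
  "\<bar>horizon w x - horizon w' x\<bar> \<le> norm (w - w') * (5 * ?q)"
  unfolding ell_def horizon_def
  by (auto intro!: order_trans [OF ell_obs_lipschitz(1)] order_trans [OF ell_obs_lipschitz(2)])
qed

lemma horizon_scaleR: "0 < c ==> horizon (c *\<^sub>R w) x = c * horizon w x"
 by (auto simp: horizon_def horizon_obs_def quad_scaleR algebra_simps max_mult_distrib_left min_mult_distrib_left)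

lemma poly_bounded_ell: "poly_bounded (ell w)" "poly_bounded (horizon w)"
proof -
 let ?G = "\<lambda>x::'a obs. \<bar>2 * softplus 0\<bar> + norm w * (5 * norm (qvec (fst x)))"
 have G: "poly_bounded ?G"
  by (intro poly_bounded_intros poly_bounded_compose [OF poly_bounded_qvec]
    poly_bounded_mono [OF poly_bounded_norm, of "\<lambda>x. norm (fst x)"])
   (simp add: norm_components_le)
 have "\<bar>ell 0 x\<bar> \<le> \<bar>2 * softplus 0\<bar>" "horizon 0 x = 0" for x :: "'a obs"
  using softplus_pos [of 0] by (auto simp: ell_def horizon_def ell_obs_def horizon_obs_def)
 hence "\<bar>ell w x\<bar> \<le> ?G x" "\<bar>horizon w x\<bar> \<le> ?G x" for x
  using ell_lipschitz [of w x 0] by (smt (verit) diff_zero)+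
 thus "poly_bounded (ell w)" "poly_bounded (horizon w)"
  by (auto intro!: poly_bounded_mono [OF G] intro: order_trans [OF _ abs_ge_self])
qed

lemma canonical_model_simps:
 fixes k :: "'p::finite"
 shows "prior (canonical_model D k) i = 1 / 2" "mean (canonical_model D k) 1 = class_mean D k 1"
  "mean (canonical_model D k) 2 = class_mean D k 0" "cov (canonical_model D k) = mat 1"
 by (simp_all add: canonical_model_def class_mean_def)

lemma matrix_inv_mat_1: "matrix_inv (mat 1 :: real^'n^'n) = mat 1"
 by (simp add: matrix_inv_unique)

lemma coef_canonical_model: "coef (canonical_model D k) = (0, D *\<^sub>R axis k 1)"
 unfolding coef_def Let_def canonical_model_simps matrix_inv_mat_1 class_mean_axis
 by (simp add: scaleR_add_left [symmetric])

lemma class_distr_canonical_model: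
 "class_distr (canonical_model D k) 1 = iso_normal (class_mean D k 1)"
 "class_distr (canonical_model D k) 2 = iso_normal (class_mean D k 0)"
 by (simp_all add: class_distr_def class_density_def canonical_model_simps mvn_density_iso iso_normal_def del: One_nat_def)

lemma canonical_model_space: "0 < D ==> canonical_model D k \<in> model_space"
 using pos_def_mat_1 by (auto simp: model_space_def canonical_model_def axis_eq_axis)

text \<open>The likelihood that ignores the mechanism is treated as the full one with \<open>\<xi>\<close> restricted to the
 single value \<open>0\<close>, for which the mechanism contributes a constant factor.\<close>

locale mechanism_law = canonical_law P X Q D k q
 for P :: "'w measure" and X :: "nat => 'w => 'p::finite obs" and Q D k q +
 fixes xi :: "real \<times> real" and Xi :: "(real \<times> real) set"
 assumes mech: "Xi = UNIV \<and> (\<forall>t. q t = logistic (fst xi + snd xi * (D * t)^2)) \<or> Xi = {0} \<and> xi = 0"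
begin

abbreviation "\<theta>0 \<equiv> canonical_model D k"

definition mech_quads :: "'p quad set" where
 "mech_quads = (if Xi = UNIV then {g. sym_quad g} else {0})"

definition w0 :: "'p quad \<times> 'p quad \<times> 'p quad" where
 "w0 = (class_quad \<theta>0 1, class_quad \<theta>0 2, mech_quad xi (coef \<theta>0))"

definition quads :: "('p quad \<times> 'p quad \<times> 'p quad) set" where
 "quads = {w. (fst w, fst (snd w)) \<in> sub_quads \<and> snd (snd w) \<in> mech_quads}"

lemma \<theta>0: "\<theta>0 \<in> model_space"
 by (rule canonical_model_space [OF D])

lemmas \<theta>0_simps = canonical_model_simps [of D k] matrix_inv_mat_1

lemmas coef_\<theta>0 = coef_canonical_model [of D k]

lemma exp_w0: "exp (quad (fst w0) y) = iso_normal_density (class_mean D k 1) y / 2"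
 "exp (quad (fst (snd w0)) y) = iso_normal_density (class_mean D k 0) y / 2"
 using exp_class_quad [OF \<theta>0, of 1 y] exp_class_quad [OF \<theta>0, of 2 y]
 by (simp_all add: w0_def class_density_def \<theta>0_simps mvn_density_iso del: One_nat_def)

lemma quad_g0: "quad (snd (snd w0)) y = fst xi + snd xi * (D * y $ k)^2"
 by (simp add: w0_def quad_mech_quad discr_def coef_\<theta>0 inner_axis')

lemma mech_quad_mem: "\<xi> \<in> Xi ==> mech_quad \<xi> b \<in> mech_quads"
 using mech sym_mech_quad by (auto simp: mech_quads_def mech_quad_def zero_prod_def vec_eq_iff)

lemma xi_Xi: "xi \<in> Xi" using mech by auto

lemma w0_mem: "w0 \<in> quads"
 using class_quads_sub_quads [OF \<theta>0] mech_quad_mem [OF xi_Xi] by (simp add: quads_def w0_def)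

lemma closed_quads: "closed quads"
proof -
 have "closed mech_quads" using closed_sym_quad by (auto simp: mech_quads_def)
 moreover have "quads = (\<lambda>w. (fst w, fst (snd w))) -` sub_quads \<inter> (\<lambda>w. snd (snd w)) -` mech_quads"
  by (auto simp: quads_def)
 ultimately show ?thesis
  using closed_sub_quads by (auto intro!: closed_Int closed_vimage continuous_intros)
qed

lemma nice_ell: "nice (ell w)" "nice (horizon w)"
 by (simp_all add: nice_def poly_bounded_ell)

lemma AE_Q:
 assumes AE: "AE x in Q. R x" and [measurable]: "Measurable.pred borel R"
 shows "AE y in lborel. R (y, 1, 0) \<and> R (y, 0, 0) \<and> (0 < q (y $ k) \<longrightarrow> R (y, 1, 1) \<and> R (y, 0, 1))"
proof -
 let ?F = "\<lambda>x. indicator {x. \<not> R x} x :: ennreal"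
 let ?G = "\<lambda>s y. ennreal (1 / 2) * (ennreal (q (y $ k)) * ?F (y, s, 1) + ennreal (1 - q (y $ k)) * ?F (y, s, 0))"
 have [measurable]: "(\<lambda>y. ?F (y, s, m)) \<in> borel_measurable borel" for s m :: real
  by (rule measurable_obs) measurable
 have "(\<integral>\<^sup>+x. ?F x \<partial>Q) = 0"
  using AE by (subst nn_integral_0_iff_AE) (auto simp: indicator_def)
 hence "(\<Sum>s\<in>{0,1}. \<integral>\<^sup>+y. ?G s y \<partial>iso_normal (class_mean D k s)) = 0"
  by (subst (asm) law) auto
 hence "(\<integral>\<^sup>+y. ?G s y \<partial>iso_normal (class_mean D k s)) = 0" if "s \<in> {0, 1}" for s
  using that by auto
 hence "AE y in iso_normal (class_mean D k s). ?G s y = 0" if "s \<in> {0, 1}" for s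
  using that by (subst (asm) nn_integral_0_iff_AE) auto
 hence "AE y in lborel. 0 < ennreal (iso_normal_density (class_mean D k s) y) \<longrightarrow> ?G s y = 0" if "s \<in> {0, 1}" for s
  using that unfolding iso_normal_def by (subst (asm) AE_density) auto
 hence "AE y in lborel. ?G s y = 0" if "s \<in> {0, 1}" for s
  using that by (simp only: ennreal_less_zero_iff iso_normal_density_pos simp_thms)
 from this [of 1] this [of 0] have "AE y in lborel. ?G 1 y = 0" "AE y in lborel. ?G 0 y = 0" by auto
 thus ?thesis
 proof eventually_elim
  case (elim y)
  have "0 < 1 - q (y $ k)" using q by simp
  thus ?case using elim
   by (auto simp: indicator_def ennreal_eq_0_iff split: if_splits)
 qed
qed

lemma horizon_expectation_negative:
 assumes f: "\<And>n. f n \<in> quads" and a: "filterlim a at_top sequentially" "\<And>n. 0 < a n"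
  and lim: "(\<lambda>n::nat. f n /\<^sub>R a n) \<longlonglongrightarrow> u" and u: "u \<noteq> 0"
 shows "(LINT x|Q. horizon u x) < 0"
proof (rule ccontr)
 assume neg: "\<not> ?thesis"
 let ?a = "fst u" and ?b = "fst (snd u)" and ?g = "snd (snd u)"
 have sub: "(\<lambda>n. (fst (f n), fst (snd (f n))) /\<^sub>R a n) \<longlonglongrightarrow> (?a, ?b)"
  using tendsto_fst [OF lim] tendsto_fst [OF tendsto_snd [OF lim]] by (auto intro: tendsto_Pair)
 have le: "quad ?a y \<le> 0" "quad ?b y \<le> 0" for y
  using sub_quads_recession [OF _ a sub] f by (auto simp: quads_def)
 have sym: "sym_quad ?a" "sym_quad ?b"
 proof -
  have "fst (f n /\<^sub>R a n) \<in> {w. sym_quad w}" "fst (snd (f n /\<^sub>R a n)) \<in> {w. sym_quad w}" for n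
   using f [of n] by (auto simp: quads_def sub_quads_def intro: sym_quad_scaleR)
  thus "sym_quad ?a" "sym_quad ?b"
   using closed_sequentially [OF closed_sym_quad _ tendsto_fst [OF lim]]
    closed_sequentially [OF closed_sym_quad _ tendsto_fst [OF tendsto_snd [OF lim]]] by blast+
 qed
 have "closed mech_quads" using closed_sym_quad by (auto simp: mech_quads_def)
 moreover have "v \<in> mech_quads ==> c *\<^sub>R v \<in> mech_quads" for v c
  by (simp add: mech_quads_def sym_quad_scaleR split: if_splits)
 ultimately have g: "?g \<in> mech_quads"
  by (intro closed_sequentially [OF _ _ tendsto_snd [OF tendsto_snd [OF lim]]])
   (use f in \<open>simp_all add: quads_def\<close>)
 have nonpos: "horizon u x \<le> 0" for x
  using le [of "fst x"] by (auto simp: horizon_def horizon_obs_def)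
 have "AE x in Q. horizon u x = 0"
 proof -
  have "(LINT x|Q. - horizon u x) = 0"
   using neg integral_nonneg_AE [of "\<lambda>x. - horizon u x" Q] nonpos by simp
  thus ?thesis
   using nonpos by (subst (asm) integral_nonneg_eq_0_iff_AE) (auto intro!: nice_integrable nice_ell)
 qed
 hence "AE y in lborel. horizon u (y, 1, 0) = 0 \<and> horizon u (y, 0, 0) = 0 \<and>
   (0 < q (y $ k) \<longrightarrow> horizon u (y, 1, 1) = 0 \<and> horizon u (y, 0, 1) = 0)"
  by (rule AE_Q) measurable
 hence "AE y in lborel. quad ?a y = 0 \<and> quad ?b y = 0 \<and> quad ?g y = 0"
 proof eventually_elim
  case (elim y)
  hence ab: "quad ?a y = 0" "quad ?b y = 0" "quad ?g y \<le> 0"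
   using le [of y] by (auto simp: horizon_def horizon_obs_def max_def split: if_splits)
  have "quad ?g y = 0"
  proof (cases "Xi = UNIV")
   case True
   hence "0 < q (y $ k)" using mech by auto
   thus ?thesis using elim ab by (auto simp: horizon_def horizon_obs_def min_def split: if_splits)
  qed (use g in \<open>simp add: mech_quads_def\<close>)
  thus ?case using ab by simp
 qed
 hence zero: "quad ?a y = 0 \<and> quad ?b y = 0 \<and> quad ?g y = 0" for y
  by (rule AE_lborel_closed [rotated]) (intro closed_Collect_conj closed_Collect_eq continuous_intros)
 moreover have "sym_quad ?g" using g sym_quad_0 by (simp add: mech_quads_def split: if_splits)
 ultimately have "?a = 0" "?b = 0" "?g = 0" using sym by (auto intro: quad_eq_0_imp)
 thus False using u by (simp add: prod_eq_iff)
qed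

lemma nn_integral_likelihood_ratio:
 assumes w: "w \<in> quads"
 shows "(\<integral>\<^sup>+x. ennreal (exp (ell w x - ell w0 x)) \<partial>Q) \<le> 1"
proof -
 let ?e = "\<lambda>w x. exp (ell w x - ell w0 x)"
 let ?H = "\<lambda>s y. q (y $ k) * ?e w (y, s, 1) + (1 - q (y $ k)) * ?e w (y, s, 0)"
 let ?F = "\<lambda>y. exp (quad (fst w) y) + exp (quad (fst (snd w)) y)"
 let ?d = "\<lambda>s y. iso_normal_density (class_mean D k s) y / 2"
 have [measurable]: "(\<lambda>y. ?e w (y, s, m)) \<in> borel_measurable borel" for s m
  by (rule measurable_obs) measurable
 have "(\<integral>\<^sup>+x. ennreal (?e w x) \<partial>Q) = (\<Sum>s\<in>{0,1}. \<integral>\<^sup>+y. ennreal (1 / 2) * (ennreal (q (y $ k)) * ennreal (?e w (y, s, 1))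
   + ennreal (1 - q (y $ k)) * ennreal (?e w (y, s, 0))) \<partial>iso_normal (class_mean D k s))"
  by (subst law) auto
 also have "... = (\<Sum>s\<in>{0,1}. \<integral>\<^sup>+y. ennreal (?d s y * ?H s y) \<partial>lborel)"
  unfolding iso_normal_def
 proof (intro sum.cong refl, subst nn_integral_density)
  fix s :: real
  show "(\<integral>\<^sup>+y. ennreal (iso_normal_density (class_mean D k s) y) * (ennreal (1 / 2) * (ennreal (q (y $ k)) * ennreal (?e w (y, s, 1))
   + ennreal (1 - q (y $ k)) * ennreal (?e w (y, s, 0)))) \<partial>lborel) = (\<integral>\<^sup>+y. ennreal (?d s y * ?H s y) \<partial>lborel)"
  proof (intro nn_integral_cong)
   fix y
   have "ennreal e * (ennreal h * (ennreal a * ennreal u + ennreal b * ennreal v)) = ennreal (e * h * (a * u + b * v))"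
    if "0 \<le> e" "0 \<le> h" "0 \<le> a" "0 \<le> b" "0 \<le> u" "0 \<le> v" for e h a b u v
    using that by (simp add: ennreal_mult [symmetric] ennreal_plus [symmetric] mult.assoc del: ennreal_plus)
   from this [of "iso_normal_density (class_mean D k s) y" "1 / 2" "q (y $ k)" "1 - q (y $ k)"]
   show "ennreal (iso_normal_density (class_mean D k s) y) * (ennreal (1 / 2) * (ennreal (q (y $ k)) * ennreal (?e w (y, s, 1))
    + ennreal (1 - q (y $ k)) * ennreal (?e w (y, s, 0)))) = ennreal (?d s y * ?H s y)"
    using q q_le_1 by simp
  qed
 qed auto
 also have "... = (\<integral>\<^sup>+y. ennreal (?d 1 y * ?H 1 y + ?d 0 y * ?H 0 y) \<partial>lborel)"
  using q q_le_1 by (subst ennreal_plus) (auto simp: nn_integral_add add.commute)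
 also have "... = (\<integral>\<^sup>+y. ennreal (?F y) \<partial>lborel)"
 proof (intro nn_integral_cong arg_cong [where f = ennreal])
  fix y
  define a b g a0 b0 g0 where "a = quad (fst w) y" and "b = quad (fst (snd w)) y" and "g = quad (snd (snd w)) y"
   and "a0 = quad (fst w0) y" and "b0 = quad (fst (snd w0)) y" and "g0 = quad (snd (snd w0)) y"
  have lse: "exp (v + softplus (u - v)) = exp u + exp v" for u v :: real
   unfolding ln_add_exp [symmetric] by (simp add: add_pos_pos)
  have lg: "exp (g - softplus g) = logistic g" "exp (- softplus g) = 1 - logistic g" for g
   unfolding ln_logistic [symmetric] ln_one_minus_logistic [symmetric] by simp_all
  have e1: "?e w (y, s, 1) = (exp a + exp b) / (exp a0 + exp b0) * (logistic g / logistic g0)" for s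
  proof -
   have "?e w (y, s, 1) = exp (b + softplus (a - b)) * exp (g - softplus g)
     / (exp (b0 + softplus (a0 - b0)) * exp (g0 - softplus g0))"
    by (simp add: ell_def ell_obs_def a_def b_def g_def a0_def b0_def g0_def exp_diff exp_add)
   thus ?thesis unfolding lse lg by simp
  qed
  have e0: "?e w (y, s, 0) = (if s = 1 then exp a / exp a0 else exp b / exp b0) * ((1 - logistic g) / (1 - logistic g0))" for s
  proof -
   have "?e w (y, s, 0) = (if s = 1 then exp a / exp a0 else exp b / exp b0) * (exp (- softplus g) / exp (- softplus g0))"
    by (simp add: ell_def ell_obs_def a_def b_def g_def a0_def b0_def g0_def algebra_simps flip: exp_diff exp_add)
   thus ?thesis unfolding lg .
  qed
  have d: "?d 1 y = exp a0" "?d 0 y = exp b0"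
   by (simp_all add: exp_w0 a0_def b0_def)
  have nz: "logistic g0 \<noteq> 0" "logistic g0 \<noteq> 1"
   using less_imp_neq [OF logistic_pos, of g0] less_imp_neq [OF logistic_less_1, of g0] by simp_all
  have qg: "q (y $ k) * (logistic g / logistic g0) = logistic g \<and>
    (1 - q (y $ k)) * ((1 - logistic g) / (1 - logistic g0)) = 1 - logistic g \<or> logistic g = logistic g0"
   using mech
  proof
   assume "Xi = UNIV \<and> (\<forall>t. q t = logistic (fst xi + snd xi * (D * t)^2))"
   hence "q (y $ k) = logistic g0" by (simp add: g0_def quad_g0)
   thus ?thesis using nz by simp
  next
   assume *: "Xi = {0} \<and> xi = 0"
   hence "Xi \<noteq> UNIV" using UNIV_I [of "(1, 1) :: real \<times> real"] by (auto simp: zero_prod_def)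
   hence "snd (snd w) = 0" "snd (snd w0) = 0" using w w0_mem by (simp_all add: quads_def mech_quads_def)
   thus ?thesis by (simp add: g_def g0_def)
  qed
  have p: "exp a0 \<noteq> 0" "exp b0 \<noteq> 0" "exp a0 + exp b0 \<noteq> 0"
   using add_pos_pos [OF exp_gt_zero exp_gt_zero, of a0 b0] by auto
  have alg: "A0 * (qq * ((A + B) / (A0 + B0) * L1) + (1 - qq) * (A / A0 * L2)) + B0 * (qq * ((A + B) / (A0 + B0) * L1) + (1 - qq) * (B / B0 * L2))
    = (A + B) * (qq * L1 + (1 - qq) * L2)" if "A0 \<noteq> 0" "B0 \<noteq> 0" "A0 + B0 \<noteq> 0" for A B A0 B0 qq L1 L2 :: real
   using that by (simp add: divide_simps) (simp add: algebra_simps)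
  have "q (y $ k) * (logistic g / logistic g0) + (1 - q (y $ k)) * ((1 - logistic g) / (1 - logistic g0)) = 1"
   using qg nz by auto
  thus "?d 1 y * ?H 1 y + ?d 0 y * ?H 0 y = ?F y"
   by (simp only: d e1 e0 alg [OF p] if_True if_False zero_neq_one a_def [symmetric] b_def [symmetric] mult_1_right refl)
 qed
 also have "... \<le> 1" using w by (simp add: quads_def sub_quads_def)
 finally show ?thesis .
qed

lemma expected_ell_less:
 assumes w: "w \<in> quads" "w \<noteq> w0"
 shows "(LINT x|Q. ell w x) < (LINT x|Q. ell w0 x)"
proof (rule ccontr)
 assume neg: "\<not> ?thesis"
 interpret Q: prob_space Q by (rule prob_space_Q)
 let ?U = "\<lambda>x. ell w x - ell w0 x"
 have U: "integrable Q ?U" by (intro nice_integrable nice_diff nice_ell)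
 have "(LINT x|Q. ?U x) = (LINT x|Q. ell w x) - (LINT x|Q. ell w0 x)"
  by (intro Bochner_Integration.integral_diff nice_integrable nice_ell)
 hence "(LINT x|Q. ?U x) = 0"
  using neg Q.expectation_le_0_if_exp_le_1(1) [OF U nn_integral_likelihood_ratio [OF w(1)]] by linarith
 hence "AE x in Q. ?U x = 0"
  by (rule Q.expectation_le_0_if_exp_le_1(2) [OF U nn_integral_likelihood_ratio [OF w(1)]])
 hence "AE y in lborel. ?U (y, 1, 0) = 0 \<and> ?U (y, 0, 0) = 0 \<and>
   (0 < q (y $ k) \<longrightarrow> ?U (y, 1, 1) = 0 \<and> ?U (y, 0, 1) = 0)"
  by (rule AE_Q) measurable
 hence "AE y in lborel. quad (fst (w - w0)) y = 0 \<and> quad (fst (snd (w - w0))) y = 0 \<and> quad (snd (snd (w - w0))) y = 0"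
 proof eventually_elim
  case (elim y)
  have df: "quad (v - v') y = quad v y - quad v' y" for v v' by (simp add: quad_def inner_diff_left)
  have g: "quad (snd (snd w)) y = quad (snd (snd w0)) y"
  proof (cases "Xi = UNIV")
   case True
   hence "0 < q (y $ k)" using mech by auto
   hence eqs: "?U (y, 1, 0) = 0" "?U (y, 0, 0) = 0" "?U (y, 1, 1) = 0" using elim by auto
   hence "quad (fst w) y - quad (fst (snd w)) y = quad (fst w0) y - quad (fst (snd w0)) y"
    by (simp add: ell_def ell_obs_def)
   thus ?thesis using eqs by (simp add: ell_def ell_obs_def)
  next
   case False
   thus ?thesis using w(1) w0_mem by (simp add: quads_def mech_quads_def)
  qed
  thus ?case using elim by (simp add: df ell_def ell_obs_def)
 qed
 hence zero: "quad (fst (w - w0)) y = 0 \<and> quad (fst (snd (w - w0))) y = 0 \<and> quad (snd (snd (w - w0))) y = 0" for y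
  by (rule AE_lborel_closed [rotated]) (intro closed_Collect_conj closed_Collect_eq continuous_intros)
 have "sym_quad (fst (w - w0))" "sym_quad (fst (snd (w - w0)))" "sym_quad (snd (snd (w - w0)))"
  using w(1) w0_mem sym_quad_0
  by (auto simp: quads_def sub_quads_def mech_quads_def intro!: sym_quad_diff split: if_splits)
 hence "fst (w - w0) = 0" "fst (snd (w - w0)) = 0" "snd (snd (w - w0)) = 0"
  by (intro quad_eq_0_imp; use zero in blast)+
 thus False using w(2) by (simp add: prod_eq_iff)
qed

theorem whp_quads_close:
 assumes r: "0 < r"
 shows "whp (\<lambda>n v. \<forall>w\<in>quads. avg (ell w0) n v \<le> avg (ell w) n v \<longrightarrow> norm (w - w0) < r)"
proof (rule whp_maximiser_close [where \<Phi> = horizon and G = "\<lambda>x. 5 * norm (qvec (fst x))" and c = "softplus 0"])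
 have "poly_bounded (\<lambda>x::'p obs. 5 * norm (qvec (fst x)))"
  by (intro poly_bounded_intros poly_bounded_compose [OF poly_bounded_qvec]
    poly_bounded_mono [OF poly_bounded_norm, of "\<lambda>x. norm (fst x)"])
   (simp add: norm_components_le)
 thus "nice (\<lambda>x::'p obs. 5 * norm (qvec (fst x)))"
  by (simp add: nice_def)
 show "ell w x \<le> horizon w x + softplus 0" for w :: "'p quad \<times> 'p quad \<times> 'p quad" and x
  unfolding ell_def horizon_def by (rule ell_obs_le_horizon)
qed (use r in \<open>auto intro: nice_ell ell_lipschitz horizon_scaleR closed_quads horizon_expectation_negative expected_ell_less\<close>)

end

section \<open>Scores and information\<close>

lemma jet_fst:
 fixes F :: "'e::euclidean_space => 'x::euclidean_space => real" and u :: "'d::euclidean_space"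
 assumes "jet t F F'"
 shows "jet (t, u) (\<lambda>s. F (fst s)) (\<lambda>x h. F' x (fst h))"
proof -
 obtain G where "jet_bound t F F' G"
  using assms by (auto simp: jet_def)
 note G = jet_boundD [OF this]
 show ?thesis
 proof (rule jetI [of _ _ _ G])
  show "linear (\<lambda>h. F' x (fst h))" for x
   using linear_compose [OF linear_fst jetD(1) [OF assms]] by (simp add: comp_def)
  fix x and h :: "'e \<times> 'd"
  show "\<bar>F' x (fst h)\<bar> \<le> G x * norm h"
   by (rule order_trans [OF G(3)]) (intro mult_left_mono norm_components_le G)
  assume "norm h \<le> 1"
  hence "norm (fst h) \<le> 1" using norm_components_le(1) [of h] by linarith
  from G(4) [OF this, of x]
  have "\<bar>F (t + fst h) x - F t x - F' x (fst h)\<bar> \<le> G x * (norm (fst h))^2" .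
  also have "... \<le> G x * (norm h)^2"
   by (intro mult_left_mono power_mono norm_components_le G norm_ge_zero)
  finally show "\<bar>F (fst ((t, u) + h)) x - F (fst (t, u)) x - F' x (fst h)\<bar> \<le> G x * (norm h)^2"
   by simp
 qed (use G jetD(2,3) [OF assms] in auto)
qed

lemma negative_definite_coercive:
 fixes B :: "'v::euclidean_space => 'e::euclidean_space => real"
 assumes lin: "\<And>v. linear (B v)" "\<And>h. linear (\<lambda>v. B v h)" "linear T"
  and W: "closed W" "\<And>c h. h \<in> W ==> c *\<^sub>R h \<in> W"
  and neg: "\<And>h. h \<in> W ==> h \<noteq> 0 ==> B (T h) h < 0"
 obtains \<kappa> where "0 < \<kappa>" "\<And>h. h \<in> W ==> B (T h) h \<le> - \<kappa> * (norm h)^2"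
proof -
 have B: "B (T h) h = (\<Sum>b\<in>Basis. (T h \<bullet> b) * B b h)" for h
  by (rule linear_sum_Basis [OF lin(2)])
 have cont: "continuous_on A (\<lambda>h. B (T h) h)" for A
  unfolding B
  by (intro continuous_intros linear_continuous_on linear_conv_bounded_linear [THEN iffD1] lin)
 have hom: "B (T (c *\<^sub>R h)) (c *\<^sub>R h) = c^2 * B (T h) h" for c h
  by (simp add: linear_cmul [OF lin(1)] linear_cmul [OF lin(2)] linear_cmul [OF lin(3)] power2_eq_square)
 let ?S = "W \<inter> sphere 0 1"
 have "\<exists>\<kappa>>0. \<forall>h\<in>?S. B (T h) h \<le> - \<kappa>"
 proof (cases "?S = {}")
  case False
  obtain m where m: "m \<in> ?S" "\<And>h. h \<in> ?S ==> B (T h) h \<le> B (T m) m"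
   using continuous_attains_sup [OF closed_Int_compact [OF W(1) compact_sphere] False cont] by blast
  hence "m \<in> W" "m \<noteq> 0" by auto
  thus ?thesis using neg [of m] m(2) by (intro exI [of _ "- B (T m) m"]) auto
 qed (auto intro: exI [of _ 1])
 then obtain \<kappa> where \<kappa>: "0 < \<kappa>" "\<And>h. h \<in> ?S ==> B (T h) h \<le> - \<kappa>" by blast
 show thesis
 proof (rule that [OF \<kappa>(1)])
  fix h assume h: "h \<in> W"
  show "B (T h) h \<le> - \<kappa> * (norm h)^2"
  proof (cases "h = 0")
   case True
   thus ?thesis using hom [of 0 0] by simp
  next
   case False
   define g where "g = (1 / norm h) *\<^sub>R h"
   have "g \<in> ?S" using h W(2) False by (simp add: g_def)
   hence "(norm h)^2 * B (T g) g \<le> (norm h)^2 * - \<kappa>" using \<kappa>(2) by (intro mult_left_mono) auto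
   moreover have "h = norm h *\<^sub>R g" using False by (simp add: g_def)
   ultimately show ?thesis using hom [of "norm h" g] by (simp add: mult.commute)
  qed
 qed
qed

context mechanism_law
begin

definition xi_dir :: "real \<times> real => real \<times> real" where
 "xi_dir z = (if Xi = UNIV then z else 0)"

definition mech_logit :: "'p par \<times> (real \<times> real) => real^'p => real" where
 "mech_logit u y = fst (snd u) + snd (snd u) * (log_odds (fst u) y)^2"

definition mech_dir :: "'p par \<times> (real \<times> real) => 'p par \<times> (real \<times> real) => real^'p => real" where
 "mech_dir v u y = fst (xi_dir (snd v)) + snd (xi_dir (snd v)) * (log_odds (fst u) y)^2
   + 2 * snd (snd u) * (log_odds (fst u) y * score_diff (fst v) (fst u) y)"

definition score :: "'p par \<times> (real \<times> real) => 'p par \<times> (real \<times> real) => 'p obs => real" where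
 "score v u x = score_ig (fst v) (fst u) x
   + (snd (snd x) - logistic (mech_logit u (fst x))) * mech_dir v u (fst x)"

definition dmech_logit :: "real^'p => 'p par \<times> (real \<times> real) => real" where
 "dmech_logit y h = fst (snd h) + (snd (snd h) * (D * y $ k)^2 + snd xi * (2 * (D * y $ k) * dlog_odds D k y (fst h)))"

definition dmech_dir :: "'p par \<times> (real \<times> real) => real^'p => 'p par \<times> (real \<times> real) => real" where
 "dmech_dir v y h = snd (xi_dir (snd v)) * (2 * (D * y $ k) * dlog_odds D k y (fst h))
   + 2 * (snd (snd h) * (D * y $ k * score_diff (fst v) t0 y)
    + snd xi * (dlog_odds D k y (fst h) * score_diff (fst v) t0 y
     + D * y $ k * (dscore1 D k (fst v) y (fst h) - dscore2 D k (fst v) y (fst h))))"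

abbreviation "q0 y \<equiv> logistic (fst xi + snd xi * (D * y $ k)^2)"

definition dscore :: "'p par \<times> (real \<times> real) => 'p obs => 'p par \<times> (real \<times> real) => real" where
 "dscore v x h = dscore_ig D k (fst v) x (fst h)
   - q0 (fst x) * (1 - q0 (fst x)) * dmech_logit (fst x) h * mech_dir v (t0, xi) (fst x)
   + (snd (snd x) - q0 (fst x)) * dmech_dir v (fst x) h"

lemma mech_logit_0: "mech_logit (t0, xi) y = fst xi + snd xi * (D * y $ k)^2"
 by (simp add: mech_logit_def log_odds_par0)

lemma jet_mech_logit: "jet (t0, xi) (\<lambda>u x. mech_logit u (fst x)) (\<lambda>x::'p obs. dmech_logit (fst x))"
proof -
 have l: "linear (\<lambda>u::'p par \<times> (real \<times> real). fst (snd u))" "linear (\<lambda>u::'p par \<times> (real \<times> real). snd (snd u))"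
  by (auto intro!: linearI)
 show ?thesis
  by (rule jet_cong [OF jet_add [OF jet_param [OF l(1)] jet_mult [OF jet_param [OF l(2)]
    jet_mult [OF jet_fst [OF jet_log_odds] jet_fst [OF jet_log_odds]]]]])
   (simp_all add: mech_logit_def dmech_logit_def log_odds_par0 power2_eq_square algebra_simps)
qed

lemma jet_mech_dir: "jet (t0, xi) (\<lambda>u x. mech_dir v u (fst x)) (\<lambda>x::'p obs. dmech_dir v (fst x))"
proof -
 have l: "linear (\<lambda>u::'p par \<times> (real \<times> real). snd (snd u))"
  by (auto intro!: linearI)
 show ?thesis
  by (rule jet_cong [OF jet_add [OF jet_add [OF jet_const [of _ "fst (xi_dir (snd v))"]
     jet_cmult [where c = "snd (xi_dir (snd v))", OF jet_mult [OF jet_fst [OF jet_log_odds] jet_fst [OF jet_log_odds]]]]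
    jet_mult [OF jet_cmult [where c = 2, OF jet_param [OF l]]
     jet_mult [OF jet_fst [OF jet_log_odds] jet_fst [OF jet_score_diff [where v = "fst v"]]]]]])
   (simp_all add: mech_dir_def dmech_dir_def log_odds_par0 power2_eq_square algebra_simps)
qed

lemma jet_score: "jet (t0, xi) (score v) (dscore v)"
proof -
 have l: "linear (\<lambda>u::'p par \<times> (real \<times> real). snd (snd u))"
  by (auto intro!: linearI)
 show ?thesis
  by (rule jet_cong [OF jet_add [OF jet_fst [OF jet_score_ig [where v = "fst v"]]
    jet_mult [OF jet_diff [OF jet_obs_coord(2) jet_logistic [OF jet_mech_logit]] jet_mech_dir [where v = v]]]])
   (simp_all add: score_def dscore_def mech_logit_0)
qed

lemma integral_Q_no_class:
 assumes "nice F" "\<And>y s m. F (y, s, m) = A y + m * B y"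
 shows "(LINT x|Q. F x) = EY (\<lambda>y. A y + q (y $ k) * B y)"
 unfolding integral_Q_EY [OF assms(1)] obs_given_y_def assms(2)
 by (rule arg_cong [of _ _ EY]) (simp add: fun_eq_iff algebra_simps)

lemma EY_eq_0: "(\<And>y. g y = 0) ==> EY g = 0"
 by (simp add: EY_def)

lemma mech_cases:
 obtains "Xi = UNIV" "\<And>y. q (y $ k) = q0 y" | "Xi = {0}" "xi = 0" "\<And>z. xi_dir z = 0"
proof (cases "Xi = UNIV")
 case True
 thus ?thesis using mech that(1) by (auto simp: zero_prod_def)
next
 case False
 hence "xi_dir z = 0" for z by (simp add: xi_dir_def)
 thus ?thesis using False mech that(2) by blast
qed

definition dir_space :: "('p par \<times> (real \<times> real)) set" where
 "dir_space = {h. transpose (par_K (fst h)) = par_K (fst h) \<and> snd h \<in> Xi}"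

lemma mech_residual:
 "(q (y $ k) - q0 y) * mech_dir v (t0, xi) y = 0"
 "h \<in> dir_space ==> (q (y $ k) - q0 y) * dmech_dir v y h = 0"
proof -
 have "(\<forall>y. q (y $ k) - q0 y = 0) \<or> (Xi = {0} \<and> xi = 0 \<and> xi_dir (snd v) = 0)"
  by (rule mech_cases) simp_all
 thus "(q (y $ k) - q0 y) * mech_dir v (t0, xi) y = 0"
  "h \<in> dir_space ==> (q (y $ k) - q0 y) * dmech_dir v y h = 0"
  unfolding mech_dir_def dmech_dir_def dir_space_def by auto
qed

lemma nice_mech:
 "nice (\<lambda>x. q0 (fst x) * (1 - q0 (fst x)) * dmech_logit (fst x) h)"
 "nice (\<lambda>x. mech_dir v (t0, xi) (fst x))" "nice (\<lambda>x. dmech_dir v (fst x) h)"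
 "nice (\<lambda>x. snd (snd x) - q0 (fst x))"
 using jet_nice [OF jet_logistic [OF jet_mech_logit]] jet_nice [OF jet_mech_dir]
  jet_nice(1) [OF jet_diff [OF jet_obs_coord(2) jet_logistic [OF jet_mech_logit]]]
 by (simp_all add: mech_logit_0)

lemma integral_score_zero: "(LINT x|Q. score v (t0, xi) x) = 0"
proof -
 let ?F = "\<lambda>x. (snd (snd x) - q0 (fst x)) * mech_dir v (t0, xi) (fst x)"
 have n: "nice ?F" by (intro nice_mult nice_mech)
 have "(LINT x|Q. ?F x) = EY (\<lambda>y. - (q0 y * mech_dir v (t0, xi) y) + q (y $ k) * mech_dir v (t0, xi) y)"
  by (rule integral_Q_no_class [OF n]) (simp add: algebra_simps)
 also have "... = 0"
  by (rule EY_eq_0, use mech_residual(1) [of _ v] in \<open>simp add: left_diff_distrib del: mult_eq_0_iff\<close>)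
 finally show ?thesis
  using integral_score_ig_zero [of "fst v"] nice_integrable [OF n] nice_integrable [OF jet_nice(1) [OF jet_score_ig]]
  by (simp add: score_def mech_logit_0)
qed

lemma integral_dscore:
 assumes h: "h \<in> dir_space"
 shows "(LINT x|Q. dscore v x h) = (LINT x|Q. dscore_ig D k (fst v) x (fst h))
   - EY (\<lambda>y. q0 y * (1 - q0 y) * dmech_logit y h * mech_dir v (t0, xi) y)"
proof -
 let ?A = "\<lambda>x. dscore_ig D k (fst v) x (fst h)"
 let ?B = "\<lambda>x. q0 (fst x) * (1 - q0 (fst x)) * dmech_logit (fst x) h * mech_dir v (t0, xi) (fst x)"
 let ?C = "\<lambda>x. (snd (snd x) - q0 (fst x)) * dmech_dir v (fst x) h"
 have n: "nice ?A" "nice ?B" "nice ?C"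
  by (rule jet_nice(2) [OF jet_score_ig], (intro nice_mult nice_mech)+)
 note i = n [THEN nice_integrable]
 have "(LINT x|Q. ?C x) = EY (\<lambda>y. - (q0 y * dmech_dir v y h) + q (y $ k) * dmech_dir v y h)"
  by (rule integral_Q_no_class [OF n(3)]) (simp add: algebra_simps)
 also have "... = 0"
  by (rule EY_eq_0, use mech_residual(2) [OF h, of _ v] in \<open>simp add: left_diff_distrib del: mult_eq_0_iff\<close>)
 finally have C: "(LINT x|Q. ?C x) = 0" .
 have B: "(LINT x|Q. ?B x) = EY (\<lambda>y. q0 y * (1 - q0 y) * dmech_logit y h * mech_dir v (t0, xi) y)"
  using integral_Q_no_class [OF n(2), of "\<lambda>y. q0 y * (1 - q0 y) * dmech_logit y h * mech_dir v (t0, xi) y" "\<lambda>_. 0"] by simp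
 have "(LINT x|Q. dscore v x h) = (LINT x|Q. ?A x) - (LINT x|Q. ?B x) + (LINT x|Q. ?C x)"
  unfolding dscore_def using i by (simp only: Bochner_Integration.integral_add Bochner_Integration.integral_diff
   Bochner_Integration.integrable_diff)
 thus ?thesis using B C by simp
qed

definition mech_weight :: "real => real" where
 "mech_weight t = logistic (fst xi + snd xi * (D * t)^2) * (1 - logistic (fst xi + snd xi * (D * t)^2))"

definition mech_info :: real where
 "mech_info = ey (\<lambda>t. 4 * (snd xi)^2 * (D * t)^2 * mech_weight t)"

lemma nice_mech_weight: "nice1 mech_weight"
proof -
 have [measurable]: "mech_weight \<in> borel_measurable borel"
  unfolding mech_weight_def [abs_def] by measurable
 have "\<bar>mech_weight t\<bar> \<le> 1" for t
  unfolding mech_weight_def using logistic_variance_le by (simp add: abs_mult)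
 thus ?thesis by (auto simp: nice1_def intro: poly_bounded_bounded)
qed

lemma mech_dir_eff: "x $ k = 0 ==> mech_dir (eff_dir D k x0 x, 0) (t0, xi) y = 2 * snd xi * (D * y $ k) * (x0 + x \<bullet> y)"
 by (simp add: mech_dir_def log_odds_par0 score_diff_eff_dir [OF _ D] xi_dir_def)

lemma integral_dscore_eff:
 assumes x: "x $ k = 0" and h: "h \<in> dir_space"
 shows "(LINT z|Q. dscore (eff_dir D k x0 x, 0) z h)
  = - (1 / (4 + D^2) - info_loss + mech_info) * (x0 * dcoef0 D k (fst h) + x \<bullet> dcoef1 D k (fst h))"
proof -
 have sym: "transpose (par_K (fst h)) = par_K (fst h)" using h by (simp add: dir_space_def)
 let ?a = "dcoef0 D k (fst h)" and ?w = "dcoef1 D k (fst h)"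
 define \<phi> where "\<phi> t = mech_weight t * (fst (snd h) + snd (snd h) * (D * t)^2) * (2 * snd xi * D * t)" for t
 define \<psi> where "\<psi> t = 4 * (snd xi)^2 * (D * t)^2 * mech_weight t" for t
 have n: "nice1 \<phi>" "nice1 \<psi>"
  unfolding \<phi>_def [abs_def] \<psi>_def [abs_def] by (intro nice1_intros nice_mech_weight)+
 have odd: "\<phi> (- t) = - \<phi> t" "\<psi> (- t) = \<psi> t" for t
  by (simp_all add: \<phi>_def \<psi>_def mech_weight_def)
 have "EY (\<lambda>y. q0 y * (1 - q0 y) * dmech_logit y h * mech_dir (eff_dir D k x0 x, 0) (t0, xi) y)
   = EY (\<lambda>y. (x0 * \<phi> (y $ k) + \<phi> (y $ k) * (x \<bullet> y)) + \<psi> (y $ k) * ((x0 + x \<bullet> y) * (?a + ?w \<bullet> y)))"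
  unfolding mech_dir_eff [OF x] dmech_logit_def dlog_odds_symmetric [OF sym] \<phi>_def \<psi>_def mech_weight_def
  by (rule arg_cong [of _ _ EY]) (simp add: fun_eq_iff power2_eq_square algebra_simps)
 also have "... = (x0 * EY (\<lambda>y. \<phi> (y $ k)) + EY (\<lambda>y. \<phi> (y $ k) * (x \<bullet> y))) + EY (\<lambda>y. \<psi> (y $ k) * ((x0 + x \<bullet> y) * (?a + ?w \<bullet> y)))"
  by (subst EY_add; (intro niceY_intros niceY_coord n)?)+ (simp add: EY_cmult)
 also have "... = (x0 * ?a + x \<bullet> ?w) * mech_info"
  unfolding EY_coord [OF n(1)] ey_odd [OF n(1) odd(1)] EY_orthogonal(1) [OF n(1) x]
   EY_affine_product [OF n(2) odd(2) x] by (simp add: mech_info_def \<psi>_def [abs_def])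
 finally show ?thesis
  unfolding integral_dscore [OF h] fst_conv integral_dscore_eff_dir [OF x sym] by (simp add: algebra_simps)
qed

lemma integral_score_eff_square:
 assumes x: "x $ k = 0"
 shows "(LINT z|Q. (score (eff_dir D k x0 x, 0) (t0, xi) z)^2)
  = (1 / (4 + D^2) - info_loss + mech_info) * (x0^2 + x \<bullet> x)"
proof -
 let ?v = "eff_dir D k x0 x"
 define \<psi> where "\<psi> t = 4 * (snd xi)^2 * (D * t)^2 * mech_weight t" for t
 have n: "nice1 \<psi>" unfolding \<psi>_def [abs_def] by (intro nice1_intros nice_mech_weight)
 have even: "\<psi> (- t) = \<psi> t" for t by (simp add: \<psi>_def mech_weight_def)
 let ?F = "\<lambda>z. (score (?v, 0) (t0, xi) z)^2 - (score_ig ?v t0 z)^2"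
 have nF: "nice (\<lambda>z. (score (?v, 0) (t0, xi) z)^2)" "nice (\<lambda>z. (score_ig ?v t0 z)^2)"
  by (intro nice_power jet_nice(1) [OF jet_score] jet_nice(1) [OF jet_score_ig])+
 have alg: "T * (p * ((a * ((1 - 1) * 1 + 1 * T - c) + (1 - p) * b)^2 - (a * ((1 - 1) * 1 + 1 * T - c))^2)
    + (1 - p) * ((a * ((1 - 0) * 1 + 0 * T - c) + (0 - p) * b)^2 - (a * ((1 - 0) * 1 + 0 * T - c))^2))
   + (1 - T) * (p * ((a * ((1 - 1) * 0 + 1 * T - c) + (1 - p) * b)^2 - (a * ((1 - 1) * 0 + 1 * T - c))^2)
    + (1 - p) * ((a * ((1 - 0) * 0 + 0 * T - c) + (0 - p) * b)^2 - (a * ((1 - 0) * 0 + 0 * T - c))^2))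
   = p * (1 - p) * b^2" for T p a b c :: real
  by (simp add: power2_eq_square algebra_simps)
 have "(LINT z|Q. ?F z) = EY (\<lambda>y. \<psi> (y $ k) * ((x0 + x \<bullet> y) * (x0 + x \<bullet> y)))"
  unfolding integral_Q_EY [OF nice_diff [OF nF]]
 proof (rule arg_cong [of _ _ EY], rule ext)
  fix y :: "real^'p"
  let ?b = "2 * snd xi * (D * y $ k) * (x0 + x \<bullet> y)"
  have "\<tau> y * obs_given_y ?F 1 y + (1 - \<tau> y) * obs_given_y ?F 0 y = q0 y * (1 - q0 y) * ?b\<^sup>2"
  proof (cases rule: mech_cases)
   case 1
   show ?thesis
    unfolding obs_given_y_def score_def fst_conv snd_conv mech_dir_eff [OF x] mech_logit_0 score_ig_eff_dir [OF x] 1(2)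
    by (rule alg)
  next
   case 2
   hence "snd xi = 0" by simp
   thus ?thesis by (simp add: obs_given_y_def score_def mech_dir_eff [OF x])
  qed
  thus "\<tau> y * obs_given_y ?F 1 y + (1 - \<tau> y) * obs_given_y ?F 0 y = \<psi> (y $ k) * ((x0 + x \<bullet> y) * (x0 + x \<bullet> y))"
   by (simp add: \<psi>_def mech_weight_def power2_eq_square algebra_simps)
 qed
 also have "... = (x0 * x0 + x \<bullet> x) * mech_info"
  unfolding EY_affine_product [OF n even x] by (simp add: mech_info_def \<psi>_def [abs_def])
 finally show ?thesis
  using nF [THEN nice_integrable] integral_score_eff_dir_square [OF x, of x0]
  by (simp add: algebra_simps power2_eq_square)
qed

lemma mech_weight_pos: "0 < mech_weight t"
 unfolding mech_weight_def by (rule logistic_variance_pos)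

lemma score_variance_pos: "0 < 1 / (4 + D^2) - info_loss + mech_info"
proof -
 have "0 \<le> mech_info"
  unfolding mech_info_def using mech_weight_pos by (intro ey_nonneg mult_nonneg_nonneg) (auto intro: less_imp_le)
 thus ?thesis using info_loss_less(1) by simp
qed

lemma linear_score_ig: "linear (\<lambda>v. score_ig v t x)" "linear (\<lambda>v. score_diff v t y)"
proof -
 have 1: "linear (\<lambda>v. score2 v t y)" for y
  by (rule linearI) (simp_all add: score2_def trace_def sum.distrib sum_distrib_left matrix_vector_mult_add_rdistrib
   scaleR_matrix_vector inner_simps matrix_vector_mult_diff_distrib matrix_vector_right_distrib
   matrix_vector_mult_scaleR algebra_simps)
 show 2: "linear (\<lambda>v. score_diff v t y)" for y
  by (rule linearI) (simp_all add: score_diff_def matrix_vector_mult_add_rdistrib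
   scaleR_matrix_vector inner_simps matrix_vector_mult_diff_distrib matrix_vector_right_distrib
   matrix_vector_mult_scaleR algebra_simps)
 show "linear (\<lambda>v. score_ig v t x)"
  by (rule linearI) (simp_all add: score_ig_def linear_add [OF 1] linear_add [OF 2] linear_cmul [OF 1] linear_cmul [OF 2] algebra_simps)
qed

lemma linear_dscore12: "linear (\<lambda>v. dscore1 D k v y h)" "linear (\<lambda>v. dscore2 D k v y h)"
 by (rule linearI; simp add: dscore1_def dscore2_def matrix_vector_mult_add_rdistrib
   scaleR_matrix_vector inner_simps matrix_vector_mult_diff_distrib matrix_vector_right_distrib
   matrix_vector_mult_scaleR algebra_simps add_divide_distrib diff_divide_distrib)+

lemma linear_mech_dir: "linear (\<lambda>v. mech_dir v u y)" "linear (\<lambda>v. dmech_dir v y h)"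
 by (rule linearI; simp add: mech_dir_def dmech_dir_def xi_dir_def linear_add [OF linear_score_ig(2)] linear_cmul [OF linear_score_ig(2)]
   linear_add [OF linear_dscore12(1)] linear_add [OF linear_dscore12(2)]
   linear_cmul [OF linear_dscore12(1)] linear_cmul [OF linear_dscore12(2)] algebra_simps)+

lemma linear_score: "linear (\<lambda>v. score v u x)" "linear (\<lambda>v. dscore v x h)"
 by (rule linearI; simp add: score_def dscore_def dscore_ig_def linear_add [OF linear_mech_dir(1)] linear_cmul [OF linear_mech_dir(1)]
   linear_add [OF linear_mech_dir(2)] linear_cmul [OF linear_mech_dir(2)]
   linear_add [OF linear_score_ig(1)] linear_cmul [OF linear_score_ig(1)]
   linear_add [OF linear_score_ig(2)] linear_cmul [OF linear_score_ig(2)]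
   linear_add [OF linear_dscore12(1)] linear_add [OF linear_dscore12(2)]
   linear_cmul [OF linear_dscore12(1)] linear_cmul [OF linear_dscore12(2)] algebra_simps)+

definition full_tilt :: "'p par \<times> (real \<times> real) => 'p par \<times> (real \<times> real)" where
 "full_tilt h = (tilt_dir D k (fst h), snd h)"

lemma linear_full_tilt: "linear full_tilt"
 by (rule linearI) (simp_all add: full_tilt_def tilt_dir_def matrix_vector_mult_add_rdistrib scaleR_matrix_vector scaleR_add_right)

lemma dir_space: "closed dir_space" "h \<in> dir_space ==> c *\<^sub>R h \<in> dir_space"
proof -
 have Xi: "closed Xi" "z \<in> Xi ==> c *\<^sub>R z \<in> Xi" for z using mech by auto
 have "dir_space = {h. transpose (par_K (fst h)) = par_K (fst h)} \<inter> snd -` Xi" by (auto simp: dir_space_def)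
 thus "closed dir_space"
  unfolding transpose_eq_iff
  by (auto intro!: closed_Int closed_Collect_all closed_Collect_eq closed_vimage_snd Xi(1) continuous_intros)
 show "h \<in> dir_space ==> c *\<^sub>R h \<in> dir_space"
  using Xi(2) by (auto simp: dir_space_def transpose_eq_iff)
qed

lemma dscore_coercive:
 obtains \<kappa> where "0 < \<kappa>" "\<And>h. h \<in> dir_space ==> (LINT x|Q. dscore (full_tilt h) x h) \<le> - \<kappa> * (norm h)^2"
proof (rule negative_definite_coercive [where B = "\<lambda>v h. LINT x|Q. dscore v x h", OF _ _ linear_full_tilt dir_space(1)])
 show "linear (\<lambda>h. LINT x|Q. dscore v x h)" for v by (rule jet_integral_linear [OF jet_score])
 show "linear (\<lambda>v. LINT x|Q. dscore v x h)" for h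
  using nice_integrable [OF jet_nice(2) [OF jet_score]]
  by (intro linearI) (simp_all add: linear_add [OF linear_score(2)] linear_cmul [OF linear_score(2)])
 fix h assume h: "h \<in> dir_space" "h \<noteq> 0"
 have sym: "transpose (par_K (fst h)) = par_K (fst h)" using h by (simp add: dir_space_def)
 have "xi_dir (snd h) = snd h \<or> Xi = {0} \<and> xi_dir (snd h) = 0"
  using mech unfolding xi_dir_def by (cases "Xi = UNIV") auto
 hence xh: "xi_dir (snd h) = snd h" using h(1) unfolding dir_space_def by auto
 have eq: "mech_dir (full_tilt h) (t0, xi) y = dmech_logit y h" for y
  by (simp add: mech_dir_def dmech_logit_def full_tilt_def xh score_diff_tilt_dir [OF sym]
   dlog_odds_symmetric [OF sym] log_odds_par0)
 have E: "EY (\<lambda>y. q0 y * (1 - q0 y) * dmech_logit y h * mech_dir (full_tilt h) (t0, xi) y)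
   = EY (\<lambda>y. mech_weight (y $ k) * (dmech_logit y h)^2)"
  by (simp add: eq mech_weight_def power2_eq_square mult.assoc)
 obtain c where c: "0 < c" "\<And>h. transpose (par_K h) = par_K h ==>
  (LINT z|Q. dscore_ig D k (tilt_dir D k h) z h) \<le> - c * (norm h)^2"
  by (rule integral_dscore_tilt_dir, rule that)
 have le: "(LINT x|Q. dscore (full_tilt h) x h) \<le> - c * (norm (fst h))^2 - EY (\<lambda>y. mech_weight (y $ k) * (dmech_logit y h)^2)"
  using c(2) [OF sym] unfolding integral_dscore [OF h(1)] E by (simp add: full_tilt_def)
 have nn: "0 \<le> EY (\<lambda>y. mech_weight (y $ k) * (dmech_logit y h)^2)"
  using mech_weight_pos by (intro EY_nonneg mult_nonneg_nonneg) (auto intro: less_imp_le)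
 show "(LINT x|Q. dscore (full_tilt h) x h) < 0"
 proof (cases "fst h = 0")
  case False
  hence "0 < c * (norm (fst h))^2" using c by simp
  thus ?thesis using le nn by linarith
 next
  case True
  define a b where "a = fst (snd h)" and "b = snd (snd h)"
  have ab: "a \<noteq> 0 \<or> b \<noteq> 0" using True h(2) by (auto simp: a_def b_def prod_eq_iff)
  have "dmech_logit y h = a + b * (D * y $ k)^2" for y
   using True by (simp add: dmech_logit_def dlog_odds_def a_def b_def)
  hence "EY (\<lambda>y. mech_weight (y $ k) * (dmech_logit y h)^2) = EY (\<lambda>y. (\<lambda>t. mech_weight t * (a + b * (D * t)^2)^2) (y $ k))"
   by simp
  also have "... = ey (\<lambda>t. mech_weight t * (a + b * (D * t)^2)^2)"
   by (intro EY_coord nice1_intros nice_mech_weight)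
  also have "0 < ..."
  proof (rule ey_pos)
   show "nice1 (\<lambda>t. mech_weight t * (a + b * (D * t)^2)^2)" by (intro nice1_intros nice_mech_weight)
   show "0 \<le> mech_weight t * (a + b * (D * t)^2)^2" for t
    using mech_weight_pos [of t] by simp
   have "{t. a + b * (D * t)^2 = 0} \<subseteq> {sqrt (- a / (b * D^2)), - sqrt (- a / (b * D^2))}"
   proof (cases "b = 0")
    case False
    have "t = sqrt (- a / (b * D^2)) \<or> t = - sqrt (- a / (b * D^2))" if "a + b * (D * t)^2 = 0" for t
    proof -
     have "t^2 = - a / (b * D^2)"
      using that False D by (simp add: power_mult_distrib field_simps)
     thus ?thesis using real_sqrt_abs [of t] by (auto simp: abs_if split: if_splits)
    qed
    thus ?thesis by blast
   qed (use ab in auto)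
   hence "finite {t. a + b * (D * t)^2 = 0}" by (rule finite_subset) simp
   hence "{t. a + b * (D * t)^2 = 0} \<in> null_sets lborel" by (rule finite_imp_null_set_lborel)
   thus "AE t in lborel. 0 < mech_weight t * (a + b * (D * t)^2)^2"
    by (rule AE_I') (use mech_weight_pos in \<open>auto simp: zero_less_mult_iff\<close>)
  qed
  finally show ?thesis using le by (simp add: True)
 qed
next
 show "c *\<^sub>R h \<in> dir_space" if "h \<in> dir_space" for c h using that by (rule dir_space(2))
 fix \<kappa> :: real
 assume "0 < \<kappa>" "\<And>h. h \<in> dir_space ==> (LINT x|Q. dscore (full_tilt h) x h) \<le> - \<kappa> * (norm h)^2"
 thus thesis by (rule that)
qed

end

section \<open>Expansion of the error rate\<close>

lemma iso_normal_halfspace: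
 fixes m u :: "real^'p::finite"
 assumes u: "norm u = 1"
 shows "measure (iso_normal m) {y. 0 < c + u \<bullet> y} = measure (normal1 (u \<bullet> m)) {t. 0 < c + t}"
proof -
 obtain k :: 'p where True by simp
 have "u \<bullet> (mat 1 *v u) = 1" using u by (simp add: dot_square_norm)
 from pos_def_orthonormal_matrix [OF pos_def_mat_1 this, of k]
 obtain A where A: "transpose A ** mat 1 ** A = mat 1" "A *v axis k 1 = u" "invertible A"
  by blast
 define G where "G = transpose A"
 have G: "invertible G" "G ** mat 1 ** transpose G = mat 1"
  using A by (simp_all add: G_def invertible_det_nz)
 have Gk: "(G *v y) $ k = u \<bullet> y" for y
 proof -
  have "(G *v y) $ k = axis k 1 \<bullet> (G *v y)" by (simp add: inner_axis')
  also have "... = (A *v axis k 1) \<bullet> y" unfolding G_def by (rule inner_matrix_vector [symmetric])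
  finally show ?thesis using A(2) by simp
 qed
 have dens: "iso_normal_density m y = \<bar>det G\<bar> * iso_normal_density (G *v m) (G *v y)" for y
  using mvn_density_affine [OF G(1) pos_def_mat_1, of m y 0] unfolding G(2) mvn_density_iso by simp
 let ?S = "{z :: real^'p. 0 < c + z $ k}"
 let ?F = "\<lambda>z. ennreal (iso_normal_density (G *v m) z) * indicator ?S z"
 have "emeasure (iso_normal m) {y. 0 < c + u \<bullet> y}
   = (\<integral>\<^sup>+y. ennreal (iso_normal_density m y) * indicator {y. 0 < c + u \<bullet> y} y \<partial>lborel)"
  unfolding iso_normal_def by (subst emeasure_density) auto
 also have "... = (\<integral>\<^sup>+y. ?F (G *v (y - 0)) * ennreal \<bar>det G\<bar> \<partial>lborel)"
  by (intro nn_integral_cong) (simp add: dens ennreal_mult Gk indicator_def mult.commute)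
 also have "... = (\<integral>\<^sup>+z. ?F z \<partial>lborel)"
  by (rule nn_integral_lborel_affine [OF G(1)]) measurable
 also have "... = emeasure (iso_normal (G *v m)) ?S"
  unfolding iso_normal_def by (subst emeasure_density) auto
 finally have "measure (iso_normal m) {y. 0 < c + u \<bullet> y} = measure (iso_normal (G *v m)) ?S"
  by (simp add: measure_def)
 also have "... = (LINT z|iso_normal (G *v m). (\<lambda>t. indicator {t. 0 < c + t} t) (z $ k))"
 proof -
  have "(\<lambda>z. indicator {t. 0 < c + t} (z $ k)) = (indicator ?S :: _ => real)"
   by (auto simp: indicator_def fun_eq_iff)
  thus ?thesis by simp
 qed
 also have "... = (LINT t|normal1 ((G *v m) $ k). indicator {t. 0 < c + t} t)"
  by (rule integral_iso_normal_coords(1) [where \<psi> = "\<lambda>_. 0" and \<eta> = "\<lambda>_. 0"])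
   (auto intro!: poly_bounded_bounded [of _ 1])
 also have "... = measure (normal1 (u \<bullet> m)) {t. 0 < c + t}"
  by (simp add: Gk)
 finally show ?thesis .
qed

definition gauss :: "real => real" where
 "gauss x = measure (normal1 0) {..<x}"

lemma normal1_halfline: "measure (normal1 m) {t. 0 < c + t} = gauss (c + m)"
proof -
 have "measure (normal1 m) {t. 0 < c + t} = (LINT t|normal1 m. indicator {t. 0 < c + t} t)" by simp
 also have "... = (LINT t|lborel. normal_density m 1 t * indicator {t. 0 < c + t} t)"
  by (rule integral_normal1) measurable
 also have "... = (LINT s|lborel. normal_density m 1 (m + (- 1) * s) * indicator {t. 0 < c + t} (m + (- 1) * s))"
  by (subst lborel_integral_real_affine [where c = "- 1" and t = m]) auto
 also have "... = (LINT s|lborel. normal_density 0 1 s * indicator {..<c + m} s)"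
  by (intro Bochner_Integration.integral_cong) (auto simp: normal_density_def indicator_def)
 also have "... = (LINT s|normal1 0. indicator {..<c + m} s)"
  by (rule integral_normal1 [symmetric]) measurable
 finally show ?thesis by (simp add: gauss_def)
qed

lemma DERIV_gauss: "(gauss has_real_derivative normal_density 0 1 x) (at x)"
proof -
 let ?f = "normal_density 0 1"
 have cont: "continuous_on S ?f" for S
  unfolding normal_density_def by (intro continuous_intros) auto
 have eq: "gauss y = gauss (x - 1) + integral {x - 1..y} ?f" if "y \<in> {x - 1..x + 1}" for y
 proof -
  interpret N: prob_space "normal1 0" by (rule prob_space_normal1)
  have "gauss y = gauss (x - 1) + measure (normal1 0) {x - 1..<y}"
   unfolding gauss_def using that
   by (subst N.finite_measure_Union [symmetric]) (auto intro!: arg_cong [of _ _ "measure (normal1 0)"])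
  also have "measure (normal1 0) {x - 1..<y} = (LINT t|normal1 0. indicator {x - 1..<y} t)" by simp
  also have "... = (LINT t|lborel. ?f t * indicator {x - 1..<y} t)"
   by (rule integral_normal1) measurable
  also have "... = (LBINT t:{x - 1..y}. ?f t)"
   unfolding set_lebesgue_integral_def
   by (intro integral_cong_AE) (use AE_lborel_singleton [of y] in \<open>auto simp: indicator_def elim!: eventually_mono\<close>)
  also have "... = integral {x - 1..y} ?f"
   by (intro set_borel_integral_eq_integral borel_integrable_atLeastAtMost' cont)
  finally show ?thesis .
 qed
 have "((\<lambda>y. integral {x - 1..y} ?f) has_real_derivative ?f x) (at x within {x - 1..x + 1})"
  by (rule integral_has_real_derivative [OF cont]) auto
 hence "((\<lambda>y. integral {x - 1..y} ?f) has_real_derivative ?f x) (at x)"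
  by (simp add: at_within_Icc_at)
 hence "((\<lambda>y. gauss (x - 1) + integral {x - 1..y} ?f) has_real_derivative ?f x) (at x)"
  by (auto intro!: derivative_eq_intros)
 thus ?thesis
 proof (rule has_field_derivative_transform_within_open)
  show "open {x - 1<..<x + 1}" "x \<in> {x - 1<..<x + 1}" by simp_all
  show "gauss (x - 1) + integral {x - 1..y} ?f = gauss y" if "y \<in> {x - 1<..<x + 1}" for y
   using that by (intro eq [symmetric]) simp
 qed
qed

lemma gauss_expansion:
 defines "f \<equiv> normal_density 0 1"
 shows "((\<lambda>x. (gauss (a + x) - gauss a - f a * x + a * f a / 2 * x^2) / x^2) \<longlongrightarrow> 0) (nhds 0)"
proof -
 define c where "c = 1 / sqrt (2 * pi)"
 have f: "f = (\<lambda>x. c * exp (- x\<^sup>2 / 2))"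
  by (simp add: fun_eq_iff normal_density_def f_def c_def)
 have f': "(f has_real_derivative - a * f a) (at a)"
  unfolding f by (auto intro!: DERIV_cmult derivative_eq_intros)
 let ?F = "\<lambda>x. gauss (a + x) - gauss a - f a * x + a * f a / 2 * x^2"
 have F': "(?F has_real_derivative f (a + x) - f a + a * f a * x) (at x)" for x
  unfolding f_def by (auto intro!: derivative_eq_intros DERIV_chain2 [OF DERIV_gauss])
 have "((\<lambda>x. ((f (a + x) - f a) / x + a * f a) / 2) \<longlongrightarrow> (- a * f a + a * f a) / 2) (at 0)"
  using f' by (intro tendsto_intros) (auto simp: DERIV_def)
 moreover have "\<forall>\<^sub>F x in at 0. ((f (a + x) - f a) / x + a * f a) / 2 = (f (a + x) - f a + a * f a * x) / (2 * x)"
  using eventually_neq_at_within [of 0 0]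
  by eventually_elim (simp add: add_divide_distrib)
 ultimately have "((\<lambda>x. (f (a + x) - f a + a * f a * x) / (2 * x)) \<longlongrightarrow> 0) (at 0)"
  using Lim_transform_eventually by fastforce
 hence "((\<lambda>x. ?F x / x^2) \<longlongrightarrow> 0) (at 0)"
 proof (rule lhopital [rotated -1])
  show "(?F \<longlongrightarrow> 0) (at 0)"
   using DERIV_isCont [OF F' [of 0]] by (simp add: isCont_def)
  show "((\<lambda>x::real. x^2) \<longlongrightarrow> 0) (at 0)"
   by (auto intro!: tendsto_eq_intros)
  show "\<forall>\<^sub>F x in at 0. (x::real)^2 \<noteq> 0" "\<forall>\<^sub>F x in at 0. 2 * (x::real) \<noteq> 0"
   by (simp_all add: eventually_neq_at_within)
  show "\<forall>\<^sub>F x in at 0. ((\<lambda>x. x^2) has_real_derivative 2 * x) (at x)"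
   by (auto intro!: always_eventually derivative_eq_intros)
 qed (use F' in simp)
 thus ?thesis
  using tendsto_at_iff_tendsto_nhds [of "\<lambda>x. ?F x / x^2" 0] by simp
qed

lemma err_canonical:
 assumes b: "snd b \<noteq> 0"
 shows "err (canonical_model D k) b = 1 - gauss ((fst b + D / 2 * snd b $ k) / norm (snd b)) / 2
  - gauss ((- fst b + D / 2 * snd b $ k) / norm (snd b)) / 2"
proof -
 let ?N = "norm (snd b)"
 have N: "0 < ?N" using b by simp
 have half: "measure (iso_normal m) {y. 0 < s * discr b y} = gauss (s * (fst b + snd b \<bullet> m) / ?N)"
  if "s = 1 \<or> s = - 1" for s m
 proof -
  have S: "{y. 0 < s * discr b y} = {y. 0 < s * fst b / ?N + ((s / ?N) *\<^sub>R snd b) \<bullet> y}"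
   using N by (auto simp: discr_def add_divide_distrib [symmetric] distrib_left zero_less_divide_iff mult.assoc)
  have "norm ((s / ?N) *\<^sub>R snd b) = 1" using that N by auto
  thus ?thesis
   unfolding S iso_normal_halfspace [OF \<open>norm _ = 1\<close>] normal1_halfline by (simp add: add_divide_distrib distrib_left)
 qed
 have "{y. bayes_rule b y = 1} = {y. 0 < 1 * discr b y}" "{y. bayes_rule b y = 2} = {y. 0 < - 1 * discr b y}"
  by (auto simp: bayes_rule_def)
 thus ?thesis
  unfolding err_def using half [of 1 "class_mean D k 1"] half [of "- 1" "class_mean D k 0"]
  by (simp add: class_distr_canonical_model canonical_model_simps class_mean_axis inner_axis mult.commute field_simps del: One_nat_def)
qed

text \<open>The deviations of the coefficients from \<open>(0, D *\<^sub>R axis k 1)\<close> that matter to second order.\<close>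

definition dev :: "'p => 'p => real \<times> (real^'p::finite) => real" where
 "dev k j b = (if j = k then fst b else snd b $ j)"

lemma sum_dev_squares:
 "(\<Sum>j\<in>UNIV. (dev k j b)^2) = (fst b)^2 + (\<Sum>j\<in>UNIV - {k}. (snd b $ j)^2)"
 "(norm (snd b))^2 = (snd b $ k)^2 + (\<Sum>j\<in>UNIV - {k}. (snd b $ j)^2)"
 unfolding power2_norm_eq_inner inner_vec_def
 by (subst sum.remove [of _ k]; simp add: dev_def power2_eq_square)+

lemma dev_diff: "dev k j (b - b') = dev k j b - dev k j b'"
 by (simp add: dev_def)

lemma err_expansion:
 fixes k :: "'a::finite"
 assumes D: "0 < D"
 defines "\<theta> \<equiv> canonical_model D k" and "c \<equiv> normal_density 0 1 (D / 2) / (4 * D)"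
 shows "(\<lambda>b. err \<theta> b - err \<theta> (0, D *\<^sub>R axis k 1) - c * (\<Sum>j\<in>UNIV. (dev k j b)^2))
  \<in> o[nhds (0, D *\<^sub>R axis k 1)](\<lambda>b. \<Sum>j\<in>UNIV. (dev k j b)^2)"
proof -
 let ?b = "(0, D *\<^sub>R axis k 1) :: real \<times> (real^'a)"
 define \<phi> where "\<phi> = normal_density 0 1 (D / 2)"
 define N where "N b = norm (snd b)" for b :: "real \<times> (real^'a)"
 define S where "S b = (\<Sum>j\<in>UNIV - {k}. (snd b $ j)^2)" for b :: "real \<times> (real^'a)"
 have SN: "(N b)^2 = (snd b $ k)^2 + S b" "0 \<le> S b" for b
  unfolding N_def S_def by (rule sum_dev_squares(2)) (auto intro: sum_nonneg)
 have id: "((\<lambda>b. b) \<longlongrightarrow> ?b) (nhds ?b)" by (rule filterlim_ident)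
 have t1: "(fst \<longlongrightarrow> 0) (nhds ?b)" using tendsto_fst [OF id] by simp
 have t2: "(N \<longlongrightarrow> D) (nhds ?b)" using tendsto_norm [OF tendsto_snd [OF id]] D by (simp add: N_def [abs_def])
 have t3: "((\<lambda>b. snd b $ k) \<longlongrightarrow> D) (nhds ?b)" using tendsto_vec_nth [OF tendsto_snd [OF id], of k] by (simp add: axis_def)
 have t4: "(S \<longlongrightarrow> 0) (nhds ?b)"
 proof -
  have "((\<lambda>b. (N b)^2 - (snd b $ k)^2) \<longlongrightarrow> D\<^sup>2 - D^2) (nhds ?b)" by (intro tendsto_intros t2 t3)
  thus ?thesis by (simp add: SN)
 qed
 define x where "x s b = (s * fst b + D / 2 * snd b $ k) / N b - D / 2" for s :: real and b
 define \<rho> where "\<rho> s b = (gauss (D / 2 + x s b) - gauss (D / 2) - \<phi> * x s b + D / 2 * \<phi> / 2 * (x s b)^2) / (x s b)^2" for s b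
 have \<rho>: "(\<rho> s \<longlongrightarrow> 0) (nhds ?b)" for s
 proof -
  have "(x s \<longlongrightarrow> (s * 0 + D / 2 * D) / D - D / 2) (nhds ?b)"
   unfolding x_def [abs_def] using D by (intro tendsto_intros t1 t2 t3) auto
  hence "(x s \<longlongrightarrow> 0) (nhds ?b)" using D by simp
  from filterlim_compose [OF gauss_expansion this, of "D / 2"] show ?thesis
   by (simp add: \<rho>_def [abs_def] \<phi>_def)
 qed
 define A where "A b = D / (2 * (N b * (N b + snd b $ k)))" for b
 define B where "B b = D / (4 * (N b)^2)" for b
 define p where "p b = D / 2 * (snd b $ k / N b - 1)" for b
 define E1 where "E1 b = \<phi> * \<bar>A b - 1 / (4 * D)\<bar> + (D / 4 * \<phi> + \<bar>\<rho> 1 b\<bar> + \<bar>\<rho> (-1) b\<bar>) * \<bar>A b * p b\<bar>" for b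
 define E2 where "E2 b = \<phi> * \<bar>B b - 1 / (4 * D)\<bar> + (\<bar>\<rho> 1 b\<bar> + \<bar>\<rho> (-1) b\<bar>) * (1 / (N b)^2)" for b
 have A: "(A \<longlongrightarrow> D / (2 * (D * (D + D)))) (nhds ?b)" and B: "(B \<longlongrightarrow> D / (4 * D^2)) (nhds ?b)"
  and p: "(p \<longlongrightarrow> D / 2 * (D / D - 1)) (nhds ?b)"
  unfolding A_def [abs_def] B_def [abs_def] p_def [abs_def] using D by (intro tendsto_intros t2 t3; simp)+
 have "(E1 \<longlongrightarrow> \<phi> * \<bar>D / (2 * (D * (D + D))) - 1 / (4 * D)\<bar> + (D / 4 * \<phi> + \<bar>0\<bar> + \<bar>0\<bar>) *
   \<bar>D / (2 * (D * (D + D))) * (D / 2 * (D / D - 1))\<bar>) (nhds ?b)"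
  "(E2 \<longlongrightarrow> \<phi> * \<bar>D / (4 * D^2) - 1 / (4 * D)\<bar> + (\<bar>0\<bar> + \<bar>0\<bar>) * (1 / D^2)) (nhds ?b)"
  unfolding E1_def [abs_def] E2_def [abs_def] using D by (intro tendsto_intros A B p \<rho> t2; simp)+
 hence E: "(E1 \<longlongrightarrow> 0) (nhds ?b)" "(E2 \<longlongrightarrow> 0) (nhds ?b)"
  using D by (simp_all add: power2_eq_square)
 have "(\<lambda>b. err \<theta> b - err \<theta> ?b - c * ((fst b)^2 + S b)) \<in> o[nhds ?b](\<lambda>b. (fst b)^2 + S b)"
 proof (rule landau_o.smallI)
  fix \<delta> :: real assume "0 < \<delta>"
  hence "\<forall>\<^sub>F b in nhds ?b. E1 b < \<delta> \<and> E2 b < \<delta> \<and> 0 < N b \<and> 0 < snd b $ k"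
   using D by (intro eventually_conj order_tendstoD(2) [OF E(1)] order_tendstoD(2) [OF E(2)]
     order_tendstoD(1) [OF t2] order_tendstoD(1) [OF t3]) auto
  thus "\<forall>\<^sub>F b in nhds ?b. norm (err \<theta> b - err \<theta> ?b - c * ((fst b)^2 + S b)) \<le> \<delta> * norm ((fst b)^2 + S b)"
  proof eventually_elim
   case (elim b)
   let ?S = "S b" and ?f = "fst b"
   have N: "0 < N b" "0 < N b + snd b $ k" using elim by linarith+
   define u where "u = ?f / N b"
   have x12: "x 1 b = p b + u" "x (- 1) b = p b - u"
    using N by (simp_all add: x_def p_def u_def field_simps)
   have pS: "p b = - (A b * ?S)"
   proof -
    have "(N b - snd b $ k) * (N b + snd b $ k) = ?S" using SN(1) [of b] by (simp add: power2_eq_square algebra_simps)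
    hence "N b - snd b $ k = ?S / (N b + snd b $ k)" using N by (simp add: field_simps)
    moreover have "p b = - (D / 2 * ((N b - snd b $ k) / N b))" using N by (simp add: p_def field_simps)
    ultimately show ?thesis by (simp add: A_def)
   qed
   have p2: "(p b)^2 = ?S * \<bar>A b * p b\<bar>"
   proof -
    have "(p b)^2 = \<bar>p b * p b\<bar>" by (simp add: power2_eq_square)
    also have "... = \<bar>A b * ?S * p b\<bar>" by (subst pS) (simp add: abs_mult)
    finally show ?thesis using SN(2) [of b] by (simp add: abs_mult)
   qed
   have u2: "u^2 = ?f\<^sup>2 * (1 / (N b)^2)" "D / 4 * u^2 = ?f\<^sup>2 * B b"
    by (simp_all add: u_def B_def power_divide)
   have g: "gauss (D / 2 + x s b) - gauss (D / 2) = \<phi> * x s b - D / 4 * \<phi> * (x s b)^2 + \<rho> s b * (x s b)^2" for s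
    by (simp add: \<rho>_def)
   have b0: "snd b \<noteq> 0" using N by (auto simp: N_def)
   have x0: "(s * ?f + D / 2 * snd b $ k) / norm (snd b) = D / 2 + x s b" for s by (simp add: x_def N_def)
   have e0: "err \<theta> ?b = 1 - gauss (D / 2)"
    unfolding \<theta>_def using D by (subst err_canonical) simp_all
   define R where "R = (\<rho> 1 b * (p b + u)^2 + \<rho> (- 1) b * (p b - u)^2) / 2"
   have "err \<theta> b - err \<theta> ?b = - (gauss (D / 2 + x 1 b) - gauss (D / 2)) / 2 - (gauss (D / 2 + x (- 1) b) - gauss (D / 2)) / 2"
    unfolding e0 unfolding \<theta>_def err_canonical [OF b0, of D k] x0 [of 1, unfolded mult_1]
     x0 [of "- 1", unfolded mult_minus1] by (simp add: diff_divide_distrib)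
   also have "... = - \<phi> * p b + \<phi> * (D / 4 * u^2) + D / 4 * \<phi> * (p b)^2 - R"
    unfolding g unfolding x12 R_def by (simp add: power2_eq_square field_simps)
   also have "- \<phi> * p b = \<phi> * ?S * A b" by (simp add: pS)
   also have "\<phi> * (D / 4 * u^2) = \<phi> * ?f\<^sup>2 * B b" by (simp only: u2(2) mult.assoc)
   finally have e1: "err \<theta> b - err \<theta> ?b = \<phi> * ?S * A b + \<phi> * ?f\<^sup>2 * B b + D / 4 * \<phi> * (p b)^2 - R" .
   have cs: "c * (?f\<^sup>2 + ?S) = \<phi> * ?S * (1 / (4 * D)) + \<phi> * ?f\<^sup>2 * (1 / (4 * D))"
    by (simp add: c_def \<phi>_def add_divide_distrib distrib_left)
   have eq: "err \<theta> b - err \<theta> ?b - c * (?f\<^sup>2 + ?S)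
     = \<phi> * ?S * (A b - 1 / (4 * D)) + \<phi> * ?f\<^sup>2 * (B b - 1 / (4 * D)) + D / 4 * \<phi> * (p b)^2 - R"
    unfolding e1 cs right_diff_distrib by simp
   have "\<bar>R\<bar> \<le> (\<bar>\<rho> 1 b\<bar> * (p b + u)^2 + \<bar>\<rho> (- 1) b\<bar> * (p b - u)^2) / 2"
    using abs_triangle_ineq [of "\<rho> 1 b * (p b + u)^2" "\<rho> (- 1) b * (p b - u)^2"] by (simp add: R_def abs_mult)
   also have "... \<le> (\<bar>\<rho> 1 b\<bar> * (2 * ((p b)^2 + u^2)) + \<bar>\<rho> (- 1) b\<bar> * (2 * ((p b)^2 + u^2))) / 2"
    using sum_squares_bound [of "p b" u] sum_squares_bound [of "p b" "- u"]
    by (intro divide_right_mono add_mono mult_left_mono) (simp_all add: power2_sum power2_diff)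
   also have "... = (\<bar>\<rho> 1 b\<bar> + \<bar>\<rho> (- 1) b\<bar>) * ((p b)^2 + u^2)"
    by (simp add: algebra_simps)
   finally have R: "\<bar>R\<bar> \<le> (\<bar>\<rho> 1 b\<bar> + \<bar>\<rho> (- 1) b\<bar>) * ((p b)^2 + u^2)" .
   have tri: "\<bar>a1\<bar> = b1 ==> \<bar>a2\<bar> = b2 ==> \<bar>R\<bar> \<le> r ==> 0 \<le> a3 ==> \<bar>a1 + a2 + a3 - R\<bar> \<le> b1 + b2 + a3 + r"
    for a1 a2 a3 b1 b2 r by linarith
   have pos: "0 < \<phi>" "0 \<le> ?S" "0 \<le> D / 4 * \<phi> * (p b)^2"
    using SN(2) D by (simp_all add: \<phi>_def normal_density_pos less_imp_le)
   have "\<bar>\<phi> * ?S * (A b - 1 / (4 * D))\<bar> = \<phi> * ?S * \<bar>A b - 1 / (4 * D)\<bar>"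
    "\<bar>\<phi> * ?f\<^sup>2 * (B b - 1 / (4 * D))\<bar> = \<phi> * ?f\<^sup>2 * \<bar>B b - 1 / (4 * D)\<bar>"
    using pos by (simp_all add: abs_mult)
   hence "\<bar>err \<theta> b - err \<theta> ?b - c * (?f\<^sup>2 + ?S)\<bar> \<le> \<phi> * ?S * \<bar>A b - 1 / (4 * D)\<bar> + \<phi> * ?f\<^sup>2 * \<bar>B b - 1 / (4 * D)\<bar>
     + D / 4 * \<phi> * (p b)^2 + (\<bar>\<rho> 1 b\<bar> + \<bar>\<rho> (- 1) b\<bar>) * ((p b)^2 + u^2)"
    unfolding eq using R pos(3) by (rule tri)
   also have "... = ?S * E1 b + ?f\<^sup>2 * E2 b"
    unfolding p2 u2(1) E1_def E2_def by (simp only: distrib_left distrib_right mult_ac add_ac)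
   also have "... \<le> ?S * \<delta> + ?f\<^sup>2 * \<delta>"
    using elim pos by (intro add_mono mult_left_mono) auto
   finally show ?case using pos by (simp add: algebra_simps)
  qed
 qed
 thus ?thesis by (simp add: sum_dev_squares(1) S_def)
qed

definition coef_par :: "'p::finite par => real \<times> (real^'p)" where
 "coef_par t = (par_rho t - (par_mu1 t \<bullet> (par_K t *v par_mu1 t)) / 2 + (par_mu2 t \<bullet> (par_K t *v par_mu2 t)) / 2,
   par_K t *v (par_mu1 t - par_mu2 t))"

lemma coef_par_0: "coef_par (par0 D k) = (0, D *\<^sub>R axis k 1)"
 by (simp add: coef_par_def par0_def class_mean_axis scaleR_add_left [symmetric])

lemma bounded_bilinear_matrix_vector: "bounded_bilinear (\<lambda>(A::real^'n^'m) x. A *v x)"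
 unfolding bilinear_conv_bounded_bilinear [symmetric] bilinear_def
 by (auto intro!: linearI simp: matrix_vector_right_distrib matrix_vector_mult_add_rdistrib matrix_vector_mult_scaleR scaleR_matrix_vector)

lemma has_derivative_coef_par:
 "(coef_par has_derivative (\<lambda>h. (dcoef0 D k h, dcoef1 D k h))) (at (par0 D k))"
proof -
 note mv = bounded_bilinear.FDERIV [OF bounded_bilinear_matrix_vector]
 have l: "(par_rho has_derivative par_rho) (at t)" "(par_mu1 has_derivative par_mu1) (at t)"
  "(par_mu2 has_derivative par_mu2) (at t)" "(par_K has_derivative par_K) (at t)" for t :: "'a par"
  by (intro bounded_linear_imp_has_derivative linear_conv_bounded_linear [THEN iffD1] par_linear)+
 show ?thesis
  unfolding coef_par_def [abs_def]
  by (rule has_derivative_eq_rhs [OF has_derivative_Pair [OF has_derivative_add [OF has_derivative_diff [OF l(1)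
    bounded_linear.has_derivative [OF bounded_linear_divide, OF has_derivative_inner [OF l(2) mv [OF l(4) l(2)]]]]
    bounded_linear.has_derivative [OF bounded_linear_divide, OF has_derivative_inner [OF l(3) mv [OF l(4) l(3)]]]]
    mv [OF l(4) has_derivative_diff [OF l(2) l(3)]]]])
   (simp add: fun_eq_iff par0_def dcoef0_def dcoef1_def class_mean_axis inner_axis inner_axis'
    matrix_vector_mult_scaleR matrix_vector_mult_uminus scaleR_add_left [symmetric] inner_commute algebra_simps add_divide_distrib, simp add: field_simps)
qed

lemma err_coef_par_expansion:
 fixes k :: "'a::finite"
 assumes D: "0 < D" and \<delta>: "0 < \<delta>"
 defines "\<theta> \<equiv> canonical_model D k"
 shows "\<exists>r>0. \<forall>h. norm h \<le> r \<longrightarrow> \<bar>err \<theta> (coef_par (par0 D k + h)) - err \<theta> (0, D *\<^sub>R axis k 1)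
   - normal_density 0 1 (D / 2) / (4 * D) * (\<Sum>j\<in>UNIV. (dev k j (dcoef0 D k h, dcoef1 D k h))^2)\<bar> \<le> \<delta> * (norm h)^2"
proof -
 let ?b = "(0, D *\<^sub>R axis k 1) :: real \<times> (real^'a)" and ?d = "\<lambda>h. (dcoef0 D k h, dcoef1 D k h)"
 define c where "c = normal_density 0 1 (D / 2) / (4 * D)"
 define b where "b h = coef_par (par0 D k + h)" for h :: "'a par"
 note dc = has_derivative_coef_par [of D k]
 have dev0: "dev k j ?b = 0" for j by (simp add: dev_def axis_def)
 have devle: "\<bar>dev k j z\<bar> \<le> norm z" for j z
  using norm_fst_le [of "fst z" "snd z"] component_le_norm_cart [of "snd z" j] norm_components_le(2) [of z]
   norm_components_le(1) [of z] by (auto simp: dev_def)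
 have diff: "(\<lambda>h. dev k j (b h) - dev k j (?d h)) \<in> o[nhds 0](norm)" for j
 proof (rule landau_o.smallI)
  fix e :: real assume "0 < e"
  then obtain r where r: "0 < r" "\<And>t. norm (t - par0 D k) < r ==>
    norm (coef_par t - coef_par (par0 D k) - ?d (t - par0 D k)) \<le> e * norm (t - par0 D k)"
   using dc unfolding has_derivative_at_alt by blast
  have "norm (dev k j (b h) - dev k j (?d h)) \<le> e * norm (norm h)" if "norm h < r" for h
  proof -
   have "dev k j (b h) - dev k j (?d h) = dev k j (b h - ?b - ?d h)" by (simp only: dev_diff dev0 diff_0_right)
   thus ?thesis
    using order_trans [OF devle r(2) [of "par0 D k + h"]] that by (simp add: b_def coef_par_0)
  qed
  with r(1) show "\<forall>\<^sub>F h in nhds 0. norm (dev k j (b h) - dev k j (?d h)) \<le> e * norm (norm h)"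
   unfolding eventually_nhds_metric by (auto simp: dist_norm)
 qed
 have lin: "(\<lambda>h. dev k j (?d h)) \<in> O[nhds 0](norm)" for j
 proof -
  obtain M where "\<And>h. norm (?d h) \<le> norm h * M"
   using bounded_linear.bounded [OF has_derivative_bounded_linear [OF dc]] by blast
  thus ?thesis
   by (intro bigoI [of _ M] always_eventually allI) (auto intro: order_trans [OF devle] simp: mult.commute)
 qed
 have O: "(\<lambda>h. dev k j (b h)) \<in> O[nhds 0](norm)" for j
  using sum_in_bigo(1) [OF landau_o.small_imp_big [OF diff [of j]] lin [of j]] by simp
 have "(\<lambda>h. (dev k j (b h) - dev k j (?d h)) * (dev k j (b h) + dev k j (?d h))) \<in> o[nhds 0](\<lambda>h. norm h * norm h)" for j
  by (intro landau_o.small_big_mult diff sum_in_bigo O lin)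
 hence sq: "(\<lambda>h. (dev k j (b h))^2 - (dev k j (?d h))^2) \<in> o[nhds 0](\<lambda>h. norm h * norm h)" for j
  by (simp add: power2_eq_square square_diff_square_factored mult.commute)
 have "(\<lambda>h. \<Sum>j\<in>UNIV. dev k j (b h) * dev k j (b h)) \<in> O[nhds 0](\<lambda>h. norm h * norm h)"
  by (intro big_sum_in_bigo landau_o.big_mult O)
 hence S: "(\<lambda>h. \<Sum>j\<in>UNIV. (dev k j (b h))^2) \<in> O[nhds 0](\<lambda>h. norm h * norm h)"
  by (simp add: power2_eq_square)
 have "isCont coef_par (par0 D k)" by (rule has_derivative_continuous [OF dc])
 hence "(b \<longlongrightarrow> b 0) (nhds 0)"
  unfolding tendsto_at_iff_tendsto_nhds [symmetric] by (simp add: isCont_iff b_def [abs_def])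
 hence "(b \<longlongrightarrow> ?b) (nhds 0)"
  by (simp add: b_def coef_par_0)
 from landau_o.small_big_trans [OF landau_o.small.compose [OF err_expansion [OF D] this] S]
 have "(\<lambda>h. err \<theta> (b h) - err \<theta> ?b - c * (\<Sum>j\<in>UNIV. (dev k j (b h))^2)) \<in> o[nhds 0](\<lambda>h. norm h * norm h)"
  by (simp add: \<theta>_def c_def)
 moreover have "(\<lambda>h. c * (\<Sum>j\<in>UNIV. (dev k j (b h))^2 - (dev k j (?d h))^2)) \<in> o[nhds 0](\<lambda>h. norm h * norm h)"
  by (simp add: big_sum_in_smallo sq)
 ultimately have "(\<lambda>h. err \<theta> (b h) - err \<theta> ?b - c * (\<Sum>j\<in>UNIV. (dev k j (?d h))^2)) \<in> o[nhds 0](\<lambda>h. norm h * norm h)"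
  by (auto dest: sum_in_smallo(1) simp: sum_subtractf right_diff_distrib)
 from landau_o.smallD [OF this \<delta>] obtain r where "0 < r" "\<And>h. norm h < r ==>
   \<bar>err \<theta> (b h) - err \<theta> ?b - c * (\<Sum>j\<in>UNIV. (dev k j (?d h))^2)\<bar> \<le> \<delta> * (norm h)^2"
  unfolding eventually_nhds_metric by (auto simp: power2_eq_square)
 thus ?thesis
  unfolding b_def c_def by (intro exI [of _ "r / 2"]) auto
qed

lemma err_bounds: "\<bar>err (canonical_model D k) b\<bar> \<le> 1"
proof -
 have "measure (class_distr (canonical_model D k) i) A \<le> 1" if "i \<in> {1, 2}" for i A
  using that prob_space.prob_le_1 [OF prob_space_iso_normal] by (auto simp: class_distr_canonical_model simp del: One_nat_def)
 from this [of 1 "{y. bayes_rule b y = 1}"] this [of 2 "{y. bayes_rule b y = 2}"] show ?thesis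
  using measure_nonneg [of "class_distr (canonical_model D k) 1" "{y. bayes_rule b y = 1}"]
   measure_nonneg [of "class_distr (canonical_model D k) 2" "{y. bayes_rule b y = 2}"]
  unfolding err_def canonical_model_simps(1) abs_le_iff by (subst (1 2) sum.insert; simp del: One_nat_def measure_nonneg; linarith)
qed

lemma measurable_err [measurable]: "err (canonical_model D k) \<in> borel_measurable borel"
proof -
 have m: "(\<lambda>b. measure (iso_normal m) {y::real^'a. 0 < s * discr b y}) \<in> borel_measurable borel" for m and s :: real
 proof -
  interpret N: prob_space "iso_normal m" by (rule prob_space_iso_normal)
  have "open {p::(real \<times> (real^'a)) \<times> (real^'a). 0 < s * discr (fst p) (snd p)}"
   unfolding discr_def by (intro open_Collect_less continuous_intros)
  hence "{p::(real \<times> (real^'a)) \<times> (real^'a). 0 < s * discr (fst p) (snd p)} \<in> sets (borel \<Otimes>\<^sub>M iso_normal m)"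
   unfolding sets_pair_measure_cong [OF refl sets_iso_normal] borel_prod by (rule borel_open)
  from N.measurable_emeasure_Pair [OF this]
  have "(\<lambda>b. emeasure (iso_normal m) {y. 0 < s * discr b y}) \<in> borel_measurable borel" by (simp add: vimage_def)
  thus ?thesis unfolding measure_def by measurable
 qed
 have "err (canonical_model D k) b = 1 - measure (iso_normal (class_mean D k 1)) {y. 0 < 1 * discr b y} / 2
   - measure (iso_normal (class_mean D k 0)) {y. 0 < - 1 * discr b y} / 2" for b :: "real \<times> (real^'a)"
 proof -
  have "{y. bayes_rule b y = 1} = {y. 0 < 1 * discr b y}" "{y. bayes_rule b y = 2} = {y. 0 < - 1 * discr b y}"
   by (auto simp: bayes_rule_def)
  thus ?thesis by (simp add: err_def class_distr_canonical_model canonical_model_simps(1) del: One_nat_def)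
 qed
 thus ?thesis
  by (simp only: borel_measurable_diff borel_measurable_divide borel_measurable_const m cong: measurable_cong_simp)
qed

section \<open>Score equations\<close>

definition model_of :: "'p::finite par => 'p model" where
 "model_of t = (logistic (par_rho t), par_mu1 t, par_mu2 t, matrix_inv (par_K t))"

definition par_of :: "'p::finite model => 'p par" where
 "par_of \<theta> = (ln (prior \<theta> 1 / prior \<theta> 2), mean \<theta> 1, mean \<theta> 2, matrix_inv (cov \<theta>))"

definition par_space :: "'p::finite par set" where
 "par_space = {t. pos_def (par_K t) \<and> par_mu1 t \<noteq> par_mu2 t}"

definition par_quad :: "nat => 'p::finite par => 'p quad" where
 "par_quad i t = (let \<mu> = if i = 1 then par_mu1 t else par_mu2 t in
   (ln (logistic (if i = 1 then par_rho t else - par_rho t)) + ln (det (par_K t)) / 2 - CARD('p) * ln (2 * pi) / 2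
    - (\<mu> \<bullet> (par_K t *v \<mu>)) / 2,
   par_K t *v \<mu>, - ((1 / 2) *\<^sub>R par_K t)))"

lemma matrix_inv_matrix_inv: "pos_def K ==> matrix_inv (matrix_inv K) = K"
 by (rule matrix_inv_unique) (simp add: matrix_inv_cancel pos_def_invertible)

lemma model_of_par_of: "\<theta> \<in> model_space ==> model_of (par_of \<theta>) = \<theta>"
 using model_spaceD [of \<theta>]
 by (cases \<theta>) (auto simp: model_of_def par_of_def logistic_def matrix_inv_matrix_inv field_simps)

lemma model_of_space: "t \<in> par_space ==> model_of t \<in> model_space"
 by (auto simp: par_space_def model_space_def model_of_def pos_def_matrix_inv)

lemma par_of_space: "\<theta> \<in> model_space ==> par_of \<theta> \<in> par_space"
 using model_spaceD [of \<theta>] by (simp add: par_space_def par_of_def pos_def_matrix_inv)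

lemma logit_logistic: "ln (logistic u / (1 - logistic u)) = u"
 by (subst ln_divide_pos) (auto simp: ln_logistic ln_one_minus_logistic)

lemma det_matrix_inv: "pos_def K ==> det (matrix_inv K) = inverse (det K)"
 using matrix_inv_cancel(1) [OF pos_def_invertible, of K] pos_def_det_pos [of K]
 by (metis det_I det_mul inverse_unique mult.commute)

lemma class_quad_model_of:
 assumes K: "pos_def (par_K t)" and i: "i \<in> {1, 2}"
 shows "class_quad (model_of (t :: 'p::finite par)) i = par_quad i t"
proof -
 have d: "0 < det (par_K t)" by (rule pos_def_det_pos [OF K])
 have l: "ln (l / sqrt ((2 * pi) ^ CARD('p) * inverse (det (par_K t))))
   = ln l + ln (det (par_K t)) / 2 - CARD('p) * ln (2 * pi) / 2" if "0 < l" for l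
  using that d by (simp add: ln_div ln_sqrt ln_mult ln_realpow ln_inverse diff_divide_distrib, simp add: algebra_simps)
 show ?thesis
  using i l [OF logistic_pos, of "par_rho t"] l [OF logistic_pos, of "- par_rho t"]
  by (auto simp: class_quad_def par_quad_def Let_def model_of_def matrix_inv_matrix_inv [OF K] det_matrix_inv [OF K] logistic_minus)
qed

lemma coef_model_of:
 assumes K: "pos_def (par_K t)"
 shows "coef (model_of t) = coef_par t"
proof -
 have s: "transpose (par_K t) = par_K t" using K by (simp add: pos_def_def)
 show ?thesis
  using logit_logistic inner_symmetric_matrix [OF s, of "par_mu1 t" "par_mu2 t"]
  by (simp add: coef_def coef_par_def model_of_def Let_def matrix_inv_matrix_inv [OF K] inner_simps
   matrix_vector_mult_diff_distrib diff_divide_distrib)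
qed

lemma quad_par_quad:
 assumes K: "transpose (par_K t) = par_K t"
 shows "quad (par_quad 1 t) y = ln (logistic (par_rho t)) + ln (det (par_K t)) / 2 - CARD('p) * ln (2 * pi) / 2
   - ((y - par_mu1 t) \<bullet> (par_K t *v (y - par_mu1 (t :: 'p::finite par)))) / 2"
  and "quad (par_quad 2 t) y = ln (logistic (- par_rho t)) + ln (det (par_K t)) / 2 - CARD('p) * ln (2 * pi) / 2
   - ((y - par_mu2 t) \<bullet> (par_K t *v (y - par_mu2 t))) / 2"
 unfolding par_quad_def Let_def using quad_completed_square [OF K] by simp_all

lemma discr_coef_par:
 assumes K: "transpose (par_K t) = par_K t"
 shows "discr (coef_par t) y = log_odds t y"
 using inner_symmetric_matrix [OF K, of y "par_mu1 t"] inner_symmetric_matrix [OF K, of y "par_mu2 t"]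
 by (simp add: discr_def coef_par_def log_odds_def inner_simps matrix_vector_mult_diff_distrib inner_commute field_simps)

lemma quad_par_quad_diff:
 assumes K: "transpose (par_K t) = par_K t"
 shows "quad (par_quad 1 t) y - quad (par_quad 2 t) y = log_odds t y"
 unfolding quad_par_quad [OF K] log_odds_def ln_logistic using softplus_minus [of "par_rho t"] by simp

definition unit_matrix :: "'n => 'n => real^'n::finite^'n" where
 "unit_matrix i j = (\<chi> a c. of_bool (a = i \<and> c = j))"

lemma det_elementary: "det (mat 1 + c *\<^sub>R unit_matrix i j) = 1 + c * trace (unit_matrix i j)"
proof (cases "i = j")
 case True
 have "det (mat 1 + c *\<^sub>R unit_matrix i i) = (\<Prod>a\<in>UNIV. 1 + c * of_bool (a = i))"
  by (subst det_diagonal) (auto simp: unit_matrix_def mat_def)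
 also have "... = (\<Prod>a\<in>UNIV. if a = i then 1 + c else 1)" by (intro prod.cong) auto
 finally show ?thesis using True by (simp add: trace_def unit_matrix_def)
next
 case False
 have "mat 1 + c *\<^sub>R unit_matrix i j = (\<chi> a. if a = i then row i (mat 1) + c *s row j (mat 1) else row a (mat 1))"
  by (auto simp: vec_eq_iff unit_matrix_def mat_def row_def)
 thus ?thesis
  using False det_row_operation [OF False, of "mat 1" c] by (simp add: trace_def unit_matrix_def)
qed

lemma congruence_form: "x \<bullet> ((transpose G ** A ** G) *v x) = (G *v x) \<bullet> (A *v (G *v (x :: real^'n)))"
 by (simp only: matrix_vector_mul_assoc [symmetric] inner_matrix_vector)

text \<open>The curve through \<open>t\<close> along which the score in direction \<open>v\<close> is the derivative of the
 log-densities.\<close>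

definition par_curve :: "'p::finite par => 'p par => real => 'p par" where
 "par_curve v t s = (let G = mat 1 + s *\<^sub>R par_K v in
   (par_rho t + s * par_rho v, matrix_inv G *v (par_mu1 t + s *\<^sub>R par_mu1 v),
   matrix_inv G *v (par_mu2 t + s *\<^sub>R par_mu2 v), transpose G ** par_K t ** G))"

context
 fixes v t :: "'p::finite par" and i j :: 'p and b :: real
 assumes t: "t \<in> par_space" and v: "par_K v = b *\<^sub>R unit_matrix i j"
begin

lemma curve_det: "det (mat 1 + s *\<^sub>R par_K v) = 1 + s * trace (par_K v)"
 using det_elementary [of "s * b" i j] by (simp add: v trace_def sum_distrib_left mult.assoc)

lemma eventually_curve:
 "\<forall>\<^sub>F s in nhds 0. 0 < det (mat 1 + s *\<^sub>R par_K v) \<and> par_curve v t s \<in> par_space"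
proof -
 have "((\<lambda>s. 1 + s * trace (par_K v)) \<longlongrightarrow> 1 + 0 * trace (par_K v)) (nhds 0)"
  by (intro tendsto_intros filterlim_ident)
 hence 1: "\<forall>\<^sub>F s in nhds 0. 0 < det (mat 1 + s *\<^sub>R par_K v)"
  unfolding curve_det by (intro order_tendstoD) auto
 have "((\<lambda>s. norm (par_mu1 t + s *\<^sub>R par_mu1 v - (par_mu2 t + s *\<^sub>R par_mu2 v))) \<longlongrightarrow>
   norm (par_mu1 t + 0 *\<^sub>R par_mu1 v - (par_mu2 t + 0 *\<^sub>R par_mu2 v))) (nhds 0)"
  by (intro tendsto_intros filterlim_ident)
 hence 2: "\<forall>\<^sub>F s in nhds 0. 0 < norm (par_mu1 t + s *\<^sub>R par_mu1 v - (par_mu2 t + s *\<^sub>R par_mu2 v))"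
  using t by (intro order_tendstoD) (auto simp: par_space_def)
 from 1 2 show ?thesis
 proof eventually_elim
  case (elim s)
  let ?G = "mat 1 + s *\<^sub>R par_K v"
  have G: "invertible ?G" using elim by (simp add: invertible_det_nz)
  have "par_mu1 (par_curve v t s) \<noteq> par_mu2 (par_curve v t s)"
  proof
   assume "par_mu1 (par_curve v t s) = par_mu2 (par_curve v t s)"
   hence "?G *v (matrix_inv ?G *v (par_mu1 t + s *\<^sub>R par_mu1 v)) = ?G *v (matrix_inv ?G *v (par_mu2 t + s *\<^sub>R par_mu2 v))"
    by (simp add: par_curve_def Let_def)
   thus False using elim by (simp add: matrix_inv_cancel(4) [OF G])
  qed
  thus ?case
   using elim pos_def_congruence [OF _ G, of "par_K t"] t by (simp add: par_space_def par_curve_def Let_def)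
 qed
qed

lemma quad_curve:
 assumes s: "0 < det (mat 1 + s *\<^sub>R par_K v)" "par_curve v t s \<in> par_space"
 defines "C \<equiv> ln (det (par_K t)) / 2 - CARD('p) * ln (2 * pi) / 2"
  and "q \<equiv> \<lambda>x. x \<bullet> (par_K t *v x)"
 shows "quad (par_quad 1 (par_curve v t s)) y = ln (logistic (par_rho t + s * par_rho v))
    + ln (1 + s * trace (par_K v)) + C - q (y - par_mu1 t + s *\<^sub>R (par_K v *v y - par_mu1 v)) / 2"
  and "quad (par_quad 2 (par_curve v t s)) y = ln (logistic (- (par_rho t + s * par_rho v)))
    + ln (1 + s * trace (par_K v)) + C - q (y - par_mu2 t + s *\<^sub>R (par_K v *v y - par_mu2 v)) / 2"
proof -
 let ?G = "mat 1 + s *\<^sub>R par_K v" and ?u = "par_curve v t s"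
 have G: "invertible ?G" using s by (simp add: invertible_det_nz)
 have K: "transpose (par_K ?u) = par_K ?u" using s(2) by (simp add: par_space_def pos_def_def)
 have d: "ln (det (par_K ?u)) / 2 = ln (1 + s * trace (par_K v)) + ln (det (par_K t)) / 2"
 proof -
  have "0 < det (par_K t)" using t by (simp add: par_space_def pos_def_det_pos)
  thus ?thesis using s(1) unfolding curve_det
   by (simp add: par_curve_def Let_def det_mul det_transpose curve_det ln_mult add_divide_distrib)
 qed
 have qd: "(y - matrix_inv ?G *v (m + s *\<^sub>R c)) \<bullet> (par_K ?u *v (y - matrix_inv ?G *v (m + s *\<^sub>R c)))
   = q (y - m + s *\<^sub>R (par_K v *v y - c))" for m c
 proof -
  have "?G *v (y - matrix_inv ?G *v (m + s *\<^sub>R c)) = y - m + s *\<^sub>R (par_K v *v y - c)"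
   by (simp add: matrix_vector_mult_diff_distrib matrix_inv_cancel(4) [OF G])
    (simp add: matrix_vector_mult_add_rdistrib scaleR_matrix_vector algebra_simps)
  from arg_cong [OF this, of q] show ?thesis
   by (simp add: q_def par_curve_def Let_def congruence_form)
 qed
 show "quad (par_quad 1 ?u) y = ln (logistic (par_rho t + s * par_rho v))
    + ln (1 + s * trace (par_K v)) + C - q (y - par_mu1 t + s *\<^sub>R (par_K v *v y - par_mu1 v)) / 2"
  "quad (par_quad 2 ?u) y = ln (logistic (- (par_rho t + s * par_rho v)))
    + ln (1 + s * trace (par_K v)) + C - q (y - par_mu2 t + s *\<^sub>R (par_K v *v y - par_mu2 v)) / 2"
  unfolding quad_par_quad [OF K] d using qd [of "par_mu1 t" "par_mu1 v"] qd [of "par_mu2 t" "par_mu2 v"]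
  by (simp_all add: par_curve_def Let_def C_def)
qed

lemma par_curve_0 [simp]: "par_curve v t 0 = t"
 by (simp add: par_curve_def matrix_inv_unique prod_eq_iff)

lemma DERIV_quad_curve:
 "((\<lambda>s. quad (par_quad 1 (par_curve v t s)) y) has_real_derivative score2 v t y + score_diff v t y) (at 0)"
 "((\<lambda>s. quad (par_quad 2 (par_curve v t s)) y) has_real_derivative score2 v t y) (at 0)"
proof -
 let ?q = "\<lambda>x. x \<bullet> (par_K t *v x)"
 have K: "transpose (par_K t) = par_K t" using t by (simp add: par_space_def pos_def_def)
 have q: "((\<lambda>s. ?q (x + s *\<^sub>R z)) has_real_derivative 2 * (x \<bullet> (par_K t *v z))) (at 0)" for x z
 proof -
  have "?q (x + s *\<^sub>R z) = ?q x + s * (2 * (x \<bullet> (par_K t *v z))) + s^2 * ?q z" for s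
   using inner_symmetric_matrix [OF K, of z x]
   by (simp add: matrix_vector_right_distrib matrix_vector_mult_scaleR inner_simps power2_eq_square algebra_simps)
  thus ?thesis by (auto intro!: derivative_eq_intros)
 qed
 have lg: "((\<lambda>s. ln (logistic (a + s * c))) has_real_derivative c * (1 - logistic a)) (at 0)" for a c
  unfolding ln_logistic by (auto intro!: derivative_eq_intros simp: algebra_simps)
 have lg': "((\<lambda>s. ln (logistic (- (a + s * c)))) has_real_derivative - (c * logistic a)) (at 0)" for a c
  using lg [of "- a" "- c"] by (simp add: logistic_minus)
 have tr: "((\<lambda>s. ln (1 + s * c)) has_real_derivative c) (at 0)" for c
  by (auto intro!: derivative_eq_intros)
 note ev = eventually_curve
 have d1: "((\<lambda>s. ln (logistic (par_rho t + s * par_rho v))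
    + ln (1 + s * trace (par_K v)) + (ln (det (par_K t)) / 2 - CARD('p) * ln (2 * pi) / 2)
    - ?q (y - par_mu1 t + s *\<^sub>R (par_K v *v y - par_mu1 v)) / 2)
   has_real_derivative par_rho v * (1 - logistic (par_rho t)) + trace (par_K v) + 0
    - (2 * ((y - par_mu1 t) \<bullet> (par_K t *v (par_K v *v y - par_mu1 v)))) / 2) (at 0)"
  by (intro DERIV_diff DERIV_add lg tr DERIV_const DERIV_cdivide q)
 have ev1: "\<forall>\<^sub>F s in nhds 0. quad (par_quad 1 (par_curve v t s)) y = ln (logistic (par_rho t + s * par_rho v))
    + ln (1 + s * trace (par_K v)) + (ln (det (par_K t)) / 2 - CARD('p) * ln (2 * pi) / 2)
    - ?q (y - par_mu1 t + s *\<^sub>R (par_K v *v y - par_mu1 v)) / 2"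
  using ev by eventually_elim (rule quad_curve(1), auto)
 from DERIV_cong_ev [OF refl ev1 refl, THEN iffD2, OF d1]
 show "((\<lambda>s. quad (par_quad 1 (par_curve v t s)) y) has_real_derivative score2 v t y + score_diff v t y) (at 0)"
  by (rule DERIV_cong) (simp add: score2_def score_diff_def algebra_simps add_divide_distrib diff_divide_distrib)
 have d2: "((\<lambda>s. ln (logistic (- (par_rho t + s * par_rho v)))
    + ln (1 + s * trace (par_K v)) + (ln (det (par_K t)) / 2 - CARD('p) * ln (2 * pi) / 2)
    - ?q (y - par_mu2 t + s *\<^sub>R (par_K v *v y - par_mu2 v)) / 2)
   has_real_derivative - (par_rho v * logistic (par_rho t)) + trace (par_K v) + 0
    - (2 * ((y - par_mu2 t) \<bullet> (par_K t *v (par_K v *v y - par_mu2 v)))) / 2) (at 0)"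
  by (intro DERIV_diff DERIV_add lg' tr DERIV_const DERIV_cdivide q)
 have ev2: "\<forall>\<^sub>F s in nhds 0. quad (par_quad 2 (par_curve v t s)) y = ln (logistic (- (par_rho t + s * par_rho v)))
    + ln (1 + s * trace (par_K v)) + (ln (det (par_K t)) / 2 - CARD('p) * ln (2 * pi) / 2)
    - ?q (y - par_mu2 t + s *\<^sub>R (par_K v *v y - par_mu2 v)) / 2"
  using ev by eventually_elim (rule quad_curve(2), auto)
 from DERIV_cong_ev [OF refl ev2 refl, THEN iffD2, OF d2]
 show "((\<lambda>s. quad (par_quad 2 (par_curve v t s)) y) has_real_derivative score2 v t y) (at 0)"
  by (rule DERIV_cong) (simp add: score2_def algebra_simps add_divide_distrib diff_divide_distrib)
qed

end

definition nat_par :: "'p::finite par \<times> (real \<times> real) => 'p quad \<times> 'p quad \<times> 'p quad" where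
 "nat_par u = (par_quad 1 (fst u), par_quad 2 (fst u), mech_quad (snd u) (coef_par (fst u)))"

definition nat_model :: "'p::finite model \<times> (real \<times> real) => 'p quad \<times> 'p quad \<times> 'p quad" where
 "nat_model p = (class_quad (fst p) 1, class_quad (fst p) 2, mech_quad (snd p) (coef (fst p)))"

lemma nat_model_of: "t \<in> par_space ==> nat_model (model_of t, \<xi>) = nat_par (t, \<xi>)"
 by (simp add: nat_model_def nat_par_def par_space_def class_quad_model_of coef_model_of del: One_nat_def)

lemma norm_matrix_vector_le:
 obtains C where "0 < C" "\<And>A x. norm ((A :: real^'p::finite^'p) *v x) \<le> C * norm A * norm x"
 using bounded_bilinear.pos_bounded [OF bounded_bilinear_matrix_vector] by (metis mult.commute mult.assoc)

lemma tendsto_solve: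
 fixes K :: "'a => real^'p::finite^'p"
 assumes K: "(K \<longlongrightarrow> mat 1) F" and b: "((\<lambda>a. K a *v x a) \<longlongrightarrow> m) F"
 shows "(x \<longlongrightarrow> m) F"
proof -
 obtain C where C: "0 < C" "\<And>A x. norm ((A :: real^'p^'p) *v x) \<le> C * norm A * norm x"
  by (rule norm_matrix_vector_le, rule that)
 have e: "((\<lambda>a. C * norm (mat 1 - K a)) \<longlongrightarrow> C * norm (mat 1 - mat 1 :: real^'p^'p)) F"
  by (intro tendsto_intros K)
 have "((\<lambda>a. C * norm (mat 1 - K a) * (2 * norm (K a *v x a))) \<longlongrightarrow> C * norm (mat 1 - mat 1 :: real^'p^'p) * (2 * norm m)) F"
  by (intro tendsto_mult e tendsto_intros b)
 hence z: "((\<lambda>a. C * norm (mat 1 - K a) * (2 * norm (K a *v x a))) \<longlongrightarrow> 0) F" by simp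
 have "\<forall>\<^sub>F a in F. norm (x a - K a *v x a) \<le> C * norm (mat 1 - K a) * (2 * norm (K a *v x a))"
  using order_tendstoD(2) [OF e, of "1 / 2", simplified]
 proof eventually_elim
  case (elim a)
  have 1: "norm (x a - K a *v x a) \<le> C * norm (mat 1 - K a) * norm (x a)"
   using C(2) [of "mat 1 - K a" "x a"] by (simp add: matrix_vector_mult_diff_rdistrib)
  also have "... \<le> 1 / 2 * norm (x a)" using elim by (intro mult_right_mono) auto
  finally have "norm (x a) \<le> 2 * norm (K a *v x a)"
   using norm_triangle_ineq2 [of "x a" "K a *v x a"] by simp
  hence "C * norm (mat 1 - K a) * norm (x a) \<le> C * norm (mat 1 - K a) * (2 * norm (K a *v x a))"
   using C(1) by (intro mult_left_mono) auto
  thus ?case using 1 by linarith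
 qed
 hence "((\<lambda>a. x a - K a *v x a) \<longlongrightarrow> 0) F" by (rule Lim_null_comparison [OF _ z])
 from tendsto_add [OF this b] show ?thesis by simp
qed

lemma tendsto_matrix_vector:
 "(A \<longlongrightarrow> A') F ==> (x \<longlongrightarrow> x') F ==> ((\<lambda>a. A a *v x a) \<longlongrightarrow> (A' :: real^'n^'m) *v x') F"
 by (rule bounded_bilinear.tendsto [OF bounded_bilinear_matrix_vector])

lemma continuous_on_matrix_vector [continuous_intros]:
 "continuous_on S A ==> continuous_on S x ==> continuous_on S (\<lambda>a. (A a :: real^'n^'m) *v x a)"
 by (rule bounded_bilinear.continuous_on [OF bounded_bilinear_matrix_vector])

lemma continuous_on_det [continuous_intros]:
 "continuous_on S A ==> continuous_on S (\<lambda>a. det (A a :: real^'n^'n))"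
 unfolding det_def by (intro continuous_intros)

lemma continuous_on_nat_par:
 assumes "\<And>u. u \<in> S ==> fst u \<in> par_space"
 shows "continuous_on S (nat_par :: 'p::finite par \<times> _ => _)"
proof -
 have "det (par_K (fst u)) \<noteq> 0" if "u \<in> S" for u :: "'p par \<times> (real \<times> real)"
  using assms [OF that] pos_def_det_pos [of "par_K (fst u)"] by (auto simp: par_space_def)
 moreover have "logistic a \<noteq> 0" for a using less_imp_neq [OF logistic_pos] by simp
 ultimately show ?thesis
  unfolding nat_par_def [abs_def] par_quad_def Let_def coef_par_def mech_quad_def
  by (auto intro!: continuous_intros)
qed

lemma ell_of_nat_par:
 assumes "transpose (par_K (fst u)) = par_K (fst u)"
 shows "ell (nat_par u) x = ell_obs (quad (par_quad 1 (fst u)) (fst x)) (quad (par_quad 2 (fst u)) (fst x))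
   (fst (snd u) + snd (snd u) * (quad (par_quad 1 (fst u)) (fst x) - quad (par_quad 2 (fst u)) (fst x))^2) (snd x)"
 unfolding ell_def nat_par_def fst_conv snd_conv quad_mech_quad discr_coef_par [OF assms] quad_par_quad_diff [OF assms] ..

lemma continuous_on_ell [continuous_intros]: "continuous_on S f ==> continuous_on S (\<lambda>a. ell (f a) x)"
 unfolding ell_def ell_obs_def by (cases "snd (snd x) = 1"; cases "fst (snd x) = 1"; simp; intro continuous_intros)

context mechanism_law
begin

lemma w0_nat_model: "w0 = nat_model (\<theta>0, xi)"
 by (simp add: w0_def nat_model_def)

lemma par_of_\<theta>0: "par_of \<theta>0 = t0"
 unfolding par_of_def \<theta>0_simps par0_def by simp

lemma t0: "t0 \<in> par_space" "model_of t0 = \<theta>0"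
 using par_of_space [OF \<theta>0] model_of_par_of [OF \<theta>0] by (simp_all add: par_of_\<theta>0)

lemma w0_nat_par: "w0 = nat_par (t0, xi)"
 unfolding w0_nat_model t0(2) [symmetric] by (rule nat_model_of [OF t0(1)])

lemma nat_model_mem: "\<theta> \<in> model_space ==> \<xi> \<in> Xi ==> nat_model (\<theta>, \<xi>) \<in> quads"
 by (simp add: quads_def nat_model_def class_quads_sub_quads mech_quad_mem del: One_nat_def)

lemma nat_par_inverse_continuous:
 assumes f: "((\<lambda>a. nat_par (f a)) \<longlongrightarrow> w0) F"
 shows "(f \<longlongrightarrow> (t0, xi)) F"
proof -
 let ?K = "\<lambda>a. par_K (fst (f a))" and ?m1 = "\<lambda>a. par_mu1 (fst (f a))" and ?m2 = "\<lambda>a. par_mu2 (fst (f a))"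
 note f = f [unfolded w0_nat_par]
 have q1: "((\<lambda>a. par_quad 1 (fst (f a))) \<longlongrightarrow> par_quad 1 t0) F" and q2: "((\<lambda>a. par_quad 2 (fst (f a))) \<longlongrightarrow> par_quad 2 t0) F"
  and g: "((\<lambda>a. mech_quad (snd (f a)) (coef_par (fst (f a)))) \<longlongrightarrow> mech_quad xi (coef_par t0)) F"
  using tendsto_fst [OF f] tendsto_fst [OF tendsto_snd [OF f]] tendsto_snd [OF tendsto_snd [OF f]]
  by (simp_all add: nat_par_def)
 have K: "(?K \<longlongrightarrow> par_K t0) F"
  using tendsto_scaleR [OF tendsto_const [of "- 2"] tendsto_snd [OF tendsto_snd [OF q1]]]
  by (simp add: par_quad_def Let_def)
 hence K1: "(?K \<longlongrightarrow> mat 1) F" by (simp add: par0_def)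
 have m1: "(?m1 \<longlongrightarrow> par_mu1 t0) F"
 proof (rule tendsto_solve [OF K1])
  have "par_K t0 *v par_mu1 t0 = par_mu1 t0" by (simp add: par0_def)
  thus "((\<lambda>a. ?K a *v ?m1 a) \<longlongrightarrow> par_mu1 t0) F"
   using tendsto_fst [OF tendsto_snd [OF q1]] by (simp add: par_quad_def Let_def)
 qed
 have m2: "(?m2 \<longlongrightarrow> par_mu2 t0) F"
 proof (rule tendsto_solve [OF K1])
  have "par_K t0 *v par_mu2 t0 = par_mu2 t0" by (simp add: par0_def)
  thus "((\<lambda>a. ?K a *v ?m2 a) \<longlongrightarrow> par_mu2 t0) F"
   using tendsto_fst [OF tendsto_snd [OF q2]] by (simp add: par_quad_def Let_def)
 qed
 have rho: "par_rho t = fst (par_quad 1 t) - fst (par_quad 2 t) + (par_mu1 t \<bullet> (par_K t *v par_mu1 t)) / 2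
   - (par_mu2 t \<bullet> (par_K t *v par_mu2 t)) / 2" for t :: "'p par"
  using softplus_minus [of "par_rho t"] by (simp add: par_quad_def Let_def ln_logistic)
 have r: "((\<lambda>a. par_rho (fst (f a))) \<longlongrightarrow> par_rho t0) F"
  unfolding rho by (intro tendsto_intros tendsto_matrix_vector K m1 m2 q1 q2) auto
 have t: "((\<lambda>a. fst (f a)) \<longlongrightarrow> t0) F"
  using tendsto_Pair [OF r tendsto_Pair [OF m1 tendsto_Pair [OF m2 K]]] by simp
 have c0: "((\<lambda>a. fst (coef_par (fst (f a)))) \<longlongrightarrow> fst (coef_par t0)) F"
  and c1: "((\<lambda>a. snd (coef_par (fst (f a)))) \<longlongrightarrow> snd (coef_par t0)) F"
  unfolding coef_par_def fst_conv snd_conv by (intro tendsto_intros tendsto_matrix_vector K m1 m2 r; simp)+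
 have ck: "((\<lambda>a. (snd (coef_par (fst (f a))) $ k)^2) \<longlongrightarrow> D\<^sup>2) F"
  using tendsto_power [OF tendsto_vec_nth [OF c1, of k], of 2] by (simp add: coef_par_0)
 have D2: "D^2 \<noteq> 0" using D by simp
 have gk: "((\<lambda>a. snd (snd (f a)) * (snd (coef_par (fst (f a))) $ k)^2) \<longlongrightarrow> snd xi * D^2) F"
  using tendsto_vec_nth [OF tendsto_vec_nth [OF tendsto_snd [OF tendsto_snd [OF g]], of k], of k]
  by (simp add: mech_quad_def coef_par_0 power2_eq_square mult.assoc)
 have ev: "\<forall>\<^sub>F a in F. snd (coef_par (fst (f a))) $ k \<noteq> 0"
  using tendsto_imp_eventually_ne [OF ck D2] by eventually_elim auto
 have x1: "((\<lambda>a. snd (snd (f a))) \<longlongrightarrow> snd xi) F"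
 proof -
  have "((\<lambda>a. snd (snd (f a)) * (snd (coef_par (fst (f a))) $ k)^2 / (snd (coef_par (fst (f a))) $ k)^2) \<longlongrightarrow> snd xi * D^2 / D^2) F"
   by (rule tendsto_divide [OF gk ck D2])
  hence "((\<lambda>a. snd (snd (f a)) * (snd (coef_par (fst (f a))) $ k)^2 / (snd (coef_par (fst (f a))) $ k)^2) \<longlongrightarrow> snd xi) F"
   using D by simp
  thus ?thesis
   by (rule Lim_transform_eventually) (use ev in \<open>eventually_elim; simp\<close>)
 qed
 have "((\<lambda>a. fst (mech_quad (snd (f a)) (coef_par (fst (f a)))) - snd (snd (f a)) * (fst (coef_par (fst (f a))))^2)
   \<longlongrightarrow> fst (mech_quad xi (coef_par t0)) - snd xi * (fst (coef_par t0))^2) F"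
  by (intro tendsto_intros tendsto_fst [OF g] x1 c0)
 hence x0: "((\<lambda>a. fst (snd (f a))) \<longlongrightarrow> fst xi) F" by (simp add: mech_quad_def)
 show ?thesis using tendsto_Pair [OF t tendsto_Pair [OF x0 x1]] by simp
qed

lemma nat_par_close:
 assumes "0 < r"
 obtains \<rho> where "0 < \<rho>" "\<And>u. norm (nat_par u - w0) < \<rho> ==> norm (u - (t0, xi)) < r"
proof -
 have "((\<lambda>u. u) \<longlongrightarrow> (t0, xi)) (filtercomap nat_par (nhds w0))"
  by (rule nat_par_inverse_continuous) (rule filterlim_filtercomap)
 hence "\<forall>\<^sub>F u in filtercomap nat_par (nhds w0). dist u (t0, xi) < r"
  using assms by (rule tendstoD)
 then obtain P where P: "eventually P (nhds w0)" "\<And>u. P (nat_par u) ==> dist u (t0, xi) < r"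
  unfolding eventually_filtercomap by blast
 thus thesis using that unfolding eventually_nhds_metric by (metis dist_norm)
qed

lemma par_space_near:
 obtains r where "0 < r" "\<And>u. u - (t0, xi) \<in> dir_space ==> norm (u - (t0, xi)) \<le> r ==> fst u \<in> par_space \<and> snd u \<in> Xi"
proof -
 obtain C where C: "0 < C" "\<And>A x. norm ((A :: real^'p^'p) *v x) \<le> C * norm A * norm x"
  by (rule norm_matrix_vector_le, rule that)
 define r where "r = min (1 / (2 * C)) (D / 4)"
 show thesis
 proof (rule that [of r])
  show "0 < r" using C D by (simp add: r_def)
  fix u assume u: "u - (t0, xi) \<in> dir_space" "norm (u - (t0, xi)) \<le> r"
  define h where "h = fst u - t0"
  have nh: "norm h \<le> r"
   using norm_components_le(1) [of "u - (t0, xi)"] u(2) by (simp add: h_def)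
  have hc: "norm (par_K h) \<le> norm h" "norm (par_mu1 h) \<le> norm h" "norm (par_mu2 h) \<le> norm h"
   using norm_components_le [of h] norm_components_le [of "snd h"] norm_components_le [of "snd (snd h)"] by linarith+
  have uK: "par_K (fst u) = mat 1 + par_K h" and um: "par_mu1 (fst u) - par_mu2 (fst u) = D *\<^sub>R axis k 1 + (par_mu1 h - par_mu2 h)"
  proof -
   have half: "D *\<^sub>R (axis k 1 :: real^'p) = (D / 2) *\<^sub>R axis k 1 + (D / 2) *\<^sub>R axis k 1"
    by (simp only: scaleR_add_left [symmetric] field_sum_of_halves)
   show "par_K (fst u) = mat 1 + par_K h" "par_mu1 (fst u) - par_mu2 (fst u) = D *\<^sub>R axis k 1 + (par_mu1 h - par_mu2 h)"
    unfolding half by (simp_all add: h_def par0_def class_mean_axis)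
  qed
  have sym: "transpose (par_K h) = par_K h" "snd u - xi \<in> Xi" using u(1) by (simp_all add: dir_space_def h_def)
  have "pos_def (par_K (fst u))"
   unfolding pos_def_def
  proof (intro conjI allI impI)
   show "transpose (par_K (fst u)) = par_K (fst u)"
    unfolding uK using sym(1) by (simp add: transpose_eq_iff mat_def)
   fix x :: "real^'p" assume x: "x \<noteq> 0"
   have "\<bar>x \<bullet> (par_K h *v x)\<bar> \<le> norm x * norm (par_K h *v x)" by (rule Cauchy_Schwarz_ineq2)
   also have "... \<le> norm x * (C * norm (par_K h) * norm x)" by (intro mult_left_mono C) simp
   also have "... \<le> norm x * (1 / 2 * norm x)"
   proof (intro mult_left_mono mult_right_mono norm_ge_zero)
    have "C * norm (par_K h) \<le> C * (1 / (2 * C))"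
     using C(1) hc(1) nh by (intro mult_left_mono) (auto simp: r_def)
    thus "C * norm (par_K h) \<le> 1 / 2" using C(1) by simp
   qed
   finally have "\<bar>x \<bullet> (par_K h *v x)\<bar> \<le> x \<bullet> x / 2" by (simp add: power2_norm_eq_inner [symmetric] power2_eq_square)
   moreover have "0 < x \<bullet> x" using x by simp
   ultimately have "0 < x \<bullet> x + x \<bullet> (par_K h *v x)" by linarith
   thus "0 < x \<bullet> (par_K (fst u) *v x)"
    by (simp add: uK matrix_vector_mult_add_rdistrib inner_simps)
  qed
  moreover have "par_mu1 (fst u) \<noteq> par_mu2 (fst u)"
  proof
   assume "par_mu1 (fst u) = par_mu2 (fst u)"
   hence "D *\<^sub>R axis k 1 = - (par_mu1 h - par_mu2 h)" using um by (simp only: eq_neg_iff_add_eq_0 diff_self)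
   hence "norm (D *\<^sub>R axis k 1 :: real^'p) = norm (par_mu1 h - par_mu2 h)" by (simp only: norm_minus_cancel)
   hence "D = norm (par_mu1 h - par_mu2 h)" using D by simp
   also have "... \<le> norm (par_mu1 h) + norm (par_mu2 h)" by (rule norm_triangle_ineq4)
   also have "... \<le> D / 4 + D / 4" using hc nh by (intro add_mono) (auto simp: r_def)
   finally show False using D by simp
  qed
  moreover have "snd u \<in> Xi" using mech sym(2) by auto
  ultimately show "fst u \<in> par_space \<and> snd u \<in> Xi" by (simp add: par_space_def)
 qed
qed

definition binary :: "'p obs => bool" where
 "binary x \<longleftrightarrow> (fst (snd x) = 0 \<or> fst (snd x) = 1) \<and> (snd (snd x) = 0 \<or> snd (snd x) = 1)"

lemma AE_binary: "AE w in P. \<forall>j. binary (X j w)"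
proof -
 have [measurable]: "Measurable.pred borel binary" unfolding binary_def [abs_def] by measurable
 have "(\<integral>\<^sup>+x. indicator {x. \<not> binary x} x \<partial>Q) = 0"
  by (subst law) (auto simp: binary_def indicator_def)
 hence "AE x in Q. binary x"
  by (subst (asm) nn_integral_0_iff_AE) (auto simp: indicator_def split: if_splits)
 hence "AE w in P. binary (X j w)" for j
  unfolding distr_X [of j, symmetric] by (subst (asm) AE_distr_iff) auto
 thus ?thesis by (simp add: AE_all_countable)
qed

definition full_curve :: "'p par \<times> (real \<times> real) => 'p par \<times> (real \<times> real) => real => 'p par \<times> (real \<times> real)" where
 "full_curve v u s = (par_curve (fst v) (fst u) s, snd u + s *\<^sub>R xi_dir (snd v))"

lemma DERIV_ell_curve:
 assumes t: "fst u \<in> par_space" and v: "par_K (fst v) = b *\<^sub>R unit_matrix i j" and x: "binary x"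
 shows "((\<lambda>s. ell (nat_par (full_curve v u s)) x) has_real_derivative score v u x) (at 0)"
proof -
 obtain y c m where xe: "x = (y, c, m)" by (cases x)
 let ?A = "\<lambda>s. quad (par_quad 1 (par_curve (fst v) (fst u) s)) y" and ?B = "\<lambda>s. quad (par_quad 2 (par_curve (fst v) (fst u) s)) y"
 let ?g = "\<lambda>s. (fst (snd u) + s * fst (xi_dir (snd v))) + (snd (snd u) + s * snd (xi_dir (snd v))) * (?A s - ?B s)^2"
 note dA = DERIV_quad_curve(1) [OF t v, of y] and dB = DERIV_quad_curve(2) [OF t v, of y]
 have sym: "transpose (par_K (fst u)) = par_K (fst u)" using t by (simp add: par_space_def pos_def_def)
 have AB: "?A 0 - ?B 0 = log_odds (fst u) y"
  unfolding par_curve_0 [OF t v] by (rule quad_par_quad_diff [OF sym])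
 have g0: "?g 0 = mech_logit u y" by (simp add: AB mech_logit_def del: One_nat_def)
 have dAB: "((\<lambda>s. ?A s - ?B s) has_real_derivative score_diff (fst v) (fst u) y) (at 0)"
  using DERIV_diff [OF dA dB] by simp
 have dg: "(?g has_real_derivative mech_dir v u y) (at 0)"
 proof -
  have "((\<lambda>s. a + s * z + (a' + s * z') * (H s)^2) has_real_derivative z + z' * (H 0)^2 + 2 * a' * (H 0 * H')) (at 0)"
   if "(H has_real_derivative H') (at 0)" for H H' a z a' z'
   by (auto intro!: derivative_eq_intros that)
  from this [OF dAB] show ?thesis unfolding AB mech_dir_def .
 qed
 have dsp: "((\<lambda>s. softplus (?A s - ?B s)) has_real_derivative logistic (log_odds (fst u) y) * score_diff (fst v) (fst u) y) (at 0)"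
  using DERIV_softplus [OF dAB] unfolding AB .
 have dsg: "((\<lambda>s. softplus (?g s)) has_real_derivative logistic (mech_logit u y) * mech_dir v u y) (at 0)"
  using DERIV_softplus [OF dg] unfolding g0 .
 have "((\<lambda>s. ell_obs (?A s) (?B s) (?g s) (c, m)) has_real_derivative score v u x) (at 0)"
 proof (cases "m = 1")
  case True
  show ?thesis
   unfolding ell_obs_def using True
   by (simp del: One_nat_def) (rule DERIV_cong [OF DERIV_add [OF DERIV_add [OF dB dsp] DERIV_diff [OF dg dsg]]],
    simp add: score_def score_ig_def xe algebra_simps)
 next
  case False
  hence m: "m = 0" "c = 0 \<or> c = 1" using x by (auto simp: xe binary_def)
  have "((\<lambda>s. if c = 1 then ?A s else ?B s) has_real_derivative score2 (fst v) (fst u) y + c * score_diff (fst v) (fst u) y) (at 0)"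
   using m(2) dA dB by (cases "c = 1") auto
  from DERIV_diff [OF this dsg] show ?thesis
   unfolding ell_obs_def using m(1) by (simp add: score_def score_ig_def xe algebra_simps del: One_nat_def)
 qed
 moreover have "\<forall>\<^sub>F s in nhds 0. ell (nat_par (full_curve v u s)) x = ell_obs (?A s) (?B s) (?g s) (c, m)"
  using eventually_curve [OF t v]
 proof eventually_elim
  case (elim s)
  hence "transpose (par_K (fst (full_curve v u s))) = par_K (fst (full_curve v u s))"
   by (simp add: full_curve_def par_space_def pos_def_def)
  from ell_of_nat_par [OF this, of x] show ?case by (simp add: full_curve_def xe)
 qed
 ultimately show ?thesis by (subst DERIV_cong_ev [OF refl _ refl])
qed

lemma score_equations:
 assumes t: "fst u \<in> par_space" and \<xi>: "snd u \<in> Xi" and data: "\<And>j. binary (X j w)"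
  and max: "\<And>u'. fst u' \<in> par_space ==> snd u' \<in> Xi ==> avg (ell (nat_par u')) n w \<le> avg (ell (nat_par u)) n w"
 shows "avg (score v u) n w = 0"
proof -
 have special: "avg (score v u) n w = 0" if v: "par_K (fst v) = b *\<^sub>R unit_matrix i j" for v b i j
 proof -
  let ?L = "\<lambda>s. avg (ell (nat_par (full_curve v u s))) n w"
  have d: "(?L has_real_derivative avg (score v u) n w) (at 0)"
   unfolding avg_def by (intro DERIV_cdivide DERIV_sum DERIV_ell_curve [OF t v] data)
  have "\<forall>\<^sub>F s in nhds 0. ?L s \<le> ?L 0"
   using eventually_curve [OF t v]
  proof eventually_elim
   case (elim s)
   have "snd u + s *\<^sub>R xi_dir (snd v) \<in> Xi" using mech \<xi> by (auto simp: xi_dir_def)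
   moreover have "full_curve v u 0 = u" by (simp add: full_curve_def par_curve_0 [OF t v])
   ultimately show ?case using max [of "full_curve v u s"] elim by (simp add: full_curve_def)
  qed
  then obtain e where "0 < e" "\<And>s. dist s 0 < e ==> ?L s \<le> ?L 0"
   unfolding eventually_nhds_metric by blast
  thus ?thesis using DERIV_local_max [OF d] by (simp add: dist_real_def)
 qed
 obtain r c1 c2 B z where v: "v = ((r, c1, c2, B), z)" by (cases v) auto
 let ?e = "\<lambda>i j. ((0, 0, 0, unit_matrix i j), 0) :: 'p par \<times> (real \<times> real)"
 have lin: "linear (\<lambda>v. avg (score v u) n w)"
  using linear_avg [of "\<lambda>x v. score v u x", OF linear_score(1)] by simp
 have unit: "avg (score (?e i j) u) n w = 0" for i j by (rule special [of _ 1 i j]) simp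
 have "B = (\<Sum>i\<in>UNIV. \<Sum>j\<in>UNIV. B $ i $ j *\<^sub>R unit_matrix i j)"
 proof -
  have "(\<Sum>i\<in>UNIV. \<Sum>j\<in>UNIV. B $ i $ j * of_bool (a = i \<and> c = j)) = B $ a $ c" for a c
  proof -
   have "(\<Sum>j\<in>UNIV. B $ i $ j * of_bool (a = i \<and> c = j)) = (if a = i then B $ i $ c else 0)" for i
    by (auto simp: of_bool_def if_distrib cong: if_cong)
   thus ?thesis by simp
  qed
  thus ?thesis by (simp add: vec_eq_iff unit_matrix_def)
 qed
 hence "v = ((r, c1, c2, 0), z) + (\<Sum>i\<in>UNIV. \<Sum>j\<in>UNIV. B $ i $ j *\<^sub>R ?e i j)"
  by (simp add: v prod_eq_iff fst_sum snd_sum zero_prod_def)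
 hence "avg (score v u) n w = avg (score ((r, c1, c2, 0), z) u) n w + (\<Sum>i\<in>UNIV. \<Sum>j\<in>UNIV. B $ i $ j * avg (score (?e i j) u) n w)"
  by (simp only: linear_add [OF lin] linear_sum [OF lin] linear_cmul [OF lin] real_scaleR_def)
 also have "avg (score ((r, c1, c2, 0), z) u) n w = 0" by (rule special [of _ 0]) simp
 finally show ?thesis by (simp add: unit)
qed

end

context mechanism_law
begin

lemma whp_estimator:
 assumes ml: "\<And>n. 1 \<le> n ==> AE z in P. ml_estimate (\<lambda>p. avg (ell (nat_model p)) n z) (model_space \<times> Xi) (\<lambda>p. coef (fst p)) (b n z)"
  and r: "0 < r"
 shows "whp (\<lambda>n z. \<exists>h\<in>dir_space. norm h \<le> r \<and> (\<forall>v. avg (score v ((t0, xi) + h)) n z = 0) \<and>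
  err \<theta>0 (b n z) = err \<theta>0 (coef_par (fst ((t0, xi) + h))))"
proof -
 let ?u0 = "(t0, xi)"
 obtain r0 where r0: "0 < r0" "\<And>u. u - ?u0 \<in> dir_space ==> norm (u - ?u0) \<le> r0 ==> fst u \<in> par_space \<and> snd u \<in> Xi"
  by (rule par_space_near, rule that)
 define R where "R = min r r0"
 have R: "0 < R" "R \<le> r" "R \<le> r0" using r r0 by (auto simp: R_def)
 obtain \<rho> where \<rho>: "0 < \<rho>" "\<And>u. norm (nat_par u - w0) < \<rho> ==> norm (u - ?u0) < R"
  by (rule nat_par_close [OF R(1)], rule that)
 define C where "C = {u. u - ?u0 \<in> dir_space} \<inter> cball ?u0 R"
 have C: "compact C"
  unfolding C_def
  by (intro closed_Int_compact compact_cball closed_vimage [of dir_space "\<lambda>u. u - ?u0", unfolded vimage_def] dir_space continuous_intros)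
 have "0 \<in> Xi" using mech by auto
 hence u0C: "?u0 \<in> C" using R by (simp add: C_def dir_space_def transpose_eq_iff)
 have Cpar: "fst u \<in> par_space \<and> snd u \<in> Xi" if "u \<in> C" for u
  using that R by (intro r0(2)) (auto simp: C_def dist_norm norm_minus_commute)
 have "whp (\<lambda>n z. (\<forall>w\<in>quads. avg (ell w0) n z \<le> avg (ell w) n z \<longrightarrow> norm (w - w0) < \<rho>) \<and>
   (\<forall>j. binary (X j z)) \<and> 1 \<le> n \<and>
   (1 \<le> n \<longrightarrow> ml_estimate (\<lambda>p. avg (ell (nat_model p)) n z) (model_space \<times> Xi) (\<lambda>p. coef (fst p)) (b n z)))"
  using ml by (intro whp_conj whp_quads_close \<rho> whp_AE AE_binary whp_large) auto
 thus ?thesis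
 proof (rule whp_mono)
  fix n z
  let ?L = "\<lambda>u. avg (ell (nat_par u)) n z"
  assume *: "(\<forall>w\<in>quads. avg (ell w0) n z \<le> avg (ell w) n z \<longrightarrow> norm (w - w0) < \<rho>) \<and>
   (\<forall>j. binary (X j z)) \<and> 1 \<le> n \<and>
   (1 \<le> n \<longrightarrow> ml_estimate (\<lambda>p. avg (ell (nat_model p)) n z) (model_space \<times> Xi) (\<lambda>p. coef (fst p)) (b n z))"
  have model: "nat_model p = nat_par (par_of (fst p), snd p)" "par_of (fst p) \<in> par_space" "snd p \<in> Xi"
   if "p \<in> model_space \<times> Xi" for p
   using that par_of_space [of "fst p"] nat_model_of [of "par_of (fst p)" "snd p"] model_of_par_of [of "fst p"]
   by (auto simp: mem_Times_iff)
  have par: "(model_of (fst u), snd u) \<in> model_space \<times> Xi" "nat_model (model_of (fst u), snd u) = nat_par u"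
   if "fst u \<in> par_space" "snd u \<in> Xi" for u
   using that by (simp_all add: model_of_space nat_model_of)
  have inC: "u \<in> C" if u: "fst u \<in> par_space" "snd u \<in> Xi" and le: "?L ?u0 \<le> ?L u" for u
  proof -
   have "nat_par u \<in> quads"
    using nat_model_mem [OF model_of_space [OF u(1)] u(2)] by (simp add: nat_model_of u)
   hence "norm (u - ?u0) < R"
    using * le w0_nat_par by (intro \<rho>(2)) auto
   moreover have "u - ?u0 \<in> dir_space"
    using u mech t0(1) by (auto simp: dir_space_def par_space_def pos_def_def transpose_eq_iff)
   ultimately show ?thesis by (simp add: C_def dist_norm norm_minus_commute)
  qed
  have "continuous_on C ?L"
   unfolding avg_def by (intro continuous_intros continuous_on_nat_par) (use Cpar * in auto)
  then obtain um where um: "um \<in> C" "\<And>u. u \<in> C ==> ?L u \<le> ?L um"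
   using continuous_attains_sup [OF C] u0C by blast
  have max: "?L u \<le> ?L um" if "fst u \<in> par_space" "snd u \<in> Xi" for u
  proof (cases "?L ?u0 \<le> ?L u")
   case True
   thus ?thesis using inC [OF that] um by blast
  next
   case False
   thus ?thesis using um(2) [OF u0C] by linarith
  qed
  have "is_arg_max (\<lambda>p. avg (ell (nat_model p)) n z) (\<lambda>p. p \<in> model_space \<times> Xi) (model_of (fst um), snd um)"
   unfolding is_arg_max_def
  proof (intro conjI notI, goal_cases)
   case 1
   show ?case using par(1) Cpar [OF um(1)] by blast
  next
   case 2
   then obtain p where p: "p \<in> model_space \<times> Xi"
    "avg (ell (nat_model (model_of (fst um), snd um))) n z < avg (ell (nat_model p)) n z" by blast
   thus False
    using max [of "(par_of (fst p), snd p)"] model [OF p(1)] par(2) [of um] Cpar [OF um(1)] by simp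
  qed
  then obtain p where p: "is_arg_max (\<lambda>p. avg (ell (nat_model p)) n z) (\<lambda>p. p \<in> model_space \<times> Xi) p"
   and b: "coef (fst p) = b n z"
   using * unfolding ml_estimate_def by blast
  have pm: "p \<in> model_space \<times> Xi" using p by (simp add: is_arg_max_def)
  define u where "u = (par_of (fst p), snd p)"
  have u: "fst u \<in> par_space" "snd u \<in> Xi" "nat_model p = nat_par u"
   using model [OF pm] by (simp_all add: u_def)
  have umax: "?L u' \<le> ?L u" if "fst u' \<in> par_space" "snd u' \<in> Xi" for u'
   using p par [OF that] u(3) unfolding is_arg_max_def by (metis linorder_not_less)
  have uC: "u \<in> C" using u umax t0(1) xi_Xi by (intro inC) auto
  have "coef (fst p) = coef_par (fst u)"
   using coef_model_of [of "fst u"] u(1) pm by (auto simp: u_def par_space_def model_of_par_of)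
  moreover have "avg (score v u) n z = 0" for v
   by (rule score_equations [OF u(1,2) _ umax]) (use * in auto)
  ultimately show "\<exists>h\<in>dir_space. norm h \<le> r \<and> (\<forall>v. avg (score v (?u0 + h)) n z = 0) \<and>
   err \<theta>0 (b n z) = err \<theta>0 (coef_par (fst (?u0 + h)))"
   using uC R b by (intro bexI [of _ "u - ?u0"]) (auto simp: C_def dist_norm norm_minus_commute)
 qed
qed

theorem has_AE_err:
 assumes ml: "\<And>n. 1 \<le> n ==> AE w in P. ml_estimate (\<lambda>p. avg (ell (nat_model p)) n w) (model_space \<times> Xi) (\<lambda>p. coef (fst p)) (b n w)"
  and b [measurable]: "\<And>n. b n \<in> borel_measurable P"
 shows "has_AE (expected_err P \<theta>0 b) (\<lambda>n. err \<theta>0 (coef \<theta>0)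
  + (normal_density 0 1 (D / 2) / (4 * D) * CARD('p) / (1 / (4 + D^2) - info_loss + mech_info)) / real n)"
proof -
 define v where "v j = (if j = k then (eff_dir D k 1 0, 0) else (eff_dir D k 0 (axis j 1), 0) :: 'p par \<times> (real \<times> real))" for j
 define l where "l j h = dev k j (dcoef0 D k (fst h), dcoef1 D k (fst h))" for j and h :: "'p par \<times> (real \<times> real)"
 obtain \<kappa> where \<kappa>: "0 < \<kappa>" "\<And>h. h \<in> dir_space ==> (LINT x|Q. dscore (full_tilt h) x h) \<le> - \<kappa> * (norm h)^2"
  by (rule dscore_coercive, rule that)
 have ax: "axis j 1 $ k = (0 :: real)" if "j \<noteq> k" for j using that by (simp add: axis_def)
 have "has_AE (\<lambda>n. expectation (\<lambda>w. err \<theta>0 (b n w))) (\<lambda>n. err \<theta>0 (coef \<theta>0)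
  + (normal_density 0 1 (D / 2) / (4 * D) * card (UNIV :: 'p set) / (1 / (4 + D^2) - info_loss + mech_info)) / real n)"
 proof (rule has_AE_of_Z_estimator [where F = score and F' = dscore and t = "(t0, xi)" and W = dir_space and T = full_tilt
   and v = v and l = l and e = "\<lambda>u. err \<theta>0 (coef_par (fst u))" and I = UNIV, OF jet_score linear_score integral_score_zero linear_full_tilt \<kappa>])
  show "finite (UNIV :: 'p set)" "0 < 1 / (4 + D^2) - info_loss + mech_info" by (simp_all add: score_variance_pos)
  show "(LINT x|Q. (score (v j) (t0, xi) x)^2) = 1 / (4 + D^2) - info_loss + mech_info" for j
   using ax [of j] by (simp add: v_def integral_score_eff_square inner_axis)
  show "(LINT x|Q. dscore (v j) x h) = - (1 / (4 + D^2) - info_loss + mech_info) * l j h" if "h \<in> dir_space" for j h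
   using ax [of j] that by (simp add: v_def l_def dev_def integral_dscore_eff inner_axis')
  show "(\<lambda>w. err \<theta>0 (b n w)) \<in> borel_measurable P" "\<bar>err \<theta>0 (b n w)\<bar> \<le> 1" for n w
   by (measurable, rule err_bounds)
  show "whp (\<lambda>n w. \<exists>h\<in>dir_space. norm h \<le> r \<and> (\<forall>v. avg (score v ((t0, xi) + h)) n w = 0) \<and>
    err \<theta>0 (b n w) = err \<theta>0 (coef_par (fst ((t0, xi) + h))))" if "0 < r" for r
   by (rule whp_estimator [OF ml that])
  fix \<delta> :: real assume "0 < \<delta>"
  from err_coef_par_expansion [OF D this, of k]
  obtain r where r: "0 < r" "\<And>h. norm h \<le> r ==> \<bar>err \<theta>0 (coef_par (t0 + h)) - err \<theta>0 (coef \<theta>0)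
    - normal_density 0 1 (D / 2) / (4 * D) * (\<Sum>j\<in>UNIV. (dev k j (dcoef0 D k h, dcoef1 D k h))^2)\<bar> \<le> \<delta> * (norm h)^2"
   unfolding coef_\<theta>0 by blast
  have "\<bar>err \<theta>0 (coef_par (fst ((t0, xi) + h))) - err \<theta>0 (coef \<theta>0)
    - normal_density 0 1 (D / 2) / (4 * D) * (\<Sum>j\<in>UNIV. (l j h)^2)\<bar> \<le> \<delta> * (norm h)^2" if "norm h \<le> r" for h
  proof -
   have "norm (fst h) \<le> r" using norm_components_le(1) [of h] that by linarith
   from r(2) [OF this] have "\<bar>err \<theta>0 (coef_par (fst ((t0, xi) + h))) - err \<theta>0 (coef \<theta>0)
    - normal_density 0 1 (D / 2) / (4 * D) * (\<Sum>j\<in>UNIV. (l j h)^2)\<bar> \<le> \<delta> * (norm (fst h))^2"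
    by (simp add: l_def)
   also have "... \<le> \<delta> * (norm h)^2"
    using \<open>0 < \<delta>\<close> by (intro mult_left_mono power_mono norm_components_le) auto
   finally show ?thesis .
  qed
  thus "\<exists>r>0. \<forall>h\<in>dir_space. norm h \<le> r \<longrightarrow> \<bar>err \<theta>0 (coef_par (fst ((t0, xi) + h))) - err \<theta>0 (coef \<theta>0)
    - normal_density 0 1 (D / 2) / (4 * D) * (\<Sum>j\<in>UNIV. (l j h)^2)\<bar> \<le> \<delta> * (norm h)^2"
   using r(1) by blast
 qed
 thus ?thesis unfolding expected_err_def [abs_def] .
qed

end

section \<open>Asymptotic relative efficiency\<close>

lemma loglik_ig_term:
 assumes \<theta>: "\<theta> \<in> model_space" and z: "z \<in> {1, 2}" and m: "m \<in> {0, 1}"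
 shows "(1 - real m) * (\<Sum>i\<in>{1,2}. of_bool (z = i) * ln (prior \<theta> i * class_density \<theta> i y))
   + real m * ln (\<Sum>i\<in>{1,2}. prior \<theta> i * class_density \<theta> i y)
  = ell_obs (quad (class_quad \<theta> 1) y) (quad (class_quad \<theta> 2) y) g (of_bool (z = 1), of_bool (m = 1))
   - (real m * g - softplus g)"
proof -
 have e: "prior \<theta> i * class_density \<theta> i y = exp (quad (class_quad \<theta> i) y)" if "i \<in> {1, 2}" for i
  using exp_class_quad [OF \<theta> that] by simp
 have "(\<Sum>i\<in>{1,2}. prior \<theta> i * class_density \<theta> i y) = exp (quad (class_quad \<theta> 1) y) + exp (quad (class_quad \<theta> 2) y)"
  by (simp add: e del: One_nat_def)
 thus ?thesis
  using z m e [of 1] e [of 2] by (auto simp: ell_obs_def ln_add_exp simp del: One_nat_def)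
qed

lemma sum_ell_ig:
 assumes \<theta>: "\<theta> \<in> model_space" and z: "\<And>j. z j \<in> {1, 2}" and m: "\<And>j. m j \<in> {0, 1}"
 shows "loglik_ig n y z m \<theta>
  = (\<Sum>j<n. ell (nat_model (\<theta>, 0)) (y j, of_bool (z j = 1), of_bool (m j = 1))) + n * softplus 0"
proof -
 have "quad (mech_quad 0 c) x = 0" for c and x :: "real^'a" by (simp add: quad_mech_quad)
 thus ?thesis
  using loglik_ig_term [OF \<theta> z m, where g = 0]
  by (simp add: loglik_ig_def sum.distrib [symmetric] ell_def nat_model_def del: One_nat_def) (simp add: sum.distrib)
qed

lemma sum_ell_full:
 assumes \<theta>: "\<theta> \<in> model_space" and z: "\<And>j. z j \<in> {1, 2}" and m: "\<And>j. m j \<in> {0, 1}"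
 shows "loglik_full n y z m (\<theta>, \<xi>) = (\<Sum>j<n. ell (nat_model (\<theta>, \<xi>)) (y j, of_bool (z j = 1), of_bool (m j = 1)))"
proof -
 let ?g = "\<lambda>x. fst \<xi> + snd \<xi> * (discr (coef \<theta>) x)^2"
 have "(1 - real mm) * ln (1 - missing_prob \<theta> \<xi> x) + real mm * ln (missing_prob \<theta> \<xi> x) = real mm * ?g x - softplus (?g x)" for mm x
  by (simp add: missing_prob_logistic ln_logistic ln_one_minus_logistic algebra_simps)
 hence "((1 - real (m j)) * (\<Sum>i\<in>{1,2}. of_bool (z j = i) * ln (prior \<theta> i * class_density \<theta> i (y j)))
   + real (m j) * ln (\<Sum>i\<in>{1,2}. prior \<theta> i * class_density \<theta> i (y j)))
   + ((1 - real (m j)) * ln (1 - missing_prob \<theta> \<xi> (y j)) + real (m j) * ln (missing_prob \<theta> \<xi> (y j)))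
  = ell (nat_model (\<theta>, \<xi>)) (y j, of_bool (z j = 1), of_bool (m j = 1))" for j
  unfolding loglik_ig_term [OF \<theta> z [of j] m [of j], where y = "y j" and g = "?g (y j)"]
  by (simp add: ell_def nat_model_def quad_mech_quad del: One_nat_def)
 thus ?thesis
  by (simp only: loglik_full_def loglik_ig_def prod.case sum.distrib [symmetric])
qed

text \<open>The choice \<open>\<phi> = (\<lambda>_. 0)\<close> turns the data into a completely classified sample.\<close>

lemma sample_mechanism_law:
 fixes Y :: "nat => 'w => real^'p::finite" and \<phi> :: "nat => real"
 assumes D: "0 < D" and iid: "iid_sample P (canonical_model D k) \<xi> Y Z M"
  and \<phi>: "\<phi> = (\<lambda>m. of_bool (m = 1)) \<and> q = (\<lambda>t. logistic (fst \<xi> + snd \<xi> * (D * t)^2)) \<or> \<phi> = (\<lambda>_. 0) \<and> q = (\<lambda>_. 0)"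
  and xi: "Xi = UNIV \<and> (\<forall>t. q t = logistic (fst xi + snd xi * (D * t)^2)) \<or> Xi = {0} \<and> xi = 0"
 defines "X \<equiv> \<lambda>j v. (Y j v, of_bool (Z j v = 1), \<phi> (M j v))"
 shows "mechanism_law P X (distr P borel (X 0)) D k q xi Xi"
proof -
 interpret prob_space P using iid by (simp add: iid_sample_def)
 let ?\<theta> = "canonical_model D k"
 define T :: "(real^'p) \<times> nat \<times> nat => 'p obs" where "T = (\<lambda>(y, z, m). (y, of_bool (z = 1), \<phi> m))"
 have T: "T \<in> obs_base \<rightarrow>\<^sub>M borel"
  by (rule measurable_obs_base) (auto simp: T_def intro!: borel_measurable_continuous_onI continuous_intros)
 have XT: "X j = (\<lambda>v. T (Y j v, Z j v, M j v))" for j by (simp add: X_def T_def)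
 have d: "distributed P obs_base (\<lambda>v. (Y j v, Z j v, M j v)) (\<lambda>x. ennreal (obs_density ?\<theta> \<xi> x))" for j
  using iid by (simp add: iid_sample_def)
 have distr: "distr P borel (X j) = distr (density obs_base (\<lambda>x. ennreal (obs_density ?\<theta> \<xi> x))) borel T" for j
  unfolding XT distributed_distr_eq_density [OF d, of j, symmetric]
  by (subst distr_distr [OF T distributed_measurable [OF d]]) (simp add: o_def)
 have q01: "0 \<le> q t" "q t < 1" "q (- t) = q t" for t using \<phi> by auto
 have [measurable]: "q \<in> borel_measurable borel" using \<phi> by auto
 have law: "(\<integral>\<^sup>+x. F x \<partial>distr P borel (X 0)) =
   (\<Sum>s\<in>{0,1}. \<integral>\<^sup>+y. ennreal (1 / 2) * (ennreal (q (y $ k)) * F (y, s, 1) + ennreal (1 - q (y $ k)) * F (y, s, 0))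
    \<partial>iso_normal (class_mean D k s))" if F [measurable]: "F \<in> borel_measurable borel" for F
 proof -
  have [measurable]: "(\<lambda>y. F (y, s, m)) \<in> borel_measurable borel" for s m
   by (rule measurable_compose [OF _ F]) (auto intro!: borel_measurable_continuous_onI continuous_intros)
  note [measurable] = T measurable_obs_density
  define cm where "cm z = class_mean D k (of_bool (z = 1))" for z :: nat
  have dens: "class_density ?\<theta> z = iso_normal_density (cm z)" if "z \<in> {1, 2}" for z
   using that by (auto simp: class_density_def canonical_model_simps mvn_density_iso cm_def simp del: One_nat_def)
  have mp: "missing_prob ?\<theta> \<xi> y = logistic (fst \<xi> + snd \<xi> * (D * y $ k)^2)" for y
   by (simp add: missing_prob_logistic coef_canonical_model discr_def inner_axis')
  have "(\<integral>\<^sup>+x. F x \<partial>distr P borel (X 0)) = (\<integral>\<^sup>+x. ennreal (obs_density ?\<theta> \<xi> x) * F (T x) \<partial>obs_base)"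
   unfolding distr by (subst nn_integral_distr, use T in simp, simp, subst nn_integral_density) auto
  also have "... = (\<Sum>z\<in>{1,2}. \<Sum>m\<in>{0,1}. \<integral>\<^sup>+y. ennreal (obs_density ?\<theta> \<xi> (y, z, m)) * F (T (y, z, m)) \<partial>lborel)"
   by (rule nn_integral_obs_base) measurable
  also have "... = (\<Sum>z\<in>{1,2}. \<integral>\<^sup>+y. ennreal (1 / 2) * (ennreal (q (y $ k)) * F (y, of_bool (z = 1), 1) + ennreal (1 - q (y $ k)) * F (y, of_bool (z = 1), 0))
    \<partial>iso_normal (cm z))"
  proof (rule sum.cong [OF refl])
   fix z :: nat assume z: "z \<in> {1, 2}"
   let ?p = "\<lambda>y. logistic (fst \<xi> + snd \<xi> * (D * y $ k)^2)" and ?f = "iso_normal_density (cm z)" and ?s = "of_bool (z = 1) :: real"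
   have [measurable]: "(\<lambda>y :: real^'p. ?p y) \<in> borel_measurable borel" by measurable
   have "(\<Sum>m\<in>{0,1}. \<integral>\<^sup>+y. ennreal (obs_density ?\<theta> \<xi> (y, z, m)) * F (T (y, z, m)) \<partial>lborel)
    = (\<integral>\<^sup>+y. ennreal (1 / 2 * ?f y * (1 - ?p y)) * F (y, ?s, \<phi> 0) \<partial>lborel) + (\<integral>\<^sup>+y. ennreal (1 / 2 * ?f y * ?p y) * F (y, ?s, \<phi> 1) \<partial>lborel)"
    by (simp add: obs_density_def canonical_model_simps(1) dens [OF z] mp T_def del: One_nat_def)
   also have "... = (\<integral>\<^sup>+y. ennreal (1 / 2 * ?f y * (1 - ?p y)) * F (y, ?s, \<phi> 0) + ennreal (1 / 2 * ?f y * ?p y) * F (y, ?s, \<phi> 1) \<partial>lborel)"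
    by (rule nn_integral_add [symmetric]) measurable
   also have "... = (\<integral>\<^sup>+y. ennreal (?f y) * (ennreal (1 / 2) * (ennreal (q (y $ k)) * F (y, ?s, 1) + ennreal (1 - q (y $ k)) * F (y, ?s, 0))) \<partial>lborel)"
   proof (rule nn_integral_cong)
    fix y
    have *: "ennreal (1 / 2 * ?f y * c) = ennreal (?f y) * ennreal (1 / 2) * ennreal c" if "0 \<le> c" for c
     using that by (simp add: ennreal_mult [symmetric] mult_ac del: ennreal_half)
    have "ennreal (1 - ?p y) * F (y, ?s, \<phi> 0) + ennreal (?p y) * F (y, ?s, \<phi> 1)
      = ennreal (q (y $ k)) * F (y, ?s, 1) + ennreal (1 - q (y $ k)) * F (y, ?s, 0)"
     using \<phi>
    proof
     assume "\<phi> = (\<lambda>_. 0) \<and> q = (\<lambda>_. 0)"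
     moreover have "ennreal (1 - ?p y) + ennreal (?p y) = 1" by (simp add: ennreal_plus [symmetric] del: ennreal_plus)
     ultimately show ?thesis by (simp add: distrib_right [symmetric])
    qed (simp add: add.commute)
    moreover have "ennreal (1 / 2 * ?f y * c) * u + ennreal (1 / 2 * ?f y * c') * u' = ennreal (?f y) * (ennreal (1 / 2) * e)"
     if "0 \<le> c" "0 \<le> c'" "ennreal c * u + ennreal c' * u' = e" for c c' u u' e
     unfolding that(3) [symmetric] * [OF that(1)] * [OF that(2)] by (simp only: distrib_left mult.assoc)
    ultimately show "ennreal (1 / 2 * ?f y * (1 - ?p y)) * F (y, ?s, \<phi> 0) + ennreal (1 / 2 * ?f y * ?p y) * F (y, ?s, \<phi> 1)
     = ennreal (?f y) * (ennreal (1 / 2) * (ennreal (q (y $ k)) * F (y, ?s, 1) + ennreal (1 - q (y $ k)) * F (y, ?s, 0)))"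
     by (simp only: logistic_nonneg diff_ge_0_iff_ge logistic_le_1)
   qed
   also have "... = (\<integral>\<^sup>+y. ennreal (1 / 2) * (ennreal (q (y $ k)) * F (y, ?s, 1) + ennreal (1 - q (y $ k)) * F (y, ?s, 0)) \<partial>iso_normal (cm z))"
    unfolding iso_normal_def by (subst nn_integral_density) auto
   finally show "(\<Sum>m\<in>{0,1}. \<integral>\<^sup>+y. ennreal (obs_density ?\<theta> \<xi> (y, z, m)) * F (T (y, z, m)) \<partial>lborel) = ..." .
  qed
  finally show ?thesis by (simp add: cm_def add.commute del: ennreal_half)
 qed
 have moments: "integrable (distr P borel (X 0)) (\<lambda>x. norm x ^ j)" for j
 proof (rule integrableI_nonneg)
  let ?F = "\<lambda>x::'p obs. ennreal (norm x ^ j)"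
  have "(\<integral>\<^sup>+x. ?F x \<partial>distr P borel (X 0)) = (\<Sum>s\<in>{0,1}. \<integral>\<^sup>+y. ennreal (1 / 2) * (ennreal (q (y $ k)) * ?F (y, s, 1) + ennreal (1 - q (y $ k)) * ?F (y, s, 0))
    \<partial>iso_normal (class_mean D k s))"
   by (rule law) measurable
  also have "... \<le> (\<Sum>s\<in>{0,1}. \<integral>\<^sup>+y. ennreal ((norm y + 2) ^ j) \<partial>iso_normal (class_mean D k s))"
  proof (intro sum_mono nn_integral_mono)
   fix s :: real and y :: "real^'p" assume s: "s \<in> {0, 1}"
   have n: "norm (y, s, m) ^ j \<le> (norm y + 2) ^ j" if "m \<in> {0, 1}" for m :: real
    using s that norm_Pair_le [of y "(s, m)"] norm_Pair_le [of s m] by (intro power_mono) auto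
   have "1 / 2 * (q (y $ k) * norm (y, s, 1::real) ^ j + (1 - q (y $ k)) * norm (y, s, 0::real) ^ j)
     \<le> 1 * (q (y $ k) * (norm y + 2) ^ j + (1 - q (y $ k)) * (norm y + 2) ^ j)"
    using n [of 1] n [of 0] q01(1) [of "y $ k"] q01(2) [of "y $ k"] by (intro mult_mono add_mono mult_left_mono add_nonneg_nonneg mult_nonneg_nonneg) auto
   also have "... = (norm y + 2) ^ j" by (simp add: algebra_simps)
   finally have le: "1 / 2 * (q (y $ k) * norm (y, s, 1::real) ^ j + (1 - q (y $ k)) * norm (y, s, 0::real) ^ j) \<le> (norm y + 2) ^ j" .
   have "ennreal (1 / 2) * (ennreal (q (y $ k)) * ?F (y, s, 1) + ennreal (1 - q (y $ k)) * ?F (y, s, 0))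
     = ennreal (1 / 2 * (q (y $ k) * norm (y, s, 1::real) ^ j + (1 - q (y $ k)) * norm (y, s, 0::real) ^ j))"
    using q01(1) [of "y $ k"] q01(2) [of "y $ k"]
    by (simp add: ennreal_mult [symmetric] ennreal_plus [symmetric] del: ennreal_plus ennreal_half)
   thus "ennreal (1 / 2) * (ennreal (q (y $ k)) * ?F (y, s, 1) + ennreal (1 - q (y $ k)) * ?F (y, s, 0)) \<le> ennreal ((norm y + 2) ^ j)"
    using ennreal_leI [OF le] by simp
  qed
  also have "... < \<infinity>"
  proof -
   have "integrable (iso_normal m) (\<lambda>y::real^'p. (norm y + 2) ^ j)" for m
    by (intro integrable_iso_normal poly_bounded_intros) auto
   hence "(\<integral>\<^sup>+y. ennreal ((norm y + 2) ^ j) \<partial>iso_normal m) < \<infinity>" for m :: "real^'p"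
    by (subst nn_integral_eq_integral) auto
   thus ?thesis by simp
  qed
  finally show "(\<integral>\<^sup>+x. ennreal (norm x ^ j) \<partial>distr P borel (X 0)) < \<infinity>" .
 qed auto
 have ind: "indep_vars (\<lambda>_. borel) X UNIV"
  unfolding XT [abs_def]
  by (rule indep_vars_compose2 [where Y = "\<lambda>_. T"]) (use iid T in \<open>auto simp: iid_sample_def\<close>)
 show ?thesis
  by unfold_locales (use ind distr moments D q01 law xi in auto)
qed

lemma has_ARE_of_AE:
 assumes "has_AE (expected_err P \<theta> bA) (\<lambda>n. err \<theta> (coef \<theta>) + (C / lA) / real n)"
  and "has_AE (expected_err P \<theta> bB) (\<lambda>n. err \<theta> (coef \<theta>) + (C / lB) / real n)"
  and pos: "0 < C" "0 < lA" "0 < lB"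
 shows "has_ARE P \<theta> bA bB (lA / lB)"
 unfolding has_ARE_def
 by (intro exI conjI, rule assms(1), rule assms(2)) (use pos in auto)

lemma (in canonical_law) ey_eq:
 assumes "nice1 \<phi>"
 shows "ey \<phi> = (LINT t|lborel. \<phi> t * f_y1 D t)"
proof -
 have m [measurable]: "\<phi> \<in> borel_measurable borel" and "poly_bounded \<phi>" using assms by (auto simp: nice1_def)
 hence i: "integrable lborel (\<lambda>t. normal_density m 1 t * \<phi> t)" for m
  by (rule integrable_normal_density_poly_bounded)
 have "(LINT t|lborel. \<phi> t * f_y1 D t) = (LINT t|lborel. normal_density (D / 2) 1 t * \<phi> t / 2 + normal_density (- D / 2) 1 t * \<phi> t / 2)"
  by (intro Bochner_Integration.integral_cong) (auto simp: f_y1_def algebra_simps)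
 also have "... = ey \<phi>"
  unfolding ey_def integral_normal1 [OF m]
  by (subst Bochner_Integration.integral_add) (auto intro!: i integrable_divide)
 finally show ?thesis ..
qed

context
 fixes P :: "'w measure" and D :: real and k :: "'p::finite" and \<xi> :: "real \<times> real"
  and Y :: "nat => 'w => real^'p" and Z M :: "nat => 'w => nat"
 assumes D: "0 < D" and iid: "iid_sample P (canonical_model D k) \<xi> Y Z M"
begin

lemma sample_values: "w \<in> space P ==> Z j w \<in> {1, 2}" "w \<in> space P ==> M j w \<in> {0, 1}"
proof -
 have "distributed P obs_base (\<lambda>w. (Y j w, Z j w, M j w)) (\<lambda>x. ennreal (obs_density (canonical_model D k) \<xi> x))"
  using iid by (simp add: iid_sample_def)
 note measurable_space [OF distributed_measurable [OF this]]
 thus "w \<in> space P ==> Z j w \<in> {1, 2}" "w \<in> space P ==> M j w \<in> {0, 1}"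
  by (auto simp: obs_base_def space_pair_measure)
qed

lemma loglik_avg_ig:
 assumes z: "\<And>j. z j \<in> {1, 2}" and m: "\<And>j. m j \<in> {0, 1}" and n: "1 \<le> n"
  and ml: "ml_estimate (loglik_ig n y z m) model_space coef b"
 shows "ml_estimate (\<lambda>p. (\<Sum>j<n. ell (nat_model p) (y j, of_bool (z j = 1), of_bool (m j = 1))) / real n)
  (model_space \<times> {0}) (\<lambda>p. coef (fst p)) (b :: real \<times> (real^'p))"
proof (rule ml_estimate_image [OF ml, where h = "\<lambda>\<theta>. (\<theta>, 0)" and a = "1 / real n" and C = "- softplus 0" and T = "\<lambda>b. b"])
 fix \<theta> :: "'p model" assume "\<theta> \<in> model_space"
 from sum_ell_ig [OF this z m]
 show "(\<Sum>j<n. ell (nat_model (\<theta>, 0)) (y j, of_bool (z j = 1), of_bool (m j = 1))) / real n = 1 / real n * loglik_ig n y z m \<theta> + - softplus 0"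
  using n by (simp add: add_divide_distrib)
qed (use n in auto)

lemma loglik_avg_full:
 assumes z: "\<And>j. z j \<in> {1, 2}" and m: "\<And>j. m j \<in> {0, 1}" and n: "1 \<le> n"
  and ml: "ml_estimate (loglik_full n y z m) (model_space \<times> UNIV) (\<lambda>(\<theta>, \<xi>). coef \<theta>) b"
 shows "ml_estimate (\<lambda>p. (\<Sum>j<n. ell (nat_model p) (y j, of_bool (z j = 1), of_bool (m j = 1))) / real n)
  (model_space \<times> UNIV) (\<lambda>p. coef (fst p)) (b :: real \<times> (real^'p))"
proof (rule ml_estimate_image [OF ml, where h = "\<lambda>p. p" and a = "1 / real n" and C = 0 and T = "\<lambda>b. b"])
 fix p :: "'p model \<times> (real \<times> real)" assume "p \<in> model_space \<times> UNIV"
 hence "fst p \<in> model_space" by auto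
 from sum_ell_full [OF this z m, where \<xi> = "snd p"]
 show "(\<Sum>j<n. ell (nat_model p) (y j, of_bool (z j = 1), of_bool (m j = 1))) / real n = 1 / real n * loglik_full n y z m p + 0"
  by simp
qed (use n in auto)

lemma q1_logistic: "q1 D \<xi> = (\<lambda>t. logistic (fst \<xi> + snd \<xi> * (D * t)^2))"
 by (simp add: q1_def logistic_def fun_eq_iff power_mult_distrib mult.assoc)

lemma canonical_AE_cc:
 assumes "mle_cc P Y Z b"
 shows "has_AE (expected_err P (canonical_model D k) b) (\<lambda>n. err (canonical_model D k) (coef (canonical_model D k))
  + (normal_density 0 1 (D / 2) / (4 * D) * CARD('p) / (1 / (4 + D^2))) / real n)"
proof -
 define X where "X j w = (Y j w, of_bool (Z j w = 1) :: real, 0 :: real)" for j w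
 interpret L: mechanism_law P X "distr P borel (X 0)" D k "\<lambda>_. 0" 0 "{0}"
  unfolding X_def [abs_def] by (rule sample_mechanism_law [OF D iid, where \<phi> = "\<lambda>_. 0"]) auto
 have "AE w in P. ml_estimate (\<lambda>p. L.avg (ell (nat_model p)) n w) (model_space \<times> {0}) (\<lambda>p. coef (fst p)) (b n w)"
  if n: "1 \<le> n" for n
 proof -
  have "AE w in P. ml_estimate (loglik_cc n (\<lambda>j. Y j w) (\<lambda>j. Z j w)) model_space coef (b n w)"
   using assms by (simp add: mle_cc_def)
  thus ?thesis
   using AE_space
  proof eventually_elim
   case (elim w)
   from loglik_avg_ig [OF sample_values(1) [OF elim(2)] _ n elim(1) [unfolded loglik_cc_def]]
   show ?case by (simp add: L.avg_def X_def)
  qed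
 qed
 from L.has_AE_err [OF this] assms show ?thesis
  by (simp add: mle_cc_def L.info_loss_def L.mech_info_def L.ey_def)
qed

lemma sample_law:
 assumes "Xi = UNIV \<and> xi = \<xi> \<or> Xi = {0} \<and> xi = 0"
 shows "mechanism_law P (\<lambda>j w. (Y j w, of_bool (Z j w = 1), of_bool (M j w = 1)))
  (distr P borel (\<lambda>w. (Y 0 w, of_bool (Z 0 w = 1), of_bool (M 0 w = 1)))) D k (q1 D \<xi>) xi Xi"
 by (rule sample_mechanism_law [OF D iid, where \<phi> = "\<lambda>m. of_bool (m = 1)"]) (use assms in \<open>auto simp: q1_logistic\<close>)

lemma sample_law_constants:
 assumes "mechanism_law P X Q D k (q1 D \<xi>) xi Xi" "xi = \<xi> \<or> xi = 0"
 shows "canonical_law.info_loss D (q1 D \<xi>) = gam D \<xi> * d0 D \<xi>"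
  and "mechanism_law.mech_info D xi = (if xi = 0 then 0 else b0 D \<xi>)"
proof -
 interpret L: mechanism_law P X Q D k "q1 D \<xi>" xi Xi by fact
 have "gam D \<xi> = L.ey (q1 D \<xi>)" unfolding gam_def by (rule L.ey_eq [symmetric]) (rule L.nice1_intros)
 also have "0 < ..."
  by (rule L.ey_pos, rule L.nice1_intros) (auto simp: q1_logistic)
 finally have g: "gam D \<xi> \<noteq> 0" by simp
 have "d0 D \<xi> = (LINT t|lborel. inverse (gam D \<xi>) * ((q1 D \<xi> t * L.var1 t) * f_y1 D t))"
  unfolding d0_def by (intro Bochner_Integration.integral_cong) (auto simp: tau1_def tau2_def L.var1_def logistic_def mult_ac)
 also have "... = inverse (gam D \<xi>) * L.info_loss"
  unfolding L.info_loss_def L.ey_eq [OF L.q_var1(1)] by simp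
 finally show "L.info_loss = gam D \<xi> * d0 D \<xi>" using g by simp
 have n: "L.nice1 (\<lambda>t. 4 * (snd xi)^2 * (D * t)^2 * L.mech_weight t)"
  by (intro L.nice1_intros L.nice_mech_weight)
 show "L.mech_info = (if xi = 0 then 0 else b0 D \<xi>)"
 proof (cases "xi = 0")
  case False
  hence xi: "xi = \<xi>" using assms(2) by simp
  show ?thesis
   unfolding L.mech_info_def L.ey_eq [OF n] b0_def unfolding L.mech_weight_def using False
   by (simp, intro Bochner_Integration.integral_cong)
    (auto simp: xi q1_logistic power_mult_distrib mult_ac)
 next
  case True
  thus ?thesis unfolding L.mech_info_def L.ey_def by simp
 qed
qed

lemma canonical_AE_missing:
 assumes law: "mechanism_law P X (distr P borel (X 0)) D k (q1 D \<xi>) xi Xi"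
  and X: "X = (\<lambda>j w. (Y j w, of_bool (Z j w = 1), of_bool (M j w = 1)))" and xi: "xi = \<xi> \<or> xi = 0"
  and b: "\<And>n. b n \<in> borel_measurable P"
  and ml: "\<And>n. 1 \<le> n ==> AE w in P. ml_estimate
   (\<lambda>p. (\<Sum>j<n. ell (nat_model p) (Y j w, of_bool (Z j w = 1), of_bool (M j w = 1))) / real n)
   (model_space \<times> Xi) (\<lambda>p. coef (fst p)) (b n w)"
 defines "l \<equiv> 1 / (4 + D^2) - gam D \<xi> * d0 D \<xi> + (if xi = 0 then 0 else b0 D \<xi>)"
 shows "has_AE (expected_err P (canonical_model D k) b) (\<lambda>n. err (canonical_model D k) (coef (canonical_model D k))
  + (normal_density 0 1 (D / 2) / (4 * D) * CARD('p) / l) / real n)" "0 < l"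
  "gam D \<xi> = (LINT w|P. missing_prob (canonical_model D k) \<xi> (Y j w))"
proof -
 interpret L: mechanism_law P X "distr P borel (X 0)" D k "q1 D \<xi>" xi Xi by (rule law)
 have Xj: "X j w = (Y j w, of_bool (Z j w = 1), of_bool (M j w = 1))" for j w by (simp add: X)
 have l: "l = 1 / (4 + D^2) - L.info_loss + L.mech_info"
  unfolding l_def using sample_law_constants [OF law xi] by simp
 show "has_AE (expected_err P (canonical_model D k) b) (\<lambda>n. err (canonical_model D k) (coef (canonical_model D k))
  + (normal_density 0 1 (D / 2) / (4 * D) * CARD('p) / l) / real n)"
  unfolding l by (rule L.has_AE_err) (simp_all only: L.avg_def Xj ml b)
 show "0 < l" unfolding l by (rule L.score_variance_pos)
 have n1: "L.nice1 (q1 D \<xi>)" by (rule L.nice1_intros)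
 have n: "L.nice (\<lambda>x. q1 D \<xi> (fst x $ k))"
 proof -
  have [measurable]: "q1 D \<xi> \<in> borel_measurable borel" using n1 by (simp add: L.nice1_def)
  have "(\<lambda>x::'p obs. fst x $ k) \<in> borel_measurable borel" by (intro borel_measurable_continuous_onI continuous_intros)
  hence "(\<lambda>x::'p obs. q1 D \<xi> (fst x $ k)) \<in> borel_measurable borel" by measurable
  thus ?thesis
   unfolding L.nice_def using L.q(1) L.q_le_1 by (auto intro!: poly_bounded_bounded [of _ 1])
 qed
 have "(LINT w|P. missing_prob (canonical_model D k) \<xi> (Y j w)) = (LINT w|P. q1 D \<xi> (fst (X j w) $ k))"
  by (simp add: missing_prob_logistic coef_canonical_model discr_def inner_axis' q1_logistic Xj)
 also have "... = L.EY (\<lambda>y. q1 D \<xi> (y $ k) + q1 D \<xi> (y $ k) * 0)"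
  unfolding L.expectation_X [OF n] by (rule L.integral_Q_no_class [OF n]) simp
 also have "... = gam D \<xi>"
  using L.EY_coord [OF n1] by (simp add: gam_def L.ey_eq [OF n1])
 finally show "gam D \<xi> = (LINT w|P. missing_prob (canonical_model D k) \<xi> (Y j w))" ..
qed

lemma canonical_ARE:
 assumes ig: "mle_ig P Y Z M b_ig" and full: "mle_full P Y Z M b_full" and cc: "mle_cc P Y Z b_cc"
 defines "ARE_ig \<equiv> 1 - (D^2 + 4) * gam D \<xi> * d0 D \<xi>"
  and "ARE_full \<equiv> 1 - (D^2 + 4) * (gam D \<xi> * d0 D \<xi> - b0 D \<xi>)"
 shows "has_ARE P (canonical_model D k) b_ig b_full (ARE_ig / ARE_full)"
  "has_ARE P (canonical_model D k) b_ig b_cc ARE_ig" "has_ARE P (canonical_model D k) b_full b_cc ARE_full"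
  "gam D \<xi> = (LINT w|P. missing_prob (canonical_model D k) \<xi> (Y j w))"
proof -
 let ?X = "\<lambda>j w. (Y j w, of_bool (Z j w = 1) :: real, of_bool (M j w = 1) :: real)"
 let ?C = "normal_density 0 1 (D / 2) / (4 * D) * CARD('p)"
 let ?g = "gam D \<xi> * d0 D \<xi>"
 have D4: "0 < 4 + D^2" by (simp add: add_pos_nonneg)
 have C: "0 < ?C" using D by (simp add: normal_density_pos)
 have ml_ig: "AE w in P. ml_estimate (\<lambda>p. (\<Sum>j<n. ell (nat_model p) (?X j w)) / real n)
   (model_space \<times> {0}) (\<lambda>p. coef (fst p)) (b_ig n w)" if n: "1 \<le> n" for n
 proof -
  have "AE w in P. ml_estimate (loglik_ig n (\<lambda>j. Y j w) (\<lambda>j. Z j w) (\<lambda>j. M j w)) model_space coef (b_ig n w)"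
   using ig by (simp add: mle_ig_def)
  thus ?thesis
   using AE_space by eventually_elim (rule loglik_avg_ig [OF sample_values n])
 qed
 have ml_full: "AE w in P. ml_estimate (\<lambda>p. (\<Sum>j<n. ell (nat_model p) (?X j w)) / real n)
   (model_space \<times> UNIV) (\<lambda>p. coef (fst p)) (b_full n w)" if n: "1 \<le> n" for n
 proof -
  have "AE w in P. ml_estimate (loglik_full n (\<lambda>j. Y j w) (\<lambda>j. Z j w) (\<lambda>j. M j w)) (model_space \<times> UNIV)
    (\<lambda>(\<theta>, \<xi>). coef \<theta>) (b_full n w)"
   using full by (simp add: mle_full_def)
  thus ?thesis
   using AE_space by eventually_elim (rule loglik_avg_full [OF sample_values n])
 qed
 have b: "b_ig n \<in> borel_measurable P" "b_full n \<in> borel_measurable P" for n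
  using ig full by (simp_all add: mle_ig_def mle_full_def)
 have "mechanism_law P ?X (distr P borel (?X 0)) D k (q1 D \<xi>) 0 {0}"
  "mechanism_law P ?X (distr P borel (?X 0)) D k (q1 D \<xi>) \<xi> UNIV"
  by (rule sample_law; simp)+
 note AE_ig = canonical_AE_missing [OF this(1) refl _ b(1) ml_ig] and AE_full = canonical_AE_missing [OF this(2) refl _ b(2) ml_full]
 note AE_cc = canonical_AE_cc [OF cc]
 define l_ig where "l_ig = 1 / (4 + D^2) - ?g"
 define l_full where "l_full = 1 / (4 + D^2) - ?g + b0 D \<xi>"
 define l_cc where "l_cc = 1 / (4 + D^2)"
 have "b0 D \<xi> = 0" if "\<xi> = 0" using that by (simp add: b0_def)
 hence b0: "(if \<xi> = 0 then 0 else b0 D \<xi>) = b0 D \<xi>" by simp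
 have pos: "0 < l_ig" "0 < l_full" "0 < l_cc"
  using AE_ig(2) AE_full(2) D4 by (simp_all add: l_ig_def l_full_def l_cc_def b0)
 have A: "ARE_ig = l_ig / l_cc" "ARE_full = l_full / l_cc"
  using D4 by (simp_all add: ARE_ig_def ARE_full_def l_ig_def l_full_def l_cc_def algebra_simps)
 have r: "ARE_ig / ARE_full = l_ig / l_full" using pos by (simp add: A)
 show "has_ARE P (canonical_model D k) b_ig b_full (ARE_ig / ARE_full)"
  "has_ARE P (canonical_model D k) b_ig b_cc ARE_ig" "has_ARE P (canonical_model D k) b_full b_cc ARE_full"
  unfolding r unfolding A
  by (rule has_ARE_of_AE [OF _ _ C];
    use AE_ig(1) AE_full(1) AE_cc pos in \<open>simp add: b0 l_ig_def l_full_def l_cc_def\<close>)+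
 show "gam D \<xi> = (LINT w|P. missing_prob (canonical_model D k) \<xi> (Y j w))"
  by (rule AE_ig(3)) simp
qed

end

theorem theorem4:
 fixes P :: "'w measure"
  and \<theta> :: "'p::finite model" and \<xi> :: "real \<times> real"
  and Y :: "nat \<Rightarrow> 'w \<Rightarrow> real^'p" and Z M :: "nat \<Rightarrow> 'w \<Rightarrow> nat"
  and b_ig b_full b_cc :: "nat \<Rightarrow> 'w \<Rightarrow> real \<times> (real^'p)"
  and \<Delta> ARE_ig ARE_full :: real
 assumes "\<theta> \<in> model_space"
  and "prior \<theta> 1 = prior \<theta> 2"
  and "iid_sample P \<theta> \<xi> Y Z M"
  and "mle_ig P Y Z M b_ig"
  and "mle_full P Y Z M b_full"
  and "mle_cc P Y Z b_cc"
 defines "\<Delta> \<equiv> mahalanobis \<theta>"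
 defines "ARE_ig \<equiv> 1 - (\<Delta>\<^sup>2 + 4) * gam \<Delta> \<xi> * d0 \<Delta> \<xi>"
  and "ARE_full \<equiv> 1 - (\<Delta>\<^sup>2 + 4) * (gam \<Delta> \<xi> * d0 \<Delta> \<xi> - b0 \<Delta> \<xi>)"
 shows "has_ARE P \<theta> b_ig b_full (ARE_ig / ARE_full)
  \<and> has_ARE P \<theta> b_ig b_cc ARE_ig
  \<and> has_ARE P \<theta> b_full b_cc ARE_full
  \<and> (\<forall>j. gam \<Delta> \<xi> = (\<integral>\<omega>. missing_prob \<theta> \<xi> (Y j \<omega>) \<partial>P))"
proof -
 obtain k :: 'p where True by simp
 obtain G c where G: "affine_transformation G" and \<theta>: "affine_model G c \<theta> = canonical_model (mahalanobis \<theta>) k"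
  and D: "0 < mahalanobis \<theta>"
  using exists_canonical_model [OF assms(1,2)] by blast
 interpret affine_transformation G c by (rule G)
 note iid = iid_sample_affine [OF assms(1,3), unfolded \<theta>]
 note ARE = canonical_ARE [OF D iid mle_ig_affine [OF assms(4)] mle_full_affine [OF assms(5)] mle_cc_affine [OF assms(6)]]
 have "pos_def (cov \<theta>)" using assms(1) by (rule model_spaceD)
 from missing_prob_affine [OF this, unfolded \<theta>] ARE(4) have "\<forall>j. gam \<Delta> \<xi> = (\<integral>\<omega>. missing_prob \<theta> \<xi> (Y j \<omega>) \<partial>P)"
  by (simp add: \<Delta>_def)
 then show ?thesis
  using ARE(1-3) unfolding has_ARE_affine [OF assms(1)] \<theta> ARE_ig_def ARE_full_def \<Delta>_def by blast
qed

end
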